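(* For all $m\in\mathbb{Z}_+=\{0,1,2,\dots\}$, let $H_m=2^{-m}$ and $A_m=2^{m^2}$. Let $S=(S_t)_{t\ge0}$ be the Lévy process on $[0,\infty)$ such that for each $m\in\mathbb{Z}_+$, $S$ takes jumps of size $A_m$ times a standard exponential random variable, with rate $H_m$; that is, $$S_t=\sum_{m=0}^\infty\sum_{i=1}^{N^m_t}A_mY_{m,i},$$ where $(N^m_t)_{t\ge0}$, $m\in\mathbb{Z}_+$, are independent Poisson processes with rates $H_m$ and $(Y_{m,i})$ are i.i.d. standard exponential random variables independent of them. Let $X=(X_t)=(W(S_t))$ be the subordinated Brownian motion on $\mathbb{R}$ with subordinator $S$, where $W$ is a standard Brownian motion on $\mathbb{R}$ independent of $S$. Then the Lévy measure of $S$ is absolutely continuous with respect to Lebesgue measure on $(0,\infty)$ and its density is decreasing. Furthermore, $X$ does not satisfy the elliptic Harnack inequality (EHI).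
   Context: The Lévy measure of a driftless subordinator $S$ is the measure $\mu$ on $(0,\infty)$ such that jumps of $S$ with size in $A$ occur according to a Poisson process of rate $\mu(A)$ whenever $0<\mu(A)<\infty$. $X$ is right-continuous with left limits; $\mathbb{E}_x$ is the expectation for the process started at $X_0=x$. $B(x_0,r)=(x_0-r,x_0+r)$; $\tau_U:=\inf\{t\ge0:X_t\notin U\}$. For open $D\subseteq\mathbb{R}$, $h:\mathbb{R}\to\mathbb{R}$ is harmonic on $D$ (with respect to $X$) if for every open set $E$ whose closure is compact and contained in $D$, $h(x)=\mathbb{E}_x[h(X_{\tau_E})]$ for all $x\in E$. $X$ satisfies EHI if there exist $C>0$ and $\kappa\in(0,1)$ such that for all $x_0\in\mathbb{R}$ and $r>0$, every non-negative $h$ harmonic on $B(x_0,r)$ satisfies $h(x)\le C\,h(y)$ for all $x,y\in B(x_0,\kappa r)$. *)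

theory Defs
  imports "HOL-Probability.Probability"
begin

text \<open>Processes are indexed by real times, of which only the times \<open>t \<ge> 0\<close> matter.\<close>

definition generated_events ::
  "'a measure \<Rightarrow> 'i set \<Rightarrow> 'b measure \<Rightarrow> ('i \<Rightarrow> 'a \<Rightarrow> 'b) \<Rightarrow> 'a set set" where
  "generated_events M I V Z =
     sigma_sets (space M) (\<Union>i\<in>I. {Z i -` B \<inter> space M | B. B \<in> sets V})"

definition independent_increments ::
  "'a measure \<Rightarrow> 'b measure \<Rightarrow> (real \<Rightarrow> 'a \<Rightarrow> 'b::minus) \<Rightarrow> bool" where
  "independent_increments M V Z \<longleftrightarrow>
     (\<forall>(n::nat) (u::nat \<Rightarrow> real). 0 \<le> u 0 \<longrightarrow> (\<forall>k<n. u k < u (Suc k)) \<longrightarrow>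
        prob_space.indep_vars M (\<lambda>_. V) (\<lambda>k \<omega>. Z (u (Suc k)) \<omega> - Z (u k) \<omega>) {..<n})"

text \<open>The increments below use subtraction on \<open>nat\<close>; it is not truncated, except on a null set,
  because the paths are almost surely nondecreasing.\<close>

definition poisson_process :: "'a measure \<Rightarrow> real \<Rightarrow> (real \<Rightarrow> 'a \<Rightarrow> nat) \<Rightarrow> bool" where
  "poisson_process M rate N \<longleftrightarrow>
     (\<forall>t\<ge>0. N t \<in> M \<rightarrow>\<^sub>M count_space UNIV) \<and>
     (AE \<omega> in M. N 0 \<omega> = 0 \<and> mono_on {0..} (\<lambda>t. N t \<omega>) \<and>
        (\<forall>t\<ge>0. continuous (at_right t) (\<lambda>s. N s \<omega>))) \<and>
     independent_increments M (count_space UNIV) N \<and>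
     (\<forall>s t. 0 \<le> s \<longrightarrow> s < t \<longrightarrow>
        distr M (count_space UNIV) (\<lambda>\<omega>. N t \<omega> - N s \<omega>) = measure_pmf (poisson_pmf (rate * (t - s))))"

definition standard_brownian_motion :: "'a measure \<Rightarrow> (real \<Rightarrow> 'a \<Rightarrow> real) \<Rightarrow> bool" where
  "standard_brownian_motion M W \<longleftrightarrow>
     (\<forall>t\<ge>0. W t \<in> borel_measurable M) \<and>
     (AE \<omega> in M. W 0 \<omega> = 0 \<and> continuous_on {0..} (\<lambda>t. W t \<omega>)) \<and>
     independent_increments M borel W \<and>
     (\<forall>s t. 0 \<le> s \<longrightarrow> s < t \<longrightarrow>
        distributed M lborel (\<lambda>\<omega>. W t \<omega> - W s \<omega>) (normal_density 0 (sqrt (t - s))))"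

definition jump_at :: "(real \<Rightarrow> 'a \<Rightarrow> real) \<Rightarrow> real \<Rightarrow> 'a \<Rightarrow> real" where
  "jump_at S s \<omega> = S s \<omega> - Lim (at_left s) (\<lambda>u. S u \<omega>)"

definition jump_times :: "(real \<Rightarrow> 'a \<Rightarrow> real) \<Rightarrow> real set \<Rightarrow> real \<Rightarrow> 'a \<Rightarrow> real set" where
  "jump_times S B t \<omega> = {s \<in> {0<..t}. jump_at S s \<omega> \<in> B}"

text \<open>The last clause is the defining property of the Levy measure. It determines \<open>\<mu>\<close> only together
  with the integrability condition satisfied by every Levy measure of a subordinator (which excludes
  measures taking only the values 0 and infinity) and the clause on null sets (which excludes
  \<open>\<mu> = 0\<close>). Jump counts are taken with respect to the completed measure, since the paths of
  the process are only required to be regular outside a null set.\<close>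

definition levy_measure :: "'a measure \<Rightarrow> (real \<Rightarrow> 'a \<Rightarrow> real) \<Rightarrow> real measure \<Rightarrow> bool" where
  "levy_measure M S \<mu> \<longleftrightarrow>
     space \<mu> = {0<..} \<and> sets \<mu> = sets (restrict_space borel {0<..}) \<and>
     (\<integral>\<^sup>+ x. ennreal (min 1 x) \<partial>\<mu>) < \<infinity> \<and>
     (\<forall>B\<in>sets \<mu>. emeasure \<mu> B = 0 \<longrightarrow>
        (AE \<omega> in completion M. \<forall>t\<ge>0. jump_times S B t \<omega> = {})) \<and>
     (\<forall>B\<in>sets \<mu>. 0 < emeasure \<mu> B \<and> emeasure \<mu> B < \<infinity> \<longrightarrow>
        (AE \<omega> in completion M. \<forall>t\<ge>0. finite (jump_times S B t \<omega>)) \<and>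
        poisson_process (completion M) (measure \<mu> B) (\<lambda>t \<omega>. card (jump_times S B t \<omega>)))"

definition exit_time :: "(real \<Rightarrow> 'a \<Rightarrow> real) \<Rightarrow> real set \<Rightarrow> 'a \<Rightarrow> ereal" where
  "exit_time Z U \<omega> = Inf (ereal ` {t. 0 \<le> t \<and> Z t \<omega> \<notin> U})"

text \<open>In the sequel \<open>Xs x\<close> is the process started at \<open>x\<close>, realised on \<open>M\<close>. A function of the exit
  position is given the value 0 on the event that the process never exits.\<close>

definition at_exit :: "(real \<Rightarrow> 'a \<Rightarrow> real) \<Rightarrow> real set \<Rightarrow> (real \<Rightarrow> real) \<Rightarrow> 'a \<Rightarrow> real" where
  "at_exit Z U h \<omega> =
     (if exit_time Z U \<omega> < \<infinity> then h (Z (real_of_ereal (exit_time Z U \<omega>)) \<omega>) else 0)"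

text \<open>The expectation is taken with respect to the completed measure because exit times of
  right-continuous processes need not be measurable without completion; \<open>integrable\<close> ensures that it
  is not the default value 0 of an undefined integral.\<close>

definition harmonic_wrt ::
  "'a measure \<Rightarrow> (real \<Rightarrow> real \<Rightarrow> 'a \<Rightarrow> real) \<Rightarrow> real set \<Rightarrow> (real \<Rightarrow> real) \<Rightarrow> bool" where
  "harmonic_wrt M Xs D h \<longleftrightarrow>
     h \<in> borel_measurable borel \<and>
     (\<forall>E. open E \<and> compact (closure E) \<and> closure E \<subseteq> D \<longrightarrow>
        (\<forall>x\<in>E. integrable (completion M) (at_exit (Xs x) E h) \<and>
               h x = (\<integral>\<omega>. at_exit (Xs x) E h \<omega> \<partial>completion M)))"

definition elliptic_harnack :: "'a measure \<Rightarrow> (real \<Rightarrow> real \<Rightarrow> 'a \<Rightarrow> real) \<Rightarrow> bool" where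
  "elliptic_harnack M Xs \<longleftrightarrow>
     (\<exists>C>0. \<exists>\<kappa>. 0 < \<kappa> \<and> \<kappa> < 1 \<and>
        (\<forall>x0 r h. 0 < r \<and> (\<forall>x. 0 \<le> h x) \<and> harmonic_wrt M Xs (ball x0 r) h \<longrightarrow>
           (\<forall>x\<in>ball x0 (\<kappa> * r). \<forall>y\<in>ball x0 (\<kappa> * r). h x \<le> C * h y)))"

end

theory Submission
  imports Defs
begin

text \<open>The process \<open>S\<close> jumps at total rate 2, and each jump is of type \<open>m\<close> with probability \<open>1 / 2 ^ Suc m\<close>.
  Its Levy measure is thus a mixture of exponential laws, which has a decreasing density. The process \<open>X\<close>
  moves by independent steps at the jump times, so a bounded function that has the mean value property
  for a single step on a ball is harmonic there. To see this without analysing the jump chain, stop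
  \<open>X\<close> on a grid of mesh \<open>d\<close>: each grid step changes the mean by \<open>O(d\<^sup>2)\<close> only.

  The rate of the jumps of type \<open>m\<close> equals the total rate of all larger types, and the scales \<open>A m\<close> are
  so widely separated that a larger jump leaves, with probability close to 1, any ball whose radius \<open>r\<close> is a moderate
  multiple of \<open>a = sqrt (A m)\<close>. At this scale the larger jumps therefore act as killing at a fixed rate,
  and the probability of leaving the ball into an interval adjacent to its right end decays
  exponentially in the distance to that end divided by \<open>a\<close>. This harmonic function of the starting
  point has an unbounded ratio between \<open>r / 2\<close> and \<open>0\<close> as \<open>m\<close> and \<open>r / a\<close> grow, whereas the elliptic Harnack
  inequality would bound it uniformly.\<close>

text \<open>Why the exponential rates work: on the scale \<open>a\<close> a step of type
  \<open>m\<close> has moment generating function \<open>1 / (1 - b\<^sup>2 / 2)\<close> at exponent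
  \<open>b / a\<close>. Jumps and killing being equally likely, an exponential is in balance when
  this value is 2, that is, at \<open>b = 1\<close>. The proof uses \<open>3/4\<close> and
  \<open>5/4\<close>, one on each side, so that all errors fit into the gap. A supersolution at rate
  \<open>3/4\<close> over the full distance \<open>r\<close> bounds \<open>h 0\<close> from above, a
  subsolution at rate \<open>5/4\<close> over half that distance bounds \<open>h (r / 2)\<close>
  from below, and \<open>5/8 < 3/4\<close>. Two obstacles shape the rest. The definition of a
  Poisson process used here prescribes laws of increments and monotone right-continuous paths; that
  jumps have size one and that different types never jump together must be derived. And paths are
  regular only outside a null set, so compositions such as \<open>W (S t)\<close> are reached by
  freezing independent variables with countably many values and passing to a limit, while jump
  counts and exit positions live on the completed space.\<close>

section \<open>Jump times of superposed counting paths\<close>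

text \<open>The pathwise form in which the superposed Poisson processes are used; nothing random is
  left. Only finitely many components are active up to a given time, which lets statements about one
  component hold for all at once. In \<open>simple\<close>, the case \<open>m = m'\<close> says that
  jumps have size one, the other case that two components never jump together.\<close>

locale counting_paths =
  fixes n :: "nat \<Rightarrow> real \<Rightarrow> nat"
  assumes zero: "n m 0 = 0"
    and mono: "mono_on {0..} (n m)"
    and right_cont: "0 \<le> t \<Longrightarrow> continuous (at_right t) (n m)"
    and finite_supp: "0 \<le> t \<Longrightarrow> finite {m. n m t \<noteq> 0}"
    and simple: "0 < s \<Longrightarrow> \<exists>u. 0 \<le> u \<and> u < s \<and>
      n m s + (if m = m' then 0 else n m' s) \<le> Suc (n m u + (if m = m' then 0 else n m' u))"
begin

lemma monoD: "0 \<le> s \<Longrightarrow> s \<le> t \<Longrightarrow> n m s \<le> n m t"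
  using mono[of m] by (auto simp: mono_on_def)

text \<open>A right-continuous integer-valued path is constant just to the right of every point.
  Components that vanish at time \<open>t+1\<close> vanish on all of \<open>[t, t+1]\<close> by
  monotonicity, so a neighbourhood that serves the finitely many others serves all.\<close>

lemma right_const:
  assumes "0 \<le> t"
  shows "\<exists>e>0. \<forall>s\<in>{t..<t+e}. \<forall>m. n m s = n m t"
proof -
  let ?F = "{m. n m (t+1) \<noteq> 0}"
  have F: "finite ?F" using finite_supp[of "t+1"] assms by auto
  have "\<forall>\<^sub>F s in at_right t. n m s = n m t" for m
  proof -
    have "((\<lambda>s. n m s) \<longlongrightarrow> n m t) (at_right t)"
      using right_cont[OF assms, of m] by (simp add: continuous_within)
    then show ?thesis by (simp add: tendsto_discrete)
  qed
  then have "\<forall>\<^sub>F s in at_right t. \<forall>m\<in>?F. n m s = n m t"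
    using F by (intro eventually_ball_finite) auto
  then obtain b where b: "b > t" "\<And>s. t < s \<Longrightarrow> s < b \<Longrightarrow> \<forall>m\<in>?F. n m s = n m t"
    by (auto simp: eventually_at_right_field)
  show ?thesis
  proof (intro exI[of _ "min 1 (b - t)"] conjI ballI allI)
    show "0 < min 1 (b - t)" using b by auto
    fix s m assume s: "s \<in> {t..<t + min 1 (b - t)}"
    show "n m s = n m t"
    proof (cases "m \<in> ?F")
      case True then show ?thesis using b(2)[of s] s by (cases "s = t") auto
    next
      case False
      then have "n m (t+1) = 0" by simp
      moreover have "n m t \<le> n m (t+1)" "n m s \<le> n m (t+1)" using assms s by (auto intro!: monoD)
      ultimately show ?thesis by simp
    qed
  qed
qed

text \<open>Left limits are not assumed. Before \<open>s\<close> a component takes only values up to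
  \<open>n m s\<close>, hence it attains its maximum there and keeps it until
  \<open>s\<close>.\<close>

lemma left_const:
  assumes "0 < s"
  shows "\<exists>u. 0 \<le> u \<and> u < s \<and> (\<forall>v\<in>{u..<s}. \<forall>m. n m v = n m u)"
proof -
  let ?F = "{m. n m s \<noteq> 0}"
  have F: "finite ?F" using finite_supp assms by auto
  have "\<exists>u. 0 \<le> u \<and> u < s \<and> (\<forall>v\<in>{u..<s}. n m v = n m u)" for m
  proof -
    let ?K = "n m ` {0..<s}"
    have fin: "finite ?K"
      by (rule finite_subset[of _ "{..n m s}"]) (auto intro!: monoD)
    have ne: "?K \<noteq> {}" using assms by auto
    from Max_in[OF fin ne] obtain u where u: "u \<in> {0..<s}" "Max ?K = n m u" by auto
    have "\<forall>v\<in>{u..<s}. n m v = n m u"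
    proof (intro ballI antisym)
      fix v assume that: "v \<in> {u..<s}"
      show "n m v \<le> n m u" using u that Max_ge[OF fin, of "n m v"] by auto
      show "n m u \<le> n m v" using u that by (auto intro!: monoD)
    qed
    moreover have "0 \<le> u" "u < s" using u(1) by auto
    ultimately show ?thesis by (intro exI[of _ u] conjI)
  qed
  then have "\<forall>m. \<exists>u. 0 \<le> u \<and> u < s \<and> (\<forall>v\<in>{u..<s}. n m v = n m u)" ..
  from choice[OF this] obtain u where
    "\<forall>m. 0 \<le> u m \<and> u m < s \<and> (\<forall>v\<in>{u m..<s}. n m v = n m (u m))" ..
  then have u: "\<And>m. 0 \<le> u m" "\<And>m. u m < s" "\<And>m v. v \<in> {u m..<s} \<Longrightarrow> n m v = n m (u m)"
    by blast+
  define U where "U = Max (insert 0 (u ` ?F))"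
  have U: "0 \<le> U" "U < s" "\<And>m. m \<in> ?F \<Longrightarrow> u m \<le> U"
    using F u(2) assms by (auto simp: U_def)
  show ?thesis
  proof (intro exI[of _ U] conjI ballI allI U)
    fix v m assume v: "v \<in> {U..<s}"
    show "n m v = n m U"
    proof (cases "m \<in> ?F")
      case True
      then have "v \<in> {u m..<s}" "U \<in> {u m..<s}" using U(2) U(3)[OF True] v by auto
      then show ?thesis using u(3)[of v m] u(3)[of U m] by metis
    next
      case False
      moreover have "n m U \<le> n m s" "n m v \<le> n m s" using U v by (auto intro!: monoD)
      ultimately show ?thesis by simp
    qed
  qed
qed

text \<open>The time supplied by \<open>simple\<close> depends on the pair of components, but by
  monotonicity it may be moved to the right, to the common \<open>u\<close> after which nothing
  changes before \<open>s\<close>.\<close>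

lemma jump_structure:
  assumes "0 < s"
  shows "\<exists>u. 0 \<le> u \<and> u < s \<and> (\<forall>v\<in>{u..<s}. \<forall>m. n m v = n m u) \<and>
    ((\<forall>m. n m s = n m u) \<or> (\<exists>m. n m s = Suc (n m u) \<and> (\<forall>m'. m' \<noteq> m \<longrightarrow> n m' s = n m' u)))"
proof -
  from left_const[OF assms] obtain u where u: "0 \<le> u" "u < s" "\<And>v m. v \<in> {u..<s} \<Longrightarrow> n m v = n m u"
    by blast
  have *: "n m s + (if m = m' then 0 else n m' s) \<le> Suc (n m u + (if m = m' then 0 else n m' u))" for m m'
  proof -
    obtain w where w: "0 \<le> w" "w < s" "n m s + (if m = m' then 0 else n m' s) \<le> Suc (n m w + (if m = m' then 0 else n m' w))"
      using simple[OF assms] by blast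
    have "n k w \<le> n k u" for k
    proof -
      have "n k w \<le> n k (max u w)" using w by (intro monoD) auto
      also have "\<dots> = n k u" using u w by (intro u) auto
      finally show ?thesis .
    qed
    from this[of m] this[of m'] w show ?thesis by (auto split: if_splits)
  qed
  have le: "n m u \<le> n m s" for m using u by (intro monoD) auto
  have "(\<forall>m. n m s = n m u) \<or> (\<exists>m. n m s = Suc (n m u) \<and> (\<forall>m'. m' \<noteq> m \<longrightarrow> n m' s = n m' u))"
  proof (cases "\<forall>m. n m s = n m u")
    case False
    then obtain m where "n m s \<noteq> n m u" by auto
    with le[of m] have m: "n m u < n m s" by simp
    have "n m s = Suc (n m u)" using *[of m m] m by simp
    moreover have "n m' s = n m' u" if "m' \<noteq> m" for m'
      using *[of m m'] that m le[of m'] by simp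
    ultimately show ?thesis by blast
  qed simp
  with u show ?thesis by (intro exI[of _ u]) blast
qed

text \<open>The infimum of the times with at least \<open>i\<close> jumps is attained because the
  path is right-constant; \<open>zero\<close> keeps it away from 0.\<close>

lemma first_passage:
  assumes "1 \<le> i" "i \<le> n m t" "0 \<le> t"
  shows "\<exists>s. 0 < s \<and> s \<le> t \<and> i \<le> n m s \<and> (\<forall>v\<in>{0..<s}. n m v < i)"
proof -
  define s where "s = Inf {s. 0 \<le> s \<and> i \<le> n m s}"
  have ne: "t \<in> {s. 0 \<le> s \<and> i \<le> n m s}" using assms by auto
  have bb: "bdd_below {s. 0 \<le> s \<and> i \<le> n m s}" by (rule bdd_belowI[of _ 0]) auto
  have s0: "0 \<le> s" "s \<le> t" unfolding s_def using ne bb by (auto intro!: cInf_greatest cInf_lower)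
  have lt: "n m v < i" if "v \<in> {0..<s}" for v
  proof (rule ccontr)
    assume "\<not> n m v < i"
    then have "s \<le> v" unfolding s_def using that bb by (intro cInf_lower) auto
    then show False using that by auto
  qed
  obtain e where e: "e > 0" "\<forall>v\<in>{s..<s+e}. \<forall>m. n m v = n m s" using right_const[OF s0(1)] by blast
  have "\<exists>v\<in>{s. 0 \<le> s \<and> i \<le> n m s}. v < s + e"
    using cInf_lessD[of "{s. 0 \<le> s \<and> i \<le> n m s}" "s+e"] ne e(1) unfolding s_def by auto
  then obtain v where v: "0 \<le> v" "i \<le> n m v" "v < s + e" by auto
  have "v \<ge> s" unfolding s_def using v bb by (intro cInf_lower) auto
  then have "v \<in> {s..<s+e}" using v by simp
  then have "n m v = n m s" using e by blast
  then have ge: "i \<le> n m s" using v by simp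
  have "s \<noteq> 0" using ge assms zero[of m] by auto
  then show ?thesis using s0 lt ge by (intro exI[of _ s]) auto
qed

lemma left_limit_const:
  fixes f :: "real \<Rightarrow> real"
  assumes "u < s" "\<And>v. v \<in> {u..<s} \<Longrightarrow> f v = c"
  shows "Lim (at_left s) f = c"
proof (rule tendsto_Lim)
  have "\<forall>\<^sub>F v in at_left s. f v = c"
    unfolding eventually_at_left_field using assms by (intro exI[of _ u]) auto
  then show "(f \<longlongrightarrow> c) (at_left s)" by (rule tendsto_eventually)
qed simp

context
  fixes a :: "nat \<Rightarrow> nat \<Rightarrow> real" and S :: "real \<Rightarrow> 'w \<Rightarrow> real" and \<omega> :: 'w
  assumes S: "\<And>t. 0 \<le> t \<Longrightarrow> S t \<omega> = (\<Sum>m. \<Sum>i=1..n m t. a m i)"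
begin

text \<open>The sum is constant on \<open>[u, s)\<close>, so the left limit is its value at
  \<open>u\<close> and the jump is the one new summand. The first alternative also records that no
  component changes, which rules it out at first passage times.\<close>

lemma jump_at_cases:
  assumes "0 < s"
  shows "(jump_at S s \<omega> = 0 \<and> (\<exists>u. 0 \<le> u \<and> u < s \<and> (\<forall>m. n m s = n m u))) \<or> (\<exists>m u. 0 \<le> u \<and> u < s \<and> n m s = Suc (n m u) \<and>
     (\<forall>v\<in>{u..<s}. \<forall>m'. n m' v = n m' u) \<and>
     (\<forall>m'. m' \<noteq> m \<longrightarrow> n m' s = n m' u) \<and> jump_at S s \<omega> = a m (n m s))"
proof -
  from jump_structure[OF assms] obtain u where u: "0 \<le> u" "u < s" "\<And>v m. v\<in>{u..<s} \<Longrightarrow> n m v = n m u"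
    "(\<forall>m. n m s = n m u) \<or> (\<exists>m. n m s = Suc (n m u) \<and> (\<forall>m'. m' \<noteq> m \<longrightarrow> n m' s = n m' u))"
    by blast
  have "S v \<omega> = S u \<omega>" if "v \<in> {u..<s}" for v
    using that u(1) by (simp add: S u(3)[OF that])
  then have "Lim (at_left s) (\<lambda>u. S u \<omega>) = S u \<omega>"
    by (intro left_limit_const[OF u(2)])
  then have j: "jump_at S s \<omega> = S s \<omega> - S u \<omega>" by (simp add: jump_at_def)
  from u(4) show ?thesis
  proof
    assume eq: "\<forall>m. n m s = n m u"
    then have "jump_at S s \<omega> = 0" using j assms u(1) by (simp add: S)
    then show ?thesis using eq u(1,2) by blast
  next
    assume "\<exists>m. n m s = Suc (n m u) \<and> (\<forall>m'. m' \<noteq> m \<longrightarrow> n m' s = n m' u)"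
    then obtain m where m: "n m s = Suc (n m u)" "\<And>m'. m' \<noteq> m \<Longrightarrow> n m' s = n m' u" by blast
    have sm: "summable (\<lambda>m. \<Sum>i=1..n m t. a m i)" if "0 \<le> t" for t
      using finite_supp[OF that] by (intro summable_finite[of "{m. n m t \<noteq> 0}"]) auto
    have "jump_at S s \<omega> = (\<Sum>m'. (\<Sum>i=1..n m' s. a m' i) - (\<Sum>i=1..n m' u. a m' i))"
      using j assms u(1) by (simp only: S less_imp_le) (rule suminf_diff[OF sm sm]; simp)
    also have "(\<lambda>m'. (\<Sum>i=1..n m' s. a m' i) - (\<Sum>i=1..n m' u. a m' i)) = (\<lambda>m'. if m' = m then a m (n m s) else 0)"
    proof
      fix m' show "(\<Sum>i=1..n m' s. a m' i) - (\<Sum>i=1..n m' u. a m' i) = (if m' = m then a m (n m s) else 0)"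
        by (cases "m' = m") (simp_all add: m(1) m(2))
    qed
    also have "(\<Sum>m'. if m' = m then a m (n m s) else 0) = a m (n m s)"
      by (subst suminf_finite[of "{m}"]) auto
    finally show ?thesis using m u by blast
  qed
qed

context
  fixes B :: "real set" assumes B: "0 \<notin> B"
begin

text \<open>A mark \<open>(m, i)\<close> corresponds to the time of the \<open>i\<close>-th jump of
  component \<open>m\<close>. Distinct marks have distinct times since no two components jump
  together, and as \<open>0 \<notin> B\<close> every time counted in \<open>B\<close> is such a
  jump, carrying the mark with index \<open>n m s\<close>.\<close>

lemma bij_jump_times:
  assumes t: "0 \<le> t"
  shows "\<exists>T. bij_betw T {(m,i). 1 \<le> i \<and> i \<le> n m t \<and> a m i \<in> B} (jump_times S B t \<omega>)"
proof -
  let ?P = "{(m,i). 1 \<le> i \<and> i \<le> n m t \<and> a m i \<in> B}"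
  let ?Q = "\<lambda>m i s. 0 < s \<and> s \<le> t \<and> i \<le> n m s \<and> (\<forall>v\<in>{0..<s}. n m v < i)"
  define T where "T = (\<lambda>(m,i). SOME s. ?Q m i s)"
  have T: "?Q m i (T (m,i))" if "(m,i) \<in> ?P" for m i
    unfolding T_def prod.case
  proof (rule someI_ex)
    show "\<exists>s. ?Q m i s" using first_passage[of i m t] that t by simp
  qed
  have mi: "n m (T (m,i)) = i \<and> jump_at S (T (m,i)) \<omega> = a m i \<and>
      (\<forall>m'. m' \<noteq> m \<longrightarrow> (\<exists>u. 0 \<le> u \<and> u < T (m,i) \<and> n m' (T (m,i)) = n m' u))" if "(m,i) \<in> ?P" for m i
  proof -
    let ?s = "T (m,i)"
    note q = T[OF that]
    have 1: "n m v < n m ?s" if "0 \<le> v" "v < ?s" for v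
      using q that by (meson atLeastLessThan_iff order_less_le_trans)
    have "\<exists>m0 u. 0 \<le> u \<and> u < ?s \<and> n m0 ?s = Suc (n m0 u) \<and>
     (\<forall>v\<in>{u..<?s}. \<forall>m'. n m' v = n m' u) \<and>
     (\<forall>m'. m' \<noteq> m0 \<longrightarrow> n m' ?s = n m' u) \<and> jump_at S ?s \<omega> = a m0 (n m0 ?s)"
    proof -
      have "0 < ?s" using q by blast
      from jump_at_cases[OF this] show ?thesis
      proof (elim disjE)
        assume "jump_at S ?s \<omega> = 0 \<and> (\<exists>u. 0 \<le> u \<and> u < ?s \<and> (\<forall>m. n m ?s = n m u))"
        then obtain u where "0 \<le> u" "u < ?s" "n m ?s = n m u" by blast
        with 1[of u] show ?thesis by simp
      qed
    qed
    then obtain m0 u where u: "0 \<le> u" "u < ?s" "n m0 ?s = Suc (n m0 u)"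
       "\<And>v m'. v\<in>{u..<?s} \<Longrightarrow> n m' v = n m' u" "\<And>m'. m' \<noteq> m0 \<Longrightarrow> n m' ?s = n m' u" "jump_at S ?s \<omega> = a m0 (n m0 ?s)"
      by (elim exE conjE) (rule that, assumption+, blast+)
    have m0: "m0 = m" using 1[OF u(1,2)] u(5)[of m] by (cases "m0 = m") simp_all
    have "u \<in> {0..<?s}" using u(1,2) by simp
    then have "n m u < i" "i \<le> n m ?s" using q by blast+
    then have i: "n m ?s = i" using u(3) m0 by simp
    have "\<forall>m'. m' \<noteq> m \<longrightarrow> (\<exists>u. 0 \<le> u \<and> u < ?s \<and> n m' ?s = n m' u)"
      using u(1,2,5) m0 by blast
    then show ?thesis using i u(6) m0 by (intro conjI) simp_all
  qed
  have "inj_on T ?P"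
  proof (rule inj_onI; clarify)
    fix m i m' i' assume h: "1 \<le> i" "i \<le> n m t" "a m i \<in> B" "1 \<le> i'" "i' \<le> n m' t" "a m' i' \<in> B" and eq: "T (m, i) = T (m', i')"
    then have p: "(m,i) \<in> ?P" "(m',i') \<in> ?P" by auto
    note 1 = mi[OF p(1)] and 2 = mi[OF p(2)]
    show "m = m' \<and> i = i'"
    proof (cases "m = m'")
      case True
      have "i = n m (T (m,i))" by (rule conjunct1[OF 1, symmetric])
      also have "\<dots> = n m' (T (m',i'))" by (subst eq) (simp only: True)
      also have "\<dots> = i'" by (rule conjunct1[OF 2])
      finally show ?thesis using True by blast
    next
      case False
      then obtain u where u: "0 \<le> u" "u < T (m,i)" "n m' (T (m,i)) = n m' u"
        using conjunct2[OF conjunct2[OF 1]] by metis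
      then have "u \<in> {0..<T (m',i')}" using eq by simp
      then have "n m' u < i'" "i' \<le> n m' (T (m',i'))" using T[OF p(2)] by blast+
      then show ?thesis using u(3) eq by simp
    qed
  qed
  moreover have "T ` ?P = jump_times S B t \<omega>"
  proof (intro equalityI subsetI)
    fix s assume "s \<in> T ` ?P"
    then obtain m i where p: "(m,i) \<in> ?P" "s = T (m,i)" by auto
    have "jump_at S s \<omega> = a m i" using mi[OF p(1)] p(2) by blast
    moreover have "a m i \<in> B" using p(1) by simp
    moreover have "0 < s" "s \<le> t" using T[OF p(1)] p(2) by blast+
    ultimately show "s \<in> jump_times S B t \<omega>" by (simp add: jump_times_def)
  next
    fix s assume "s \<in> jump_times S B t \<omega>"
    then have s: "0 < s" "s \<le> t" "jump_at S s \<omega> \<in> B" by (auto simp: jump_times_def)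
    then have nz: "jump_at S s \<omega> \<noteq> 0" using B by metis
    from jump_at_cases[OF s(1)] obtain m u where u: "0 \<le> u" "u < s" "n m s = Suc (n m u)" "jump_at S s \<omega> = a m (n m s)"
      "\<And>v m'. v\<in>{u..<s} \<Longrightarrow> n m' v = n m' u"
    proof (elim disjE)
      assume "jump_at S s \<omega> = 0 \<and> (\<exists>u. 0 \<le> u \<and> u < s \<and> (\<forall>m. n m s = n m u))"
      then show thesis using nz by blast
    qed (elim exE conjE, rule that, assumption+, blast+)
    have "a m (n m s) \<in> B" "1 \<le> n m s" using s(3) u(3,4) by simp_all
    then have p: "(m, n m s) \<in> ?P" using s(1,2) monoD[of s t m] by simp
    have lt: "n m v < n m s" if v: "0 \<le> v" "v < s" for v
    proof (cases "v \<le> u")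
      case True then show ?thesis using monoD[of v u m] v u(3) by simp
    next
      case False then show ?thesis using u(5)[of v m] v u(3) by simp
    qed
    have "T (m, n m s) = s"
    proof (rule antisym)
      show "T (m, n m s) \<le> s"
      proof (rule ccontr)
        assume "\<not> T (m, n m s) \<le> s"
        then have "s \<in> {0..<T (m, n m s)}" using s(1) by simp
        then have "n m s < n m s" using T[OF p] by blast
        then show False by simp
      qed
      show "s \<le> T (m, n m s)"
      proof (rule ccontr)
        assume "\<not> s \<le> T (m, n m s)"
        moreover have "0 < T (m, n m s)" "n m s \<le> n m (T (m, n m s))" using T[OF p] by blast+
        ultimately show False using lt[of "T (m, n m s)"] by simp
      qed
    qed
    then show "s \<in> T ` ?P" using p by force
  qed
  ultimately show ?thesis unfolding bij_betw_def by blast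
qed

lemma finite_marks:
  assumes t: "0 \<le> t"
  shows "finite {(m,i). 1 \<le> i \<and> i \<le> n m t \<and> P m i}"
  by (rule finite_subset[of _ "Sigma {m. n m t \<noteq> 0} (\<lambda>m. {1..n m t})"]) (use finite_supp[OF t] in \<open>auto intro!: finite_SigmaI\<close>)

lemma finite_jump_times: "0 \<le> t \<Longrightarrow> finite (jump_times S B t \<omega>)"
  using bij_jump_times[of t] finite_marks[of t "\<lambda>m i. a m i \<in> B"] by (auto simp: bij_betw_finite)

lemma card_jump_times:
  assumes t: "0 \<le> t"
  shows "card (jump_times S B t \<omega>) = card {(m,i). 1 \<le> i \<and> i \<le> n m t \<and> a m i \<in> B}"
  using bij_jump_times[OF t] by (auto simp: bij_betw_same_card)

text \<open>In this form the jump count is a sum over marks of the same kind as the process itself,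
  with \<open>indicator B (a m i)\<close> in place of \<open>a m i\<close>. The results on
  increments of such sums therefore apply to both.\<close>

lemma real_card_jump_times:
  assumes t: "0 \<le> t"
  shows "real (card (jump_times S B t \<omega>)) = (\<Sum>m. \<Sum>i=1..n m t. indicator B (a m i))"
proof -
  let ?F = "{m. n m t \<noteq> 0}"
  have "{(m,i). 1 \<le> i \<and> i \<le> n m t \<and> a m i \<in> B} = Sigma ?F (\<lambda>m. {i\<in>{1..n m t}. a m i \<in> B})" by auto
  then have "card {(m,i). 1 \<le> i \<and> i \<le> n m t \<and> a m i \<in> B} = (\<Sum>m\<in>?F. card {i\<in>{1..n m t}. a m i \<in> B})"
    using finite_supp[OF t] by simp
  moreover have "real (card {i\<in>{1..n m t}. a m i \<in> B}) = (\<Sum>i=1..n m t. indicator B (a m i))" for m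
    by (simp add: indicator_def sum.If_cases Int_def)
  ultimately have "real (card {(m,i). 1 \<le> i \<and> i \<le> n m t \<and> a m i \<in> B}) = (\<Sum>m\<in>?F. \<Sum>i=1..n m t. indicator B (a m i))"
    by simp
  also have "\<dots> = (\<Sum>m. \<Sum>i=1..n m t. indicator B (a m i))"
    using finite_supp[OF t] by (subst suminf_finite[of ?F]) auto
  finally show ?thesis using card_jump_times[OF t] by simp
qed

lemma card_jump_times_regular:
  "card (jump_times S B 0 \<omega>) = 0"
  "mono_on {0..} (\<lambda>t. card (jump_times S B t \<omega>))"
  "0 \<le> t \<Longrightarrow> continuous (at_right t) (\<lambda>s. card (jump_times S B s \<omega>))"
proof -
  show "card (jump_times S B 0 \<omega>) = 0" by (simp add: jump_times_def)
  show "mono_on {0..} (\<lambda>t. card (jump_times S B t \<omega>))"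
    by (rule mono_onI, rule card_mono[OF finite_jump_times]) (auto simp: jump_times_def)
  assume t: "0 \<le> t"
  from right_const[OF t] obtain e where "e > 0" and "\<forall>s\<in>{t..<t+e}. \<forall>m. n m s = n m t" by blast
  then have e: "e > 0" "\<And>s m. s\<in>{t..<t+e} \<Longrightarrow> n m s = n m t" by blast+
  have "\<forall>\<^sub>F s in at_right t. card (jump_times S B s \<omega>) = card (jump_times S B t \<omega>)"
    unfolding eventually_at_right_field
  proof (intro exI[of _ "t+e"] conjI allI impI)
    fix s assume s: "t < s" "s < t + e"
    then have "n m s = n m t" for m by (intro e(2)) simp
    then show "card (jump_times S B s \<omega>) = card (jump_times S B t \<omega>)"
      using t s(1) by (simp add: card_jump_times)
  qed (use e(1) in simp)
  then show "continuous (at_right t) (\<lambda>s. card (jump_times S B s \<omega>))"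
    unfolding continuous_within by (rule tendsto_eventually)
qed

end
end
end

section \<open>Freezing independent variables\<close>

text \<open>The \<sigma>-algebra of \<open>generated_events\<close> packaged as a measure space, so
  that measurability with respect to it can be expressed.\<close>

definition generated_algebra ::
  "'a measure \<Rightarrow> 'i set \<Rightarrow> 'b measure \<Rightarrow> ('i \<Rightarrow> 'a \<Rightarrow> 'b) \<Rightarrow> 'a measure" where
  "generated_algebra M I V Z = sigma (space M) (\<Union>i\<in>I. {Z i -` B \<inter> space M | B. B \<in> sets V})"

lemma space_generated_algebra [simp]: "space (generated_algebra M I V Z) = space M"
  unfolding generated_algebra_def by (rule space_measure_of) auto

lemma sets_generated_algebra: "sets (generated_algebra M I V Z) = generated_events M I V Z"
  unfolding generated_algebra_def generated_events_def by (rule sets_measure_of) auto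

lemma measurable_generated_algebra:
  assumes "i \<in> I" "Z i \<in> space M \<rightarrow> space V"
  shows "Z i \<in> generated_algebra M I V Z \<rightarrow>\<^sub>M V"
proof (rule measurableI)
  fix A assume "A \<in> sets V"
  then have "Z i -` A \<inter> space M \<in> (\<Union>i\<in>I. {Z i -` B \<inter> space M | B. B \<in> sets V})" using assms(1) by auto
  then show "Z i -` A \<inter> space (generated_algebra M I V Z) \<in> sets (generated_algebra M I V Z)"
    unfolding sets_generated_algebra generated_events_def space_generated_algebra by (rule sigma_sets.Basic)
qed (use assms(2) in auto)

context prob_space
begin

text \<open>Induction over measurable functions: for indicators this is independence itself, and
  multiples, sums and monotone limits pass through the integral.\<close>

lemma nn_integral_indep_event:
  fixes G :: "'a \<Rightarrow> ennreal"
  assumes ind: "indep_set \<A> (sets K)" and K: "space K = space M" and E: "E \<in> \<A>"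
    and G: "G \<in> borel_measurable K"
  shows "(\<integral>\<^sup>+\<omega>. indicator E \<omega> * G \<omega> \<partial>M) = emeasure M E * (\<integral>\<^sup>+\<omega>. G \<omega> \<partial>M)"
proof -
  have ev: "E \<in> events" and sub: "sets K \<subseteq> events"
    using indep_setD_ev1[OF ind] indep_setD_ev2[OF ind] E by auto
  have KM: "f \<in> borel_measurable M" if "f \<in> borel_measurable K" for f :: "'a \<Rightarrow> ennreal"
    using measurable_mono[of borel borel K M] that K sub by (auto simp: subset_eq)
  show ?thesis using G
  proof (induction rule: borel_measurable_induct)
    case (cong f g)
    have fg: "f \<omega> = g \<omega>" if "\<omega> \<in> space M" for \<omega> using cong(3) K that by auto
    have "(\<integral>\<^sup>+\<omega>. f \<omega> \<partial>M) = (\<integral>\<^sup>+\<omega>. g \<omega> \<partial>M)"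
      by (intro nn_integral_cong fg)
    moreover have "(\<integral>\<^sup>+\<omega>. indicator E \<omega> * f \<omega> \<partial>M) = (\<integral>\<^sup>+\<omega>. indicator E \<omega> * g \<omega> \<partial>M)"
      by (intro nn_integral_cong arg_cong2[where f="(*)"] fg refl)
    ultimately show ?case using cong(4) by (simp only:)
  next
    case (set A)
    then have A: "A \<in> events" using sub by auto
    have "(\<integral>\<^sup>+\<omega>. indicator E \<omega> * indicator A \<omega> \<partial>M) = (\<integral>\<^sup>+\<omega>. indicator (E \<inter> A) \<omega> \<partial>M)"
      by (intro nn_integral_cong) (auto simp: indicator_def)
    also have "\<dots> = emeasure M (E \<inter> A)" using A ev by (intro nn_integral_indicator) auto
    also have "\<dots> = emeasure M E * emeasure M A"
      using indep_setD[OF ind E set] by (simp add: emeasure_eq_measure ennreal_mult)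
    finally show ?case using A by simp
  next
    case (mult f c)
    then have f: "f \<in> borel_measurable M" using KM by blast
    have "(\<integral>\<^sup>+\<omega>. indicator E \<omega> * (c * f \<omega>) \<partial>M) = (\<integral>\<^sup>+\<omega>. c * (indicator E \<omega> * f \<omega>) \<partial>M)"
      by (intro nn_integral_cong) (simp add: mult_ac)
    also have "\<dots> = c * (\<integral>\<^sup>+\<omega>. indicator E \<omega> * f \<omega> \<partial>M)"
      using f ev by (intro nn_integral_cmult) auto
    also have "\<dots> = c * (emeasure M E * (\<integral>\<^sup>+\<omega>. f \<omega> \<partial>M))" by (simp only: mult)
    also have "\<dots> = emeasure M E * (\<integral>\<^sup>+\<omega>. c * f \<omega> \<partial>M)"
      using f by (simp add: nn_integral_cmult mult_ac)
    finally show ?case .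
  next
    case (add f g)
    then have fg: "f \<in> borel_measurable M" "g \<in> borel_measurable M" using KM by blast+
    have "(\<integral>\<^sup>+\<omega>. indicator E \<omega> * (g \<omega> + f \<omega>) \<partial>M) = (\<integral>\<^sup>+\<omega>. indicator E \<omega> * g \<omega> \<partial>M) + (\<integral>\<^sup>+\<omega>. indicator E \<omega> * f \<omega> \<partial>M)"
      using fg ev by (subst nn_integral_add[symmetric]) (auto simp: distrib_left)
    also have "\<dots> = emeasure M E * (\<integral>\<^sup>+\<omega>. g \<omega> + f \<omega> \<partial>M)"
      using fg add by (simp add: nn_integral_add distrib_left)
    finally show ?case .
  next
    case (seq U)
    have U: "U i \<in> borel_measurable M" for i by (rule KM) (rule seq)
    have inc: "incseq U" by (rule seq)
    then have inc': "incseq (\<lambda>i \<omega>. indicator E \<omega> * U i \<omega>)"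
      unfolding incseq_def le_fun_def by (intro allI impI mult_left_mono) auto
    have 1: "(\<integral>\<^sup>+\<omega>. (SUP i. U i \<omega>) \<partial>M) = (SUP i. \<integral>\<^sup>+\<omega>. U i \<omega> \<partial>M)"
      by (rule nn_integral_monotone_convergence_SUP[OF inc U])
    have "(\<integral>\<^sup>+\<omega>. indicator E \<omega> * (SUP i. U i \<omega>) \<partial>M) = (\<integral>\<^sup>+\<omega>. (SUP i. indicator E \<omega> * U i \<omega>) \<partial>M)"
      by (simp only: SUP_mult_left_ennreal)
    also have "\<dots> = (SUP i. \<integral>\<^sup>+\<omega>. indicator E \<omega> * U i \<omega> \<partial>M)"
      by (rule nn_integral_monotone_convergence_SUP[OF inc']) (use U ev in measurable)
    also have "\<dots> = (SUP i. emeasure M E * (\<integral>\<^sup>+\<omega>. U i \<omega> \<partial>M))"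
      by (simp only: seq)
    also have "\<dots> = emeasure M E * (SUP i. \<integral>\<^sup>+\<omega>. U i \<omega> \<partial>M)"
      by (simp only: SUP_mult_left_ennreal)
    finally show ?case unfolding 1[symmetric] by (simp add: image_comp)
  qed
qed

text \<open>Conditioning on an independent variable \<open>V\<close> amounts to fixing its value in
  \<open>G\<close>. Because \<open>V\<close> has countable range, the integral splits into the
  events \<open>V = v\<close>, and measurability of \<open>G v\<close> for each fixed
  \<open>v\<close> suffices.\<close>

lemma freeze_countable:
  fixes V :: "'a \<Rightarrow> 'c" and G :: "'c \<Rightarrow> 'a \<Rightarrow> real"
  assumes ind: "indep_set \<A> (sets K)" and K: "space K = space M"
    and I: "countable I" and V: "\<And>\<omega>. \<omega> \<in> space M \<Longrightarrow> V \<omega> \<in> I"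
    and ev: "\<And>v. v \<in> I \<Longrightarrow> {\<omega>\<in>space M. V \<omega> = v} \<in> \<A>"
    and G: "\<And>v. v \<in> I \<Longrightarrow> G v \<in> borel_measurable K"
    and bound: "\<And>v \<omega>. v \<in> I \<Longrightarrow> 0 \<le> G v \<omega> \<and> G v \<omega> \<le> 1"
  shows "expectation (\<lambda>\<omega>. G (V \<omega>) \<omega>) = expectation (\<lambda>\<omega>. expectation (G (V \<omega>)))"
    and "(\<lambda>\<omega>. G (V \<omega>) \<omega>) \<in> borel_measurable M"
    and "(\<lambda>\<omega>. expectation (G (V \<omega>))) \<in> borel_measurable M"
proof -
  have sub: "sets K \<subseteq> events" "\<A> \<subseteq> events"
    using indep_setD_ev1[OF ind] indep_setD_ev2[OF ind] by auto
  have GM: "G v \<in> borel_measurable M" if "v \<in> I" for v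
    using measurable_mono[of borel borel K M] G[OF that] K sub by (auto simp: subset_eq)
  have VM: "V \<in> M \<rightarrow>\<^sub>M count_space I"
    using I V ev sub by (subst measurable_count_space_eq_countable) (auto simp: vimage_def Int_def conj_commute)
  have meas: "(\<lambda>\<omega>. F (V \<omega>) \<omega>) \<in> borel_measurable M" if "\<And>v. v \<in> I \<Longrightarrow> F v \<in> borel_measurable M" for F :: "'c \<Rightarrow> 'a \<Rightarrow> real"
    by (rule measurable_compose_countable'[where f=F, OF that VM I])
  show m1: "(\<lambda>\<omega>. G (V \<omega>) \<omega>) \<in> borel_measurable M" using GM by (rule meas)
  show m2: "(\<lambda>\<omega>. expectation (G (V \<omega>))) \<in> borel_measurable M" by (rule meas[of "\<lambda>v _. expectation (G v)"]) auto
  have E: "{\<omega>\<in>space M. V \<omega> = v} \<in> events" if "v \<in> I" for v using ev[OF that] sub by auto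
  have *: "(\<integral>\<^sup>+\<omega>. F (V \<omega>) \<omega> \<partial>M) = (\<integral>\<^sup>+v. (\<integral>\<^sup>+\<omega>. indicator {\<omega>\<in>space M. V \<omega> = v} \<omega> * F v \<omega> \<partial>M) \<partial>count_space I)"
    if F: "\<And>v. v \<in> I \<Longrightarrow> F v \<in> borel_measurable M" for F :: "'c \<Rightarrow> 'a \<Rightarrow> ennreal"
  proof -
    have "(\<integral>\<^sup>+\<omega>. F (V \<omega>) \<omega> \<partial>M) = (\<integral>\<^sup>+\<omega>. (\<integral>\<^sup>+v. indicator {\<omega>\<in>space M. V \<omega> = v} \<omega> * F v \<omega> \<partial>count_space I) \<partial>M)"
    proof (rule nn_integral_cong)
      fix \<omega> assume w: "\<omega> \<in> space M"
      have "(\<integral>\<^sup>+v. indicator {\<omega>\<in>space M. V \<omega> = v} \<omega> * F v \<omega> \<partial>count_space I) = (\<integral>\<^sup>+v. F v \<omega> * indicator {V \<omega>} v \<partial>count_space I)"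
        using w by (intro nn_integral_cong) (auto simp: indicator_def)
      also have "\<dots> = F (V \<omega>) \<omega>" using V[OF w] by (subst nn_integral_indicator_singleton) auto
      finally show "F (V \<omega>) \<omega> = (\<integral>\<^sup>+v. indicator {\<omega>\<in>space M. V \<omega> = v} \<omega> * F v \<omega> \<partial>count_space I)" ..
    qed
    also have "\<dots> = (\<integral>\<^sup>+v. (\<integral>\<^sup>+\<omega>. indicator {\<omega>\<in>space M. V \<omega> = v} \<omega> * F v \<omega> \<partial>M) \<partial>count_space I)"
      using I F E by (intro nn_integral_count_space_nn_integral) auto
    finally show ?thesis .
  qed
  have ge: "0 \<le> expectation (G v)" if "v \<in> I" for v using bound[OF that] by (intro integral_nonneg_AE) auto
  have intG: "integrable M (G v)" if "v \<in> I" for v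
    using bound[OF that] GM[OF that] by (intro integrable_const_bound[of _ 1]) auto
  have le: "expectation (G v) \<le> 1" if "v \<in> I" for v
    using bound[OF that] by (intro integral_le_const[OF intG[OF that]]) auto
  have "(\<integral>\<^sup>+\<omega>. ennreal (G (V \<omega>) \<omega>) \<partial>M) = (\<integral>\<^sup>+v. (\<integral>\<^sup>+\<omega>. indicator {\<omega>\<in>space M. V \<omega> = v} \<omega> * ennreal (G v \<omega>) \<partial>M) \<partial>count_space I)"
    using GM by (intro *) auto
  also have "\<dots> = (\<integral>\<^sup>+v. (\<integral>\<^sup>+\<omega>. indicator {\<omega>\<in>space M. V \<omega> = v} \<omega> * ennreal (expectation (G v)) \<partial>M) \<partial>count_space I)"
  proof (rule nn_integral_cong)
    fix v assume "v \<in> space (count_space I)"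
    then have v: "v \<in> I" by simp
    have "(\<integral>\<^sup>+\<omega>. indicator {\<omega>\<in>space M. V \<omega> = v} \<omega> * ennreal (G v \<omega>) \<partial>M) = emeasure M {\<omega>\<in>space M. V \<omega> = v} * (\<integral>\<^sup>+\<omega>. ennreal (G v \<omega>) \<partial>M)"
      using G[OF v] by (intro nn_integral_indep_event[OF ind K ev[OF v]]) auto
    also have "(\<integral>\<^sup>+\<omega>. ennreal (G v \<omega>) \<partial>M) = ennreal (expectation (G v))"
      using bound[OF v] intG[OF v] by (intro nn_integral_eq_integral) auto
    finally show "(\<integral>\<^sup>+\<omega>. indicator {\<omega>\<in>space M. V \<omega> = v} \<omega> * ennreal (G v \<omega>) \<partial>M)
       = (\<integral>\<^sup>+\<omega>. indicator {\<omega>\<in>space M. V \<omega> = v} \<omega> * ennreal (expectation (G v)) \<partial>M)"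
      using E[OF v] by (simp add: nn_integral_multc)
  qed
  also have "\<dots> = (\<integral>\<^sup>+\<omega>. ennreal (expectation (G (V \<omega>))) \<partial>M)"
    by (rule *[symmetric]) auto
  finally have "(\<integral>\<^sup>+\<omega>. ennreal (G (V \<omega>) \<omega>) \<partial>M) = (\<integral>\<^sup>+\<omega>. ennreal (expectation (G (V \<omega>))) \<partial>M)" .
  moreover have "(\<integral>\<^sup>+\<omega>. ennreal (G (V \<omega>) \<omega>) \<partial>M) = ennreal (expectation (\<lambda>\<omega>. G (V \<omega>) \<omega>))"
    using bound V m1 by (intro nn_integral_eq_integral integrable_const_bound[of _ 1]) auto
  moreover have "(\<integral>\<^sup>+\<omega>. ennreal (expectation (G (V \<omega>))) \<partial>M) = ennreal (expectation (\<lambda>\<omega>. expectation (G (V \<omega>))))"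
    using ge le V m2 by (intro nn_integral_eq_integral integrable_const_bound[of _ 1]) auto
  ultimately have "ennreal (expectation (\<lambda>\<omega>. G (V \<omega>) \<omega>)) = ennreal (expectation (\<lambda>\<omega>. expectation (G (V \<omega>))))"
    by (simp only:)
  moreover have "0 \<le> expectation (\<lambda>\<omega>. G (V \<omega>) \<omega>)" "0 \<le> expectation (\<lambda>\<omega>. expectation (G (V \<omega>)))"
    using bound ge V by (auto intro!: integral_nonneg_AE)
  ultimately show "expectation (\<lambda>\<omega>. G (V \<omega>) \<omega>) = expectation (\<lambda>\<omega>. expectation (G (V \<omega>)))"
    by (simp only: ennreal_inj)
qed

lemma indep_vars_reindex':
  assumes f: "inj_on f I" and X: "indep_vars M' X (f ` I)"
  shows "indep_vars (\<lambda>i. M' (f i)) (\<lambda>i. X (f i)) I"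
  unfolding indep_vars_def2
proof
  show "\<forall>i\<in>I. random_variable (M' (f i)) (X (f i))" using X by (auto simp: indep_vars_def2)
  have ind: "indep_sets (\<lambda>j. {X j -` A \<inter> space M |A. A \<in> sets (M' j)}) (f ` I)"
    using X by (simp add: indep_vars_def2)
  show "indep_sets (\<lambda>i. {X (f i) -` A \<inter> space M |A. A \<in> sets (M' (f i))}) I"
  proof (rule indep_setsI)
    fix i assume "i \<in> I" then show "{X (f i) -` A \<inter> space M |A. A \<in> sets (M' (f i))} \<subseteq> events"
      using ind by (auto simp: indep_sets_def)
  next
    fix A J assume J: "J \<noteq> {}" "J \<subseteq> I" "finite J" and A: "\<forall>j\<in>J. A j \<in> {X (f j) -` A \<inter> space M |A. A \<in> sets (M' (f j))}"
    have inj: "inj_on f J" using f J by (auto intro: inj_on_subset)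
    let ?A = "\<lambda>k. A (the_inv_into J f k)"
    have "prob (\<Inter>k\<in>f ` J. ?A k) = (\<Prod>k\<in>f`J. prob (?A k))"
      using J A inj by (intro indep_setsD[OF ind]) (auto simp: the_inv_into_f_f)
    then show "prob (\<Inter>j\<in>J. A j) = (\<Prod>j\<in>J. prob (A j))"
      using inj by (simp add: prod.reindex the_inv_into_f_f)
  qed
qed

end

section \<open>Marked Poisson processes\<close>

lemma measurable_diff_nat:
  fixes f g :: "'a \<Rightarrow> nat"
  assumes "f \<in> K \<rightarrow>\<^sub>M count_space UNIV" "g \<in> K \<rightarrow>\<^sub>M count_space UNIV"
  shows "(\<lambda>x. f x - g x) \<in> K \<rightarrow>\<^sub>M count_space UNIV"
proof (rule measurable_compose_countable[where f="\<lambda>i x. i - g x", OF _ assms(1)])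
  fix i show "(\<lambda>x. i - g x) \<in> K \<rightarrow>\<^sub>M count_space UNIV"
    by (rule measurable_compose[OF assms(2)]) simp
qed

lemma increasing_times:
  assumes "0 \<le> u 0" "\<And>k. k < n \<Longrightarrow> u k < (u (Suc k) :: real)" "j \<le> k" "k \<le> n"
  shows "0 \<le> u j" "u j \<le> u k"
proof -
  show "u j \<le> u k" using assms(3,4)
    by (induction k rule: dec_induct) (use assms(2) in \<open>auto intro: order_trans less_imp_le simp: Suc_le_eq\<close>)
  have "j \<le> n" using assms(3,4) by simp
  then show "0 \<le> u j"
    by (induction j) (use assms(1,2) in \<open>auto intro: order_trans less_imp_le simp: Suc_le_eq\<close>)
qed

locale marked_poisson = prob_space M for M :: "'a measure" +
  fixes H :: "nat \<Rightarrow> real" and N :: "nat \<Rightarrow> real \<Rightarrow> 'a \<Rightarrow> nat" and Y :: "nat \<Rightarrow> nat \<Rightarrow> 'a \<Rightarrow> real"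
  assumes H_pos: "0 < H m" and H_summable: "summable H"
    and poisson: "poisson_process M (H m) (N m)"
    and N_indep: "indep_sets (\<lambda>m. generated_events M {0..} (count_space UNIV) (N m)) UNIV"
    and Y_distr: "1 \<le> i \<Longrightarrow> distributed M lborel (Y m i) (exponential_density 1)"
    and Y_indep: "indep_vars (\<lambda>_. borel) (\<lambda>(m, i). Y m i) (UNIV \<times> {1..})"
    and NY_indep: "indep_set
           (generated_events M (UNIV \<times> {0..}) (count_space UNIV) (\<lambda>(m, t). N m t))
           (generated_events M (UNIV \<times> {1..}) borel (\<lambda>(m, i). Y m i))"
begin

lemma N_measurable: "0 \<le> t \<Longrightarrow> N m t \<in> M \<rightarrow>\<^sub>M count_space UNIV"
  using poisson[of m] by (auto simp: poisson_process_def)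

lemma Y_measurable: "1 \<le> i \<Longrightarrow> Y m i \<in> borel_measurable M"
  using distributed_measurable[OF Y_distr, of i m] by simp

lemma N_regular: "AE \<omega> in M. \<forall>m. N m 0 \<omega> = 0 \<and> mono_on {0..} (\<lambda>t. N m t \<omega>) \<and>
    (\<forall>t\<ge>0. continuous (at_right t) (\<lambda>s. N m s \<omega>))"
  unfolding AE_all_countable using poisson by (auto simp: poisson_process_def)

text \<open>An intersection over all \<open>(k, m)\<close> is taken component by component:
  independence of the processes factors it over \<open>m\<close>, and the independent increments of
  each process factor it over \<open>k\<close>. Joint independence is what later separates the rows
  that belong to different time intervals.\<close>

lemma N_increments_indep:
  assumes u: "0 \<le> u 0" "\<And>k. k < n \<Longrightarrow> u k < u (Suc k)"
  shows "indep_vars (\<lambda>_. count_space UNIV) (\<lambda>(k,m) \<omega>. N m (u (Suc k)) \<omega> - N m (u k) \<omega>) ({..<n} \<times> {..<L})"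
    (is "indep_vars _ ?X ?I")
proof (cases "?I = {}")
  case True show ?thesis unfolding True indep_vars_def2 indep_sets_def by auto
next
  case False
  have u0: "0 \<le> u k" if "k \<le> n" for k
    using that by (induction k) (use u in \<open>auto intro: order_trans less_imp_le simp: Suc_le_eq\<close>)
  let ?K = "\<lambda>m. generated_algebra M {0..} (count_space UNIV) (N m)"
  have XK: "(\<lambda>\<omega>. N m (u (Suc k)) \<omega> - N m (u k) \<omega>) \<in> ?K m \<rightarrow>\<^sub>M count_space UNIV" if "k < n" for k m
    using u0[of k] u0[of "Suc k"] that
    by (intro measurable_diff_nat measurable_generated_algebra) auto
  have XM: "?X p \<in> M \<rightarrow>\<^sub>M count_space UNIV" if "p \<in> ?I" for p
    using u0[of "fst p"] u0[of "Suc (fst p)"] that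
    by (auto intro!: measurable_diff_nat N_measurable split: prod.split)
  have prod1: "prob (\<Inter>k<n. A k) = (\<Prod>k<n. prob (A k))"
    if "\<And>k. k < n \<Longrightarrow> \<exists>C. A k = (\<lambda>\<omega>. N m (u (Suc k)) \<omega> - N m (u k) \<omega>) -` C \<inter> space M" and n: "0 < n" for A m
  proof -
    have "\<forall>k\<in>{..<n}. \<exists>C. A k = (\<lambda>\<omega>. N m (u (Suc k)) \<omega> - N m (u k) \<omega>) -` C \<inter> space M" using that by simp
    from bchoice[OF this] obtain C where
      A: "\<And>k. k < n \<Longrightarrow> A k = (\<lambda>\<omega>. N m (u (Suc k)) \<omega> - N m (u k) \<omega>) -` C k \<inter> space M" by auto
    have "indep_vars (\<lambda>_. count_space UNIV) (\<lambda>k \<omega>. N m (u (Suc k)) \<omega> - N m (u k) \<omega>) {..<n}"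
      using poisson[of m] u unfolding poisson_process_def independent_increments_def by blast
    from indep_varsD_finite[OF this, of C] n show ?thesis by (simp add: A lessThan_empty_iff)
  qed
  show ?thesis unfolding indep_vars_def2
  proof (intro conjI ballI)
    fix p assume "p \<in> ?I" then show "random_variable (count_space UNIV) (?X p)" by (rule XM)
  next
    show "indep_sets (\<lambda>p. {?X p -` A \<inter> space M |A. A \<in> sets (count_space UNIV)}) ?I"
    proof (subst indep_sets_finite; (intro ballI)?)
      fix A assume A: "A \<in> Pi ?I (\<lambda>p. {?X p -` A \<inter> space M |A. A \<in> sets (count_space UNIV)})"
      have "\<forall>p\<in>?I. \<exists>C. A p = ?X p -` C \<inter> space M" using A by (auto simp: Pi_iff)
      from bchoice[OF this] obtain C where C: "\<And>p. p \<in> ?I \<Longrightarrow> A p = ?X p -` C p \<inter> space M" by blast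
      have n: "0 < n" "0 < L" using False by auto
      have "(\<Inter>p\<in>?I. A p) = (\<Inter>m<L. \<Inter>k<n. A (k,m))" by auto
      also have "prob \<dots> = (\<Prod>m<L. prob (\<Inter>k<n. A (k,m)))"
      proof (rule indep_setsD[OF N_indep])
        show "\<forall>m\<in>{..<L}. (\<Inter>k<n. A (k, m)) \<in> generated_events M {0..} (count_space UNIV) (N m)"
        proof
          fix m assume m: "m \<in> {..<L}"
          have "A (k,m) \<in> sets (?K m)" if "k < n" for k
            using measurable_sets[OF XK[OF that, of m], of "C (k,m)"] C[of "(k,m)"] that m by simp
          then have "(\<Inter>k<n. A (k, m)) \<in> sets (?K m)" using n by (intro sets.finite_INT) auto
          then show "(\<Inter>k<n. A (k, m)) \<in> generated_events M {0..} (count_space UNIV) (N m)"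
            by (simp only: sets_generated_algebra)
        qed
      qed (use n in auto)
      also have "\<dots> = (\<Prod>m<L. \<Prod>k<n. prob (A (k,m)))"
      proof (intro prod.cong refl prod1)
        fix m k assume "m \<in> {..<L}" "k < n"
        then show "\<exists>C. A (k,m) = (\<lambda>\<omega>. N m (u (Suc k)) \<omega> - N m (u k) \<omega>) -` C \<inter> space M"
          using C[of "(k,m)"] by auto
      qed (use n in auto)
      also have "\<dots> = (\<Prod>p\<in>?I. prob (A p))"
        by (subst prod.swap) (simp add: prod.cartesian_product case_prod_beta)
      finally show "prob (\<Inter>p\<in>?I. A p) = (\<Prod>p\<in>?I. prob (A p))" .
    next
      fix p assume p: "p \<in> ?I"
      then show "{?X p -` A \<inter> space M |A. A \<in> sets (count_space UNIV)} \<subseteq> events"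
        using XM[OF p] by (auto intro: measurable_sets)
      show "space M \<in> {?X p -` A \<inter> space M |A. A \<in> sets (count_space UNIV)}"
        by (auto intro!: exI[of _ UNIV])
    qed (use False in auto)
  qed
qed

lemma N_increment_law:
  assumes "0 \<le> s" "s < t"
  shows "prob {\<omega>\<in>space M. N m t \<omega> - N m s \<omega> = k} = (H m * (t - s)) ^ k / fact k * exp (- (H m * (t - s)))"
proof -
  have d: "distr M (count_space UNIV) (\<lambda>\<omega>. N m t \<omega> - N m s \<omega>) = measure_pmf (poisson_pmf (H m * (t - s)))"
    using poisson[of m] assms by (auto simp: poisson_process_def)
  have me: "(\<lambda>\<omega>. N m t \<omega> - N m s \<omega>) \<in> M \<rightarrow>\<^sub>M count_space UNIV"
    using assms by (intro measurable_diff_nat N_measurable) auto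
  have "pmf (poisson_pmf (H m * (t - s))) k = measure (distr M (count_space UNIV) (\<lambda>\<omega>. N m t \<omega> - N m s \<omega>)) {k}"
    by (simp add: d measure_pmf_single)
  also have "\<dots> = prob {\<omega>\<in>space M. N m t \<omega> - N m s \<omega> = k}"
    using me by (subst measure_distr) (auto intro!: arg_cong[where f=prob])
  finally show ?thesis using assms H_pos[of m] by simp
qed

text \<open>The conditional mean of \<open>f\<close> applied to an increment, given that component
  \<open>m\<close> contributes \<open>d m\<close> marks. Since the marks are i.i.d., only their
  numbers matter.\<close>

definition marks_mean :: "(nat \<Rightarrow> real \<Rightarrow> real) \<Rightarrow> (real \<Rightarrow> real) \<Rightarrow> nat \<Rightarrow> (nat \<Rightarrow> nat) \<Rightarrow> real" where
  "marks_mean \<psi> f L d = expectation (\<lambda>\<omega>. f (\<Sum>m<L. \<Sum>i=1..d m. \<psi> m (Y m i \<omega>)))"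

lemma marks_mean_cong: "(\<And>m. m < L \<Longrightarrow> d m = e m) \<Longrightarrow> marks_mean \<psi> f L d = marks_mean \<psi> f L e"
  unfolding marks_mean_def by (intro Bochner_Integration.integral_cong refl arg_cong[where f=f] sum.cong) auto

text \<open>The truncation to \<open>L\<close> components involves finitely many counts, which
  together take only countably many values; this is what freezing requires.\<close>

definition marked_sum :: "(nat \<Rightarrow> real \<Rightarrow> real) \<Rightarrow> nat \<Rightarrow> real \<Rightarrow> 'a \<Rightarrow> real" where
  "marked_sum \<psi> L t \<omega> = (\<Sum>m<L. \<Sum>i=1..N m t \<omega>. \<psi> m (Y m i \<omega>))"

text \<open>The marks in a block starting after position \<open>a m\<close> have the same joint law
  as the first \<open>d m\<close> marks, namely a product of exponential laws that does not depend
  on the shift.\<close>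

lemma block_law:
  assumes [measurable]: "f \<in> borel_measurable borel" "\<And>m. \<psi> m \<in> borel_measurable borel"
  shows "expectation (\<lambda>\<omega>. f (\<Sum>m<L. \<Sum>i=Suc (a m)..a m + d m. \<psi> m (Y m i \<omega>))) = marks_mean \<psi> f L d"
proof -
  define K where "K = Sigma {..<L} (\<lambda>m. {1..d m})"
  define g where "g = (\<lambda>y :: nat \<times> nat \<Rightarrow> real. f (\<Sum>m<L. \<Sum>i=1..d m. \<psi> m (y (m,i))))"
  have shift: "(\<Sum>i=Suc (b m)..b m + d m. \<psi> m (Y m i \<omega>)) = (\<Sum>i=1..d m. \<psi> m (Y m (b m + i) \<omega>))" for b m \<omega>
    by (rule sum.reindex_bij_witness[of _ "\<lambda>i. b m + i" "\<lambda>i. i - b m"]) auto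
  show ?thesis
  proof (cases "K = {}")
    case True
    then have "d m = 0" if "m < L" for m using that unfolding K_def by force
    then show ?thesis unfolding marks_mean_def
      by (intro Bochner_Integration.integral_cong refl arg_cong[where f=f] sum.cong) auto
  next
    case False
    let ?X = "\<lambda>b (m,i). Y m (b m + i)"
    have ind: "indep_vars (\<lambda>_. borel) (?X b) K" for b
    proof -
      let ?h = "\<lambda>(m,i). (m, b m + i)"
      have "indep_vars (\<lambda>_. borel) (\<lambda>(m, i). Y m i) (?h ` K)"
        by (rule indep_vars_subset[OF Y_indep]) (auto simp: K_def)
      moreover have "inj_on ?h K" by (auto simp: inj_on_def)
      ultimately have "indep_vars (\<lambda>_. borel) (\<lambda>p. (\<lambda>(m, i). Y m i) (?h p)) K"
        using indep_vars_reindex'[where M'="\<lambda>_. borel"] by blast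
      then show ?thesis by (simp add: case_prod_unfold)
    qed
    have distr: "distr M borel (?X b p) = density lborel (exponential_density 1)" if "p \<in> K" for b p
      using that distributed_distr_eq_density[OF Y_distr[of "b (fst p) + snd p" "fst p"]]
      by (auto simp: K_def case_prod_beta cong: distr_cong)
    have rv: "random_variable borel (?X b p)" if "p \<in> K" for b p
      using that Y_measurable[of "b (fst p) + snd p" "fst p"] by (auto simp: K_def case_prod_beta)
    have law: "distr M (PiM K (\<lambda>_. borel)) (\<lambda>\<omega>. \<lambda>p\<in>K. ?X b p \<omega>) = PiM K (\<lambda>_. density lborel (exponential_density 1))" for b
    proof -
      have "distr M (PiM K (\<lambda>_. borel)) (\<lambda>\<omega>. \<lambda>p\<in>K. ?X b p \<omega>) = PiM K (\<lambda>p. distr M borel (?X b p))"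
        using indep_vars_iff_distr_eq_PiM'[OF False, of "?X b" "\<lambda>_. borel"] rv ind[of b] by blast
      also have "\<dots> = PiM K (\<lambda>_. density lborel (exponential_density 1))"
        by (intro PiM_cong refl distr)
      finally show ?thesis .
    qed
    have comp: "(\<lambda>y. y (m,i)) \<in> PiM K (\<lambda>_. borel) \<rightarrow>\<^sub>M (borel :: real measure)" if "m < L" "i \<in> {1..d m}" for m i
      using that by (intro measurable_component_singleton) (auto simp: K_def)
    have g: "g \<in> PiM K (\<lambda>_. borel) \<rightarrow>\<^sub>M borel"
      unfolding g_def
      by (intro measurable_compose[OF _ assms(1)] borel_measurable_sum measurable_compose[OF comp assms(2)]) auto
    have X: "(\<lambda>\<omega>. \<lambda>p\<in>K. ?X b p \<omega>) \<in> M \<rightarrow>\<^sub>M PiM K (\<lambda>_. borel)" for b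
      by (intro measurable_restrict rv)
    have "expectation (\<lambda>\<omega>. f (\<Sum>m<L. \<Sum>i=Suc (b m)..b m + d m. \<psi> m (Y m i \<omega>)))
        = expectation (\<lambda>\<omega>. g (\<lambda>p\<in>K. ?X b p \<omega>))" for b
      unfolding g_def shift
      by (intro Bochner_Integration.integral_cong refl arg_cong[where f=f] sum.cong) (auto simp: K_def)
    moreover have "expectation (\<lambda>\<omega>. g (\<lambda>p\<in>K. ?X b p \<omega>)) = (\<integral>y. g y \<partial>PiM K (\<lambda>_. density lborel (exponential_density 1)))" for b
      by (simp only: integral_distr[OF X g, symmetric] law)
    ultimately have "expectation (\<lambda>\<omega>. f (\<Sum>m<L. \<Sum>i=Suc (b m)..b m + d m. \<psi> m (Y m i \<omega>)))
        = (\<integral>y. g y \<partial>PiM K (\<lambda>_. density lborel (exponential_density 1)))" for b by simp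
    \<comment> \<open>The integral on the right does not involve \<open>b\<close>, so the shifts
      \<open>a\<close> and 0 may be compared.\<close>
    from this[of a] this[of "\<lambda>_. 0"] show ?thesis by (simp add: marks_mean_def)
  qed
qed

text \<open>Blocks over consecutive index ranges use disjoint sets of marks, so functions of
  different blocks are independent.\<close>

lemma blocks_independent:
  fixes v :: "nat \<Rightarrow> nat \<Rightarrow> nat"
  assumes f: "\<And>k. f k \<in> borel_measurable borel" and f01: "\<And>k x. 0 \<le> f k x \<and> f k x \<le> 1"
    and \<psi>: "\<And>m. \<psi> m \<in> borel_measurable borel"
    and v: "\<And>j k m. j \<le> k \<Longrightarrow> k \<le> n \<Longrightarrow> m < L \<Longrightarrow> v j m \<le> v k m"
  shows "expectation (\<lambda>\<omega>. \<Prod>k<n. f k (\<Sum>m<L. \<Sum>i=Suc (v k m)..v (Suc k) m. \<psi> m (Y m i \<omega>)))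
    = (\<Prod>k<n. marks_mean \<psi> (f k) L (\<lambda>m. v (Suc k) m - v k m))"
proof -
  define K where "K = (\<lambda>k. Sigma {..<L} (\<lambda>m. {Suc (v k m)..v (Suc k) m}))"
  define g where "g = (\<lambda>k (y :: nat \<times> nat \<Rightarrow> real). f k (\<Sum>m<L. \<Sum>i=Suc (v k m)..v (Suc k) m. \<psi> m (y (m,i))))"
  have "disjoint_family_on K {..<n}"
    unfolding disjoint_family_on_def
  proof (intro ballI impI)
    fix j k assume jk: "j \<in> {..<n}" "k \<in> {..<n}" "j \<noteq> k"
    have *: "K j \<inter> K k = {}" if "j < k" "k < n" for j k
    proof -
      have "v (Suc j) m \<le> v k m" if "m < L" for m using \<open>j < k\<close> \<open>k < n\<close> that by (intro v) auto
      then show ?thesis unfolding K_def by fastforce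
    qed
    show "K j \<inter> K k = {}" using jk *[of j k] *[of k j] by (cases "j < k") auto
  qed
  then have "indep_vars (\<lambda>k. PiM (K k) (\<lambda>_. borel)) (\<lambda>k \<omega>. \<lambda>p\<in>K k. (case p of (m,i) \<Rightarrow> Y m i) \<omega>) {..<n}"
    by (intro indep_vars_restrict[OF Y_indep]) (auto simp: K_def)
  moreover have "g k \<in> PiM (K k) (\<lambda>_. borel) \<rightarrow>\<^sub>M borel" for k
  proof -
    have comp: "(\<lambda>y. y (m,i)) \<in> PiM (K k) (\<lambda>_. borel) \<rightarrow>\<^sub>M (borel :: real measure)"
      if "m < L" "i \<in> {Suc (v k m)..v (Suc k) m}" for m i
      using that by (intro measurable_component_singleton) (auto simp: K_def)
    show ?thesis unfolding g_def
      by (intro measurable_compose[OF _ f] borel_measurable_sum measurable_compose[OF comp \<psi>]) auto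
  qed
  ultimately have ind: "indep_vars (\<lambda>_. borel) (\<lambda>k \<omega>. g k (\<lambda>p\<in>K k. (case p of (m,i) \<Rightarrow> Y m i) \<omega>)) {..<n}"
    by (rule indep_vars_compose2)
  have eq: "g k (\<lambda>p\<in>K k. (case p of (m,i) \<Rightarrow> Y m i) \<omega>) = f k (\<Sum>m<L. \<Sum>i=Suc (v k m)..v (Suc k) m. \<psi> m (Y m i \<omega>))" for k \<omega>
    unfolding g_def by (intro arg_cong[where f="f k"] sum.cong refl) (auto simp: K_def)
  have ind': "indep_vars (\<lambda>_. borel) (\<lambda>k \<omega>. f k (\<Sum>m<L. \<Sum>i=Suc (v k m)..v (Suc k) m. \<psi> m (Y m i \<omega>))) {..<n}"
    using ind unfolding eq .
  have "expectation (\<lambda>\<omega>. \<Prod>k<n. f k (\<Sum>m<L. \<Sum>i=Suc (v k m)..v (Suc k) m. \<psi> m (Y m i \<omega>)))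
    = (\<Prod>k<n. expectation (\<lambda>\<omega>. f k (\<Sum>m<L. \<Sum>i=Suc (v k m)..v (Suc k) m. \<psi> m (Y m i \<omega>))))"
  proof (rule indep_vars_lebesgue_integral[OF _ ind'])
    fix k assume "k \<in> {..<n}"
    then have "random_variable borel (\<lambda>\<omega>. f k (\<Sum>m<L. \<Sum>i=Suc (v k m)..v (Suc k) m. \<psi> m (Y m i \<omega>)))"
      using ind' by (auto simp: indep_vars_def2)
    then show "integrable M (\<lambda>\<omega>. f k (\<Sum>m<L. \<Sum>i=Suc (v k m)..v (Suc k) m. \<psi> m (Y m i \<omega>)))"
      using f01 by (intro integrable_const_bound[of _ 1]) auto
  qed simp
  also have "\<dots> = (\<Prod>k<n. marks_mean \<psi> (f k) L (\<lambda>m. v (Suc k) m - v k m))"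
  proof (rule prod.cong[OF refl])
    fix k assume k: "k \<in> {..<n}"
    have "expectation (\<lambda>\<omega>. f k (\<Sum>m<L. \<Sum>i=Suc (v k m)..v (Suc k) m. \<psi> m (Y m i \<omega>)))
      = expectation (\<lambda>\<omega>. f k (\<Sum>m<L. \<Sum>i=Suc (v k m)..v k m + (v (Suc k) m - v k m). \<psi> m (Y m i \<omega>)))"
      using v[of k "Suc k"] k by (intro Bochner_Integration.integral_cong refl arg_cong[where f="f k"] sum.cong) auto
    then show "expectation (\<lambda>\<omega>. f k (\<Sum>m<L. \<Sum>i=Suc (v k m)..v (Suc k) m. \<psi> m (Y m i \<omega>)))
       = marks_mean \<psi> (f k) L (\<lambda>m. v (Suc k) m - v k m)"
      using block_law[OF f \<psi>, where L=L and a="v k" and d="\<lambda>m. v (Suc k) m - v k m"] by simp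
  qed
  finally show ?thesis .
qed

lemma N_mono: "AE \<omega> in M. \<forall>m s t. 0 \<le> s \<longrightarrow> s \<le> t \<longrightarrow> N m s \<omega> \<le> N m t \<omega>"
  using N_regular by eventually_elim (auto simp: mono_on_def)

lemma sum_increment:
  fixes g :: "nat \<Rightarrow> real"
  assumes "a \<le> b"
  shows "(\<Sum>i=1..b. g i) - (\<Sum>i=1..a. g i) = (\<Sum>i=Suc a..b. g i)"
proof -
  have "{1..b} = {1..a} \<union> {Suc a..b}" using assms by auto
  then show ?thesis by (simp add: sum.union_disjoint)
qed

lemma marked_sum_measurable:
  assumes "\<And>m. \<psi> m \<in> borel_measurable borel" "0 \<le> t"
  shows "marked_sum \<psi> L t \<in> borel_measurable M"
  unfolding marked_sum_def
proof (intro borel_measurable_sum)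
  fix m
  show "(\<lambda>\<omega>. \<Sum>i=1..N m t \<omega>. \<psi> m (Y m i \<omega>)) \<in> borel_measurable M"
  proof (rule measurable_compose_countable[where f="\<lambda>j \<omega>. \<Sum>i=1..j. \<psi> m (Y m i \<omega>)"])
    show "(\<lambda>\<omega>. \<Sum>i=1..j. \<psi> m (Y m i \<omega>)) \<in> borel_measurable M" for j
      by (intro borel_measurable_sum measurable_compose[OF Y_measurable assms(1)]) auto
  qed (rule N_measurable[OF assms(2)])
qed

lemma marks_mean_increments_measurable:
  assumes "0 \<le> s" "0 \<le> t"
  shows "(\<lambda>\<omega>. marks_mean \<psi> f L (\<lambda>m. N m t \<omega> - N m s \<omega>)) \<in> borel_measurable M"
proof -
  let ?V = "\<lambda>\<omega>. \<lambda>m\<in>{..<L}. N m t \<omega> - N m s \<omega>"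
  have "?V \<in> M \<rightarrow>\<^sub>M PiM {..<L} (\<lambda>_. count_space UNIV)"
    using assms by (intro measurable_restrict measurable_diff_nat N_measurable)
  then have "?V \<in> M \<rightarrow>\<^sub>M count_space (PiE {..<L} (\<lambda>_. UNIV))"
    by (simp add: count_space_PiM_finite)
  then have "(\<lambda>\<omega>. marks_mean \<psi> f L (?V \<omega>)) \<in> borel_measurable M"
    by (rule measurable_compose) simp
  also have "(\<lambda>\<omega>. marks_mean \<psi> f L (?V \<omega>)) = (\<lambda>\<omega>. marks_mean \<psi> f L (\<lambda>m. N m t \<omega> - N m s \<omega>))"
    by (intro ext marks_mean_cong) simp
  finally show ?thesis .
qed

lemma marks_mean_bounds:
  assumes "f \<in> borel_measurable borel" "\<And>x. 0 \<le> f x \<and> f x \<le> 1" "\<And>m. \<psi> m \<in> borel_measurable borel"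
  shows "0 \<le> marks_mean \<psi> f L d" "marks_mean \<psi> f L d \<le> 1"
proof -
  have "(\<lambda>\<omega>. f (\<Sum>m<L. \<Sum>i=1..d m. \<psi> m (Y m i \<omega>))) \<in> borel_measurable M"
    by (intro measurable_compose[OF _ assms(1)] borel_measurable_sum measurable_compose[OF Y_measurable assms(3)]) auto
  then have "integrable M (\<lambda>\<omega>. f (\<Sum>m<L. \<Sum>i=1..d m. \<psi> m (Y m i \<omega>)))"
    using assms(2) by (intro integrable_const_bound[of _ 1]) auto
  then show "marks_mean \<psi> f L d \<le> 1" unfolding marks_mean_def using assms(2)
    by (intro integral_le_const) auto
  show "0 \<le> marks_mean \<psi> f L d" unfolding marks_mean_def using assms(2)
    by (intro integral_nonneg_AE) auto
qed

text \<open>Given all counts at the times \<open>u k\<close>, the increments are functions of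
  disjoint blocks of marks, so the conditional mean is a product of \<open>marks_mean\<close>
  factors. These factors depend on count increments over different intervals, which are
  independent.\<close>

lemma marked_increments_expectation:
  assumes f: "\<And>k. f k \<in> borel_measurable borel" and f01: "\<And>k x. 0 \<le> f k x \<and> f k x \<le> 1"
    and \<psi>: "\<And>m. \<psi> m \<in> borel_measurable borel"
    and u: "0 \<le> u 0" "\<And>k. k < n \<Longrightarrow> u k < u (Suc k)"
  shows "expectation (\<lambda>\<omega>. \<Prod>k<n. f k (marked_sum \<psi> L (u (Suc k)) \<omega> - marked_sum \<psi> L (u k) \<omega>))
    = (\<Prod>k<n. expectation (\<lambda>\<omega>. marks_mean \<psi> (f k) L (\<lambda>m. N m (u (Suc k)) \<omega> - N m (u k) \<omega>)))"
proof -
  have u0: "0 \<le> u j" and umono: "u j \<le> u k" if "j \<le> k" "k \<le> n" for j k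
    by (rule increasing_times[OF u that]; assumption)+
  have u0': "0 \<le> u k" if "k \<le> n" for k by (rule u0[OF order_refl that])
  define P where "P = {..n} \<times> {..<L}"
  define V where "V = (\<lambda>\<omega>. \<lambda>(k,m)\<in>P. N m (u k) \<omega>)"
  define I where "I = PiE P (\<lambda>_. UNIV :: nat set)"
  define G where "G = (\<lambda>v \<omega>. \<Prod>k<n. f k (\<Sum>m<L. \<Sum>i=Suc (v (k,m))..v (Suc k,m). \<psi> m (Y m i \<omega>)))"
  let ?KN = "generated_algebra M (UNIV \<times> {0..}) (count_space UNIV) (\<lambda>(m, t). N m t)"
  let ?KY = "generated_algebra M (UNIV \<times> {1..}) borel (\<lambda>(m, i). Y m i)"
  have NK: "N m t \<in> ?KN \<rightarrow>\<^sub>M count_space UNIV" if "0 \<le> t" for m t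
    using measurable_generated_algebra[of "(m,t)" "UNIV \<times> {0..}" "\<lambda>(m, t). N m t" M "count_space UNIV"] that by simp
  have YK: "Y m i \<in> ?KY \<rightarrow>\<^sub>M borel" if "1 \<le> i" for m i
    using measurable_generated_algebra[of "(m,i)" "UNIV \<times> {1..}" "\<lambda>(m, i). Y m i" M borel] that by simp
  have ind: "indep_set (sets ?KN) (sets ?KY)" unfolding sets_generated_algebra by (rule NY_indep)
  have finP: "finite P" by (simp add: P_def)
  have cI: "countable I" unfolding I_def using finP by (intro countable_PiE) auto
  have VI: "V \<omega> \<in> I" for \<omega> by (auto simp: V_def I_def)
  have ev: "{\<omega>\<in>space M. V \<omega> = v} \<in> sets ?KN" if v: "v \<in> I" for v
  proof -
    have "{\<omega>\<in>space M. V \<omega> = v} = {\<omega>\<in>space ?KN. \<forall>p\<in>P. N (snd p) (u (fst p)) \<omega> = v p}"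
    proof -
      have "V \<omega> = v \<longleftrightarrow> (\<forall>p\<in>P. N (snd p) (u (fst p)) \<omega> = v p)" for \<omega>
      proof
        assume "V \<omega> = v" then show "\<forall>p\<in>P. N (snd p) (u (fst p)) \<omega> = v p" by (auto simp: V_def)
      next
        assume *: "\<forall>p\<in>P. N (snd p) (u (fst p)) \<omega> = v p"
        show "V \<omega> = v"
          by (rule PiE_ext[of _ P "\<lambda>_. UNIV"]) (use VI[of \<omega>] v * in \<open>auto simp: I_def V_def\<close>)
      qed
      then show ?thesis by simp
    qed
    also have "\<dots> \<in> sets ?KN"
    proof (rule sets.sets_Collect_finite_All[OF _ finP])
      fix p assume p: "p \<in> P"
      then have "0 \<le> u (fst p)" using u0[of "fst p" n] by (auto simp: P_def)
      from measurable_sets[OF NK[OF this, of "snd p"], of "{v p}"]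
      show "{\<omega>\<in>space ?KN. N (snd p) (u (fst p)) \<omega> = v p} \<in> sets ?KN"
        by (simp add: vimage_def Int_def conj_commute)
    qed
    finally show ?thesis .
  qed
  have GK: "G v \<in> borel_measurable ?KY" for v
    unfolding G_def
    by (intro borel_measurable_prod measurable_compose[OF _ f] borel_measurable_sum measurable_compose[OF YK \<psi>]) auto
  have bound: "0 \<le> G v \<omega> \<and> G v \<omega> \<le> 1" for v \<omega>
    using f01 by (auto simp: G_def intro!: prod_nonneg prod_le_1)
  note frz = freeze_countable[OF ind space_generated_algebra cI VI ev GK bound]
  \<comment> \<open>Monotone counts turn the difference of two partial sums into the block of marks
    between them.\<close>
  have "AE \<omega> in M. (\<Prod>k<n. f k (marked_sum \<psi> L (u (Suc k)) \<omega> - marked_sum \<psi> L (u k) \<omega>)) = G (V \<omega>) \<omega>"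
    using N_mono
  proof eventually_elim
    case (elim \<omega>)
    show ?case unfolding G_def
    proof (intro prod.cong refl arg_cong[where f="f _"])
      fix k assume k: "k \<in> {..<n}"
      have "marked_sum \<psi> L (u (Suc k)) \<omega> - marked_sum \<psi> L (u k) \<omega>
        = (\<Sum>m<L. (\<Sum>i=1..N m (u (Suc k)) \<omega>. \<psi> m (Y m i \<omega>)) - (\<Sum>i=1..N m (u k) \<omega>. \<psi> m (Y m i \<omega>)))"
        by (simp add: marked_sum_def sum_subtractf)
      also have "\<dots> = (\<Sum>m<L. \<Sum>i=Suc (N m (u k) \<omega>)..N m (u (Suc k)) \<omega>. \<psi> m (Y m i \<omega>))"
        using elim u0[of k n] umono[of k "Suc k"] k by (intro sum.cong refl sum_increment) auto
      also have "\<dots> = (\<Sum>m<L. \<Sum>i=Suc (V \<omega> (k,m))..V \<omega> (Suc k,m). \<psi> m (Y m i \<omega>))"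
        using k by (intro sum.cong refl) (auto simp: V_def P_def)
      finally show "marked_sum \<psi> L (u (Suc k)) \<omega> - marked_sum \<psi> L (u k) \<omega>
        = (\<Sum>m<L. \<Sum>i=Suc (V \<omega> (k,m))..V \<omega> (Suc k,m). \<psi> m (Y m i \<omega>))" .
    qed
  qed
  then have "expectation (\<lambda>\<omega>. \<Prod>k<n. f k (marked_sum \<psi> L (u (Suc k)) \<omega> - marked_sum \<psi> L (u k) \<omega>))
    = expectation (\<lambda>\<omega>. G (V \<omega>) \<omega>)"
    using u0' by (intro integral_cong_AE borel_measurable_prod measurable_compose[OF _ f] borel_measurable_diff
       marked_sum_measurable \<psi> frz) auto
  also have "\<dots> = expectation (\<lambda>\<omega>. expectation (G (V \<omega>)))" by (rule frz(1))
  also have "\<dots> = expectation (\<lambda>\<omega>. \<Prod>k<n. marks_mean \<psi> (f k) L (\<lambda>m. N m (u (Suc k)) \<omega> - N m (u k) \<omega>))"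
  proof (rule integral_cong_AE)
    show "AE \<omega> in M. expectation (G (V \<omega>)) = (\<Prod>k<n. marks_mean \<psi> (f k) L (\<lambda>m. N m (u (Suc k)) \<omega> - N m (u k) \<omega>))"
      using N_mono
    proof eventually_elim
      case (elim \<omega>)
      have "expectation (G (V \<omega>)) = (\<Prod>k<n. marks_mean \<psi> (f k) L (\<lambda>m. V \<omega> (Suc k, m) - V \<omega> (k, m)))"
        unfolding G_def
      proof (rule blocks_independent[OF f f01 \<psi>])
        fix j k m assume "j \<le> k" "k \<le> n" "m < L"
        then show "V \<omega> (j, m) \<le> V \<omega> (k, m)" using elim u0[of j k] umono[of j k] by (auto simp: V_def P_def)
      qed
      also have "\<dots> = (\<Prod>k<n. marks_mean \<psi> (f k) L (\<lambda>m. N m (u (Suc k)) \<omega> - N m (u k) \<omega>))"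
        by (intro prod.cong refl marks_mean_cong) (auto simp: V_def P_def)
      finally show ?case .
    qed
  qed (use u0' in \<open>auto intro!: frz borel_measurable_prod marks_mean_increments_measurable\<close>)
  also have "\<dots> = (\<Prod>k<n. expectation (\<lambda>\<omega>. marks_mean \<psi> (f k) L (\<lambda>m. N m (u (Suc k)) \<omega> - N m (u k) \<omega>)))"
  proof (rule indep_vars_lebesgue_integral)
    have "indep_vars (\<lambda>k. PiM ({k} \<times> {..<L}) (\<lambda>_. count_space UNIV))
        (\<lambda>k \<omega>. \<lambda>p\<in>{k} \<times> {..<L}. (\<lambda>(k,m) \<omega>. N m (u (Suc k)) \<omega> - N m (u k) \<omega>) p \<omega>) {..<n}"
      by (intro indep_vars_restrict[OF N_increments_indep[OF u]]) (auto simp: disjoint_family_on_def)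
    moreover have "(\<lambda>y. marks_mean \<psi> (f k) L (\<lambda>m. y (k,m))) \<in> PiM ({k} \<times> {..<L}) (\<lambda>_. count_space UNIV) \<rightarrow>\<^sub>M borel" for k
      by (subst count_space_PiM_finite) auto
    ultimately have "indep_vars (\<lambda>_. borel) (\<lambda>k \<omega>. marks_mean \<psi> (f k) L
        (\<lambda>m. (\<lambda>p\<in>{k} \<times> {..<L}. (\<lambda>(k,m) \<omega>. N m (u (Suc k)) \<omega> - N m (u k) \<omega>) p \<omega>) (k,m))) {..<n}"
      by (rule indep_vars_compose2)
    also have "(\<lambda>k \<omega>. marks_mean \<psi> (f k) L
        (\<lambda>m. (\<lambda>p\<in>{k} \<times> {..<L}. (\<lambda>(k,m) \<omega>. N m (u (Suc k)) \<omega> - N m (u k) \<omega>) p \<omega>) (k,m)))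
       = (\<lambda>k \<omega>. marks_mean \<psi> (f k) L (\<lambda>m. N m (u (Suc k)) \<omega> - N m (u k) \<omega>))"
      by (intro ext marks_mean_cong) auto
    finally show "indep_vars (\<lambda>_. borel) (\<lambda>k \<omega>. marks_mean \<psi> (f k) L (\<lambda>m. N m (u (Suc k)) \<omega> - N m (u k) \<omega>)) {..<n}" .
  next
    fix k assume k: "k \<in> {..<n}"
    show "integrable M (\<lambda>\<omega>. marks_mean \<psi> (f k) L (\<lambda>m. N m (u (Suc k)) \<omega> - N m (u k) \<omega>))"
      using marks_mean_bounds[OF f f01 \<psi>] k
      by (intro integrable_const_bound[of _ 1] marks_mean_increments_measurable u0') auto
  qed simp
  finally show ?thesis .
qed

end

section \<open>Short-time estimates for the counts and almost sure path properties\<close>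

lemma one_minus_exp_le: "1 - exp (- x) \<le> (x::real)"
  using exp_ge_add_one_self[of "- x"] by simp

lemma one_minus_poisson_01_le: "0 \<le> x \<Longrightarrow> 1 - exp (- x) - x * exp (- x) \<le> (x::real)^2"
proof -
  assume x: "0 \<le> x"
  have "(1 + - x) * (1 + x) \<le> exp (- x) * (1 + x)"
    using exp_ge_add_one_self[of "- x"] x by (intro mult_right_mono) auto
  then show ?thesis by (simp add: algebra_simps power2_eq_square)
qed

context marked_poisson
begin

abbreviation inc :: "real \<Rightarrow> real \<Rightarrow> nat \<Rightarrow> 'a \<Rightarrow> nat" where
  "inc s t m \<omega> \<equiv> N m t \<omega> - N m s \<omega>"

lemma inc_measurable: "0 \<le> s \<Longrightarrow> 0 \<le> t \<Longrightarrow> inc s t m \<in> M \<rightarrow>\<^sub>M count_space UNIV"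
  by (intro measurable_diff_nat N_measurable)

lemma inc_events: "0 \<le> s \<Longrightarrow> 0 \<le> t \<Longrightarrow> {\<omega>\<in>space M. P (inc s t m \<omega>)} \<in> events"
  using measurable_sets[OF inc_measurable[of s t m], of "Collect P"]
  by (simp add: vimage_def Int_def conj_commute)

lemma inc_indep:
  assumes "0 \<le> s" "s < t"
  shows "indep_vars (\<lambda>_. count_space UNIV) (inc s t) {..<L}"
proof -
  let ?u = "\<lambda>k::nat. if k = 0 then s else t"
  have "indep_vars (\<lambda>_. count_space UNIV) (\<lambda>(k,m) \<omega>. N m (?u (Suc k)) \<omega> - N m (?u k) \<omega>) ({..<1} \<times> {..<L})"
    using assms by (intro N_increments_indep) auto
  moreover have "{..<1::nat} \<times> {..<L} = Pair 0 ` {..<L}" by auto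
  ultimately have "indep_vars (\<lambda>_. count_space UNIV) (\<lambda>(k,m) \<omega>. N m (?u (Suc k)) \<omega> - N m (?u k) \<omega>) (Pair 0 ` {..<L})"
    by metis
  from indep_vars_reindex'[where f="Pair 0", OF _ this] show ?thesis by (simp add: inj_on_def)
qed

lemma prob_inc_ge1:
  assumes "0 \<le> s" "s < t"
  shows "prob {\<omega>\<in>space M. 1 \<le> inc s t m \<omega>} \<le> H m * (t - s)"
proof -
  have "{\<omega>\<in>space M. 1 \<le> inc s t m \<omega>} = space M - {\<omega>\<in>space M. inc s t m \<omega> = 0}" by auto
  also have "prob \<dots> = 1 - exp (- (H m * (t - s)))"
    using assms inc_events[of s t "\<lambda>k. k = 0"] N_increment_law[OF assms, of m 0] by (subst prob_compl) auto
  also have "\<dots> \<le> H m * (t - s)" by (rule one_minus_exp_le)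
  finally show ?thesis .
qed

lemma prob_inc_ge2:
  assumes "0 \<le> s" "s < t"
  shows "prob {\<omega>\<in>space M. 2 \<le> inc s t m \<omega>} \<le> (H m * (t - s))^2"
proof -
  have "{\<omega>\<in>space M. 2 \<le> inc s t m \<omega>} = space M - ({\<omega>\<in>space M. inc s t m \<omega> = 0} \<union> {\<omega>\<in>space M. inc s t m \<omega> = 1})"
    by auto
  also have "prob \<dots> = 1 - prob ({\<omega>\<in>space M. inc s t m \<omega> = 0} \<union> {\<omega>\<in>space M. inc s t m \<omega> = 1})"
    using assms inc_events[of s t "\<lambda>k. k = 0"] inc_events[of s t "\<lambda>k. k = 1"] by (intro prob_compl) auto
  also have "prob ({\<omega>\<in>space M. inc s t m \<omega> = 0} \<union> {\<omega>\<in>space M. inc s t m \<omega> = 1})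
      = prob {\<omega>\<in>space M. inc s t m \<omega> = 0} + prob {\<omega>\<in>space M. inc s t m \<omega> = 1}"
    using assms inc_events[of s t "\<lambda>k. k = 0"] inc_events[of s t "\<lambda>k. k = 1"] by (intro finite_measure_Union) auto
  also have "1 - \<dots> = 1 - exp (- (H m * (t - s))) - (H m * (t - s)) * exp (- (H m * (t - s)))"
    using N_increment_law[OF assms, of m 0] N_increment_law[OF assms, of m 1] by simp
  also have "\<dots> \<le> (H m * (t - s))^2"
    using H_pos[of m] assms by (intro one_minus_poisson_01_le) auto
  finally show ?thesis .
qed

lemma total_inc_events:
  assumes "0 \<le> s" "0 \<le> t"
  shows "{\<omega>\<in>space M. P (\<Sum>m<L. inc s t m \<omega>)} \<in> events"
proof -
  have "(\<lambda>\<omega>. real (inc s t m \<omega>)) \<in> borel_measurable M" for m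
    by (rule measurable_compose[OF inc_measurable[OF assms]]) simp
  then have "(\<lambda>\<omega>. \<Sum>m<L. real (inc s t m \<omega>)) \<in> borel_measurable M" by (intro borel_measurable_sum)
  from measurable_sets[OF this, of "real ` Collect P"]
  have "(\<lambda>\<omega>. \<Sum>m<L. real (inc s t m \<omega>)) -` (real ` Collect P) \<inter> space M \<in> events"
    using sets.countable[of "real ` Collect P" borel] by auto
  also have "(\<lambda>\<omega>. \<Sum>m<L. real (inc s t m \<omega>)) -` (real ` Collect P) \<inter> space M = {\<omega>\<in>space M. P (\<Sum>m<L. inc s t m \<omega>)}"
    unfolding of_nat_sum[symmetric] by (auto simp del: of_nat_sum)
  finally show ?thesis .
qed

text \<open>Two jumps in all mean that one component jumps twice or that two components both jump.
  The event belonging to the pair \<open>(m, m')\<close> has probability at most the product of the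
  two expected counts, and these products add up to a square.\<close>

lemma prob_total_inc_ge2:
  assumes st: "0 \<le> s" "s < t"
  shows "prob {\<omega>\<in>space M. 2 \<le> (\<Sum>m<L. inc s t m \<omega>)} \<le> ((t - s) * (\<Sum>m<L. H m))^2"
proof -
  define E where "E = (\<lambda>(m,m'). if m = m' then {\<omega>\<in>space M. 2 \<le> inc s t m \<omega>}
    else {\<omega>\<in>space M. 1 \<le> inc s t m \<omega>} \<inter> {\<omega>\<in>space M. 1 \<le> inc s t m' \<omega>})"
  have E: "E p \<in> events" for p
    unfolding E_def using st by (auto split: prod.split intro!: inc_events sets.Int)
  have "{\<omega>\<in>space M. 2 \<le> (\<Sum>m<L. inc s t m \<omega>)} \<subseteq> (\<Union>p\<in>{..<L}\<times>{..<L}. E p)"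
  proof
    fix \<omega> assume "\<omega> \<in> {\<omega>\<in>space M. 2 \<le> (\<Sum>m<L. inc s t m \<omega>)}"
    then have w: "\<omega> \<in> space M" and 2: "2 \<le> (\<Sum>m<L. inc s t m \<omega>)" by auto
    obtain m where m: "m < L" "1 \<le> inc s t m \<omega>"
    proof (rule ccontr)
      assume "\<not> thesis"
      then have "\<And>m. m < L \<Longrightarrow> inc s t m \<omega> = 0" using that by (metis One_nat_def Suc_leI neq0_conv)
      then show False using 2 by simp
    qed
    show "\<omega> \<in> (\<Union>p\<in>{..<L}\<times>{..<L}. E p)"
    proof (cases "2 \<le> inc s t m \<omega>")
      case True then show ?thesis using m w by (intro UN_I[of "(m,m)"]) (auto simp: E_def)
    next
      case False
      have "(\<Sum>m<L. inc s t m \<omega>) = inc s t m \<omega> + (\<Sum>m\<in>{..<L}-{m}. inc s t m \<omega>)"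
        using m by (simp add: sum.remove)
      then have "(\<Sum>m\<in>{..<L}-{m}. inc s t m \<omega>) \<noteq> 0" using False 2 by linarith
      then obtain m' where "m' < L" "m' \<noteq> m" "inc s t m' \<omega> \<noteq> 0" by (auto simp: sum_eq_0_iff)
      then show ?thesis using m w by (intro UN_I[of "(m,m')"]) (auto simp: E_def)
    qed
  qed
  then have "prob {\<omega>\<in>space M. 2 \<le> (\<Sum>m<L. inc s t m \<omega>)} \<le> prob (\<Union>p\<in>{..<L}\<times>{..<L}. E p)"
    using E by (intro finite_measure_mono) auto
  also have "\<dots> \<le> (\<Sum>p\<in>{..<L}\<times>{..<L}. prob (E p))"
    using E by (intro finite_measure_subadditive_finite) auto
  also have "\<dots> \<le> (\<Sum>p\<in>{..<L}\<times>{..<L}. (H (fst p) * (t - s)) * (H (snd p) * (t - s)))"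
  proof (rule sum_mono)
    fix p assume "p \<in> {..<L}\<times>{..<L}"
    then obtain m m' where p: "p = (m,m')" "m < L" "m' < L" by auto
    show "prob (E p) \<le> (H (fst p) * (t - s)) * (H (snd p) * (t - s))"
    proof (cases "m = m'")
      case True then show ?thesis using prob_inc_ge2[OF st, of m] p by (simp add: E_def power2_eq_square)
    next
      case False
      have "indep_vars (\<lambda>_. count_space UNIV) (inc s t) {m,m'}"
        by (rule indep_vars_subset[OF inc_indep[OF st, of L]]) (use p in auto)
      then have "prob (\<Inter>i\<in>{m,m'}. inc s t i -` {1..} \<inter> space M) = (\<Prod>i\<in>{m,m'}. prob (inc s t i -` {1..} \<inter> space M))"
        by (rule indep_varsD_finite) auto
      moreover have "inc s t i -` {1..} \<inter> space M = {\<omega>\<in>space M. 1 \<le> inc s t i \<omega>}" for i by auto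
      ultimately have "prob (E p) = prob {\<omega>\<in>space M. 1 \<le> inc s t m \<omega>} * prob {\<omega>\<in>space M. 1 \<le> inc s t m' \<omega>}"
        using False p(1) by (simp add: E_def)
      also have "\<dots> \<le> (H m * (t - s)) * (H m' * (t - s))"
        using H_pos[of m] st by (intro mult_mono prob_inc_ge1[OF st]) auto
      finally show ?thesis using p by simp
    qed
  qed
  also have "\<dots> = (\<Sum>m<L. H m * (t - s)) * (\<Sum>m<L. H m * (t - s))"
    unfolding sum_product by (simp add: sum.cartesian_product case_prod_beta)
  also have "(\<Sum>m<L. H m * (t - s)) = (t - s) * (\<Sum>m<L. H m)"
    by (simp add: sum_distrib_left mult.commute)
  also have "\<dots> * \<dots> = \<dots>^2" by (simp only: power2_eq_square)
  finally show ?thesis .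
qed

text \<open>Borel-Cantelli over the components, for each integer horizon: the probability that
  component \<open>m\<close> has jumped is at most a multiple of \<open>H m\<close>, and
  \<open>H\<close> is summable.\<close>

lemma finite_support: "AE \<omega> in M. \<forall>t\<ge>0. finite {m. N m t \<omega> \<noteq> 0}"
proof -
  have "AE \<omega> in M. eventually (\<lambda>m. \<omega> \<in> space M - {\<omega>\<in>space M. 1 \<le> inc 0 (real (Suc j)) m \<omega>}) sequentially" for j
  proof (rule borel_cantelli_AE1)
    show "{\<omega>\<in>space M. 1 \<le> inc 0 (real (Suc j)) m \<omega>} \<in> events" for m by (rule inc_events) auto
    show "summable (\<lambda>m. prob {\<omega>\<in>space M. 1 \<le> inc 0 (real (Suc j)) m \<omega>})"
    proof (rule summable_comparison_test')
      show "summable (\<lambda>m. H m * (real (Suc j) - 0))" by (intro summable_mult2 H_summable)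
      show "norm (prob {\<omega>\<in>space M. 1 \<le> inc 0 (real (Suc j)) m \<omega>}) \<le> H m * (real (Suc j) - 0)" for m
        using prob_inc_ge1[of 0 "real (Suc j)" m] by simp
    qed
  qed (simp add: emeasure_eq_measure)
  then have "AE \<omega> in M. \<forall>j. eventually (\<lambda>m. \<omega> \<in> space M - {\<omega>\<in>space M. 1 \<le> inc 0 (real (Suc j)) m \<omega>}) sequentially"
    by (simp add: AE_all_countable)
  with N_regular N_mono show ?thesis
  proof (eventually_elim, intro allI impI)
    fix \<omega> and t :: real
    assume reg: "\<forall>m. N m 0 \<omega> = 0 \<and> mono_on {0..} (\<lambda>t. N m t \<omega>) \<and> (\<forall>t\<ge>0. continuous (at_right t) (\<lambda>s. N m s \<omega>))"
      and mono: "\<forall>m s t. 0 \<le> s \<longrightarrow> s \<le> t \<longrightarrow> N m s \<omega> \<le> N m t \<omega>"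
      and ev: "\<forall>j. eventually (\<lambda>m. \<omega> \<in> space M - {\<omega>\<in>space M. 1 \<le> inc 0 (real (Suc j)) m \<omega>}) sequentially"
      and t: "0 \<le> t"
    obtain j where j: "t \<le> real (Suc j)" using real_arch_simple[of t] by (metis le_SucI of_nat_mono order_trans le_refl)
    from ev obtain K where K: "\<And>m. K \<le> m \<Longrightarrow> \<omega> \<in> space M - {\<omega>\<in>space M. 1 \<le> inc 0 (real (Suc j)) m \<omega>}"
      unfolding eventually_sequentially by blast
    have "N m t \<omega> = 0" if "K \<le> m" for m
    proof -
      have "N m (real (Suc j)) \<omega> = 0" using K[OF that] reg by auto
      moreover have "N m t \<omega> \<le> N m (real (Suc j)) \<omega>" using mono t j by blast
      ultimately show ?thesis by simp
    qed
    then have "{m. N m t \<omega> \<noteq> 0} \<subseteq> {..<K}" by (metis (mono_tags, lifting) lessThan_iff mem_Collect_eq not_le subsetI)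
    then show "finite {m. N m t \<omega> \<noteq> 0}" by (rule finite_subset) simp
  qed
qed

text \<open>When \<open>[0, T+1]\<close> is cut into \<open>n\<close> cells, two jumps in a given
  cell have probability of order \<open>1/n\<^sup>2\<close>, and in some cell of order
  \<open>1/n\<close>. The event that every \<open>n\<close> fails is therefore null.\<close>

lemma fine_grid: "AE \<omega> in M. \<forall>L T. \<exists>n>0. \<forall>k<n. (\<Sum>m<L. inc (real k * real (Suc T) / real n) (real (Suc k) * real (Suc T) / real n) m \<omega>) \<le> 1"
proof -
  have "AE \<omega> in M. \<exists>n>0. \<forall>k<n. (\<Sum>m<L. inc (real k * real (Suc T) / real n) (real (Suc k) * real (Suc T) / real n) m \<omega>) \<le> 1" for L T
  proof -
    define B where "B = (\<lambda>n. \<Union>k<n. {\<omega>\<in>space M. 2 \<le> (\<Sum>m<L. inc (real k * real (Suc T) / real n) (real (Suc k) * real (Suc T) / real n) m \<omega>)})"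
    have B: "B n \<in> events" for n unfolding B_def by (intro sets.finite_UN total_inc_events) auto
    define c where "c = (real (Suc T) * (\<Sum>m<L. H m))^2"
    have le: "prob (B n) \<le> c * (1 / real n)" if n: "0 < n" for n
    proof -
      have "prob (B n) \<le> (\<Sum>k<n. prob {\<omega>\<in>space M. 2 \<le> (\<Sum>m<L. inc (real k * real (Suc T) / real n) (real (Suc k) * real (Suc T) / real n) m \<omega>)})"
        unfolding B_def by (intro finite_measure_subadditive_finite) (auto intro!: total_inc_events)
      also have "\<dots> \<le> (\<Sum>k<n. ((real (Suc T) / real n) * (\<Sum>m<L. H m))^2)"
      proof (rule sum_mono)
        fix k
        have "real (Suc k) * real (Suc T) / real n - real k * real (Suc T) / real n = real (Suc T) / real n"
          by (simp only: left_diff_distrib[symmetric] diff_divide_distrib[symmetric]) simp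
        then show "prob {\<omega>\<in>space M. 2 \<le> (\<Sum>m<L. inc (real k * real (Suc T) / real n) (real (Suc k) * real (Suc T) / real n) m \<omega>)}
          \<le> ((real (Suc T) / real n) * (\<Sum>m<L. H m))^2"
          using prob_total_inc_ge2[of "real k * real (Suc T) / real n" "real (Suc k) * real (Suc T) / real n" L] n
          by (simp add: divide_strict_right_mono)
      qed
      also have "\<dots> = c * (1 / real n)" using n by (simp add: c_def power2_eq_square field_simps)
      finally show ?thesis .
    qed
    let ?S = "{\<omega>\<in>space M. \<forall>n>0. \<omega> \<in> B n}"
    have S: "?S \<in> events"
    proof -
      have "?S = (\<Inter>n\<in>{0<..}. B n) \<inter> space M" by auto
      also have "\<dots> \<in> events" using B by (intro sets.Int sets.countable_INT') auto
      finally show ?thesis .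
    qed
    have "prob ?S \<le> c * (1 / real n)" if "0 < n" for n
      by (rule order_trans[OF finite_measure_mono le[OF that]]) (use that B in auto)
    moreover have "(\<lambda>n. c * (1 / real n)) \<longlonglongrightarrow> c * 0" by (intro tendsto_intros lim_1_over_n)
    ultimately have "prob ?S \<le> c * 0"
      by (intro LIMSEQ_le_const[of "\<lambda>n. c * (1 / real n)"]) (auto intro!: exI[of _ 1])
    then have "prob ?S = 0" using measure_nonneg[of M ?S] by linarith
    then have "AE \<omega> in M. \<not> (\<forall>n>0. \<omega> \<in> B n)" by (rule iffD1[OF prob_Collect_eq_0[OF S]])
    then show ?thesis using AE_space
    proof eventually_elim
      case (elim \<omega>)
      then obtain n where n: "n > 0" "\<omega> \<notin> B n" by blast
      have "(\<Sum>m<L. inc (real k * real (Suc T) / real n) (real (Suc k) * real (Suc T) / real n) m \<omega>) \<le> 1" if "k < n" for k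
        using n(2) elim(2) that unfolding B_def by fastforce
      then show ?case using n(1) by blast
    qed
  qed
  then show ?thesis by (simp add: AE_all_countable)
qed

lemma AE_counting_paths: "AE \<omega> in M. counting_paths (\<lambda>m t. N m t \<omega>)"
  using N_regular N_mono finite_support fine_grid
proof eventually_elim
  case (elim \<omega>)
  note mono = elim(2)[rule_format]
  show ?case
  proof (rule counting_paths.intro)
    fix s :: real and m m' assume s: "0 < s"
    define L where "L = Suc (max m m')"
    obtain T where T: "s \<le> real (Suc T)" using real_arch_simple[of s] by (metis le_SucI of_nat_mono order_trans le_refl)
    from elim(4) obtain n where n: "n > 0"
      "\<And>k. k < n \<Longrightarrow> (\<Sum>m<L. inc (real k * real (Suc T) / real n) (real (Suc k) * real (Suc T) / real n) m \<omega>) \<le> 1"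
      by blast
    define d where "d = real (Suc T) / real n"
    have d: "0 < d" using n by (simp add: d_def)
    have dn: "real k * real (Suc T) / real n = real k * d" for k by (simp add: d_def)
    \<comment> \<open>With this choice \<open>s\<close> lies in the cell
      \<open>(k d, (k+1) d]\<close>; its left end is strictly before \<open>s\<close>, as
      \<open>simple\<close> demands.\<close>
    define k where "k = nat (\<lceil>s / d\<rceil> - 1)"
    have c1: "1 \<le> \<lceil>s / d\<rceil>" using s d by (simp add: less_ceiling_iff)
    have rk: "real k = of_int \<lceil>s / d\<rceil> - 1" unfolding k_def using c1 by simp
    have "s / d \<le> real k + 1" "real k < s / d" using rk by linarith+
    then have k: "real k * d < s" "s \<le> real (Suc k) * d" using d by (simp_all add: field_simps)
    have "real k * d < real n * d" using k(1) T n by (simp add: d_def)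
    then have kn: "k < n" using d by simp
    have le: "N i s \<omega> \<le> N i (real k * d) \<omega> + inc (real k * d) (real (Suc k) * d) i \<omega>" for i
      using mono[of s "real (Suc k) * d" i] k s by simp
    have tot: "(\<Sum>m<L. inc (real k * d) (real (Suc k) * d) m \<omega>) \<le> 1" using n(2)[OF kn] unfolding dn .
    have sub: "(\<Sum>i\<in>{m,m'}. inc (real k * d) (real (Suc k) * d) i \<omega>) \<le> (\<Sum>m<L. inc (real k * d) (real (Suc k) * d) m \<omega>)"
      by (rule sum_mono2) (auto simp: L_def)
    show "\<exists>u. 0 \<le> u \<and> u < s \<and>
      N m s \<omega> + (if m = m' then 0 else N m' s \<omega>) \<le> Suc (N m u \<omega> + (if m = m' then 0 else N m' u \<omega>))"
    proof (intro exI[of _ "real k * d"] conjI)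
      show "N m s \<omega> + (if m = m' then 0 else N m' s \<omega>) \<le> Suc (N m (real k * d) \<omega> + (if m = m' then 0 else N m' (real k * d) \<omega>))"
        using le[of m] le[of m'] order_trans[OF sub tot] by (cases "m = m'") auto
    qed (use k d in auto)
  qed (use elim in blast)+
qed

end

section \<open>Increments of marked sums\<close>

context marked_poisson
begin

definition marked :: "(nat \<Rightarrow> real \<Rightarrow> real) \<Rightarrow> real \<Rightarrow> 'a \<Rightarrow> real" where
  "marked \<psi> t \<omega> = (\<Sum>m. \<Sum>i=1..N m t \<omega>. \<psi> m (Y m i \<omega>))"

lemma marked_eventually: "AE \<omega> in M. \<forall>t\<ge>0. \<forall>\<^sub>F L in sequentially. marked_sum \<psi> L t \<omega> = marked \<psi> t \<omega>"
  using finite_support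
proof (eventually_elim, intro allI impI)
  fix \<omega> and t :: real assume "\<forall>t\<ge>0. finite {m. N m t \<omega> \<noteq> 0}" "0 \<le> t"
  then have fin: "finite {m. N m t \<omega> \<noteq> 0}" by blast
  then obtain K where K: "{m. N m t \<omega> \<noteq> 0} \<subseteq> {..<K}" by (meson finite_nat_iff_bounded)
  have "marked_sum \<psi> L t \<omega> = marked \<psi> t \<omega>" if "K \<le> L" for L
  proof -
    have z: "N m t \<omega> = 0" if "\<not> m < L" for m
      using K that \<open>K \<le> L\<close> by (metis (mono_tags, lifting) lessThan_iff mem_Collect_eq order_less_le_trans subsetD)
    show ?thesis unfolding marked_def marked_sum_def
      by (rule suminf_finite[symmetric]) (simp_all add: z)
  qed
  then show "\<forall>\<^sub>F L in sequentially. marked_sum \<psi> L t \<omega> = marked \<psi> t \<omega>"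
    unfolding eventually_sequentially by blast
qed

lemma marked_measurable:
  assumes "\<And>m. \<psi> m \<in> borel_measurable borel" "0 \<le> t"
  shows "marked \<psi> t \<in> borel_measurable M"
proof -
  have "(\<lambda>\<omega>. \<Sum>i=1..N m t \<omega>. \<psi> m (Y m i \<omega>)) \<in> borel_measurable M" for m
  proof -
    have "(\<lambda>\<omega>. marked_sum \<psi> (Suc m) t \<omega> - marked_sum \<psi> m t \<omega>) \<in> borel_measurable M"
      using assms by (intro borel_measurable_diff marked_sum_measurable)
    then show ?thesis by (simp add: marked_sum_def)
  qed
  then show ?thesis unfolding marked_def by (intro borel_measurable_suminf)
qed

lemma marked_sum_increment_expectation:
  assumes "f \<in> borel_measurable borel" "\<And>x. 0 \<le> f x \<and> f x \<le> 1" "\<And>m. \<psi> m \<in> borel_measurable borel" "0 \<le> s" "s < t"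
  shows "expectation (\<lambda>\<omega>. f (marked_sum \<psi> L t \<omega> - marked_sum \<psi> L s \<omega>)) = expectation (\<lambda>\<omega>. marks_mean \<psi> f L (\<lambda>m. inc s t m \<omega>))"
  using marked_increments_expectation[where f="\<lambda>_. f" and u="\<lambda>k. if k = 0 then s else t" and n=1 and L=L and \<psi>=\<psi>] assms
  by simp

text \<open>Almost surely the truncated sums equal the full ones from some \<open>L\<close> on, so
  the integrands are eventually constant in \<open>L\<close> and the limit holds for merely
  measurable \<open>f k\<close>.\<close>

lemma marked_increments_limit:
  fixes f :: "nat \<Rightarrow> real \<Rightarrow> real"
  assumes f: "\<And>k. f k \<in> borel_measurable borel" and f01: "\<And>k x. 0 \<le> f k x \<and> f k x \<le> 1"
    and \<psi>: "\<And>m. \<psi> m \<in> borel_measurable borel"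
    and u: "\<And>k. k \<le> n \<Longrightarrow> 0 \<le> u k"
  shows "(\<lambda>L. expectation (\<lambda>\<omega>. \<Prod>k<n. f k (marked_sum \<psi> L (u (Suc k)) \<omega> - marked_sum \<psi> L (u k) \<omega>)))
     \<longlonglongrightarrow> expectation (\<lambda>\<omega>. \<Prod>k<n. f k (marked \<psi> (u (Suc k)) \<omega> - marked \<psi> (u k) \<omega>))"
proof (rule Bochner_Integration.integral_dominated_convergence[where w="\<lambda>_. 1 :: real"])
  show "(\<lambda>\<omega>. \<Prod>k<n. f k (marked_sum \<psi> L (u (Suc k)) \<omega> - marked_sum \<psi> L (u k) \<omega>)) \<in> borel_measurable M" for L
    using u by (intro borel_measurable_prod measurable_compose[OF _ f] borel_measurable_diff marked_sum_measurable \<psi>) auto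
  show "(\<lambda>\<omega>. \<Prod>k<n. f k (marked \<psi> (u (Suc k)) \<omega> - marked \<psi> (u k) \<omega>)) \<in> borel_measurable M"
    using u by (intro borel_measurable_prod measurable_compose[OF _ f] borel_measurable_diff marked_measurable \<psi>) auto
  show "AE \<omega> in M. norm (\<Prod>k<n. f k (marked_sum \<psi> L (u (Suc k)) \<omega> - marked_sum \<psi> L (u k) \<omega>)) \<le> 1" for L
    using f01 by (intro AE_I2) (auto simp: prod_nonneg intro!: prod_le_1)
  show "AE \<omega> in M. (\<lambda>L. \<Prod>k<n. f k (marked_sum \<psi> L (u (Suc k)) \<omega> - marked_sum \<psi> L (u k) \<omega>))
     \<longlonglongrightarrow> (\<Prod>k<n. f k (marked \<psi> (u (Suc k)) \<omega> - marked \<psi> (u k) \<omega>))"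
    using marked_eventually[of \<psi>]
  proof eventually_elim
    case (elim \<omega>)
    have "(\<lambda>L. f k (marked_sum \<psi> L (u (Suc k)) \<omega> - marked_sum \<psi> L (u k) \<omega>)) \<longlonglongrightarrow> f k (marked \<psi> (u (Suc k)) \<omega> - marked \<psi> (u k) \<omega>)"
      if k: "k < n" for k
    proof (rule tendsto_eventually)
      have "\<forall>\<^sub>F L in sequentially. marked_sum \<psi> L (u (Suc k)) \<omega> = marked \<psi> (u (Suc k)) \<omega>"
        "\<forall>\<^sub>F L in sequentially. marked_sum \<psi> L (u k) \<omega> = marked \<psi> (u k) \<omega>"
        using elim u[of k] u[of "Suc k"] k by auto
      then show "\<forall>\<^sub>F L in sequentially. f k (marked_sum \<psi> L (u (Suc k)) \<omega> - marked_sum \<psi> L (u k) \<omega>) = f k (marked \<psi> (u (Suc k)) \<omega> - marked \<psi> (u k) \<omega>)"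
        by eventually_elim simp
    qed
    then show ?case by (intro tendsto_prod) auto
  qed
qed simp

lemma marked_increment_limit:
  assumes "f \<in> borel_measurable borel" "\<And>x. 0 \<le> f x \<and> f x \<le> 1" "\<And>m. \<psi> m \<in> borel_measurable borel" "0 \<le> s" "s < t"
  shows "(\<lambda>L. expectation (\<lambda>\<omega>. marks_mean \<psi> f L (\<lambda>m. inc s t m \<omega>))) \<longlonglongrightarrow> expectation (\<lambda>\<omega>. f (marked \<psi> t \<omega> - marked \<psi> s \<omega>))"
  using marked_increments_limit[where f="\<lambda>_. f" and u="\<lambda>k. if k = 0 then s else t" and n=1 and \<psi>=\<psi>] assms
  by (simp add: marked_sum_increment_expectation[symmetric])

lemma marked_increments_product:
  fixes f :: "nat \<Rightarrow> real \<Rightarrow> real"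
  assumes f: "\<And>k. f k \<in> borel_measurable borel" and f01: "\<And>k x. 0 \<le> f k x \<and> f k x \<le> 1"
    and \<psi>: "\<And>m. \<psi> m \<in> borel_measurable borel"
    and u: "0 \<le> u 0" "\<And>k. k < n \<Longrightarrow> u k < u (Suc k)"
  shows "expectation (\<lambda>\<omega>. \<Prod>k<n. f k (marked \<psi> (u (Suc k)) \<omega> - marked \<psi> (u k) \<omega>))
    = (\<Prod>k<n. expectation (\<lambda>\<omega>. f k (marked \<psi> (u (Suc k)) \<omega> - marked \<psi> (u k) \<omega>)))"
proof (rule LIMSEQ_unique)
  have u0: "0 \<le> u k" if "k \<le> n" for k
    by (rule increasing_times[OF u order_refl that]; assumption)
  show "(\<lambda>L. expectation (\<lambda>\<omega>. \<Prod>k<n. f k (marked_sum \<psi> L (u (Suc k)) \<omega> - marked_sum \<psi> L (u k) \<omega>)))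
     \<longlonglongrightarrow> expectation (\<lambda>\<omega>. \<Prod>k<n. f k (marked \<psi> (u (Suc k)) \<omega> - marked \<psi> (u k) \<omega>))"
    by (rule marked_increments_limit[OF f f01 \<psi> u0])
  show "(\<lambda>L. expectation (\<lambda>\<omega>. \<Prod>k<n. f k (marked_sum \<psi> L (u (Suc k)) \<omega> - marked_sum \<psi> L (u k) \<omega>)))
     \<longlonglongrightarrow> (\<Prod>k<n. expectation (\<lambda>\<omega>. f k (marked \<psi> (u (Suc k)) \<omega> - marked \<psi> (u k) \<omega>)))"
    unfolding marked_increments_expectation[where f=f and u=u and n=n and \<psi>=\<psi>, OF f f01 \<psi> u(1) u(2), simplified]
    by (intro tendsto_prod marked_increment_limit f f01 \<psi>) (use u u0 in auto)
qed

text \<open>For indicator functions the product formula is the independence of the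
  increments.\<close>

lemma marked_independent_increments:
  assumes \<psi>: "\<And>m. \<psi> m \<in> borel_measurable borel"
  shows "independent_increments M borel (marked \<psi>)"
  unfolding independent_increments_def
proof (intro allI impI)
  fix n :: nat and u :: "nat \<Rightarrow> real" assume u0: "0 \<le> u 0" and "\<forall>k<n. u k < u (Suc k)"
  then have u: "0 \<le> u 0" "\<And>k. k < n \<Longrightarrow> u k < u (Suc k)" by auto
  have u': "0 \<le> u k" if "k \<le> n" for k
    by (rule increasing_times[OF u order_refl that]; assumption)
  let ?X = "\<lambda>k \<omega>. marked \<psi> (u (Suc k)) \<omega> - marked \<psi> (u k) \<omega>"
  have X: "?X k \<in> borel_measurable M" if "k < n" for k
    using u' that by (intro borel_measurable_diff marked_measurable \<psi>) auto
  show "indep_vars (\<lambda>_. borel) ?X {..<n}"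
  proof (cases "n = 0")
    case True then show ?thesis by (simp add: indep_vars_def2 indep_sets_def)
  next
    case False
    show ?thesis unfolding indep_vars_def2
    proof (intro conjI ballI)
      show "indep_sets (\<lambda>k. {?X k -` A \<inter> space M |A. A \<in> sets borel}) {..<n}"
      proof (subst indep_sets_finite; (intro ballI)?)
        fix A assume A: "A \<in> Pi {..<n} (\<lambda>k. {?X k -` A \<inter> space M |A. A \<in> sets borel})"
        then have "\<forall>k\<in>{..<n}. \<exists>C. A k = ?X k -` C \<inter> space M \<and> C \<in> sets borel" by (auto simp: Pi_iff)
        from bchoice[OF this] obtain C where C: "\<And>k. k < n \<Longrightarrow> A k = ?X k -` C k \<inter> space M" "\<And>k. k < n \<Longrightarrow> C k \<in> sets borel" by auto
        \<comment> \<open>Beyond \<open>n\<close> the set is replaced by the empty one in order to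
          have a measurable function for every \<open>k\<close>.\<close>
        define f where "f = (\<lambda>k. indicator (if k < n then C k else {}) :: real \<Rightarrow> real)"
        have f: "f k \<in> borel_measurable borel" for k using C(2) by (auto simp: f_def)
        have f01: "0 \<le> f k x \<and> f k x \<le> 1" for k x by (simp add: f_def indicator_def)
        have Aev: "A k \<in> events" if "k < n" for k using measurable_sets[OF X C(2)] C(1) that by auto
        have ind: "f k (?X k \<omega>) = indicator (A k) \<omega>" if "k < n" "\<omega> \<in> space M" for k \<omega>
          using C(1)[OF that(1)] that by (auto simp: f_def indicator_def)
        have "expectation (\<lambda>\<omega>. \<Prod>k<n. f k (?X k \<omega>)) = expectation (indicator (\<Inter>k<n. A k))"
        proof (intro Bochner_Integration.integral_cong refl)
          fix \<omega> assume w: "\<omega> \<in> space M"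
          have "(\<Prod>k<n. f k (?X k \<omega>)) = (\<Prod>k<n. indicator (A k) \<omega>)" by (intro prod.cong refl ind) (use w in auto)
          also have "\<dots> = indicator (\<Inter>k<n. A k) \<omega>"
          proof (cases "\<forall>k<n. \<omega> \<in> A k")
            case True then show ?thesis by simp
          next
            case F: False
            then obtain k where "k < n" "\<omega> \<notin> A k" by blast
            then have "(\<Prod>k<n. indicator (A k) \<omega>) = (0::real)"
              by (intro prod_zero bexI[of _ k]) auto
            then show ?thesis using \<open>k < n\<close> \<open>\<omega> \<notin> A k\<close> by (auto simp: indicator_def)
          qed
          finally show "(\<Prod>k<n. f k (?X k \<omega>)) = indicator (\<Inter>k<n. A k) \<omega>" .
        qed
        also have "\<dots> = prob (\<Inter>k<n. A k)" proof -
          have "(\<Inter>k<n. A k) \<in> events" using Aev False by (intro sets.finite_INT) auto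
          then show ?thesis by simp
        qed
        finally have 1: "expectation (\<lambda>\<omega>. \<Prod>k<n. f k (?X k \<omega>)) = prob (\<Inter>k<n. A k)" .
        have 2: "expectation (\<lambda>\<omega>. f k (?X k \<omega>)) = prob (A k)" if "k < n" for k
        proof -
          have "expectation (\<lambda>\<omega>. f k (?X k \<omega>)) = expectation (indicator (A k))"
            by (intro Bochner_Integration.integral_cong refl ind that)
          then show ?thesis using Aev[OF that] by simp
        qed
        show "prob (\<Inter>k<n. A k) = (\<Prod>k<n. prob (A k))"
          using marked_increments_product[OF f f01 \<psi> u] 1 2 by simp
      next
        fix k assume k: "k \<in> {..<n}"
        show "{?X k -` A \<inter> space M |A. A \<in> sets borel} \<subseteq> events"
          using measurable_sets[OF X] k by auto
        show "space M \<in> {?X k -` A \<inter> space M |A. A \<in> sets borel}" by (auto intro!: exI[of _ UNIV])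
      qed (use False in auto)
    qed (use X in auto)
  qed
qed

lemma prob_single_jump:
  assumes st: "0 \<le> s" "s < t" and m: "m < L"
  shows "prob {\<omega>\<in>space M. \<forall>j<L. inc s t j \<omega> = (if j = m then 1 else 0)} = H m * (t - s) * exp (- ((t - s) * (\<Sum>j<L. H j)))"
    and "{\<omega>\<in>space M. \<forall>j<L. inc s t j \<omega> = (if j = m then 1 else 0)} \<in> events"
proof -
  let ?e = "\<lambda>j. if j = m then 1 else 0 :: nat"
  let ?A = "\<lambda>j. inc s t j -` {?e j} \<inter> space M"
  have eq: "{\<omega>\<in>space M. \<forall>j<L. inc s t j \<omega> = ?e j} = (\<Inter>j<L. ?A j)"
    using m by auto
  have A: "?A j = {\<omega>\<in>space M. inc s t j \<omega> = ?e j}" for j by auto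
  show "{\<omega>\<in>space M. \<forall>j<L. inc s t j \<omega> = ?e j} \<in> events"
    unfolding eq A using st m by (intro sets.finite_INT inc_events) auto
  have "prob (\<Inter>j<L. ?A j) = (\<Prod>j<L. prob (?A j))"
    using m by (intro indep_varsD_finite[OF inc_indep[OF st]]) auto
  also have "\<dots> = (\<Prod>j<L. (if j = m then H m * (t - s) else 1) * exp (- (H j * (t - s))))"
    unfolding A N_increment_law[OF st] by (intro prod.cong) auto
  also have "\<dots> = (\<Prod>j<L. (if j = m then H m * (t - s) else 1)) * (\<Prod>j<L. exp (- (H j * (t - s))))"
    by (rule prod.distrib)
  also have "(\<Prod>j<L. (if j = m then H m * (t - s) else 1)) = H m * (t - s)"
    using m by (simp add: prod.delta)
  also have "(\<Prod>j<L. exp (- (H j * (t - s)))) = exp (- ((t - s) * (\<Sum>j<L. H j)))"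
    by (simp add: exp_sum[symmetric] sum_negf sum_distrib_left mult.commute)
  finally show "prob {\<omega>\<in>space M. \<forall>j<L. inc s t j \<omega> = ?e j} = H m * (t - s) * exp (- ((t - s) * (\<Sum>j<L. H j)))"
    unfolding eq .
qed

text \<open>With no jump the conditional mean is \<open>f 0\<close>; with exactly one jump, of type
  \<open>m\<close>, it is the mean over a single mark. So the remainder \<open>R\<close> lives on
  the event \<open>B\<close> of two or more jumps, whose probability is at most
  \<open>x\<^sup>2\<close>. A further \<open>x\<^sup>2\<close> pays for the factor
  \<open>exp (- x)\<close> in the probability of a single jump.\<close>

lemma marked_sum_expansion:
  assumes f: "f \<in> borel_measurable borel" and f01: "\<And>x. 0 \<le> f x \<and> f x \<le> 1" and \<psi>: "\<And>m. \<psi> m \<in> borel_measurable borel"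
    and st: "0 \<le> s" "s < t"
  shows "\<bar>expectation (\<lambda>\<omega>. marks_mean \<psi> f L (\<lambda>m. inc s t m \<omega>)) - f 0
     - (t - s) * (\<Sum>m<L. H m * (expectation (\<lambda>\<omega>. f (\<psi> m (Y m 1 \<omega>))) - f 0))\<bar> \<le> 2 * ((t - s) * (\<Sum>m<L. H m))^2"
proof -
  define c where "c = (\<lambda>m. expectation (\<lambda>\<omega>. f (\<psi> m (Y m 1 \<omega>))))"
  define A where "A = (\<lambda>m. {\<omega>\<in>space M. \<forall>j<L. inc s t j \<omega> = (if j = m then 1 else 0)})"
  define x where "x = (t - s) * (\<Sum>m<L. H m)"
  define B where "B = {\<omega>\<in>space M. 2 \<le> (\<Sum>m<L. inc s t m \<omega>)}"
  let ?q = "\<lambda>\<omega>. marks_mean \<psi> f L (\<lambda>m. inc s t m \<omega>)"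
  have H0: "0 \<le> H m" for m using H_pos[of m] by simp
  have x0: "0 \<le> x" using st H0 by (auto simp: x_def intro!: mult_nonneg_nonneg sum_nonneg)
  have Aev: "A m \<in> events" if "m < L" for m unfolding A_def by (rule prob_single_jump[OF st that])
  have Bev: "B \<in> events" unfolding B_def using st by (intro total_inc_events) auto
  have pA: "prob (A m) = H m * (t - s) * exp (- x)" if "m < L" for m
    unfolding A_def x_def by (rule prob_single_jump[OF st that])
  have cmean: "c m = marks_mean \<psi> f L (\<lambda>j. if j = m then 1 else 0)" if "m < L" for m
  proof -
    have "(\<Sum>j<L. \<Sum>i=1..(if j = m then 1 else 0). \<psi> j (Y j i \<omega>)) = (\<Sum>j<L. if j = m then \<psi> m (Y m 1 \<omega>) else 0)" for \<omega>
      by (intro sum.cong) auto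
    also have "\<dots> \<omega> = \<psi> m (Y m 1 \<omega>)" for \<omega> using that by simp
    finally show ?thesis by (simp add: c_def marks_mean_def)
  qed
  note q01 = marks_mean_bounds[where f=f and \<psi>=\<psi>, OF f f01 \<psi>]
  have c01: "0 \<le> c m" "c m \<le> 1" if "m < L" for m using q01 cmean[OF that] by auto
  have q0: "marks_mean \<psi> f L (\<lambda>_. 0) = f 0" by (simp add: marks_mean_def prob_space)
  have qm: "?q \<in> borel_measurable M" using st by (intro marks_mean_increments_measurable) auto
  define R where "R = (\<lambda>\<omega>. ?q \<omega> - f 0 - (\<Sum>m<L. indicator (A m) \<omega> * (c m - f 0)))"
  have R: "\<bar>R \<omega>\<bar> \<le> indicator B \<omega>" if w: "\<omega> \<in> space M" for \<omega>
  proof -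
    consider "(\<Sum>m<L. inc s t m \<omega>) = 0" | "(\<Sum>m<L. inc s t m \<omega>) = 1" | "2 \<le> (\<Sum>m<L. inc s t m \<omega>)" by linarith
    then show ?thesis
    proof cases
      case 1
      then have z: "inc s t m \<omega> = 0" if "m < L" for m using that by (simp only: sum_eq_0_iff finite_lessThan) auto
      have "?q \<omega> = marks_mean \<psi> f L (\<lambda>_. 0)" by (rule marks_mean_cong) (rule z)
      moreover have "indicator (A m) \<omega> = (0::real)" if "m < L" for m
      proof -
        have "\<omega> \<notin> A m" using z[OF that] that unfolding A_def by fastforce
        then show ?thesis by simp
      qed
      then have "(\<Sum>m<L. indicator (A m) \<omega> * (c m - f 0)) = 0" by (intro sum.neutral) simp
      ultimately have "R \<omega> = 0" by (simp only: R_def q0)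
      then show ?thesis by simp
    next
      case 2
      then obtain m where m: "m < L" "inc s t m \<omega> = 1" "\<And>j. j < L \<Longrightarrow> j \<noteq> m \<Longrightarrow> inc s t j \<omega> = 0"
        by (subst (asm) sum_eq_1_iff) auto
      have e: "inc s t j \<omega> = (if j = m then 1 else 0)" if "j < L" for j using m that by auto
      have "?q \<omega> = c m" unfolding cmean[OF m(1)] by (rule marks_mean_cong) (rule e)
      moreover have "(\<Sum>k<L. indicator (A k) \<omega> * (c k - f 0)) = (\<Sum>k<L. if k = m then c m - f 0 else 0)"
      proof (intro sum.cong refl)
        fix k assume k: "k \<in> {..<L}"
        show "indicator (A k) \<omega> * (c k - f 0) = (if k = m then c m - f 0 else 0)"
        proof (cases "k = m")
          case True
          have "\<omega> \<in> A m" unfolding A_def using e w by blast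
          then show ?thesis using True by simp
        next
          case False
          have "\<omega> \<notin> A k" unfolding A_def using e[of k] k False by auto
          then show ?thesis using False by simp
        qed
      qed
      ultimately have "R \<omega> = 0" using m(1) by (simp add: R_def)
      then show ?thesis by simp
    next
      case 3
      have "indicator (A m) \<omega> = (0::real)" if "m < L" for m
      proof -
        have "\<omega> \<notin> A m"
        proof
          assume "\<omega> \<in> A m"
          then have "(\<Sum>j<L. inc s t j \<omega>) = (\<Sum>j<L. if j = m then 1 else 0)" unfolding A_def by (intro sum.cong) auto
          then show False using 3 that by simp
        qed
        then show ?thesis by simp
      qed
      then have "(\<Sum>m<L. indicator (A m) \<omega> * (c m - f 0)) = 0" by (intro sum.neutral) simp
      then have "R \<omega> = ?q \<omega> - f 0" by (simp only: R_def)
      also have "\<bar>\<dots>\<bar> \<le> 1" using q01(1)[of L "\<lambda>m. inc s t m \<omega>"] q01(2)[of L "\<lambda>m. inc s t m \<omega>"] f01[of 0] by linarith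
      also have "1 = indicator B \<omega>" using 3 w by (simp add: B_def)
      finally show ?thesis .
    qed
  qed
  have Rm: "R \<in> borel_measurable M" unfolding R_def using Aev qm by (intro borel_measurable_diff borel_measurable_sum) auto
  have iB: "integrable M (indicator B :: 'a \<Rightarrow> real)" using Bev by (simp add: emeasure_eq_measure)
  have iR: "integrable M R"
    by (rule Bochner_Integration.integrable_bound[OF iB Rm]) (use R in auto)
  have "\<bar>expectation R\<bar> \<le> expectation (indicator B)"
    by (rule order_trans[OF integral_abs_bound integral_mono]) (use iR iB R in auto)
  also have "\<dots> = prob B" using Bev by simp
  also have "\<dots> \<le> x^2" unfolding B_def x_def by (rule prob_total_inc_ge2[OF st])
  finally have ER: "\<bar>expectation R\<bar> \<le> x^2" .
  have iA: "integrable M (\<lambda>\<omega>. indicator (A m) \<omega> * (c m - f 0))" if "m < L" for m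
    using Aev[OF that] by (intro integrable_mult_left) (simp add: emeasure_eq_measure)
  have "expectation ?q = expectation (\<lambda>\<omega>. R \<omega> + f 0 + (\<Sum>m<L. indicator (A m) \<omega> * (c m - f 0)))"
    by (simp add: R_def)
  also have "\<dots> = expectation R + f 0 + (\<Sum>m<L. prob (A m) * (c m - f 0))"
  proof -
    have "expectation (\<lambda>\<omega>. indicator (A m) \<omega> * (c m - f 0)) = prob (A m) * (c m - f 0)" if "m \<in> {..<L}" for m
      using Aev[of m] that by simp
    then have "(\<Sum>m<L. expectation (\<lambda>\<omega>. indicator (A m) \<omega> * (c m - f 0))) = (\<Sum>m<L. prob (A m) * (c m - f 0))"
      by (intro sum.cong refl)
    moreover have "expectation (\<lambda>\<omega>. \<Sum>m<L. indicator (A m) \<omega> * (c m - f 0)) = (\<Sum>m<L. expectation (\<lambda>\<omega>. indicator (A m) \<omega> * (c m - f 0)))"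
      using iA by (intro Bochner_Integration.integral_sum) auto
    moreover have "expectation (\<lambda>\<omega>. R \<omega> + f 0 + (\<Sum>m<L. indicator (A m) \<omega> * (c m - f 0)))
      = expectation (\<lambda>\<omega>. R \<omega> + f 0) + expectation (\<lambda>\<omega>. \<Sum>m<L. indicator (A m) \<omega> * (c m - f 0))"
      using iR iA by (intro Bochner_Integration.integral_add Bochner_Integration.integrable_sum) auto
    moreover have "expectation (\<lambda>\<omega>. R \<omega> + f 0) = expectation R + f 0" using iR by (simp add: prob_space)
    ultimately show ?thesis by (simp only:)
  qed
  finally have Eq: "expectation ?q = expectation R + f 0 + (\<Sum>m<L. prob (A m) * (c m - f 0))" .
  have "(\<Sum>m<L. prob (A m) * (c m - f 0)) - (t - s) * (\<Sum>m<L. H m * (c m - f 0)) = (\<Sum>m<L. H m * (t - s) * (exp (- x) - 1) * (c m - f 0))"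
    by (simp add: sum_distrib_left sum_subtractf[symmetric] pA algebra_simps)
  also have "\<bar>\<dots>\<bar> \<le> (\<Sum>m<L. \<bar>H m * (t - s) * (exp (- x) - 1) * (c m - f 0)\<bar>)" by (rule sum_abs)
  also have "\<dots> \<le> (\<Sum>m<L. H m * (t - s) * x)"
  proof (rule sum_mono)
    fix m assume m: "m \<in> {..<L}"
    have "\<bar>c m - f 0\<bar> \<le> 1" using c01[of m] f01[of 0] m by auto
    moreover have "\<bar>exp (- x) - 1\<bar> \<le> x" using one_minus_exp_le[of x] x0 by simp
    ultimately have "(H m * (t - s)) * (\<bar>exp (- x) - 1\<bar> * \<bar>c m - f 0\<bar>) \<le> (H m * (t - s)) * (x * 1)"
      using H0 st x0 by (intro mult_left_mono mult_mono) auto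
    then show "\<bar>H m * (t - s) * (exp (- x) - 1) * (c m - f 0)\<bar> \<le> H m * (t - s) * x"
      using H0[of m] st by (simp add: abs_mult mult.assoc)
  qed
  also have "\<dots> = x^2" by (simp add: x_def power2_eq_square sum_distrib_right[symmetric] mult_ac)
  finally have "\<bar>(\<Sum>m<L. prob (A m) * (c m - f 0)) - (t - s) * (\<Sum>m<L. H m * (c m - f 0))\<bar> \<le> x^2" .
  then show ?thesis using ER Eq unfolding x_def c_def by linarith
qed

lemma summable_generator:
  assumes "\<And>m. \<bar>c m\<bar> \<le> 1"
  shows "summable (\<lambda>m. H m * c m)"
proof (rule summable_comparison_test'[OF H_summable])
  fix m show "norm (H m * c m) \<le> H m" using assms[of m] H_pos[of m] by (simp add: abs_mult mult_left_le)
qed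

text \<open>The generator of the full process to first order. The error bound involves
  \<open>L\<close> only through a convergent sum of rates, so \<open>L\<close> may tend to
  infinity.\<close>

lemma marked_expansion:
  assumes f: "f \<in> borel_measurable borel" and f01: "\<And>x. 0 \<le> f x \<and> f x \<le> 1" and \<psi>: "\<And>m. \<psi> m \<in> borel_measurable borel"
    and st: "0 \<le> s" "s < t"
  shows "\<bar>expectation (\<lambda>\<omega>. f (marked \<psi> t \<omega> - marked \<psi> s \<omega>)) - f 0
     - (t - s) * (\<Sum>m. H m * (expectation (\<lambda>\<omega>. f (\<psi> m (Y m 1 \<omega>))) - f 0))\<bar> \<le> 2 * ((t - s) * (\<Sum>m. H m))^2"
proof (rule LIMSEQ_le)
  have c: "\<bar>expectation (\<lambda>\<omega>. f (\<psi> m (Y m 1 \<omega>))) - f 0\<bar> \<le> 1" for m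
  proof -
    have "marks_mean \<psi> f (Suc m) (\<lambda>j. if j = m then 1 else 0) = expectation (\<lambda>\<omega>. f (\<psi> m (Y m 1 \<omega>)))"
      unfolding marks_mean_def by (intro Bochner_Integration.integral_cong refl arg_cong[where f=f]) simp
    then show ?thesis using marks_mean_bounds[where f=f and \<psi>=\<psi> and L="Suc m" and d="\<lambda>j. if j = m then 1 else 0", OF f f01 \<psi>] f01[of 0] by auto
  qed
  show "(\<lambda>L. \<bar>expectation (\<lambda>\<omega>. marks_mean \<psi> f L (\<lambda>m. inc s t m \<omega>)) - f 0
     - (t - s) * (\<Sum>m<L. H m * (expectation (\<lambda>\<omega>. f (\<psi> m (Y m 1 \<omega>))) - f 0))\<bar>)
     \<longlonglongrightarrow> \<bar>expectation (\<lambda>\<omega>. f (marked \<psi> t \<omega> - marked \<psi> s \<omega>)) - f 0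
     - (t - s) * (\<Sum>m. H m * (expectation (\<lambda>\<omega>. f (\<psi> m (Y m 1 \<omega>))) - f 0))\<bar>"
    by (intro tendsto_intros marked_increment_limit assms summable_LIMSEQ summable_generator c)
  show "(\<lambda>L. 2 * ((t - s) * (\<Sum>m<L. H m))^2) \<longlonglongrightarrow> 2 * ((t - s) * (\<Sum>m. H m))^2"
    by (intro tendsto_intros summable_LIMSEQ H_summable)
  show "\<exists>n0. \<forall>n\<ge>n0. \<bar>expectation (\<lambda>\<omega>. marks_mean \<psi> f n (\<lambda>m. inc s t m \<omega>)) - f 0
     - (t - s) * (\<Sum>m<n. H m * (expectation (\<lambda>\<omega>. f (\<psi> m (Y m 1 \<omega>))) - f 0))\<bar> \<le> 2 * ((t - s) * (\<Sum>m<n. H m))^2"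
    by (intro exI allI impI marked_sum_expansion assms)
qed

text \<open>Along \<open>n\<close> equal pieces the expectation is a product of \<open>n\<close>
  factors, each within \<open>C * d\<^sup>2\<close> of \<open>exp (- (d * a))\<close>. Products of
  numbers in \<open>[0, 1]\<close> differ by at most the sum of the differences of their factors, so
  the total error is of order \<open>1/n\<close>.\<close>

lemma marked_multiplicative_expectation:
  assumes f: "f \<in> borel_measurable borel" and f01: "\<And>x. 0 \<le> f x \<and> f x \<le> 1" and f0: "f 0 = 1"
    and \<psi>: "\<And>m. \<psi> m \<in> borel_measurable borel"
    and st: "0 \<le> s" "s < t"
    and mult: "\<And>n u. 0 \<le> u 0 \<Longrightarrow> (\<And>k. k < n \<Longrightarrow> u k < u (Suc k)) \<Longrightarrow>
      AE \<omega> in M. f (marked \<psi> (u n) \<omega> - marked \<psi> (u 0) \<omega>) = (\<Prod>k<n. f (marked \<psi> (u (Suc k)) \<omega> - marked \<psi> (u k) \<omega>))"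
  shows "expectation (\<lambda>\<omega>. f (marked \<psi> t \<omega> - marked \<psi> s \<omega>)) = exp (- ((t - s) * (\<Sum>m. H m * (1 - expectation (\<lambda>\<omega>. f (\<psi> m (Y m 1 \<omega>)))))))"
    (is "?E = exp (- ((t - s) * ?a))")
proof -
  define a where "a = ?a"
  \<comment> \<open>The first term bounds the error of the generator expansion, the second that of
    \<open>1 - d * a\<close> as an approximation to \<open>exp (- (d * a))\<close>.\<close>
  define C where "C = 2 * (\<Sum>m. H m)^2 + a^2"
  have c01: "0 \<le> expectation (\<lambda>\<omega>. f (\<psi> m (Y m 1 \<omega>)))" "expectation (\<lambda>\<omega>. f (\<psi> m (Y m 1 \<omega>))) \<le> 1" for m
  proof -
    have "marks_mean \<psi> f (Suc m) (\<lambda>j. if j = m then 1 else 0) = expectation (\<lambda>\<omega>. f (\<psi> m (Y m 1 \<omega>)))"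
      unfolding marks_mean_def by (intro Bochner_Integration.integral_cong refl arg_cong[where f=f]) simp
    then show "0 \<le> expectation (\<lambda>\<omega>. f (\<psi> m (Y m 1 \<omega>)))" "expectation (\<lambda>\<omega>. f (\<psi> m (Y m 1 \<omega>))) \<le> 1"
      using marks_mean_bounds[where f=f and \<psi>=\<psi> and L="Suc m" and d="\<lambda>j. if j = m then 1 else 0", OF f f01 \<psi>] by auto
  qed
  have sm: "summable (\<lambda>m. H m * (1 - expectation (\<lambda>\<omega>. f (\<psi> m (Y m 1 \<omega>)))))"
    using c01 by (intro summable_generator) (simp add: abs_le_iff)
  have a0: "0 \<le> a" unfolding a_def using H_pos c01 by (intro suminf_nonneg sm mult_nonneg_nonneg) (auto intro: less_imp_le)
  have neg: "(\<Sum>m. H m * (expectation (\<lambda>\<omega>. f (\<psi> m (Y m 1 \<omega>))) - f 0)) = - a"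
    unfolding a_def f0 by (subst suminf_minus[OF sm, symmetric]) (simp add: algebra_simps)
  have exp_bd: "\<bar>exp (- x) - 1 + x\<bar> \<le> x^2" if "0 \<le> x" for x :: real
  proof -
    have "exp (- x) \<le> 1 / (1 + x)" using exp_ge_add_one_self[of x] that by (simp add: exp_minus field_simps)
    also have "\<dots> \<le> 1 - x + x^2" using that by (simp add: field_simps power2_eq_square power3_eq_cube)
    finally show ?thesis using exp_ge_add_one_self[of "- x"] by simp
  qed
  have bd: "\<bar>?E - exp (- ((t - s) * a))\<bar> \<le> C * (t - s)^2 * (1 / real n)" if n: "0 < n" for n
  proof -
    define d where "d = (t - s) / real n"
    define u where "u = (\<lambda>k::nat. s + real k * d)"
    have d: "0 < d" using st n by (simp add: d_def)
    have u: "0 \<le> u 0" "\<And>k. k < n \<Longrightarrow> u k < u (Suc k)" using st d by (auto simp: u_def algebra_simps)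
    have un: "u n = t" "u 0 = s" using n by (simp_all add: u_def d_def)
    have ud: "u (Suc k) - u k = d" for k by (simp add: u_def algebra_simps)
    have u': "0 \<le> u k" for k using st d by (simp add: u_def)
    have "?E = expectation (\<lambda>\<omega>. \<Prod>k<n. f (marked \<psi> (u (Suc k)) \<omega> - marked \<psi> (u k) \<omega>))"
      using mult[OF u] un st u'
      by (intro integral_cong_AE borel_measurable_prod measurable_compose[OF _ f] borel_measurable_diff marked_measurable \<psi>) auto
    also have "\<dots> = (\<Prod>k<n. expectation (\<lambda>\<omega>. f (marked \<psi> (u (Suc k)) \<omega> - marked \<psi> (u k) \<omega>)))"
      by (rule marked_increments_product[OF f f01 \<psi> u])
    finally have E: "?E = (\<Prod>k<n. expectation (\<lambda>\<omega>. f (marked \<psi> (u (Suc k)) \<omega> - marked \<psi> (u k) \<omega>)))" .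
    have e: "exp (- ((t - s) * a)) = (\<Prod>k<n. exp (- (d * a)))"
      using n by (simp add: d_def exp_of_nat_mult[symmetric])
    have int: "integrable M (\<lambda>\<omega>. f (marked \<psi> (u (Suc k)) \<omega> - marked \<psi> (u k) \<omega>))" for k
      using f01 u' by (intro integrable_const_bound[of _ 1] measurable_compose[OF _ f] borel_measurable_diff marked_measurable \<psi>) auto
    have "\<bar>?E - exp (- ((t - s) * a))\<bar> \<le> (\<Sum>k<n. \<bar>expectation (\<lambda>\<omega>. f (marked \<psi> (u (Suc k)) \<omega> - marked \<psi> (u k) \<omega>)) - exp (- (d * a))\<bar>)"
    proof -
      have "norm ((\<Prod>k<n. expectation (\<lambda>\<omega>. f (marked \<psi> (u (Suc k)) \<omega> - marked \<psi> (u k) \<omega>))) - (\<Prod>k<n. exp (- (d * a))))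
        \<le> (\<Sum>k<n. norm (expectation (\<lambda>\<omega>. f (marked \<psi> (u (Suc k)) \<omega> - marked \<psi> (u k) \<omega>)) - exp (- (d * a))))"
        using f01 d a0 by (intro norm_prod_diff) (auto intro!: integral_le_const int simp: integral_nonneg_AE)
      then show ?thesis unfolding E e by simp
    qed
    also have "\<dots> \<le> (\<Sum>k<n. C * d^2)"
    proof (rule sum_mono)
      fix k
      have "\<bar>expectation (\<lambda>\<omega>. f (marked \<psi> (u (Suc k)) \<omega> - marked \<psi> (u k) \<omega>)) - 1 + d * a\<bar> \<le> 2 * (d * (\<Sum>m. H m))^2"
        using marked_expansion[where f=f and \<psi>=\<psi> and s="u k" and t="u (Suc k)", OF f f01 \<psi>] u'[of k] ud[of k] d neg f0
        by simp
      moreover have "\<bar>exp (- (d * a)) - 1 + d * a\<bar> \<le> (d * a)^2" using d a0 by (intro exp_bd) auto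
      ultimately show "\<bar>expectation (\<lambda>\<omega>. f (marked \<psi> (u (Suc k)) \<omega> - marked \<psi> (u k) \<omega>)) - exp (- (d * a))\<bar> \<le> C * d^2"
        unfolding C_def by (simp add: power_mult_distrib algebra_simps)
    qed
    also have "\<dots> = C * (t - s)^2 * (1 / real n)" using n by (simp add: d_def power2_eq_square field_simps)
    finally show ?thesis .
  qed
  have "(\<lambda>n. C * (t - s)^2 * (1 / real n)) \<longlonglongrightarrow> C * (t - s)^2 * 0" by (intro tendsto_intros lim_1_over_n)
  then have "\<bar>?E - exp (- ((t - s) * a))\<bar> \<le> C * (t - s)^2 * 0"
    by (rule LIMSEQ_le_const) (use bd in \<open>auto intro!: exI[of _ 1]\<close>)
  then show ?thesis by (simp add: a_def)
qed

end

section \<open>The Levy measure\<close>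

text \<open>Dividing by \<open>z ^ n\<close> isolates \<open>c n\<close>: the terms after it are
  bounded by \<open>z / (1 - z)\<close>, which can be made arbitrarily small. Used to recover a law
  on the natural numbers from its generating function on \<open>(0, 1)\<close>.\<close>

lemma bounded_power_series_zero:
  fixes c :: "nat \<Rightarrow> real"
  assumes c: "\<And>k. \<bar>c k\<bar> \<le> 1" and z: "\<And>z. 0 < z \<Longrightarrow> z < 1 \<Longrightarrow> (\<lambda>k. c k * z ^ k) sums 0"
  shows "c n = 0"
proof (induction n rule: less_induct)
  case (less n)
  have le: "\<bar>c n\<bar> \<le> z / (1 - z)" if z01: "0 < z" "z < 1" for z
  proof -
    have "(\<lambda>k. c (k + n) * z ^ (k + n)) sums (0 - (\<Sum>k<n. c k * z ^ k))"
      by (rule sums_split_initial_segment[OF z[OF z01]])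
    then have "(\<lambda>k. c (k + n) * z ^ (k + n)) sums 0" using less by simp
    then have "(\<lambda>k. (1 / z ^ n) * (c (k + n) * z ^ (k + n))) sums ((1 / z ^ n) * 0)" by (rule sums_mult)
    then have "(\<lambda>k. c (k + n) * z ^ k) sums 0" using z01 by (simp add: power_add)
    then have "(\<lambda>k. c (Suc k + n) * z ^ Suc k) sums (0 - c n)" by (subst sums_Suc_iff) simp
    moreover have "(\<lambda>k. z * z ^ k) sums (z * (1 / (1 - z)))" using z01 by (intro sums_mult geometric_sums) auto
    moreover have "norm (c (Suc k + n) * z ^ Suc k) \<le> z * z ^ k" for k
      using c[of "Suc k + n"] z01 by (simp add: abs_mult mult_left_le_one_le)
    ultimately have "norm (0 - c n) \<le> z * (1 / (1 - z))"
      by (metis (no_types, lifting) sums_unique sums_summable norm_suminf_le)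
    then show ?thesis by simp
  qed
  show ?case
  proof (rule ccontr)
    assume "c n \<noteq> 0"
    define e where "e = \<bar>c n\<bar>"
    have e: "0 < e" using \<open>c n \<noteq> 0\<close> by (simp add: e_def)
    \<comment> \<open>At \<open>z = e / (2 + e)\<close> the bound \<open>z / (1 - z)\<close> equals
      \<open>e / 2\<close>, half of what it ought to dominate.\<close>
    have "e \<le> (e / (2 + e)) / (1 - e / (2 + e))" unfolding e_def[symmetric]
      using le[of "e / (2 + e)"] e unfolding e_def[symmetric] by (simp add: field_simps)
    also have "\<dots> = e / 2" using e by (simp add: field_simps)
    finally show False using e by simp
  qed
qed

section \<open>Passing to almost surely equal variables on the completed space\<close>

context prob_space
begin

lemma measurable_completion_AE:
  assumes f: "f \<in> M \<rightarrow>\<^sub>M K" and eq: "AE \<omega> in M. f \<omega> = g \<omega>" and g: "g \<in> space M \<rightarrow> space K"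
  shows "g \<in> completion M \<rightarrow>\<^sub>M K"
proof (rule measurableI)
  fix B assume B: "B \<in> sets K"
  have fB: "f -` B \<inter> space M \<in> sets (completion M)" using measurable_sets[OF f B] by (rule sets_completionI_sets)
  have ae: "AE \<omega> in completion M. \<omega> \<in> f -` B \<inter> space M \<longleftrightarrow> \<omega> \<in> g -` B \<inter> space (completion M)"
    using AE_completion[OF eq] AE_space[of "completion M"] by eventually_elim auto
  show "g -` B \<inter> space (completion M) \<in> sets (completion M)"
    by (rule completion.in_sets_AE[OF ae fB]) auto
qed (use g in auto)

lemma measure_completion_AE:
  assumes f: "f \<in> M \<rightarrow>\<^sub>M K" and eq: "AE \<omega> in M. f \<omega> = g \<omega>" and g: "g \<in> space M \<rightarrow> space K" and B: "B \<in> sets K"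
  shows "measure (completion M) (g -` B \<inter> space M) = measure M (f -` B \<inter> space M)"
proof -
  have "measure (completion M) (g -` B \<inter> space M) = measure (completion M) (f -` B \<inter> space M)"
  proof (rule measure_eq_AE)
    show "AE \<omega> in completion M. \<omega> \<in> g -` B \<inter> space M \<longleftrightarrow> \<omega> \<in> f -` B \<inter> space M"
      using AE_completion[OF eq] by eventually_elim auto
    show "g -` B \<inter> space M \<in> sets (completion M)"
      using measurable_sets[OF measurable_completion_AE[OF f eq g] B] by simp
    show "f -` B \<inter> space M \<in> sets (completion M)" using measurable_sets[OF f B] by (rule sets_completionI_sets)
  qed
  then show ?thesis using measurable_sets[OF f B] by simp
qed

text \<open>Jump counts agree with measurable functions only almost surely, so their independence
  lives on the completion; there each event may be exchanged for an almost surely equal one of the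
  original \<sigma>-algebra.\<close>

lemma indep_vars_completion_AE:
  assumes ind: "indep_vars M' X I" and eq: "\<And>i. i \<in> I \<Longrightarrow> AE \<omega> in M. X i \<omega> = X' i \<omega>"
    and X': "\<And>i. i \<in> I \<Longrightarrow> X' i \<in> space M \<rightarrow> space (M' i)"
  shows "prob_space.indep_vars (completion M) M' X' I"
proof -
  interpret C: prob_space "completion M" by (rule prob_space_completion)
  have X: "i \<in> I \<Longrightarrow> X i \<in> M \<rightarrow>\<^sub>M M' i" for i using ind by (auto simp: indep_vars_def2)
  have XC: "i \<in> I \<Longrightarrow> X' i \<in> completion M \<rightarrow>\<^sub>M M' i" for i
    by (rule measurable_completion_AE[OF X eq X'])
  show ?thesis unfolding C.indep_vars_def2
  proof (intro conjI ballI XC C.indep_setsI)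
    fix i assume "i \<in> I" then show "{X' i -` A \<inter> space (completion M) |A. A \<in> sets (M' i)} \<subseteq> sets (completion M)"
      using measurable_sets[OF XC] by auto
  next
    fix A J assume J: "J \<noteq> {}" "J \<subseteq> I" "finite J" and "\<forall>j\<in>J. A j \<in> {X' j -` A \<inter> space (completion M) |A. A \<in> sets (M' j)}"
    then have "\<forall>j\<in>J. \<exists>B. A j = X' j -` B \<inter> space M \<and> B \<in> sets (M' j)" by auto
    from bchoice[OF this] obtain B where B: "\<And>j. j \<in> J \<Longrightarrow> A j = X' j -` B j \<inter> space M" "\<And>j. j \<in> J \<Longrightarrow> B j \<in> sets (M' j)" by blast
    have ev: "j \<in> J \<Longrightarrow> X j -` B j \<inter> space M \<in> events" for j
      using measurable_sets[OF X B(2)] J(2) by auto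
    have ev': "j \<in> J \<Longrightarrow> A j \<in> sets (completion M)" for j
      using measurable_sets[OF XC B(2)] J(2) B(1) by auto
    have "AE \<omega> in M. \<forall>j\<in>J. X j \<omega> = X' j \<omega>"
      using J eq by (intro AE_finite_allI) auto
    then have "AE \<omega> in completion M. \<forall>j\<in>J. X j \<omega> = X' j \<omega>" by (rule AE_completion)
    then have "AE \<omega> in completion M. \<omega> \<in> (\<Inter>j\<in>J. A j) \<longleftrightarrow> \<omega> \<in> (\<Inter>j\<in>J. X j -` B j \<inter> space M)"
      by eventually_elim (simp add: B(1))
    moreover have "(\<Inter>j\<in>J. A j) \<in> sets (completion M)" using J ev' by (intro sets.finite_INT) auto
    moreover have "(\<Inter>j\<in>J. X j -` B j \<inter> space M) \<in> sets (completion M)"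
      using J ev by (intro sets.finite_INT sets_completionI_sets) auto
    ultimately have "C.prob (\<Inter>j\<in>J. A j) = C.prob (\<Inter>j\<in>J. X j -` B j \<inter> space M)"
      by (rule measure_eq_AE)
    also have "\<dots> = prob (\<Inter>j\<in>J. X j -` B j \<inter> space M)"
      using J ev by (intro measure_completion sets.finite_INT) auto
    also have "\<dots> = (\<Prod>j\<in>J. prob (X j -` B j \<inter> space M))"
      using ind J B(2) by (intro indep_varsD[OF ind]) auto
    also have "\<dots> = (\<Prod>j\<in>J. C.prob (A j))"
    proof (rule prod.cong[OF refl])
      fix j assume j: "j \<in> J"
      then have "j \<in> I" using J(2) by blast
      from measure_completion_AE[OF X[OF this] eq[OF this] X'[OF this] B(2)[OF j]]
      show "prob (X j -` B j \<inter> space M) = C.prob (A j)" unfolding B(1)[OF j] by (rule sym)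
    qed
    finally show "C.prob (\<Inter>j\<in>J. A j) = (\<Prod>j\<in>J. C.prob (A j))" .
  qed
qed

end

context marked_poisson
begin

lemma H_nonneg: "0 \<le> H m"
  using H_pos[of m] by simp

lemma prob_Y:
  assumes "1 \<le> i" "B \<in> sets borel"
  shows "emeasure M {\<omega>\<in>space M. c * Y m i \<omega> \<in> B} = (\<integral>\<^sup>+y. ennreal (exponential_density 1 y) * indicator B (c * y) \<partial>lborel)"
proof -
  have "emeasure M (Y m i -` ((\<lambda>y. c * y) -` B) \<inter> space M) = (\<integral>\<^sup>+y. ennreal (exponential_density 1 y) * indicator ((\<lambda>y. c * y) -` B) y \<partial>lborel)"
  proof (rule distributed_emeasure[OF Y_distr[OF assms(1)]])
    have "(\<lambda>y::real. c * y) -` B \<inter> space borel \<in> sets borel" using assms(2) by (intro measurable_sets) auto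
    then show "(\<lambda>y::real. c * y) -` B \<in> sets lborel" by simp
  qed
  then show ?thesis by (simp add: vimage_def Int_def conj_commute indicator_def)
qed

end

section \<open>Exponential marks: density, jump counts and uniqueness of the Levy measure\<close>

locale exponential_jumps = marked_poisson M H N Y for M :: "'a measure" and H N Y +
  fixes A :: "nat \<Rightarrow> real" and S :: "real \<Rightarrow> 'a \<Rightarrow> real"
  assumes A_ge1: "1 \<le> A m"
    and S_eq: "0 \<le> t \<Longrightarrow> \<omega> \<in> space M \<Longrightarrow> S t \<omega> = (\<Sum>m. \<Sum>i=1..N m t \<omega>. A m * Y m i \<omega>)"
begin

lemma A_pos: "0 < A m" using A_ge1[of m] by linarith

definition levy_density :: "real \<Rightarrow> real" where
  "levy_density x = (\<Sum>m. H m / A m * exp (- x / A m))"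

text \<open>The rates dominate the series because \<open>1 \<le> A m\<close>; the bound is uniform
  in \<open>x \<ge> 0\<close>.\<close>

lemma levy_density_summable: "0 \<le> x \<Longrightarrow> summable (\<lambda>m. H m / A m * exp (- x / A m))"
proof (rule summable_comparison_test'[OF H_summable])
  fix m assume x: "0 \<le> x"
  have "H m / A m * exp (- x / A m) \<le> H m * 1"
    using H_pos[of m] A_ge1[of m] A_pos[of m] x by (intro mult_mono) (auto simp: divide_le_eq mult_le_cancel_left1)
  then show "norm (H m / A m * exp (- x / A m)) \<le> H m" using H_pos[of m] A_pos[of m] by simp
qed

lemma levy_density_nonneg: "0 \<le> x \<Longrightarrow> 0 \<le> levy_density x"
  unfolding levy_density_def using H_pos A_pos
  by (intro suminf_nonneg levy_density_summable) (auto intro!: mult_nonneg_nonneg divide_nonneg_nonneg less_imp_le)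

lemma levy_density_strict_antimono: "strict_antimono_on {0<..} levy_density"
proof (rule monotone_onI)
  fix x y :: real assume xy: "x \<in> {0<..}" "y \<in> {0<..}" "x < y"
  have "0 < (\<Sum>m. H m / A m * exp (- x / A m) - H m / A m * exp (- y / A m))"
  proof (rule suminf_pos)
    fix m
    have "H m / A m * exp (- y / A m) < H m / A m * exp (- x / A m)"
      using H_pos[of m] A_pos[of m] xy by (intro mult_strict_left_mono) (auto simp: divide_strict_right_mono)
    then show "0 < H m / A m * exp (- x / A m) - H m / A m * exp (- y / A m)" by simp
  next
    show "summable (\<lambda>m. H m / A m * exp (- x / A m) - H m / A m * exp (- y / A m))"
      using xy by (intro summable_diff levy_density_summable) auto
  qed
  also have "\<dots> = levy_density x - levy_density y"
    unfolding levy_density_def using xy by (intro suminf_diff[symmetric] levy_density_summable) auto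
  finally have "levy_density y < levy_density x" by simp
  then show "levy_density x > levy_density y" .
qed

lemma levy_density_measurable: "levy_density \<in> borel_measurable borel"
  unfolding levy_density_def by measurable

definition levy :: "real measure" where
  "levy = density (restrict_space lborel {0<..}) (\<lambda>x. ennreal (levy_density x))"

lemma space_levy: "space levy = {0<..}"
  by (simp add: levy_def space_restrict_space)

lemma sets_levy: "sets levy = sets (restrict_space borel {0<..})"
  by (simp add: levy_def sets_restrict_space)

lemma sets_levy_iff: "B \<in> sets levy \<longleftrightarrow> B \<in> sets borel \<and> B \<subseteq> {0<..}"
  unfolding sets_levy by (subst sets_restrict_space_iff) auto

lemma summable_jump_rate: "summable (\<lambda>m. H m * prob {\<omega>\<in>space M. A m * Y m 1 \<omega> \<in> B})"
  by (rule summable_generator) simp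

text \<open>The mass of \<open>B\<close> is the total rate of jumps with size in \<open>B\<close>.
  Term by term, the substitution \<open>x = A m * y\<close> turns the exponential density of mean
  \<open>A m\<close> into the law of a standard mark.\<close>

lemma emeasure_levy:
  assumes B: "B \<in> sets levy"
  shows "emeasure levy B = ennreal (\<Sum>m. H m * prob {\<omega>\<in>space M. A m * Y m 1 \<omega> \<in> B})"
proof -
  have Bb: "B \<in> sets borel" "B \<subseteq> {0<..}" using B sets_levy_iff by auto
  note Bb(1)[measurable]
  have "emeasure levy B = (\<integral>\<^sup>+x. ennreal (levy_density x) * indicator B x \<partial>restrict_space lborel {0<..})"
    unfolding levy_def using B sets_levy levy_density_measurable
    by (intro emeasure_density) (auto simp: sets_restrict_space intro: measurable_restrict_space1)
  also have "\<dots> = (\<integral>\<^sup>+x. ennreal (levy_density x) * indicator B x * indicator {0<..} x \<partial>lborel)"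
    by (subst nn_integral_restrict_space) auto
  also have "\<dots> = (\<integral>\<^sup>+x. (\<Sum>m. ennreal (H m / A m * exp (- x / A m)) * indicator B x) \<partial>lborel)"
  proof (rule nn_integral_cong)
    fix x :: real
    show "ennreal (levy_density x) * indicator B x * indicator {0<..} x = (\<Sum>m. ennreal (H m / A m * exp (- x / A m)) * indicator B x)"
    proof (cases "x \<in> B")
      case True
      then have x: "0 < x" using Bb by auto
      have "ennreal (levy_density x) = (\<Sum>m. ennreal (H m / A m * exp (- x / A m)))"
        unfolding levy_density_def using x H_pos A_pos
        by (intro suminf_ennreal2[symmetric] levy_density_summable) (auto intro!: mult_nonneg_nonneg divide_nonneg_nonneg less_imp_le)
      then show ?thesis using True x by simp
    qed simp
  qed
  also have "\<dots> = (\<Sum>m. \<integral>\<^sup>+x. ennreal (H m / A m * exp (- x / A m)) * indicator B x \<partial>lborel)"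
    by (intro nn_integral_suminf) measurable
  also have "\<dots> = (\<Sum>m. ennreal (H m * prob {\<omega>\<in>space M. A m * Y m 1 \<omega> \<in> B}))"
  proof (intro suminf_cong)
    fix m
    have "(\<integral>\<^sup>+x. ennreal (H m / A m * exp (- x / A m)) * indicator B x \<partial>lborel)
      = ennreal \<bar>A m\<bar> * (\<integral>\<^sup>+y. ennreal (H m / A m * exp (- (0 + A m * y) / A m)) * indicator B (0 + A m * y) \<partial>lborel)"
      using A_pos[of m] by (intro nn_integral_real_affine) auto
    also have "\<dots> = (\<integral>\<^sup>+y. ennreal \<bar>A m\<bar> * (ennreal (H m / A m * exp (- (0 + A m * y) / A m)) * indicator B (0 + A m * y)) \<partial>lborel)"
      by (intro nn_integral_cmult[symmetric]) measurable
    also have "\<dots> = (\<integral>\<^sup>+y. ennreal (H m) * (ennreal (exponential_density 1 y) * indicator B (A m * y)) \<partial>lborel)"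
    proof (rule nn_integral_cong)
      fix y :: real
      show "ennreal \<bar>A m\<bar> * (ennreal (H m / A m * exp (- (0 + A m * y) / A m)) * indicator B (0 + A m * y))
         = ennreal (H m) * (ennreal (exponential_density 1 y) * indicator B (A m * y))"
      proof (cases "A m * y \<in> B")
        case True
        then have "0 < A m * y" using Bb by auto
        then have y: "0 < y" using A_pos[of m] by (simp add: zero_less_mult_iff)
        have "ennreal \<bar>A m\<bar> * ennreal (H m / A m * exp (- (A m * y) / A m)) = ennreal (H m * exp (- y))"
          using A_pos[of m] H_pos[of m] by (subst ennreal_mult[symmetric]) (auto simp: mult_ac)
        also have "\<dots> = ennreal (H m) * ennreal (exponential_density 1 y)"
          using y H_pos[of m] by (simp add: exponential_density_def ennreal_mult)
        finally show ?thesis using True by simp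
      qed simp
    qed
    also have "\<dots> = ennreal (H m) * emeasure M {\<omega>\<in>space M. A m * Y m 1 \<omega> \<in> B}"
      using Bb by (subst nn_integral_cmult) (auto simp: prob_Y)
    also have "\<dots> = ennreal (H m * prob {\<omega>\<in>space M. A m * Y m 1 \<omega> \<in> B})"
      using H_pos[of m] by (simp add: emeasure_eq_measure ennreal_mult)
    finally show "(\<integral>\<^sup>+x. ennreal (H m / A m * exp (- x / A m)) * indicator B x \<partial>lborel) = ennreal (H m * prob {\<omega>\<in>space M. A m * Y m 1 \<omega> \<in> B})" .
  qed
  also have "\<dots> = ennreal (\<Sum>m. H m * prob {\<omega>\<in>space M. A m * Y m 1 \<omega> \<in> B})"
    by (intro suminf_ennreal2 summable_jump_rate) (simp add: H_nonneg)
  finally show ?thesis .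
qed

lemma levy_integrable: "(\<integral>\<^sup>+ x. ennreal (min 1 x) \<partial>levy) < \<infinity>"
proof -
  have "(\<integral>\<^sup>+ x. ennreal (min 1 x) \<partial>levy) \<le> (\<integral>\<^sup>+ x. 1 \<partial>levy)"
    by (intro nn_integral_mono) (simp add: ennreal_le_1)
  also have "\<dots> = emeasure levy (space levy)" by simp
  also have "\<dots> < \<infinity>" by (simp add: emeasure_levy)
  finally show ?thesis .
qed

abbreviation jump_count :: "real set \<Rightarrow> real \<Rightarrow> 'a \<Rightarrow> nat" where
  "jump_count B t \<omega> \<equiv> card (jump_times S B t \<omega>)"

abbreviation mark_in :: "real set \<Rightarrow> nat \<Rightarrow> real \<Rightarrow> real" where
  "mark_in B \<equiv> \<lambda>m y. indicator B (A m * y)"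

lemma mark_in_measurable:
  assumes [measurable]: "B \<in> sets borel"
  shows "mark_in B m \<in> borel_measurable borel"
  by measurable

text \<open>Almost every path satisfies the conditions of \<open>counting_paths\<close>. As a marked
  sum, the jump count inherits measurability, independent increments and the generator
  expansion.\<close>

lemma jump_count_marked:
  assumes "0 \<notin> B"
  shows "AE \<omega> in M. (\<forall>t\<ge>0. finite (jump_times S B t \<omega>) \<and> real (jump_count B t \<omega>) = marked (mark_in B) t \<omega>)
     \<and> jump_count B 0 \<omega> = 0 \<and> mono_on {0..} (\<lambda>t. jump_count B t \<omega>) \<and> (\<forall>t\<ge>0. continuous (at_right t) (\<lambda>s. jump_count B s \<omega>))"
  using AE_counting_paths AE_space
proof eventually_elim
  case (elim \<omega>)
  interpret counting_paths "\<lambda>m t. N m t \<omega>" by (rule elim)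
  note S = S_eq[OF _ elim(2)]
  show ?case
    using finite_jump_times[where S=S and \<omega>=\<omega> and a="\<lambda>m i. A m * Y m i \<omega>", OF S assms] real_card_jump_times[where S=S and \<omega>=\<omega> and a="\<lambda>m i. A m * Y m i \<omega>", OF S assms] card_jump_times_regular[where S=S and \<omega>=\<omega> and a="\<lambda>m i. A m * Y m i \<omega>", OF S assms]
    by (simp add: marked_def)
qed

lemma sets_levy_props:
  assumes "B \<in> sets levy"
  shows "B \<in> sets borel" "0 \<notin> B"
  using assms sets_levy_iff by auto

text \<open>\<open>z\<close> to the power of the count is multiplicative over consecutive intervals.
  A mark reduces it by the amount \<open>1 - z\<close> exactly when it falls into \<open>B\<close>,
  and the rates of such marks add up to \<open>measure levy B\<close>.\<close>

lemma jump_count_pgf: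
  assumes B: "B \<in> sets levy" and st: "0 \<le> s" "s < t" and z: "0 \<le> z" "z \<le> 1"
  shows "expectation (\<lambda>\<omega>. z ^ nat \<lfloor>marked (mark_in B) t \<omega> - marked (mark_in B) s \<omega>\<rfloor>) = exp (- ((t - s) * (1 - z) * measure levy B))"
proof -
  note Bb = sets_levy_props[OF B]
  note \<psi> = mark_in_measurable[OF Bb(1)]
  \<comment> \<open>Marked sums are real-valued; rounding down makes the power a Borel function and
    changes nothing at integers.\<close>
  define f where "f = (\<lambda>x::real. z ^ nat \<lfloor>x\<rfloor>)"
  have f: "f \<in> borel_measurable borel" unfolding f_def
    by (rule measurable_compose[OF measurable_real_floor]) simp
  have f01: "0 \<le> f x \<and> f x \<le> 1" for x using z by (simp add: f_def power_le_one)
  have tele: "z ^ (c n - c 0) = (\<Prod>k<n. z ^ (c (Suc k) - c k))" if "\<And>k. k < n \<Longrightarrow> c k \<le> c (Suc k)" for c :: "nat \<Rightarrow> nat" and n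
    using that
  proof (induction n)
    case (Suc n)
    have "c 0 \<le> c n" using Suc.prems
      by (induction n) (auto intro: order_trans[of _ "c _"] dest: less_SucI)
    then have "c (Suc n) - c 0 = (c n - c 0) + (c (Suc n) - c n)" using Suc.prems[of n] by simp
    then have "z ^ (c (Suc n) - c 0) = z ^ (c n - c 0) * z ^ (c (Suc n) - c n)" by (simp only: power_add)
    also have "z ^ (c n - c 0) = (\<Prod>k<n. z ^ (c (Suc k) - c k))" by (rule Suc.IH) (rule Suc.prems, simp)
    finally show ?case by simp
  qed simp
  have mult: "AE \<omega> in M. f (marked (mark_in B) (u n) \<omega> - marked (mark_in B) (u 0) \<omega>) = (\<Prod>k<n. f (marked (mark_in B) (u (Suc k)) \<omega> - marked (mark_in B) (u k) \<omega>))"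
    if u: "0 \<le> u 0" "\<And>k. k < n \<Longrightarrow> u k < u (Suc k)" for n u
    using jump_count_marked[OF Bb(2)]
  proof eventually_elim
    case (elim \<omega>)
    have u0: "0 \<le> u k" if "k \<le> n" for k by (rule increasing_times[OF u order_refl that]; assumption)
    have mono: "jump_count B (u k) \<omega> \<le> jump_count B (u (Suc k)) \<omega>" if "k < n" for k
      using elim u0[of k] u0[of "Suc k"] u(2)[OF that] that by (auto simp: mono_on_def)
    have eq: "marked (mark_in B) (u k) \<omega> = real (jump_count B (u k) \<omega>)" if "k \<le> n" for k
      using elim u0[OF that] by simp
    have fd: "f (real a - real b) = z ^ (a - b)" if "b \<le> a" for a b
      using that by (simp add: f_def of_nat_diff[symmetric] del: of_nat_diff)
    have "jump_count B (u 0) \<omega> \<le> jump_count B (u n) \<omega>"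
      using elim u0[of 0] u0[of n] increasing_times(2)[of u n 0 n] u by (auto simp: mono_on_def)
    then have "f (marked (mark_in B) (u n) \<omega> - marked (mark_in B) (u 0) \<omega>) = z ^ (jump_count B (u n) \<omega> - jump_count B (u 0) \<omega>)"
      by (simp add: eq fd)
    also have "\<dots> = (\<Prod>k<n. z ^ (jump_count B (u (Suc k)) \<omega> - jump_count B (u k) \<omega>))"
      by (rule tele) (rule mono)
    also have "\<dots> = (\<Prod>k<n. f (marked (mark_in B) (u (Suc k)) \<omega> - marked (mark_in B) (u k) \<omega>))"
      by (intro prod.cong refl) (simp add: eq fd mono)
    finally show ?case .
  qed
  have Ef: "1 - expectation (\<lambda>\<omega>. f (mark_in B m (Y m 1 \<omega>))) = (1 - z) * prob {\<omega>\<in>space M. A m * Y m 1 \<omega> \<in> B}" for m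
  proof -
    have ev: "{\<omega>\<in>space M. A m * Y m 1 \<omega> \<in> B} \<in> events"
      using measurable_sets[OF _ Bb(1), of "\<lambda>\<omega>. A m * Y m 1 \<omega>" M] Y_measurable[of 1 m]
      by (simp add: vimage_def Int_def conj_commute)
    have "expectation (\<lambda>\<omega>. f (mark_in B m (Y m 1 \<omega>))) = expectation (\<lambda>\<omega>. 1 - (1 - z) * indicator {\<omega>\<in>space M. A m * Y m 1 \<omega> \<in> B} \<omega>)"
      by (intro Bochner_Integration.integral_cong) (auto simp: f_def indicator_def)
    also have "\<dots> = 1 - (1 - z) * prob {\<omega>\<in>space M. A m * Y m 1 \<omega> \<in> B}"
    proof -
      have "integrable M (indicator {\<omega>\<in>space M. A m * Y m 1 \<omega> \<in> B} :: 'a \<Rightarrow> real)" using ev by (simp add: emeasure_eq_measure)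
      then show ?thesis using ev by (simp add: prob_space)
    qed
    finally show ?thesis by simp
  qed
  have m: "measure levy B = (\<Sum>m. H m * prob {\<omega>\<in>space M. A m * Y m 1 \<omega> \<in> B})"
    unfolding measure_def[of levy] emeasure_levy[OF B]
    by (intro enn2real_ennreal suminf_nonneg summable_jump_rate) (simp add: H_nonneg)
  have "expectation (\<lambda>\<omega>. f (marked (mark_in B) t \<omega> - marked (mark_in B) s \<omega>))
    = exp (- ((t - s) * (\<Sum>m. H m * (1 - expectation (\<lambda>\<omega>. f (mark_in B m (Y m 1 \<omega>)))))))"
    using f f01 \<psi> st mult by (intro marked_multiplicative_expectation) (auto simp: f_def)
  also have "(\<Sum>m. H m * (1 - expectation (\<lambda>\<omega>. f (mark_in B m (Y m 1 \<omega>))))) = (\<Sum>m. (1 - z) * (H m * prob {\<omega>\<in>space M. A m * Y m 1 \<omega> \<in> B}))"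
    unfolding Ef by (simp add: mult_ac)
  also have "\<dots> = (1 - z) * measure levy B"
    unfolding m by (intro suminf_mult summable_jump_rate)
  finally show ?thesis by (simp add: f_def mult.assoc)
qed

lemma jump_count_measurable:
  assumes "B \<in> sets levy" "0 \<le> s" "0 \<le> t"
  shows "(\<lambda>\<omega>. nat \<lfloor>marked (mark_in B) t \<omega> - marked (mark_in B) s \<omega>\<rfloor>) \<in> M \<rightarrow>\<^sub>M count_space UNIV"
proof -
  have "(\<lambda>\<omega>. \<lfloor>marked (mark_in B) t \<omega> - marked (mark_in B) s \<omega>\<rfloor>) \<in> M \<rightarrow>\<^sub>M count_space UNIV"
    using sets_levy_props[OF assms(1)] assms(2,3)
    by (intro measurable_compose[OF _ measurable_real_floor] borel_measurable_diff marked_measurable mark_in_measurable)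
  then show ?thesis by (rule measurable_compose) simp
qed

lemma jump_count_increment_AE:
  assumes "B \<in> sets levy" "0 \<le> s" "s \<le> t"
  shows "AE \<omega> in M. nat \<lfloor>marked (mark_in B) t \<omega> - marked (mark_in B) s \<omega>\<rfloor> = jump_count B t \<omega> - jump_count B s \<omega>"
  using jump_count_marked[OF sets_levy_props(2)[OF assms(1)]]
proof eventually_elim
  case (elim \<omega>)
  then have "marked (mark_in B) t \<omega> = real (jump_count B t \<omega>)" "marked (mark_in B) s \<omega> = real (jump_count B s \<omega>)"
    "jump_count B s \<omega> \<le> jump_count B t \<omega>"
    using assms by (auto simp: mono_on_def)
  then show ?case by (simp add: of_nat_diff[symmetric] del: of_nat_diff)
qed

text \<open>The generating function is that of a Poisson law, and a power series with bounded
  coefficients is determined by its values on \<open>(0, 1)\<close>.\<close>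

lemma jump_count_law:
  assumes B: "B \<in> sets levy" and st: "0 \<le> s" "s < t" and pos: "0 < measure levy B"
  shows "prob {\<omega>\<in>space M. nat \<lfloor>marked (mark_in B) t \<omega> - marked (mark_in B) s \<omega>\<rfloor> = k} = pmf (poisson_pmf (measure levy B * (t - s))) k"
proof -
  define D where "D = (\<lambda>\<omega>. nat \<lfloor>marked (mark_in B) t \<omega> - marked (mark_in B) s \<omega>\<rfloor>)"
  have D: "D \<in> M \<rightarrow>\<^sub>M count_space UNIV" unfolding D_def using st by (intro jump_count_measurable B) auto
  have ev: "{\<omega>\<in>space M. D \<omega> = k} \<in> events" for k
    using measurable_sets[OF D, of "{k}"] by (simp add: vimage_def Int_def conj_commute)
  define r where "r = measure levy B * (t - s)"
  have r: "0 < r" using pos st by (simp add: r_def)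
  define c where "c = (\<lambda>k. prob {\<omega>\<in>space M. D \<omega> = k} - pmf (poisson_pmf r) k)"
  have "c k = 0"
  proof (rule bounded_power_series_zero)
    fix k show "\<bar>c k\<bar> \<le> 1"
      using measure_nonneg[of M "{\<omega>\<in>space M. D \<omega> = k}"] prob_le_1[of "{\<omega>\<in>space M. D \<omega> = k}"]
        pmf_nonneg[of "poisson_pmf r" k] pmf_le_1[of "poisson_pmf r" k] unfolding c_def by linarith
  next
    fix z :: real assume z: "0 < z" "z < 1"
    have 1: "(\<lambda>k. prob {\<omega>\<in>space M. D \<omega> = k} * z ^ k) sums expectation (\<lambda>\<omega>. z ^ D \<omega>)"
    proof -
      let ?f = "\<lambda>k \<omega>. indicator {\<omega>\<in>space M. D \<omega> = k} \<omega> * z ^ k"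
      have int: "integrable M (?f k)" for k using ev[of k] by (intro integrable_mult_left) (simp add: emeasure_eq_measure)
      have E: "expectation (?f k) = prob {\<omega>\<in>space M. D \<omega> = k} * z ^ k" for k using ev[of k] by simp
      have En: "expectation (\<lambda>\<omega>. norm (?f k \<omega>)) = prob {\<omega>\<in>space M. D \<omega> = k} * z ^ k" for k
        using E[of k] z by (simp add: abs_mult)
      have pt: "(\<lambda>k. ?f k \<omega>) sums (z ^ D \<omega>)" if "\<omega> \<in> space M" for \<omega>
      proof -
        have "(\<lambda>k. ?f k \<omega>) = (\<lambda>k. if k = D \<omega> then z ^ D \<omega> else 0)" using that by (auto simp: fun_eq_iff indicator_def)
        then show ?thesis using sums_single[of "D \<omega>" "\<lambda>k. z ^ D \<omega>"] by simp
      qed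
      have "(\<lambda>k. expectation (?f k)) sums expectation (\<lambda>\<omega>. \<Sum>k. ?f k \<omega>)"
      proof (rule sums_integral[OF int])
        show "AE \<omega> in M. summable (\<lambda>k. norm (?f k \<omega>))"
          using pt z by (intro AE_I2) (auto simp: abs_mult sums_iff)
        show "summable (\<lambda>k. expectation (\<lambda>\<omega>. norm (?f k \<omega>)))"
          unfolding En
        proof (rule summable_comparison_test'[of "\<lambda>k. z ^ k"])
          show "summable (\<lambda>k. z ^ k)" using z by (intro summable_geometric) auto
          fix k show "norm (prob {\<omega>\<in>space M. D \<omega> = k} * z ^ k) \<le> z ^ k"
            using z prob_le_1[of "{\<omega>\<in>space M. D \<omega> = k}"] by (simp add: abs_mult mult_left_le_one_le)
        qed
      qed
      moreover have "expectation (\<lambda>\<omega>. \<Sum>k. ?f k \<omega>) = expectation (\<lambda>\<omega>. z ^ D \<omega>)"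
        using pt by (intro Bochner_Integration.integral_cong) (auto simp: sums_iff)
      ultimately show ?thesis unfolding E by (simp only:)
    qed
    have 2: "(\<lambda>k. pmf (poisson_pmf r) k * z ^ k) sums expectation (\<lambda>\<omega>. z ^ D \<omega>)"
    proof -
      have "(\<lambda>k. exp (- r) * ((r * z) ^ k /\<^sub>R fact k)) sums (exp (- r) * exp (r * z))"
        by (intro sums_mult exp_converges)
      moreover have "exp (- r) * ((r * z) ^ k /\<^sub>R fact k) = pmf (poisson_pmf r) k * z ^ k" for k
        using r by (simp add: power_mult_distrib field_simps)
      moreover have "exp (- r) * exp (r * z) = expectation (\<lambda>\<omega>. z ^ D \<omega>)"
        unfolding D_def using z by (subst jump_count_pgf[OF B st]) (auto simp: exp_add[symmetric] r_def algebra_simps)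
      ultimately show ?thesis by simp
    qed
    show "(\<lambda>k. c k * z ^ k) sums 0"
      using sums_diff[OF 1 2] by (simp add: c_def left_diff_distrib)
  qed
  then show ?thesis by (simp add: c_def D_def r_def)
qed

text \<open>A null set has rate zero for every type, so almost surely no mark of any index falls
  into it.\<close>

lemma marked_zero_AE:
  assumes B: "B \<in> sets levy" and z: "emeasure levy B = 0"
  shows "AE \<omega> in M. \<forall>t\<ge>0. jump_times S B t \<omega> = {}"
proof -
  note Bb = sets_levy_props[OF B]
  have "(\<Sum>m. H m * prob {\<omega>\<in>space M. A m * Y m 1 \<omega> \<in> B}) = 0"
  proof -
    have "(\<Sum>m. H m * prob {\<omega>\<in>space M. A m * Y m 1 \<omega> \<in> B}) \<le> 0" using z emeasure_levy[OF B] by (simp add: ennreal_eq_0_iff)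
    moreover have "0 \<le> (\<Sum>m. H m * prob {\<omega>\<in>space M. A m * Y m 1 \<omega> \<in> B})"
      by (intro suminf_nonneg summable_jump_rate) (simp add: H_nonneg)
    ultimately show ?thesis by simp
  qed
  then have "\<forall>m. H m * prob {\<omega>\<in>space M. A m * Y m 1 \<omega> \<in> B} = 0"
    by (subst suminf_eq_zero_iff[symmetric, OF summable_jump_rate]) (simp_all add: H_nonneg)
  then have "H m * prob {\<omega>\<in>space M. A m * Y m 1 \<omega> \<in> B} = 0" for m by blast
  then have p1: "prob {\<omega>\<in>space M. A m * Y m 1 \<omega> \<in> B} = 0" for m
    using H_pos[of m] by (metis (no_types, lifting) less_irrefl mult_eq_0_iff)
  have "AE \<omega> in M. A m * Y m i \<omega> \<notin> B" if i: "1 \<le> i" for m i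
  proof -
    have ev: "{\<omega>\<in>space M. A m * Y m i \<omega> \<in> B} \<in> events"
      using measurable_sets[OF _ Bb(1), of "\<lambda>\<omega>. A m * Y m i \<omega>" M] Y_measurable[OF i, of m]
      by (simp add: vimage_def Int_def conj_commute)
    have "emeasure M {\<omega>\<in>space M. A m * Y m i \<omega> \<in> B} = emeasure M {\<omega>\<in>space M. A m * Y m 1 \<omega> \<in> B}"
      using prob_Y[OF i Bb(1)] prob_Y[OF order_refl Bb(1)] by simp
    then have "prob {\<omega>\<in>space M. A m * Y m i \<omega> \<in> B} = 0" using p1[of m] by (simp add: measure_def)
    then show ?thesis by (rule iffD1[OF prob_Collect_eq_0[OF ev]])
  qed
  then have "AE \<omega> in M. \<forall>m. \<forall>i\<in>{1..}. A m * Y m i \<omega> \<notin> B"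
    by (simp add: AE_all_countable AE_ball_countable)
  then show ?thesis using jump_count_marked[OF Bb(2)]
  proof (eventually_elim, intro allI impI)
    fix \<omega> and t :: real
    assume no: "\<forall>m. \<forall>i\<in>{1..}. A m * Y m i \<omega> \<notin> B" and t: "0 \<le> t"
      and *: "(\<forall>t\<ge>0. finite (jump_times S B t \<omega>) \<and> real (jump_count B t \<omega>) = marked (mark_in B) t \<omega>)
     \<and> jump_count B 0 \<omega> = 0 \<and> mono_on {0..} (\<lambda>t. jump_count B t \<omega>) \<and> (\<forall>t\<ge>0. continuous (at_right t) (\<lambda>s. jump_count B s \<omega>))"
    have "marked (mark_in B) t \<omega> = (\<Sum>m. 0)" unfolding marked_def
      using no by (intro suminf_cong sum.neutral) (auto simp: indicator_def)
    \<comment> \<open>Cardinality 0 means emptiness only together with finiteness.\<close>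
    then have "jump_count B t \<omega> = 0" "finite (jump_times S B t \<omega>)" using * t by auto
    then show "jump_times S B t \<omega> = {}" by simp
  qed
qed

lemma levy_measure_levy: "levy_measure M S levy"
  unfolding levy_measure_def
proof (intro conjI ballI impI space_levy sets_levy levy_integrable)
  fix B assume B: "B \<in> sets levy" "emeasure levy B = 0"
  show "AE \<omega> in completion M. \<forall>t\<ge>0. jump_times S B t \<omega> = {}"
    by (rule AE_completion[OF marked_zero_AE[OF B]])
next
  fix B assume B: "B \<in> sets levy" and pos: "0 < emeasure levy B \<and> emeasure levy B < \<infinity>"
  note Bb = sets_levy_props[OF B] and reg = jump_count_marked[OF sets_levy_props(2)[OF B]]
  have mpos: "0 < measure levy B" using pos by (simp add: measure_def enn2real_positive_iff)
  have "AE \<omega> in M. \<forall>t\<ge>0. finite (jump_times S B t \<omega>)" using reg by eventually_elim blast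
  then show "AE \<omega> in completion M. \<forall>t\<ge>0. finite (jump_times S B t \<omega>)" by (rule AE_completion)
  let ?D = "\<lambda>s t \<omega>. nat \<lfloor>marked (mark_in B) t \<omega> - marked (mark_in B) s \<omega>\<rfloor>"
  show "poisson_process (completion M) (measure levy B) (\<lambda>t \<omega>. jump_count B t \<omega>)"
    unfolding poisson_process_def
  proof (intro conjI allI impI)
    fix t :: real assume t: "0 \<le> t"
    have "AE \<omega> in M. ?D 0 t \<omega> = jump_count B t \<omega>"
      using jump_count_increment_AE[OF B order_refl t] reg by eventually_elim simp
    then show "(\<lambda>\<omega>. jump_count B t \<omega>) \<in> completion M \<rightarrow>\<^sub>M count_space UNIV"
      by (rule measurable_completion_AE[OF jump_count_measurable[OF B order_refl t]]) simp
  next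
    have "AE \<omega> in M. jump_count B 0 \<omega> = 0 \<and> mono_on {0..} (\<lambda>t. jump_count B t \<omega>) \<and> (\<forall>t\<ge>0. continuous (at_right t) (\<lambda>s. jump_count B s \<omega>))"
      using reg by eventually_elim blast
    then show "AE \<omega> in completion M. jump_count B 0 \<omega> = 0 \<and> mono_on {0..} (\<lambda>t. jump_count B t \<omega>) \<and> (\<forall>t\<ge>0. continuous (at_right t) (\<lambda>s. jump_count B s \<omega>))"
      by (rule AE_completion)
  next
    show "independent_increments (completion M) (count_space UNIV) (\<lambda>t \<omega>. jump_count B t \<omega>)"
      unfolding independent_increments_def
    proof (intro allI impI)
      fix n :: nat and u :: "nat \<Rightarrow> real" assume u: "0 \<le> u 0" "\<forall>k<n. u k < u (Suc k)"
      have u0: "0 \<le> u k" if "k \<le> n" for k by (rule increasing_times[of u n, OF u(1) _ order_refl that]) (use u(2) in auto)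
      have ind: "indep_vars (\<lambda>_. borel) (\<lambda>k \<omega>. marked (mark_in B) (u (Suc k)) \<omega> - marked (mark_in B) (u k) \<omega>) {..<n}"
        using marked_independent_increments[of "mark_in B", OF mark_in_measurable[OF Bb(1)]] u
        unfolding independent_increments_def by blast
      have fl: "(\<lambda>x::real. nat \<lfloor>x\<rfloor>) \<in> borel \<rightarrow>\<^sub>M count_space UNIV"
        by (rule measurable_compose[OF measurable_real_floor]) simp
      have "indep_vars (\<lambda>_. count_space UNIV) (\<lambda>k \<omega>. ?D (u k) (u (Suc k)) \<omega>) {..<n}"
        by (rule indep_vars_compose2[OF ind fl])
      then show "prob_space.indep_vars (completion M) (\<lambda>_. count_space UNIV) (\<lambda>k \<omega>. jump_count B (u (Suc k)) \<omega> - jump_count B (u k) \<omega>) {..<n}"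
      proof (rule indep_vars_completion_AE)
        fix k assume "k \<in> {..<n}"
        then show "AE \<omega> in M. ?D (u k) (u (Suc k)) \<omega> = jump_count B (u (Suc k)) \<omega> - jump_count B (u k) \<omega>"
          using u u0[of k] by (intro jump_count_increment_AE B) (auto intro: less_imp_le)
      qed simp
    qed
  next
    fix s t :: real assume st: "0 \<le> s" "s < t"
    then have ae: "AE \<omega> in M. ?D s t \<omega> = jump_count B t \<omega> - jump_count B s \<omega>"
      by (intro jump_count_increment_AE B) auto
    have D: "?D s t \<in> M \<rightarrow>\<^sub>M count_space UNIV" using st by (intro jump_count_measurable B) auto
    have C: "(\<lambda>\<omega>. jump_count B t \<omega> - jump_count B s \<omega>) \<in> completion M \<rightarrow>\<^sub>M count_space UNIV"
      by (rule measurable_completion_AE[OF D ae]) simp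
    interpret C: prob_space "completion M" by (rule prob_space_completion)
    show "distr (completion M) (count_space UNIV) (\<lambda>\<omega>. jump_count B t \<omega> - jump_count B s \<omega>) = measure_pmf (poisson_pmf (measure levy B * (t - s)))"
    proof (rule measure_eqI_countable[of _ UNIV])
      fix k :: nat
      have "measure (completion M) ((\<lambda>\<omega>. jump_count B t \<omega> - jump_count B s \<omega>) -` {k} \<inter> space M) = prob (?D s t -` {k} \<inter> space M)"
        by (rule measure_completion_AE[OF D ae]) auto
      also have "?D s t -` {k} \<inter> space M = {\<omega>\<in>space M. ?D s t \<omega> = k}" by auto
      also have "prob \<dots> = pmf (poisson_pmf (measure levy B * (t - s))) k"
        by (rule jump_count_law[OF B st mpos])
      finally show "emeasure (distr (completion M) (count_space UNIV) (\<lambda>\<omega>. jump_count B t \<omega> - jump_count B s \<omega>)) {k} = emeasure (measure_pmf (poisson_pmf (measure levy B * (t - s)))) {k}"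
        using C by (simp add: emeasure_distr C.emeasure_eq_measure emeasure_pmf_single)
    qed auto
  qed
qed

text \<open>This is the generating function at \<open>z = 0\<close>, where \<open>0 ^ 0 = 1\<close>
  makes it the probability of no jump.\<close>

lemma no_jump_prob:
  assumes B: "B \<in> sets levy"
  shows "measure (completion M) {\<omega>\<in>space M. jump_count B 1 \<omega> - jump_count B 0 \<omega> = 0} = exp (- measure levy B)"
proof -
  let ?D = "\<lambda>\<omega>. nat \<lfloor>marked (mark_in B) 1 \<omega> - marked (mark_in B) 0 \<omega>\<rfloor>"
  have D: "?D \<in> M \<rightarrow>\<^sub>M count_space UNIV" by (intro jump_count_measurable B) auto
  have ae: "AE \<omega> in M. ?D \<omega> = jump_count B 1 \<omega> - jump_count B 0 \<omega>" by (intro jump_count_increment_AE B) auto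
  have "measure (completion M) ((\<lambda>\<omega>. jump_count B 1 \<omega> - jump_count B 0 \<omega>) -` {0} \<inter> space M) = prob (?D -` {0} \<inter> space M)"
    by (rule measure_completion_AE[OF D ae]) auto
  also have "\<dots> = expectation (indicator (?D -` {0} \<inter> space M))"
    using measurable_sets[OF D, of "{0}"] by simp
  also have "\<dots> = expectation (\<lambda>\<omega>. 0 ^ ?D \<omega>)"
    by (intro Bochner_Integration.integral_cong) (auto simp: indicator_def power_0_left)
  also have "\<dots> = exp (- measure levy B)" by (subst jump_count_pgf[OF B]) auto
  finally show ?thesis by (simp add: vimage_def Int_def conj_commute)
qed

text \<open>For every candidate \<open>\<mu>\<close> and every \<open>B\<close> of finite mass, the
  probability of no jump in \<open>B\<close> up to time 1 is \<open>exp (- measure \<mu> B)\<close>,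
  so the candidate agrees with \<open>levy\<close> on such sets. Integrability of
  \<open>min 1 x\<close> gives finite mass to the half-lines away from 0, and these exhaust
  \<open>{0<..}\<close>.\<close>

lemma levy_measure_unique:
  assumes \<mu>: "levy_measure M S \<mu>"
  shows "\<mu> = levy"
proof -
  interpret C: prob_space "completion M" by (rule prob_space_completion)
  have sp: "space \<mu> = {0<..}" and st: "sets \<mu> = sets levy" and int: "(\<integral>\<^sup>+ x. ennreal (min 1 x) \<partial>\<mu>) < \<infinity>"
    using \<mu> by (auto simp: levy_measure_def sets_levy)
  have levy_fin: "emeasure levy B < \<infinity>" if "B \<in> sets levy" for B using emeasure_levy[OF that] by simp
  have fin: "emeasure \<mu> B = emeasure levy B" if B: "B \<in> sets levy" and f: "emeasure \<mu> B < \<infinity>" for B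
  proof -
    let ?E = "{\<omega>\<in>space M. jump_count B 1 \<omega> - jump_count B 0 \<omega> = 0}"
    have "measure (completion M) ?E = exp (- measure \<mu> B)"
    proof (cases "emeasure \<mu> B = 0")
      \<comment> \<open>For a null set the Poisson clause is silent, and the clause on null sets
        takes its place.\<close>
      case True
      then have "AE \<omega> in completion M. \<forall>t\<ge>0. jump_times S B t \<omega> = {}"
        using \<mu> B st unfolding levy_measure_def by blast
      then have ae: "AE \<omega> in completion M. \<omega> \<in> space M \<longleftrightarrow> \<omega> \<in> ?E"
        using AE_space by eventually_elim simp
      have sM: "space M \<in> sets (completion M)" by (rule sets_completionI_sets) simp
      have "?E \<in> sets (completion M)" by (rule completion.in_sets_AE[OF ae sM]) auto
      then have "measure (completion M) ?E = measure (completion M) (space M)"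
        by (rule measure_eq_AE[OF ae sM, symmetric])
      then show ?thesis using True by (simp add: measure_def emeasure_space_1)
    next
      case False
      then have pos: "0 < emeasure \<mu> B" by (simp add: zero_less_iff_neq_zero)
      then have mpos: "0 < measure \<mu> B" using f by (simp add: measure_def enn2real_positive_iff)
      have pp: "poisson_process (completion M) (measure \<mu> B) (\<lambda>t \<omega>. jump_count B t \<omega>)"
        using \<mu> B st pos f unfolding levy_measure_def by blast
      have d: "distr (completion M) (count_space UNIV) (\<lambda>\<omega>. jump_count B 1 \<omega> - jump_count B 0 \<omega>) = measure_pmf (poisson_pmf (measure \<mu> B * (1 - 0)))"
        using pp unfolding poisson_process_def by (meson order_refl zero_less_one)
      have me: "(\<lambda>\<omega>. jump_count B 1 \<omega> - jump_count B 0 \<omega>) \<in> completion M \<rightarrow>\<^sub>M count_space UNIV"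
        using pp unfolding poisson_process_def by (intro measurable_diff_nat) auto
      have "measure (distr (completion M) (count_space UNIV) (\<lambda>\<omega>. jump_count B 1 \<omega> - jump_count B 0 \<omega>)) {0} = exp (- measure \<mu> B)"
        unfolding d using mpos by (simp add: measure_pmf_single)
      then show ?thesis using me by (simp add: measure_distr vimage_def Int_def conj_commute)
    qed
    then have "measure \<mu> B = measure levy B" using no_jump_prob[OF B] by simp
    then show ?thesis using f levy_fin[OF B] by (simp add: emeasure_eq_ennreal_measure less_top)
  qed
  show ?thesis
  proof (rule measure_eqI[OF st])
    fix B assume "B \<in> sets \<mu>"
    then have B: "B \<in> sets levy" using st by simp
    define C where "C = (\<lambda>n::nat. {1 / real (Suc n)..} :: real set)"
    have Cs: "C n \<in> sets levy" for n by (auto simp: sets_levy_iff C_def intro: less_le_trans[of 0 "1 / real (Suc n)"])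
    have Cf: "emeasure \<mu> (C n) < \<infinity>" for n
    proof -
      have "ennreal (1 / real (Suc n)) * emeasure \<mu> (C n) = (\<integral>\<^sup>+x. ennreal (1 / real (Suc n)) * indicator (C n) x \<partial>\<mu>)"
        using Cs st by (intro nn_integral_cmult_indicator[symmetric]) auto
      also have "\<dots> \<le> (\<integral>\<^sup>+ x. ennreal (min 1 x) \<partial>\<mu>)"
        by (intro nn_integral_mono) (auto simp: C_def indicator_def intro!: ennreal_leI)
      finally have "ennreal (1 / real (Suc n)) * emeasure \<mu> (C n) < \<infinity>" using int by simp
      then show ?thesis by (auto simp: ennreal_mult_less_top)
    qed
    have inc: "incseq (\<lambda>n. B \<inter> C n)"
    proof (rule incseq_SucI)
      fix n
      have "1 / real (Suc (Suc n)) \<le> 1 / real (Suc n)" by (intro divide_left_mono) auto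
      then show "B \<inter> C n \<subseteq> B \<inter> C (Suc n)" unfolding C_def by (auto simp del: of_nat_Suc)
    qed
    have U: "(\<Union>n. B \<inter> C n) = B"
    proof -
      have "\<exists>n. x \<in> C n" if "x \<in> B" for x
      proof -
        have "0 < x" using B that sets_levy_iff by auto
        then obtain n where "inverse (real (Suc n)) < x" using reals_Archimedean by blast
        then show ?thesis by (auto simp: C_def inverse_eq_divide intro!: exI[of _ n])
      qed
      then show ?thesis by auto
    qed
    have BC: "B \<inter> C n \<in> sets levy" for n using B Cs by auto
    have rng: "range (\<lambda>n. B \<inter> C n) \<subseteq> sets levy" using BC by (rule image_subsetI)
    have eq: "emeasure \<mu> (B \<inter> C n) = emeasure levy (B \<inter> C n)" for n
    proof (rule fin[OF BC])
      have "emeasure \<mu> (B \<inter> C n) \<le> emeasure \<mu> (C n)" using Cs st by (intro emeasure_mono) auto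
      then show "emeasure \<mu> (B \<inter> C n) < \<infinity>" using Cf by (rule order.strict_trans1)
    qed
    have "emeasure \<mu> B = (SUP n. emeasure \<mu> (B \<inter> C n))"
      unfolding SUP_emeasure_incseq[OF rng[folded st] inc] U ..
    also have "\<dots> = (SUP n. emeasure levy (B \<inter> C n))" by (simp only: eq)
    also have "\<dots> = emeasure levy B"
      unfolding SUP_emeasure_incseq[OF rng inc] U ..
    finally show "emeasure \<mu> B = emeasure levy B" .
  qed
qed

end

section \<open>Subordinated Brownian motion\<close>

lemma integral_stdnormal_scale:
  fixes f :: "real \<Rightarrow> real"
  assumes [measurable]: "f \<in> borel_measurable borel" and d: "0 < d"
  shows "(\<integral>x. normal_density 0 (sqrt d) x * f x \<partial>lborel) = (\<integral>z. f (sqrt d * z) \<partial>density lborel std_normal_density)"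
proof -
  have "(\<integral>x. normal_density 0 (sqrt d) x * f x \<partial>lborel) = \<bar>sqrt d\<bar> *\<^sub>R (\<integral>z. normal_density 0 (sqrt d) (0 + sqrt d * z) * f (0 + sqrt d * z) \<partial>lborel)"
    using d by (intro lborel_integral_real_affine) auto
  also have "\<dots> = (\<integral>z. std_normal_density z * f (sqrt d * z) \<partial>lborel)"
    using d by (subst integral_scaleR_right[symmetric], intro Bochner_Integration.integral_cong)
      (auto simp: normal_density_def real_sqrt_mult field_simps power_mult_distrib)
  also have "\<dots> = (\<integral>z. f (sqrt d * z) \<partial>density lborel std_normal_density)"
    by (subst integral_density) auto
  finally show ?thesis .
qed

text \<open>The mean of \<open>f\<close> under the centred normal law of variance \<open>s\<close>.
  Scaling a standard normal variable includes the degenerate case \<open>s = 0\<close>, where the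
  value is \<open>f 0\<close>.\<close>

definition gauss_mean :: "(real \<Rightarrow> real) \<Rightarrow> real \<Rightarrow> real" where
  "gauss_mean f s = (\<integral>z. f (sqrt s * z) \<partial>density lborel std_normal_density)"

lemma prob_space_stdn: "prob_space (density lborel std_normal_density)"
  by (rule prob_space_normal_density) simp

lemma gauss_mean_bounds:
  assumes [measurable]: "f \<in> borel_measurable borel" and f01: "\<And>x. 0 \<le> f x \<and> f x \<le> (1::real)"
  shows "0 \<le> gauss_mean f s" "gauss_mean f s \<le> 1" "integrable (density lborel std_normal_density) (\<lambda>z. f (sqrt s * z))"
proof -
  interpret P: prob_space "density lborel std_normal_density" by (rule prob_space_stdn)
  show i: "integrable (density lborel std_normal_density) (\<lambda>z. f (sqrt s * z))"
    using f01 by (intro P.integrable_const_bound[of _ 1]) auto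
  show "0 \<le> gauss_mean f s" unfolding gauss_mean_def using f01 by (intro integral_nonneg_AE) auto
  show "gauss_mean f s \<le> 1" unfolding gauss_mean_def using f01 i by (intro P.integral_le_const) auto
qed

lemma gauss_mean_measurable:
  assumes [measurable]: "f \<in> borel_measurable borel"
  shows "gauss_mean f \<in> borel_measurable borel"
proof -
  interpret P: prob_space "density lborel std_normal_density" by (rule prob_space_stdn)
  show ?thesis unfolding gauss_mean_def by measurable
qed

lemma gauss_mean_tendsto:
  assumes f: "continuous_on UNIV f" and f01: "\<And>x. 0 \<le> f x \<and> f x \<le> (1::real)" and s: "s \<longlonglongrightarrow> t"
  shows "(\<lambda>j. gauss_mean f (s j)) \<longlonglongrightarrow> gauss_mean f t"
  unfolding gauss_mean_def
proof (rule Bochner_Integration.integral_dominated_convergence[where w="\<lambda>_. 1::real"])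
  interpret P: prob_space "density lborel std_normal_density" by (rule prob_space_stdn)
  note [measurable] = borel_measurable_continuous_onI[OF f]
  show "(\<lambda>z. f (sqrt t * z)) \<in> borel_measurable (density lborel std_normal_density)"
    "\<And>j. (\<lambda>z. f (sqrt (s j) * z)) \<in> borel_measurable (density lborel std_normal_density)" by measurable
  show "integrable (density lborel std_normal_density) (\<lambda>_. 1::real)" by simp
  show "AE z in density lborel std_normal_density. (\<lambda>j. f (sqrt (s j) * z)) \<longlonglongrightarrow> f (sqrt t * z)"
  proof (rule AE_I2)
    fix z
    have "(\<lambda>j. sqrt (s j) * z) \<longlonglongrightarrow> sqrt t * z" by (intro tendsto_intros s)
    then show "(\<lambda>j. f (sqrt (s j) * z)) \<longlonglongrightarrow> f (sqrt t * z)"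
      using f by (intro isCont_tendsto_compose[of _ f]) (auto simp: continuous_on_eq_continuous_at)
  qed
qed (use f01 in auto)

lemma gauss_mean_tendsto_fun:
  assumes fm: "\<And>j. f j \<in> borel_measurable borel" "g \<in> borel_measurable borel" and f01: "\<And>j x. 0 \<le> f j x \<and> f j x \<le> (1::real)"
    and lim: "\<And>x. (\<lambda>j. f j x) \<longlonglongrightarrow> g x"
  shows "(\<lambda>j. gauss_mean (f j) s) \<longlonglongrightarrow> gauss_mean g s"
  unfolding gauss_mean_def
proof (rule Bochner_Integration.integral_dominated_convergence[where w="\<lambda>_. 1::real"])
  interpret P: prob_space "density lborel std_normal_density" by (rule prob_space_stdn)
  note [measurable] = fm
  show "(\<lambda>z. g (sqrt s * z)) \<in> borel_measurable (density lborel std_normal_density)"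
    "\<And>j. (\<lambda>z. f j (sqrt s * z)) \<in> borel_measurable (density lborel std_normal_density)" by measurable
  show "integrable (density lborel std_normal_density) (\<lambda>_. 1::real)" by simp
qed (use f01 lim in auto)

locale subordinated = prob_space M for M :: "'a measure" +
  fixes T W :: "real \<Rightarrow> 'a \<Rightarrow> real"
  assumes T_measurable: "0 \<le> t \<Longrightarrow> T t \<in> borel_measurable M"
    and T_indep: "independent_increments M borel T"
    and T_mono: "AE \<omega> in M. \<forall>s t. 0 \<le> s \<longrightarrow> s \<le> t \<longrightarrow> 0 \<le> T s \<omega> \<and> T s \<omega> \<le> T t \<omega>"
    and W_bm: "standard_brownian_motion M W"
    and WT_indep: "indep_set (generated_events M {0..} borel W) (generated_events M {0..} borel T)"
begin

lemma W_measurable: "0 \<le> t \<Longrightarrow> W t \<in> borel_measurable M"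
  using W_bm by (auto simp: standard_brownian_motion_def)

lemma W_continuous: "AE \<omega> in M. W 0 \<omega> = 0 \<and> continuous_on {0..} (\<lambda>t. W t \<omega>)"
  using W_bm by (auto simp: standard_brownian_motion_def)

lemma W_increment:
  assumes st: "0 \<le> s" "s < t" and f[measurable]: "f \<in> borel_measurable borel"
  shows "expectation (\<lambda>\<omega>. f (W t \<omega> - W s \<omega>)) = gauss_mean f (t - s)"
proof -
  have "distributed M lborel (\<lambda>\<omega>. W t \<omega> - W s \<omega>) (normal_density 0 (sqrt (t - s)))"
    using W_bm st by (auto simp: standard_brownian_motion_def)
  from distributed_integral[OF this, of f] show ?thesis
    using integral_stdnormal_scale[OF f, of "t - s"] st by (simp add: gauss_mean_def)
qed

lemma W_increments_product:
  fixes f :: "nat \<Rightarrow> real \<Rightarrow> real"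
  assumes f: "\<And>k. f k \<in> borel_measurable borel" and f01: "\<And>k x. 0 \<le> f k x \<and> f k x \<le> 1"
    and u: "0 \<le> u 0" "\<And>k. k < n \<Longrightarrow> u k < u (Suc k)"
  shows "expectation (\<lambda>\<omega>. \<Prod>k<n. f k (W (u (Suc k)) \<omega> - W (u k) \<omega>)) = (\<Prod>k<n. gauss_mean (f k) (u (Suc k) - u k))"
proof -
  have u0: "0 \<le> u k" if "k \<le> n" for k by (rule increasing_times(1)[OF u order_refl that])
  have ind: "indep_vars (\<lambda>_. borel) (\<lambda>k \<omega>. W (u (Suc k)) \<omega> - W (u k) \<omega>) {..<n}"
    using W_bm u unfolding standard_brownian_motion_def independent_increments_def by blast
  have "expectation (\<lambda>\<omega>. \<Prod>k<n. f k (W (u (Suc k)) \<omega> - W (u k) \<omega>)) = (\<Prod>k<n. expectation (\<lambda>\<omega>. f k (W (u (Suc k)) \<omega> - W (u k) \<omega>)))"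
  proof (rule indep_vars_lebesgue_integral[OF _ indep_vars_compose2[OF ind f]])
    fix k assume "k \<in> {..<n}"
    then show "integrable M (\<lambda>\<omega>. f k (W (u (Suc k)) \<omega> - W (u k) \<omega>))"
      using f01 u0 by (intro integrable_const_bound[of _ 1] measurable_compose[OF _ f] borel_measurable_diff W_measurable) auto
  qed simp
  also have "\<dots> = (\<Prod>k<n. gauss_mean (f k) (u (Suc k) - u k))"
    using u u0 by (intro prod.cong refl W_increment f) auto
  finally show ?thesis .
qed

text \<open>The index of the dyadic point at or just below the random clock: it has countably many
  values, at which \<open>W\<close> can be frozen.\<close>

definition dyadic :: "nat \<Rightarrow> real \<Rightarrow> 'a \<Rightarrow> nat" where
  "dyadic j t \<omega> = nat \<lfloor>2 ^ j * T t \<omega>\<rfloor>"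

lemma dyadic_measurable: "0 \<le> t \<Longrightarrow> dyadic j t \<in> M \<rightarrow>\<^sub>M count_space UNIV"
proof -
  assume "0 \<le> t"
  then have "(\<lambda>\<omega>. \<lfloor>2 ^ j * T t \<omega>\<rfloor>) \<in> M \<rightarrow>\<^sub>M count_space UNIV"
    by (intro measurable_compose[OF _ measurable_real_floor] borel_measurable_times T_measurable) auto
  then show ?thesis unfolding dyadic_def[abs_def] by (rule measurable_compose) simp
qed

text \<open>The offset \<open>c\<close> disappears in the limit. It serves to keep sampled times
  strictly increasing even while the clock stands still.\<close>

lemma dyadic_tendsto:
  assumes "0 \<le> T t \<omega>"
  shows "(\<lambda>j. (real (dyadic j t \<omega>) + c) / 2 ^ j) \<longlonglongrightarrow> T t \<omega>"
proof -
  have 0: "(\<lambda>j. (1/2::real) ^ j) \<longlonglongrightarrow> 0" by (rule LIMSEQ_power_zero) simp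
  have *: "(\<lambda>j. real (dyadic j t \<omega>) / 2 ^ j) \<longlonglongrightarrow> T t \<omega>"
  proof (rule tendsto_sandwich)
    have r: "real (dyadic j t \<omega>) = of_int \<lfloor>2 ^ j * T t \<omega>\<rfloor>" for j
      using assms by (simp add: dyadic_def)
    show "\<forall>\<^sub>F j in sequentially. T t \<omega> - (1/2) ^ j \<le> real (dyadic j t \<omega>) / 2 ^ j"
    proof (rule always_eventually, rule allI)
      fix j
      have "2 ^ j * T t \<omega> - 1 \<le> real (dyadic j t \<omega>)" unfolding r by linarith
      then have "(2 ^ j * T t \<omega> - 1) / 2 ^ j \<le> real (dyadic j t \<omega>) / 2 ^ j" by (intro divide_right_mono) auto
      then show "T t \<omega> - (1/2) ^ j \<le> real (dyadic j t \<omega>) / 2 ^ j" by (simp add: diff_divide_distrib power_one_over)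
    qed
    show "\<forall>\<^sub>F j in sequentially. real (dyadic j t \<omega>) / 2 ^ j \<le> T t \<omega>"
    proof (rule always_eventually, rule allI)
      fix j
      have "real (dyadic j t \<omega>) \<le> 2 ^ j * T t \<omega>" unfolding r by linarith
      then show "real (dyadic j t \<omega>) / 2 ^ j \<le> T t \<omega>" by (simp add: field_simps)
    qed
    have "(\<lambda>j. T t \<omega> - (1/2) ^ j) \<longlonglongrightarrow> T t \<omega> - 0" by (intro tendsto_diff tendsto_const 0)
    then show "(\<lambda>j. T t \<omega> - (1/2) ^ j) \<longlonglongrightarrow> T t \<omega>" by simp
  qed simp
  have "(\<lambda>j. real (dyadic j t \<omega>) / 2 ^ j + c * (1/2) ^ j) \<longlonglongrightarrow> T t \<omega> + c * 0"
    by (intro tendsto_add tendsto_mult tendsto_const * 0)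
  then show ?thesis by (simp add: add_divide_distrib power_one_over)
qed

text \<open>A version of \<open>W (T t)\<close> that is measurable: since \<open>W\<close> is continuous only outside a null set,
  \<open>W (T t)\<close> itself need not be.\<close>

definition time_changed :: "real \<Rightarrow> 'a \<Rightarrow> real" where
  "time_changed t \<omega> = lim (\<lambda>j. W (real (dyadic j t \<omega>) / 2 ^ j) \<omega>)"

lemma time_changed_measurable:
  assumes "0 \<le> t" shows "time_changed t \<in> borel_measurable M"
  unfolding time_changed_def[abs_def]
proof (rule borel_measurable_lim_metric)
  fix j
  show "(\<lambda>\<omega>. W (real (dyadic j t \<omega>) / 2 ^ j) \<omega>) \<in> borel_measurable M"
    by (rule measurable_compose_countable[where f="\<lambda>i \<omega>. W (real i / 2 ^ j) \<omega>", OF W_measurable dyadic_measurable[OF assms]]) simp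
qed

lemma W_tendsto:
  assumes "continuous_on {0..} (\<lambda>t. W t \<omega>)" "0 \<le> T t \<omega>" "0 \<le> c"
  shows "(\<lambda>j. W ((real (dyadic j t \<omega>) + c) / 2 ^ j) \<omega>) \<longlonglongrightarrow> W (T t \<omega>) \<omega>"
  using assms by (intro continuous_on_tendsto_compose[OF assms(1) dyadic_tendsto]) auto

lemma time_changed_eq: "AE \<omega> in M. \<forall>t\<ge>0. time_changed t \<omega> = W (T t \<omega>) \<omega>"
  using T_mono W_continuous
proof (eventually_elim, intro allI impI)
  fix \<omega> and t :: real
  assume "\<forall>s t. 0 \<le> s \<longrightarrow> s \<le> t \<longrightarrow> 0 \<le> T s \<omega> \<and> T s \<omega> \<le> T t \<omega>" "W 0 \<omega> = 0 \<and> continuous_on {0..} (\<lambda>t. W t \<omega>)" "0 \<le> t"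
  then have "(\<lambda>j. W ((real (dyadic j t \<omega>) + 0) / 2 ^ j) \<omega>) \<longlonglongrightarrow> W (T t \<omega>) \<omega>"
    by (intro W_tendsto) auto
  then show "time_changed t \<omega> = W (T t \<omega>) \<omega>" unfolding time_changed_def by (simp add: limI)
qed

text \<open>The clock is replaced by dyadic points, frozen because \<open>W\<close> is independent
  of it; the increments of \<open>W\<close> between them are Gaussian and independent. As the mesh
  tends to 0 both sides converge, by continuity of \<open>W\<close> and of the
  \<open>f k\<close>.\<close>

lemma time_changed_increments_continuous:
  fixes f :: "nat \<Rightarrow> real \<Rightarrow> real"
  assumes f: "\<And>k. continuous_on UNIV (f k)" and f01: "\<And>k x. 0 \<le> f k x \<and> f k x \<le> 1"
    and u: "0 \<le> u 0" "\<And>k. k < n \<Longrightarrow> u k < u (Suc k)"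
  shows "expectation (\<lambda>\<omega>. \<Prod>k<n. f k (time_changed (u (Suc k)) \<omega> - time_changed (u k) \<omega>)) = expectation (\<lambda>\<omega>. \<Prod>k<n. gauss_mean (f k) (T (u (Suc k)) \<omega> - T (u k) \<omega>))"
proof -
  have u0: "0 \<le> u k" if "k \<le> n" for k by (rule increasing_times(1)[OF u order_refl that])
  have fm: "f k \<in> borel_measurable borel" for k by (rule borel_measurable_continuous_onI[OF f])
  let ?KW = "generated_algebra M {0..} borel W" and ?KT = "generated_algebra M {0..} borel T"
  have ind: "indep_set (sets ?KT) (sets ?KW)"
    unfolding sets_generated_algebra
  proof (rule indep_setI)
    show "generated_events M {0..} borel T \<subseteq> events" "generated_events M {0..} borel W \<subseteq> events"
      using indep_setD_ev1[OF WT_indep] indep_setD_ev2[OF WT_indep] by auto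
    fix a b assume "a \<in> generated_events M {0..} borel T" "b \<in> generated_events M {0..} borel W"
    then show "prob (a \<inter> b) = prob a * prob b" using indep_setD[OF WT_indep, of b a] by (simp add: Int_commute mult.commute)
  qed
  have WK: "W t \<in> borel_measurable ?KW" if "0 \<le> t" for t using that by (intro measurable_generated_algebra) auto
  have TK: "T t \<in> borel_measurable ?KT" if "0 \<le> t" for t using that by (intro measurable_generated_algebra) auto
  \<comment> \<open>Adding \<open>k\<close> to the \<open>k\<close>-th index makes the points
    strictly increasing, and the independent increments of \<open>W\<close> are stated for strictly
    increasing times.\<close>
  define pt where "pt = (\<lambda>j (v :: nat \<Rightarrow> nat) k. (real (v k) + real k) / 2 ^ j :: real)"
  define V where "V = (\<lambda>j \<omega>. \<lambda>k\<in>{..n}. dyadic j (u k) \<omega>)"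
  define I where "I = PiE {..n} (\<lambda>_. UNIV :: nat set)"
  define G where "G = (\<lambda>j v \<omega>. \<Prod>k<n. f k (W (pt j v (Suc k)) \<omega> - W (pt j v k) \<omega>))"
  have pt0: "0 \<le> pt j v k" for j v k by (simp add: pt_def)
  have cI: "countable I" unfolding I_def by (intro countable_PiE) auto
  have VI: "V j \<omega> \<in> I" for j \<omega> by (auto simp: V_def I_def)
  have ev: "{\<omega>\<in>space M. V j \<omega> = v} \<in> sets ?KT" if v: "v \<in> I" for j v
  proof -
    have "V j \<omega> = v \<longleftrightarrow> (\<forall>k\<in>{..n}. dyadic j (u k) \<omega> = v k)" for \<omega>
    proof
      assume "V j \<omega> = v" then show "\<forall>k\<in>{..n}. dyadic j (u k) \<omega> = v k" by (auto simp: V_def)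
    next
      assume *: "\<forall>k\<in>{..n}. dyadic j (u k) \<omega> = v k"
      show "V j \<omega> = v"
        by (rule PiE_ext[of _ "{..n}" "\<lambda>_. UNIV"]) (use VI[of j \<omega>] v * in \<open>auto simp: I_def V_def\<close>)
    qed
    then have "{\<omega>\<in>space M. V j \<omega> = v} = {\<omega>\<in>space ?KT. \<forall>k\<in>{..n}. dyadic j (u k) \<omega> = v k}" by simp
    also have "\<dots> \<in> sets ?KT"
    proof (rule sets.sets_Collect_finite_All)
      fix k assume "k \<in> {..n}"
      then have "(\<lambda>\<omega>. \<lfloor>2 ^ j * T (u k) \<omega>\<rfloor>) \<in> ?KT \<rightarrow>\<^sub>M count_space UNIV"
        using u0 by (intro measurable_compose[OF _ measurable_real_floor] borel_measurable_times TK) auto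
      then have "dyadic j (u k) \<in> ?KT \<rightarrow>\<^sub>M count_space UNIV" unfolding dyadic_def[abs_def] by (rule measurable_compose) simp
      from measurable_sets[OF this, of "{v k}"]
      show "{\<omega>\<in>space ?KT. dyadic j (u k) \<omega> = v k} \<in> sets ?KT" by (simp add: vimage_def Int_def conj_commute)
    qed simp
    finally show ?thesis .
  qed
  have GK: "G j v \<in> borel_measurable ?KW" for j v
    unfolding G_def by (intro borel_measurable_prod measurable_compose[OF _ fm] borel_measurable_diff WK pt0)
  have bound: "0 \<le> G j v \<omega> \<and> G j v \<omega> \<le> 1" for j v \<omega>
    using f01 by (auto simp: G_def intro!: prod_nonneg prod_le_1)
  note frz = freeze_countable[OF ind space_generated_algebra cI VI ev GK bound]
  have step: "expectation (\<lambda>\<omega>. G j (V j \<omega>) \<omega>) = expectation (\<lambda>\<omega>. \<Prod>k<n. gauss_mean (f k) (pt j (V j \<omega>) (Suc k) - pt j (V j \<omega>) k))" for j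
  proof -
    have "expectation (\<lambda>\<omega>. G j (V j \<omega>) \<omega>) = expectation (\<lambda>\<omega>. expectation (G j (V j \<omega>)))" by (rule frz(1))
    also have "\<dots> = expectation (\<lambda>\<omega>. \<Prod>k<n. gauss_mean (f k) (pt j (V j \<omega>) (Suc k) - pt j (V j \<omega>) k))"
    proof (rule integral_cong_AE)
      show "AE \<omega> in M. expectation (G j (V j \<omega>)) = (\<Prod>k<n. gauss_mean (f k) (pt j (V j \<omega>) (Suc k) - pt j (V j \<omega>) k))"
        using T_mono
      proof eventually_elim
        case (elim \<omega>)
        show ?case unfolding G_def
        proof (rule W_increments_product[OF fm f01 pt0])
          fix k assume k: "k < n"
          have "0 \<le> u k" "u k \<le> u (Suc k)" using u(2)[OF k] u0[of k] k by auto
          then have "T (u k) \<omega> \<le> T (u (Suc k)) \<omega>" using elim by blast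
          then have "dyadic j (u k) \<omega> \<le> dyadic j (u (Suc k)) \<omega>"
            unfolding dyadic_def by (intro nat_mono floor_mono mult_left_mono) auto
          then show "pt j (V j \<omega>) k < pt j (V j \<omega>) (Suc k)"
            using k by (auto simp: pt_def V_def intro!: divide_strict_right_mono)
        qed
      qed
      have "(\<lambda>\<omega>. pt j (V j \<omega>) k) \<in> borel_measurable M" if "k \<le> n" for k
        using that u0 unfolding pt_def V_def
        by (auto intro!: borel_measurable_divide borel_measurable_add measurable_compose[OF dyadic_measurable])
      then show "(\<lambda>\<omega>. \<Prod>k<n. gauss_mean (f k) (pt j (V j \<omega>) (Suc k) - pt j (V j \<omega>) k)) \<in> borel_measurable M"
        by (intro borel_measurable_prod measurable_compose[OF _ gauss_mean_measurable[OF fm]] borel_measurable_diff) auto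
    qed (rule frz(3))
    finally show ?thesis .
  qed
  have l1: "(\<lambda>j. expectation (\<lambda>\<omega>. G j (V j \<omega>) \<omega>)) \<longlonglongrightarrow> expectation (\<lambda>\<omega>. \<Prod>k<n. f k (time_changed (u (Suc k)) \<omega> - time_changed (u k) \<omega>))"
  proof (rule Bochner_Integration.integral_dominated_convergence[where w="\<lambda>_. 1::real"])
    show "(\<lambda>\<omega>. \<Prod>k<n. f k (time_changed (u (Suc k)) \<omega> - time_changed (u k) \<omega>)) \<in> borel_measurable M"
      using u0 by (intro borel_measurable_prod measurable_compose[OF _ fm] borel_measurable_diff time_changed_measurable) auto
    show "(\<lambda>\<omega>. G j (V j \<omega>) \<omega>) \<in> borel_measurable M" for j by (rule frz(2))
    show "AE \<omega> in M. (\<lambda>j. G j (V j \<omega>) \<omega>) \<longlonglongrightarrow> (\<Prod>k<n. f k (time_changed (u (Suc k)) \<omega> - time_changed (u k) \<omega>))"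
      using T_mono W_continuous time_changed_eq
    proof eventually_elim
      case (elim \<omega>)
      have lim: "(\<lambda>j. W (pt j (V j \<omega>) k) \<omega>) \<longlonglongrightarrow> time_changed (u k) \<omega>" if k: "k \<le> n" for k
      proof -
        have "pt j (V j \<omega>) k = (real (dyadic j (u k) \<omega>) + real k) / 2 ^ j" for j using k by (simp add: pt_def V_def)
        moreover have "time_changed (u k) \<omega> = W (T (u k) \<omega>) \<omega>" using elim(3) u0[OF k] by blast
        moreover have "0 \<le> T (u k) \<omega>" using elim(1) u0[OF k] by blast
        ultimately show ?thesis using W_tendsto[of \<omega> "u k" "real k"] elim(2) by simp
      qed
      show ?case unfolding G_def
      proof (rule tendsto_prod)
        fix k assume "k \<in> {..<n}"
        then have "(\<lambda>j. W (pt j (V j \<omega>) (Suc k)) \<omega> - W (pt j (V j \<omega>) k) \<omega>) \<longlonglongrightarrow> time_changed (u (Suc k)) \<omega> - time_changed (u k) \<omega>"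
          by (intro tendsto_diff lim) auto
        then show "(\<lambda>j. f k (W (pt j (V j \<omega>) (Suc k)) \<omega> - W (pt j (V j \<omega>) k) \<omega>)) \<longlonglongrightarrow> f k (time_changed (u (Suc k)) \<omega> - time_changed (u k) \<omega>)"
          using f[of k] by (intro isCont_tendsto_compose[of _ "f k"]) (auto simp: continuous_on_eq_continuous_at)
      qed
    qed
    show "AE \<omega> in M. norm (G j (V j \<omega>) \<omega>) \<le> 1" for j using bound by auto
  qed simp
  have l2: "(\<lambda>j. expectation (\<lambda>\<omega>. G j (V j \<omega>) \<omega>)) \<longlonglongrightarrow> expectation (\<lambda>\<omega>. \<Prod>k<n. gauss_mean (f k) (T (u (Suc k)) \<omega> - T (u k) \<omega>))"
    unfolding step
  proof (rule Bochner_Integration.integral_dominated_convergence[where w="\<lambda>_. 1::real"])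
    show "(\<lambda>\<omega>. \<Prod>k<n. gauss_mean (f k) (T (u (Suc k)) \<omega> - T (u k) \<omega>)) \<in> borel_measurable M"
      using u0 by (intro borel_measurable_prod measurable_compose[OF _ gauss_mean_measurable[OF fm]] borel_measurable_diff T_measurable) auto
    show "(\<lambda>\<omega>. \<Prod>k<n. gauss_mean (f k) (pt j (V j \<omega>) (Suc k) - pt j (V j \<omega>) k)) \<in> borel_measurable M" for j
    proof -
      have "(\<lambda>\<omega>. pt j (V j \<omega>) k) \<in> borel_measurable M" if "k \<le> n" for k
        using that u0 unfolding pt_def V_def
        by (auto intro!: borel_measurable_divide borel_measurable_add measurable_compose[OF dyadic_measurable])
      then show ?thesis
        by (intro borel_measurable_prod measurable_compose[OF _ gauss_mean_measurable[OF fm]] borel_measurable_diff) auto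
    qed
    show "AE \<omega> in M. (\<lambda>j. \<Prod>k<n. gauss_mean (f k) (pt j (V j \<omega>) (Suc k) - pt j (V j \<omega>) k)) \<longlonglongrightarrow> (\<Prod>k<n. gauss_mean (f k) (T (u (Suc k)) \<omega> - T (u k) \<omega>))"
      using T_mono
    proof eventually_elim
      case (elim \<omega>)
      have lim: "(\<lambda>j. pt j (V j \<omega>) k) \<longlonglongrightarrow> T (u k) \<omega>" if k: "k \<le> n" for k
      proof -
        have "pt j (V j \<omega>) k = (real (dyadic j (u k) \<omega>) + real k) / 2 ^ j" for j using k by (simp add: pt_def V_def)
        moreover have "0 \<le> T (u k) \<omega>" using elim u0[OF k] by blast
        ultimately show ?thesis using dyadic_tendsto[of "u k" \<omega> "real k"] by simp
      qed
      show ?case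
        by (intro tendsto_prod gauss_mean_tendsto f f01 tendsto_diff lim) auto
    qed
    show "AE \<omega> in M. norm (\<Prod>k<n. gauss_mean (f k) (pt j (V j \<omega>) (Suc k) - pt j (V j \<omega>) k)) \<le> 1" for j
      using gauss_mean_bounds(1,2)[OF fm f01] by (intro AE_I2) (auto simp: abs_prod intro!: prod_le_1)
  qed simp
  show ?thesis by (rule LIMSEQ_unique[OF l1 l2])
qed

end

section \<open>From continuous test functions to the law of the increments\<close>

context subordinated
begin

lemma time_changed_increments_lower_sets:
  assumes C: "\<And>k. C k \<in> insert UNIV (range atMost)"
    and u: "0 \<le> u 0" "\<And>k. k < n \<Longrightarrow> u k < u (Suc k)"
  shows "expectation (\<lambda>\<omega>. \<Prod>k<n. indicator (C k) (time_changed (u (Suc k)) \<omega> - time_changed (u k) \<omega>) :: real) = expectation (\<lambda>\<omega>. \<Prod>k<n. gauss_mean (indicator (C k)) (T (u (Suc k)) \<omega> - T (u k) \<omega>))"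
proof -
  have u0: "0 \<le> u k" if "k \<le> n" for k by (rule increasing_times(1)[OF u order_refl that])
  have Cb: "C k \<in> sets borel" for k using C[of k] by auto
  have "\<forall>k. \<exists>F :: nat \<Rightarrow> real \<Rightarrow> real. (\<forall>i. continuous_on UNIV (F i)) \<and> (\<forall>i x. 0 \<le> F i x \<and> F i x \<le> 1) \<and> (\<forall>x. (\<lambda>i. F i x) \<longlonglongrightarrow> indicator (C k) x)"
  proof
    fix k
    from C[of k] consider "C k = UNIV" | a where "C k = {..a}" by auto
    then show "\<exists>F :: nat \<Rightarrow> real \<Rightarrow> real. (\<forall>i. continuous_on UNIV (F i)) \<and> (\<forall>i x. 0 \<le> F i x \<and> F i x \<le> 1) \<and> (\<forall>x. (\<lambda>i. F i x) \<longlonglongrightarrow> indicator (C k) x)"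
    proof cases
      case 1 then show ?thesis by (intro exI[of _ "\<lambda>_ _. 1"]) auto
    next
      case 2
      show ?thesis
      proof (intro exI[of _ "\<lambda>i x. max 0 (min 1 (1 - real i * (x - a)))"] conjI allI)
        fix i show "continuous_on UNIV (\<lambda>x. max 0 (min 1 (1 - real i * (x - a))))" by (intro continuous_intros)
      next
        fix x
        show "(\<lambda>i. max 0 (min 1 (1 - real i * (x - a)))) \<longlonglongrightarrow> indicator (C k) x"
        proof (cases "x \<le> a")
          case True
          then have "real i * (x - a) \<le> 0" for i by (simp add: mult_nonneg_nonpos)
          then have "(\<lambda>i. max 0 (min 1 (1 - real i * (x - a)))) = (\<lambda>_. 1)" by (auto simp: fun_eq_iff min_def)
          then show ?thesis using 2 True by simp
        next
          case False
          then obtain K where K: "1 \<le> real K * (x - a)" using reals_Archimedean3[of "x - a"] by (auto intro: less_imp_le)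
          have "max 0 (min 1 (1 - real i * (x - a))) = 0" if "K \<le> i" for i
          proof -
            have "real K * (x - a) \<le> real i * (x - a)" using that False by (intro mult_right_mono) auto
            then show ?thesis using K by simp
          qed
          then have "(\<lambda>i. max 0 (min 1 (1 - real i * (x - a)))) \<longlonglongrightarrow> 0"
            by (intro tendsto_eventually) (auto simp: eventually_sequentially)
          then show ?thesis using 2 False by simp
        qed
      qed auto
    qed
  qed
  from choice[OF this] obtain F where "\<forall>k. (\<forall>i. continuous_on UNIV (F k i)) \<and> (\<forall>i x. 0 \<le> F k i x \<and> F k i x \<le> (1::real)) \<and> (\<forall>x. (\<lambda>i. F k i x) \<longlonglongrightarrow> indicator (C k) x)" ..
  then have F: "\<And>k i. continuous_on UNIV (F k i)" "\<And>k i x. 0 \<le> F k i x \<and> F k i x \<le> 1" "\<And>k x. (\<lambda>i. F k i x) \<longlonglongrightarrow> indicator (C k) x" by blast+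
  have Fm: "F k i \<in> borel_measurable borel" for k i by (rule borel_measurable_continuous_onI[OF F(1)])
  have Im: "(indicator (C k) :: real \<Rightarrow> real) \<in> borel_measurable borel" for k using Cb by simp
  have l1: "(\<lambda>i. expectation (\<lambda>\<omega>. \<Prod>k<n. F k i (time_changed (u (Suc k)) \<omega> - time_changed (u k) \<omega>))) \<longlonglongrightarrow> expectation (\<lambda>\<omega>. \<Prod>k<n. indicator (C k) (time_changed (u (Suc k)) \<omega> - time_changed (u k) \<omega>))"
  proof (rule Bochner_Integration.integral_dominated_convergence[where w="\<lambda>_. 1::real"])
    show "AE \<omega> in M. norm (\<Prod>k<n. F k i (time_changed (u (Suc k)) \<omega> - time_changed (u k) \<omega>)) \<le> 1" for i
      using F(2) by (intro AE_I2) (auto simp: abs_prod intro!: prod_le_1)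
  qed (use u0 in \<open>auto intro!: AE_I2 tendsto_prod F(3) borel_measurable_prod measurable_compose[OF _ Fm] measurable_compose[OF _ Im] borel_measurable_diff time_changed_measurable\<close>)
  have l2: "(\<lambda>i. expectation (\<lambda>\<omega>. \<Prod>k<n. gauss_mean (F k i) (T (u (Suc k)) \<omega> - T (u k) \<omega>))) \<longlonglongrightarrow> expectation (\<lambda>\<omega>. \<Prod>k<n. gauss_mean (indicator (C k)) (T (u (Suc k)) \<omega> - T (u k) \<omega>))"
  proof (rule Bochner_Integration.integral_dominated_convergence[where w="\<lambda>_. 1::real"])
    show "AE \<omega> in M. norm (\<Prod>k<n. gauss_mean (F k i) (T (u (Suc k)) \<omega> - T (u k) \<omega>)) \<le> 1" for i
      using gauss_mean_bounds(1,2)[OF Fm F(2)] by (intro AE_I2) (auto simp: abs_prod intro!: prod_le_1)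
    show "AE \<omega> in M. (\<lambda>i. \<Prod>k<n. gauss_mean (F k i) (T (u (Suc k)) \<omega> - T (u k) \<omega>)) \<longlonglongrightarrow> (\<Prod>k<n. gauss_mean (indicator (C k)) (T (u (Suc k)) \<omega> - T (u k) \<omega>))"
      by (intro AE_I2 tendsto_prod gauss_mean_tendsto_fun Fm Im F)
  qed (use u0 in \<open>auto intro!: borel_measurable_prod measurable_compose[OF _ gauss_mean_measurable[OF Fm]] measurable_compose[OF _ gauss_mean_measurable[OF Im]] borel_measurable_diff T_measurable\<close>)
  have "expectation (\<lambda>\<omega>. \<Prod>k<n. F k i (time_changed (u (Suc k)) \<omega> - time_changed (u k) \<omega>)) = expectation (\<lambda>\<omega>. \<Prod>k<n. gauss_mean (F k i) (T (u (Suc k)) \<omega> - T (u k) \<omega>))" for i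
    by (rule time_changed_increments_continuous[OF F(1) F(2) u])
  with l2 have l3: "(\<lambda>i. expectation (\<lambda>\<omega>. \<Prod>k<n. F k i (time_changed (u (Suc k)) \<omega> - time_changed (u k) \<omega>))) \<longlonglongrightarrow> expectation (\<lambda>\<omega>. \<Prod>k<n. gauss_mean (indicator (C k)) (T (u (Suc k)) \<omega> - T (u k) \<omega>))"
    by (simp only:)
  show ?thesis by (rule LIMSEQ_unique[OF l1 l3])
qed

text \<open>Half-lines together with \<open>UNIV\<close> form an intersection-stable generator of
  the Borel sets, on which the product formula is available; the clock contributes the independence
  of its own increments.\<close>

lemma time_changed_independent_increments: "independent_increments M borel time_changed"
  unfolding independent_increments_def
proof (intro allI impI)
  fix n :: nat and u :: "nat \<Rightarrow> real" assume "0 \<le> u 0" and "\<forall>k<n. u k < u (Suc k)"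
  then have u: "0 \<le> u 0" "\<And>k. k < n \<Longrightarrow> u k < u (Suc k)" by auto
  have u0: "0 \<le> u k" if "k \<le> n" for k by (rule increasing_times(1)[OF u order_refl that])
  let ?X = "\<lambda>k \<omega>. time_changed (u (Suc k)) \<omega> - time_changed (u k) \<omega>" and ?T = "\<lambda>k \<omega>. T (u (Suc k)) \<omega> - T (u k) \<omega>"
  let ?E = "insert UNIV (range atMost) :: real set set"
  have X: "?X k \<in> borel_measurable M" if "k < n" for k
    using u0 that by (intro borel_measurable_diff time_changed_measurable) auto
  have Tm: "?T k \<in> borel_measurable M" if "k < n" for k
    using u0 that by (intro borel_measurable_diff T_measurable) auto
  show "indep_vars (\<lambda>_. borel) ?X {..<n}"
  proof (cases "n = 0")
    case True then show ?thesis by (simp add: indep_vars_def2 indep_sets_def)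
  next
    case False
    show ?thesis
    proof (subst indep_vars_finite[where E="\<lambda>_. ?E"]; (intro ballI)?)
      show "sets borel = sigma_sets (space borel) ?E"
      proof -
        have "sets (borel :: real measure) = sigma_sets UNIV (range atMost)"
          unfolding borel_eq_atMost by (simp add: sets_measure_of)
        also have "\<dots> = sigma_sets UNIV ?E"
        proof
          show "sigma_sets UNIV (range atMost) \<subseteq> sigma_sets UNIV ?E" by (rule sigma_sets_mono'') auto
          have "?E \<subseteq> sigma_sets UNIV (range atMost)" using sigma_sets_top by auto
          then show "sigma_sets UNIV ?E \<subseteq> sigma_sets UNIV (range atMost)" by (rule sigma_sets_mono)
        qed
        finally show ?thesis by simp
      qed
      show "Int_stable ?E"
      proof (rule Int_stableI)
        fix a b :: "real set" assume "a \<in> ?E" "b \<in> ?E"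
        moreover have "{..x} \<inter> {..y} = {..min x y}" for x y :: real by auto
        ultimately show "a \<inter> b \<in> ?E" by auto
      qed
      fix A assume A: "A \<in> Pi {..<n} (\<lambda>_. ?E)"
      define C where "C = (\<lambda>k. if k < n then A k else UNIV)"
      have C: "C k \<in> ?E" for k using A by (auto simp: C_def Pi_iff)
      have Cb: "C k \<in> sets borel" for k using C[of k] by auto
      have Im: "(indicator (C k) :: real \<Rightarrow> real) \<in> borel_measurable borel" for k using Cb by simp
      have i01: "0 \<le> (indicator (C k) x :: real) \<and> indicator (C k) x \<le> (1::real)" for k x by (simp add: indicator_def)
      have ev: "?X k -` C k \<inter> space M \<in> events" if "k < n" for k by (rule measurable_sets[OF X[OF that] Cb])
      have single: "prob (?X k -` C k \<inter> space M) = expectation (\<lambda>\<omega>. gauss_mean (indicator (C k)) (?T k \<omega>))" if k: "k < n" for k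
      proof -
        have "prob (?X k -` C k \<inter> space M) = expectation (indicator (?X k -` C k \<inter> space M))" using ev[OF k] by simp
        also have "\<dots> = expectation (\<lambda>\<omega>. indicator (C k) (?X k \<omega>))"
          by (intro Bochner_Integration.integral_cong) (auto simp: indicator_def)
        also have "\<dots> = expectation (\<lambda>\<omega>. gauss_mean (indicator (C k)) (?T k \<omega>))"
          using time_changed_increments_lower_sets[where C="\<lambda>_. C k" and n=1 and u="\<lambda>i. u (k + i)"] C u u0 k by simp
        finally show ?thesis .
      qed
      have AC: "(\<Inter>k<n. ?X k -` A k \<inter> space M) = (\<Inter>k<n. ?X k -` C k \<inter> space M)" by (auto simp: C_def)
      have "prob (\<Inter>k<n. ?X k -` A k \<inter> space M) = expectation (indicator (\<Inter>k<n. ?X k -` C k \<inter> space M))"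
      proof -
        have "(\<Inter>k<n. ?X k -` C k \<inter> space M) \<in> events" using ev False by (intro sets.finite_INT) auto
        then show ?thesis unfolding AC by simp
      qed
      also have "\<dots> = expectation (\<lambda>\<omega>. \<Prod>k<n. indicator (C k) (?X k \<omega>))"
      proof (intro Bochner_Integration.integral_cong refl)
        fix \<omega> assume w: "\<omega> \<in> space M"
        show "indicator (\<Inter>k<n. ?X k -` C k \<inter> space M) \<omega> = (\<Prod>k<n. indicator (C k) (?X k \<omega>) :: real)"
        proof (cases "\<forall>k<n. ?X k \<omega> \<in> C k")
          case True then show ?thesis using w by simp
        next
          case F: False
          then obtain k where k: "k < n" "?X k \<omega> \<notin> C k" by blast
          then have "(\<Prod>k<n. indicator (C k) (?X k \<omega>)) = (0::real)" by (intro prod_zero bexI[of _ k]) auto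
          then show ?thesis using k by (auto simp: indicator_def)
        qed
      qed
      also have "\<dots> = expectation (\<lambda>\<omega>. \<Prod>k<n. gauss_mean (indicator (C k)) (?T k \<omega>))"
        by (rule time_changed_increments_lower_sets[OF C u])
      also have "\<dots> = (\<Prod>k<n. expectation (\<lambda>\<omega>. gauss_mean (indicator (C k)) (?T k \<omega>)))"
      proof (rule indep_vars_lebesgue_integral)
        have "indep_vars (\<lambda>_. borel) ?T {..<n}" using T_indep u unfolding independent_increments_def by blast
        then show "indep_vars (\<lambda>_. borel) (\<lambda>k \<omega>. gauss_mean (indicator (C k)) (?T k \<omega>)) {..<n}"
          by (rule indep_vars_compose2) (rule gauss_mean_measurable[OF Im])
        fix k assume "k \<in> {..<n}"
        then show "integrable M (\<lambda>\<omega>. gauss_mean (indicator (C k)) (?T k \<omega>))"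
          using gauss_mean_bounds(1,2)[OF Im i01]
          by (intro integrable_const_bound[of _ 1] measurable_compose[OF _ gauss_mean_measurable[OF Im]] Tm) auto
      qed simp
      also have "\<dots> = (\<Prod>k<n. prob (?X k -` C k \<inter> space M))" by (intro prod.cong refl single[symmetric]) auto
      also have "\<dots> = (\<Prod>k<n. prob (?X k -` A k \<inter> space M))" by (intro prod.cong refl) (auto simp: C_def)
      finally show "prob (\<Inter>k<n. ?X k -` A k \<inter> space M) = (\<Prod>k<n. prob (?X k -` A k \<inter> space M))" .
    qed (use X False in auto)
  qed
qed

text \<open>Both sides integrate \<open>f\<close> against a probability law: that of the increment,
  and that of a standard normal variable scaled by the square root of an independent clock
  increment. The two distribution functions agree by the case of half-lines.\<close>

lemma time_changed_increment_law:
  assumes st: "0 \<le> s" "s < t" and f[measurable]: "f \<in> borel_measurable borel" and f01: "\<And>x. 0 \<le> f x \<and> f x \<le> (1::real)"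
  shows "expectation (\<lambda>\<omega>. f (time_changed t \<omega> - time_changed s \<omega>)) = expectation (\<lambda>\<omega>. gauss_mean f (T t \<omega> - T s \<omega>))"
proof -
  interpret P: prob_space "density lborel std_normal_density" by (rule prob_space_stdn)
  let ?N = "density lborel std_normal_density"
  interpret MP: pair_prob_space M ?N ..
  have [measurable]: "T s \<in> borel_measurable M" "T t \<in> borel_measurable M" "time_changed s \<in> borel_measurable M" "time_changed t \<in> borel_measurable M"
    using st by (auto intro: T_measurable time_changed_measurable)
  define g where "g = (\<lambda>(\<omega>,z). sqrt (T t \<omega> - T s \<omega>) * z)"
  have g[measurable]: "g \<in> borel_measurable (M \<Otimes>\<^sub>M ?N)" unfolding g_def by measurable
  define D1 where "D1 = distr M borel (\<lambda>\<omega>. time_changed t \<omega> - time_changed s \<omega>)"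
  define D2 where "D2 = distr (M \<Otimes>\<^sub>M ?N) borel g"
  have E2: "(\<integral>x. h x \<partial>D2) = expectation (\<lambda>\<omega>. gauss_mean h (T t \<omega> - T s \<omega>))"
    if h[measurable]: "h \<in> borel_measurable borel" and h01: "\<And>x. 0 \<le> h x \<and> h x \<le> (1::real)" for h
  proof -
    have "(\<integral>x. h x \<partial>D2) = (\<integral>p. h (g p) \<partial>(M \<Otimes>\<^sub>M ?N))" unfolding D2_def by (rule integral_distr) measurable
    also have "\<dots> = (\<integral>\<omega>. (\<integral>z. h (g (\<omega>, z)) \<partial>?N) \<partial>M)"
    proof (rule MP.integral_fst'[symmetric])
      show "integrable (M \<Otimes>\<^sub>M ?N) (\<lambda>p. h (g p))"
        using h01 by (intro MP.integrable_const_bound[of _ 1]) auto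
    qed
    finally show ?thesis by (simp add: g_def gauss_mean_def)
  qed
  have rd: "real_distribution D1" "real_distribution D2"
    unfolding D1_def D2_def by (auto intro!: real_distribution_distr MP.real_distribution_distr)
  interpret D1: real_distribution D1 by (rule rd)
  interpret D2: real_distribution D2 by (rule rd)
  have "D1 = D2"
  proof (rule cdf_unique[OF rd], rule ext)
    fix a
    have "cdf D1 a = (\<integral>x. indicator {..a} x \<partial>D1)" by (simp add: cdf_def)
    also have "\<dots> = expectation (\<lambda>\<omega>. indicator {..a} (time_changed t \<omega> - time_changed s \<omega>))"
      unfolding D1_def by (rule integral_distr) measurable
    also have "\<dots> = expectation (\<lambda>\<omega>. gauss_mean (indicator {..a}) (T t \<omega> - T s \<omega>))"
      using time_changed_increments_lower_sets[where C="\<lambda>_. {..a}" and n=1 and u="\<lambda>i. if i = 0 then s else t"] st by simp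
    also have "\<dots> = (\<integral>x. indicator {..a} x \<partial>D2)" by (rule E2[symmetric]) (auto simp: indicator_def)
    also have "\<dots> = cdf D2 a" by (simp add: cdf_def)
    finally show "cdf D1 a = cdf D2 a" .
  qed
  have "expectation (\<lambda>\<omega>. f (time_changed t \<omega> - time_changed s \<omega>)) = (\<integral>x. f x \<partial>D1)"
    unfolding D1_def by (rule integral_distr[symmetric]) measurable
  also have "\<dots> = expectation (\<lambda>\<omega>. gauss_mean f (T t \<omega> - T s \<omega>))" unfolding \<open>D1 = D2\<close> by (rule E2[OF f f01])
  finally show ?thesis .
qed

end

section \<open>The law of a single step\<close>

abbreviation expd :: "real measure" where "expd \<equiv> density lborel (exponential_density 1)"
abbreviation stdn :: "real measure" where "stdn \<equiv> density lborel std_normal_density"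

lemma prob_space_expd: "prob_space expd"
  by (rule prob_space_exponential_density) simp

interpretation expd: prob_space expd by (rule prob_space_expd)
interpretation stdn: prob_space stdn by (rule prob_space_stdn)
interpretation es: pair_prob_space expd stdn ..

text \<open>The law of Brownian motion at an independent exponential time of mean \<open>c\<close>;
  for \<open>c > 0\<close> this is the symmetric Laplace law of variance \<open>c\<close>.\<close>

definition jump_law :: "real \<Rightarrow> real measure" where
  "jump_law c = distr (expd \<Otimes>\<^sub>M stdn) borel (\<lambda>(y,z). sqrt (c * y) * z)"

lemma jump_map_measurable: "(\<lambda>(y,z). sqrt (c * y) * z) \<in> borel_measurable (expd \<Otimes>\<^sub>M stdn)"
  by measurable

lemma prob_space_jump_law: "prob_space (jump_law c)"
  unfolding jump_law_def by (rule es.prob_space_distr) (rule jump_map_measurable)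

lemma sets_jump_law[simp, measurable_cong]: "sets (jump_law c) = sets borel"
  and space_jump_law[simp]: "space (jump_law c) = UNIV"
  by (simp_all add: jump_law_def)

lemma nn_integral_jump_law:
  assumes [measurable]: "f \<in> borel_measurable borel"
  shows "(\<integral>\<^sup>+v. f v \<partial>jump_law c) = (\<integral>\<^sup>+y. (\<integral>\<^sup>+z. f (sqrt (c * y) * z) \<partial>stdn) \<partial>expd)"
proof -
  have "(\<integral>\<^sup>+v. f v \<partial>jump_law c) = (\<integral>\<^sup>+p. f (case p of (y,z) \<Rightarrow> sqrt (c * y) * z) \<partial>(expd \<Otimes>\<^sub>M stdn))"
    unfolding jump_law_def by (rule nn_integral_distr) measurable
  also have "\<dots> = (\<integral>\<^sup>+y. (\<integral>\<^sup>+z. f (sqrt (c * y) * z) \<partial>stdn) \<partial>expd)"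
    by (subst stdn.nn_integral_fst[symmetric]) auto
  finally show ?thesis .
qed

lemma integral_jump_law:
  fixes f :: "real \<Rightarrow> real"
  assumes [measurable]: "f \<in> borel_measurable borel" and f01: "\<And>x. 0 \<le> f x \<and> f x \<le> 1"
  shows "(\<integral>v. f v \<partial>jump_law c) = (\<integral>y. gauss_mean f (c * y) \<partial>expd)"
proof -
  have "(\<integral>v. f v \<partial>jump_law c) = (\<integral>p. f (case p of (y,z) \<Rightarrow> sqrt (c * y) * z) \<partial>(expd \<Otimes>\<^sub>M stdn))"
    unfolding jump_law_def by (rule integral_distr) measurable
  also have "\<dots> = (\<integral>y. (\<integral>z. f (case (y,z) of (y,z) \<Rightarrow> sqrt (c * y) * z) \<partial>stdn) \<partial>expd)"
  proof (rule es.integral_fst'[symmetric])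
    show "integrable (expd \<Otimes>\<^sub>M stdn) (\<lambda>p. f (case p of (y,z) \<Rightarrow> sqrt (c * y) * z))"
      using f01 by (intro es.integrable_const_bound[of _ 1]) auto
  qed
  finally show ?thesis by (simp add: gauss_mean_def)
qed

lemma stdnormal_mgf: "(\<integral>\<^sup>+z. ennreal (exp (t * z)) \<partial>stdn) = ennreal (exp (t^2 / 2))"
proof -
  have "(\<integral>\<^sup>+z. ennreal (exp (t * z)) \<partial>stdn) = (\<integral>\<^sup>+z. ennreal (std_normal_density z) * ennreal (exp (t * z)) \<partial>lborel)"
    by (rule nn_integral_density) auto
  also have "\<dots> = (\<integral>\<^sup>+z. ennreal (exp (t^2 / 2)) * ennreal (normal_density t 1 z) \<partial>lborel)"
  proof (rule nn_integral_cong)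
    fix z :: real
    have "std_normal_density z * exp (t * z) = exp (t^2 / 2) * normal_density t 1 z"
      by (simp add: std_normal_density_def normal_density_def exp_add[symmetric] power2_eq_square algebra_simps field_simps)
    then show "ennreal (std_normal_density z) * ennreal (exp (t * z)) = ennreal (exp (t^2 / 2)) * ennreal (normal_density t 1 z)"
      by (simp add: ennreal_mult[symmetric])
  qed
  also have "\<dots> = ennreal (exp (t^2 / 2)) * (\<integral>\<^sup>+z. ennreal (normal_density t 1 z) \<partial>lborel)"
    by (rule nn_integral_cmult) auto
  also have "(\<integral>\<^sup>+z. ennreal (normal_density t 1 z) \<partial>lborel) = 1"
  proof -
    interpret P: prob_space "density lborel (normal_density t 1)" by (rule prob_space_normal_density) simp
    show ?thesis using P.emeasure_space_1 by (simp add: emeasure_density)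
  qed
  finally show ?thesis by simp
qed

text \<open>Given the exponential time, the Gaussian integral is explicit. It tilts the exponential
  density of rate 1 into one of rate \<open>b\<close>, up to the factor
  \<open>1 / b\<close>.\<close>

lemma jump_law_mgf:
  assumes c: "0 < c" and l: "c * l^2 / 2 < 1"
  shows "(\<integral>\<^sup>+v. ennreal (exp (l * v)) \<partial>jump_law c) = ennreal (1 / (1 - c * l^2 / 2))"
proof -
  define b where "b = 1 - c * l^2 / 2"
  have b: "0 < b" using l by (simp add: b_def)
  have "(\<integral>\<^sup>+v. ennreal (exp (l * v)) \<partial>jump_law c) = (\<integral>\<^sup>+y. (\<integral>\<^sup>+z. ennreal (exp (l * (sqrt (c * y) * z))) \<partial>stdn) \<partial>expd)"
    by (rule nn_integral_jump_law) simp
  also have "\<dots> = (\<integral>\<^sup>+y. ennreal (exp ((l * sqrt (c * y))^2 / 2)) \<partial>expd)"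
    by (simp add: mult.assoc[symmetric] stdnormal_mgf)
  also have "\<dots> = (\<integral>\<^sup>+y. ennreal (exponential_density 1 y) * ennreal (exp ((l * sqrt (c * y))^2 / 2)) \<partial>lborel)"
    by (rule nn_integral_density) auto
  also have "\<dots> = (\<integral>\<^sup>+y. ennreal (1 / b) * ennreal (exponential_density b y) \<partial>lborel)"
  proof (rule nn_integral_cong)
    fix y :: real
    show "ennreal (exponential_density 1 y) * ennreal (exp ((l * sqrt (c * y))^2 / 2)) = ennreal (1 / b) * ennreal (exponential_density b y)"
    proof (cases "y < 0")
      case False
      then have "(l * sqrt (c * y))^2 = l^2 * (c * y)" using c by (simp add: power_mult_distrib)
      then have "exp (- y) * exp ((l * sqrt (c * y))^2 / 2) = exp (- y * b)"
        by (simp add: exp_add[symmetric] b_def algebra_simps)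
      then show ?thesis using False b by (simp add: exponential_density_def ennreal_mult[symmetric])
    qed (simp add: exponential_density_def)
  qed
  also have "\<dots> = ennreal (1 / b) * (\<integral>\<^sup>+y. ennreal (exponential_density b y) \<partial>lborel)"
    by (rule nn_integral_cmult) auto
  also have "(\<integral>\<^sup>+y. ennreal (exponential_density b y) \<partial>lborel) = 1"
  proof -
    interpret P: prob_space "density lborel (exponential_density b)" by (rule prob_space_exponential_density[OF b])
    show ?thesis using P.emeasure_space_1 by (simp add: emeasure_density)
  qed
  finally show ?thesis by (simp add: b_def)
qed

lemma jump_law_exp_integral:
  assumes c: "0 < c" and l: "c * l^2 / 2 < 1"
  shows "integrable (jump_law c) (\<lambda>v. exp (l * v))" "(\<integral>v. exp (l * v) \<partial>jump_law c) = 1 / (1 - c * l^2 / 2)"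
proof -
  show i: "integrable (jump_law c) (\<lambda>v. exp (l * v))"
    by (rule integrableI_nonneg) (auto simp: jump_law_mgf[OF assms])
  have "ennreal (\<integral>v. exp (l * v) \<partial>jump_law c) = ennreal (1 / (1 - c * l^2 / 2))"
    using nn_integral_eq_integral[OF i] by (simp add: jump_law_mgf[OF assms])
  then show "(\<integral>v. exp (l * v) \<partial>jump_law c) = 1 / (1 - c * l^2 / 2)"
    using l by (subst (asm) ennreal_inj) (auto intro!: integral_nonneg_AE)
qed

lemma stdnormal_interval:
  assumes s: "0 < s" and w: "0 \<le> w"
  shows "emeasure stdn {z. p \<le> s * z \<and> s * z \<le> p + w} \<le> ennreal (w / s)"
proof -
  have eq: "{z. p \<le> s * z \<and> s * z \<le> p + w} = {p / s..(p + w) / s}" using s by (auto simp: field_simps)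
  have "emeasure stdn {p / s..(p + w) / s} = (\<integral>\<^sup>+z. ennreal (std_normal_density z) * indicator {p / s..(p + w) / s} z \<partial>lborel)"
    by (rule emeasure_density) auto
  also have "\<dots> \<le> (\<integral>\<^sup>+z. indicator {p / s..(p + w) / s} z \<partial>lborel)"
  proof (rule nn_integral_mono)
    fix z :: real
    have "exp (- z\<^sup>2 / 2) / sqrt (2 * pi) \<le> 1 / 1"
    proof (rule frac_le)
      have "1 \<le> 2 * pi" using pi_ge_two by linarith
      then show "1 \<le> sqrt (2 * pi)" by simp
    qed auto
    then have "std_normal_density z \<le> 1" by (simp add: std_normal_density_def)
    then show "ennreal (std_normal_density z) * indicator {p / s..(p + w) / s} z \<le> indicator {p / s..(p + w) / s} z"
      by (auto simp: indicator_def ennreal_le_1)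
  qed
  also have "\<dots> = ennreal (w / s)" using s w by (simp add: divide_right_mono diff_divide_distrib[symmetric])
  finally show ?thesis unfolding eq .
qed

text \<open>Split at the exponential time \<open>e = w / sqrt c\<close>. Times below
  \<open>e\<close> have probability at most \<open>e\<close>; above it the Gaussian density is at
  most \<open>1 / sqrt (c * e)\<close>, so an interval of length \<open>w\<close> has mass at most
  \<open>w / sqrt (c * e) = sqrt e\<close>. This is why a jump of large type rarely lands in a
  prescribed short interval.\<close>

lemma jump_law_concentration:
  assumes c: "0 < c" and w: "0 < w"
  shows "measure (jump_law c) {p..p + w} \<le> w / sqrt c + sqrt (w / sqrt c)"
proof -
  interpret J: prob_space "jump_law c" by (rule prob_space_jump_law)
  define e where "e = w / sqrt c"
  have e: "0 < e" using c w by (simp add: e_def)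
  have "ennreal (measure (jump_law c) {p..p + w}) = (\<integral>\<^sup>+v. indicator {p..p + w} v \<partial>jump_law c)"
    by (simp add: J.emeasure_eq_measure)
  also have "\<dots> = (\<integral>\<^sup>+y. (\<integral>\<^sup>+z. indicator {p..p + w} (sqrt (c * y) * z) \<partial>stdn) \<partial>expd)"
    by (rule nn_integral_jump_law) simp
  also have "\<dots> \<le> (\<integral>\<^sup>+y. indicator {..e} y + ennreal (sqrt e) \<partial>expd)"
  proof (rule nn_integral_mono)
    fix y :: real
    have eq: "(\<integral>\<^sup>+z. indicator {p..p + w} (sqrt (c * y) * z) \<partial>stdn) = emeasure stdn {z. p \<le> sqrt (c * y) * z \<and> sqrt (c * y) * z \<le> p + w}"
    proof -
      have "{z. p \<le> sqrt (c * y) * z \<and> sqrt (c * y) * z \<le> p + w} \<in> sets stdn" by simp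
      then have "emeasure stdn {z. p \<le> sqrt (c * y) * z \<and> sqrt (c * y) * z \<le> p + w}
        = (\<integral>\<^sup>+z. indicator {z. p \<le> sqrt (c * y) * z \<and> sqrt (c * y) * z \<le> p + w} z \<partial>stdn)" by (rule nn_integral_indicator[symmetric])
      also have "\<dots> = (\<integral>\<^sup>+z. indicator {p..p + w} (sqrt (c * y) * z) \<partial>stdn)"
        by (intro nn_integral_cong) (simp add: indicator_def)
      finally show ?thesis ..
    qed
    show "(\<integral>\<^sup>+z. indicator {p..p + w} (sqrt (c * y) * z) \<partial>stdn) \<le> indicator {..e} y + ennreal (sqrt e)"
    proof (cases "y \<le> e")
      case True
      then show ?thesis unfolding eq using stdn.emeasure_le_1 by (auto intro: order_trans[of _ 1])
    next
      case False
      have "(\<integral>\<^sup>+z. indicator {p..p + w} (sqrt (c * y) * z) \<partial>stdn) \<le> ennreal (w / sqrt (c * y))"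
        unfolding eq using False e c w by (intro stdnormal_interval) auto
      also have "w / sqrt (c * y) \<le> w / sqrt (c * e)"
        using False e c w by (intro divide_left_mono) (auto intro: mult_pos_pos)
      also have "w / sqrt (c * e) = sqrt e"
      proof -
        have "w = e * sqrt c" using c by (simp add: e_def)
        then have "w / sqrt (c * e) = e / sqrt e" using c by (simp add: real_sqrt_mult)
        also have "\<dots> = sqrt e" using e by (simp add: real_div_sqrt)
        finally show ?thesis .
      qed
      finally show ?thesis using False by (simp add: ennreal_leI)
    qed
  qed
  also have "\<dots> = emeasure expd {..e} + ennreal (sqrt e)"
    by (subst nn_integral_add) (use expd.emeasure_space_1 in auto)
  also have "emeasure expd {..e} \<le> ennreal e"
  proof -
    have "emeasure expd {..e} = (\<integral>\<^sup>+y. ennreal (exponential_density 1 y) * indicator {..e} y \<partial>lborel)"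
      by (rule emeasure_density) auto
    also have "\<dots> \<le> (\<integral>\<^sup>+y. indicator {0..e} y \<partial>lborel)"
      by (intro nn_integral_mono) (auto simp: exponential_density_def indicator_def ennreal_le_1)
    also have "\<dots> = ennreal e" using e by simp
    finally show ?thesis .
  qed
  finally have "ennreal (measure (jump_law c) {p..p + w}) \<le> ennreal e + ennreal (sqrt e)" by (simp add: add_right_mono)
  also have "\<dots> = ennreal (e + sqrt e)" using e by (intro ennreal_plus[symmetric]) auto
  finally have "measure (jump_law c) {p..p + w} \<le> e + sqrt e"
    using e by (subst (asm) ennreal_le_iff) auto
  then show ?thesis by (simp only: e_def)
qed

definition jump_scale :: "nat \<Rightarrow> real" where "jump_scale m = 2 ^ (m^2)"

lemma jump_scale_pos: "0 < jump_scale m" by (simp add: jump_scale_def)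

definition type_law :: "nat pmf" where "type_law = geometric_pmf (1/2)"

lemma pmf_type_law: "pmf type_law m = 1 / 2 ^ Suc m"
  by (simp add: type_law_def power_one_over)

definition step_law :: "real measure" where
  "step_law = distr (measure_pmf type_law \<Otimes>\<^sub>M (expd \<Otimes>\<^sub>M stdn)) borel (\<lambda>(m,(y,z)). sqrt (jump_scale m * y) * z)"

interpretation tes: pair_prob_space "measure_pmf type_law" "expd \<Otimes>\<^sub>M stdn" ..

lemma step_map_measurable: "(\<lambda>(m,(y,z)). sqrt (jump_scale m * y) * z) \<in> borel_measurable (measure_pmf type_law \<Otimes>\<^sub>M (expd \<Otimes>\<^sub>M stdn))"
proof -
  have "(\<lambda>p. (\<lambda>(y,z). sqrt (jump_scale (fst p) * y) * z) (snd p)) \<in> borel_measurable (measure_pmf type_law \<Otimes>\<^sub>M (expd \<Otimes>\<^sub>M stdn))"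
  proof (rule measurable_compose_countable[where f="\<lambda>m p. (\<lambda>(y,z). sqrt (jump_scale m * y) * z) (snd p)"])
    fix m show "(\<lambda>p. (\<lambda>(y,z). sqrt (jump_scale m * y) * z) (snd p)) \<in> borel_measurable (measure_pmf type_law \<Otimes>\<^sub>M (expd \<Otimes>\<^sub>M stdn))"
      by (rule measurable_compose[OF measurable_snd jump_map_measurable])
    have "fst \<in> measure_pmf type_law \<Otimes>\<^sub>M (expd \<Otimes>\<^sub>M stdn) \<rightarrow>\<^sub>M measure_pmf type_law" by (rule measurable_fst)
    then show "fst \<in> measure_pmf type_law \<Otimes>\<^sub>M (expd \<Otimes>\<^sub>M stdn) \<rightarrow>\<^sub>M count_space UNIV"
      by (simp cong: measurable_cong_sets)
  qed
  then show ?thesis by (simp add: case_prod_beta')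
qed

lemma prob_space_step_law: "prob_space step_law"
  unfolding step_law_def by (rule tes.prob_space_distr) (rule step_map_measurable)

lemma sets_step_law[simp, measurable_cong]: "sets step_law = sets borel"
  and space_step_law[simp]: "space step_law = UNIV"
  by (simp_all add: step_law_def)

text \<open>Decomposition by the type of the jump; every quantitative estimate of
  \<open>step_law\<close> is made type by type through this series.\<close>

lemma integral_step_law:
  fixes f :: "real \<Rightarrow> real"
  assumes f[measurable]: "f \<in> borel_measurable borel" and f01: "\<And>x. 0 \<le> f x \<and> f x \<le> B"
  shows "(\<lambda>m. 1 / 2 ^ Suc m * (\<integral>v. f v \<partial>jump_law (jump_scale m))) sums (\<integral>v. f v \<partial>step_law)"
proof -
  let ?P = "measure_pmf type_law"
  have fg: "(\<lambda>p. f (case p of (m,(y,z)) \<Rightarrow> sqrt (jump_scale m * y) * z)) \<in> borel_measurable (?P \<Otimes>\<^sub>M (expd \<Otimes>\<^sub>M stdn))"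
    by (rule measurable_compose[OF step_map_measurable f])
  have "(\<integral>v. f v \<partial>step_law) = (\<integral>p. f (case p of (m,(y,z)) \<Rightarrow> sqrt (jump_scale m * y) * z) \<partial>(?P \<Otimes>\<^sub>M (expd \<Otimes>\<^sub>M stdn)))"
    unfolding step_law_def by (rule integral_distr[OF step_map_measurable f])
  also have "\<dots> = (\<integral>m. (\<integral>q. f (case (m,q) of (m,(y,z)) \<Rightarrow> sqrt (jump_scale m * y) * z) \<partial>(expd \<Otimes>\<^sub>M stdn)) \<partial>?P)"
  proof (rule tes.integral_fst'[symmetric])
    show "integrable (?P \<Otimes>\<^sub>M (expd \<Otimes>\<^sub>M stdn)) (\<lambda>p. f (case p of (m,(y,z)) \<Rightarrow> sqrt (jump_scale m * y) * z))"
      using f01 fg by (intro tes.integrable_const_bound[of _ B]) auto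
  qed
  also have "\<dots> = (\<integral>m. (\<integral>v. f v \<partial>jump_law (jump_scale m)) \<partial>?P)"
    unfolding jump_law_def by (intro Bochner_Integration.integral_cong refl) (simp add: integral_distr[OF jump_map_measurable f])
  also have "\<dots> = (\<integral>m. pmf type_law m *\<^sub>R (\<integral>v. f v \<partial>jump_law (jump_scale m)) \<partial>count_space UNIV)"
    by (subst measure_pmf_eq_density, subst integral_density) auto
  finally have eq: "(\<integral>v. f v \<partial>step_law) = (\<integral>m. pmf type_law m *\<^sub>R (\<integral>v. f v \<partial>jump_law (jump_scale m)) \<partial>count_space UNIV)" .
  have bd: "0 \<le> (\<integral>v. f v \<partial>jump_law (jump_scale m)) \<and> (\<integral>v. f v \<partial>jump_law (jump_scale m)) \<le> B" for m
  proof -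
    interpret J: prob_space "jump_law (jump_scale m)" by (rule prob_space_jump_law)
    have "integrable (jump_law (jump_scale m)) f" using f01 by (intro J.integrable_const_bound[of _ B]) auto
    then show ?thesis using f01 by (auto intro!: integral_nonneg_AE J.integral_le_const)
  qed
  have "summable (\<lambda>m. norm (pmf type_law m *\<^sub>R (\<integral>v. f v \<partial>jump_law (jump_scale m))))"
  proof (rule summable_comparison_test'[where g="\<lambda>m. (1/2) ^ m * B"])
    show "summable (\<lambda>m. (1/2::real) ^ m * B)" by (intro summable_mult2 summable_geometric) simp
    fix m show "norm (norm (pmf type_law m *\<^sub>R (\<integral>v. f v \<partial>jump_law (jump_scale m)))) \<le> (1/2) ^ m * B"
      using bd[of m] unfolding pmf_type_law by (auto simp: power_one_over field_simps intro!: mult_mono)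
  qed
  then have "integrable (count_space UNIV) (\<lambda>m. pmf type_law m *\<^sub>R (\<integral>v. f v \<partial>jump_law (jump_scale m)))"
    by (simp add: integrable_count_space_nat_iff)
  from sums_integral_count_space_nat[OF this] show ?thesis
    unfolding eq pmf_type_law by simp
qed

text \<open>The equality of the last two weights, those of type \<open>m\<close> and of all larger
  types together, makes the balance between jumps and killing the same at every scale.\<close>

lemma mixture_weights: "(\<lambda>j. 1 / 2 ^ Suc j * (if j < m then a else if j = m then b else c)) sums ((1 - 1 / 2 ^ m) * a + 1 / 2 ^ Suc m * b + 1 / 2 ^ Suc m * c)"
  for a b c :: real
proof -
  let ?f = "\<lambda>j. 1 / 2 ^ Suc j * (if j < m then a else if j = m then b else c)"
  have "(\<lambda>j. (1/2) ^ (m + 2) * c * (1/2) ^ j) sums ((1/2) ^ (m + 2) * c * (1 / (1 - 1/2)))"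
    by (intro sums_mult geometric_sums) simp
  then have "(\<lambda>j. ?f (j + Suc m)) sums ((1/2) ^ (m + 2) * c * 2)"
    by (simp add: power_one_over power_add field_simps)
  then have "?f sums ((1/2) ^ (m + 2) * c * 2 + (\<Sum>j<Suc m. ?f j))" by (rule iffD1[OF sums_iff_shift[of ?f _ "Suc m"]] iffD1[OF sums_iff_shift[of ?f "Suc m"]])
  moreover have "(\<Sum>j<Suc m. ?f j) = (1 - 1 / 2 ^ m) * a + 1 / 2 ^ Suc m * b"
  proof -
    have "(\<Sum>j<m. ?f j) = (\<Sum>j<m. 1 / 2 ^ Suc j) * a" by (simp add: sum_distrib_right)
    also have "(\<Sum>j<m. 1 / 2 ^ Suc j :: real) = 1 - 1 / 2 ^ m" by (induction m) (auto simp: field_simps)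
    finally show ?thesis by simp
  qed
  ultimately have "?f sums ((1/2) ^ (m + 2) * c * 2 + ((1 - 1 / 2 ^ m) * a + 1 / 2 ^ Suc m * b))" by (simp only:)
  also have "(1/2) ^ (m + 2) * c * 2 = 1 / 2 ^ Suc m * c" by (simp add: power_one_over)
  finally show ?thesis by (simp only: add.commute)
qed

lemma step_law_upper:
  fixes f :: "real \<Rightarrow> real"
  assumes f: "f \<in> borel_measurable borel" "\<And>x. 0 \<le> f x \<and> f x \<le> B"
    and j: "\<And>j. j < m \<Longrightarrow> (\<integral>v. f v \<partial>jump_law (jump_scale j)) \<le> a" "(\<integral>v. f v \<partial>jump_law (jump_scale m)) \<le> b"
      "\<And>j. m < j \<Longrightarrow> (\<integral>v. f v \<partial>jump_law (jump_scale j)) \<le> c"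
  shows "(\<integral>v. f v \<partial>step_law) \<le> (1 - 1 / 2 ^ m) * a + 1 / 2 ^ Suc m * b + 1 / 2 ^ Suc m * c"
proof (rule sums_le[OF _ integral_step_law[OF f] mixture_weights])
  fix i show "1 / 2 ^ Suc i * (\<integral>v. f v \<partial>jump_law (jump_scale i)) \<le> 1 / 2 ^ Suc i * (if i < m then a else if i = m then b else c)"
    using j(1)[of i] j(2) j(3)[of i] by (intro mult_left_mono) auto
qed

lemma step_law_lower:
  fixes f :: "real \<Rightarrow> real"
  assumes f: "f \<in> borel_measurable borel" "\<And>x. 0 \<le> f x \<and> f x \<le> B"
    and j: "\<And>j. j < m \<Longrightarrow> a \<le> (\<integral>v. f v \<partial>jump_law (jump_scale j))" "b \<le> (\<integral>v. f v \<partial>jump_law (jump_scale m))"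
      "\<And>j. m < j \<Longrightarrow> c \<le> (\<integral>v. f v \<partial>jump_law (jump_scale j))"
  shows "(1 - 1 / 2 ^ m) * a + 1 / 2 ^ Suc m * b + 1 / 2 ^ Suc m * c \<le> (\<integral>v. f v \<partial>step_law)"
proof (rule sums_le[OF _ mixture_weights integral_step_law[OF f]])
  fix i show "1 / 2 ^ Suc i * (if i < m then a else if i = m then b else c) \<le> 1 / 2 ^ Suc i * (\<integral>v. f v \<partial>jump_law (jump_scale i))"
    using j(1)[of i] j(2) j(3)[of i] by (intro mult_left_mono) auto
qed

section \<open>Harmonic functions with large oscillation\<close>

interpretation step: prob_space step_law by (rule prob_space_step_law)

lemma measure_jump_law_UNIV: "measure (jump_law c) UNIV = 1"
  using prob_space.prob_space[OF prob_space_jump_law, of c] by simp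

lemma step_integrable:
  fixes f :: "real \<Rightarrow> real"
  assumes [measurable]: "f \<in> borel_measurable borel" and "\<And>x. 0 \<le> f x \<and> f x \<le> B"
  shows "integrable step_law (\<lambda>v. f (x + v))"
  using assms(2) by (intro step.integrable_const_bound[of _ B]) auto

lemma jump_integrable:
  fixes f :: "real \<Rightarrow> real"
  assumes [measurable]: "f \<in> borel_measurable borel" and "\<And>x. 0 \<le> f x \<and> f x \<le> B"
  shows "integrable (jump_law c) (\<lambda>v. f (x + v))"
proof -
  interpret J: prob_space "jump_law c" by (rule prob_space_jump_law)
  show ?thesis using assms(2) by (intro J.integrable_const_bound[of _ B]) auto
qed

lemma step_mean_measurable:
  fixes f :: "real \<Rightarrow> real"
  assumes [measurable]: "f \<in> borel_measurable borel"
  shows "(\<lambda>x. \<integral>v. f (x + v) \<partial>step_law) \<in> borel_measurable borel"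
  by measurable

text \<open>The \<open>n\<close>-th iterate is the mean of \<open>\<phi>\<close> at the position
  where the walk leaves \<open>D\<close>, counting only walks that leave within \<open>n\<close>
  steps.\<close>

primrec dirichlet_iter :: "real set \<Rightarrow> (real \<Rightarrow> real) \<Rightarrow> nat \<Rightarrow> real \<Rightarrow> real" where
  "dirichlet_iter D \<phi> 0 = (\<lambda>x. if x \<in> D then 0 else \<phi> x)"
| "dirichlet_iter D \<phi> (Suc n) = (\<lambda>x. if x \<in> D then \<integral>v. dirichlet_iter D \<phi> n (x + v) \<partial>step_law else \<phi> x)"

text \<open>The exterior value problem for the random walk, solved by monotone iteration. A supersolution
  dominates the limit directly. A subsolution does so because the error, carried by paths that have
  not left \<open>D\<close> after \<open>n\<close> steps, decays like \<open>\<theta>\<^sup>n\<close>.\<close>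

lemma exterior_value_problem:
  fixes \<phi> w v :: "real \<Rightarrow> real"
  assumes D: "D \<in> sets borel" and \<phi>[measurable]: "\<phi> \<in> borel_measurable borel" and \<phi>01: "\<And>x. 0 \<le> \<phi> x \<and> \<phi> x \<le> 1"
    and \<theta>: "0 \<le> \<theta>" "\<theta> < 1" "\<And>x. x \<in> D \<Longrightarrow> measure step_law {v. x + v \<in> D} \<le> \<theta>"
    and w: "w \<in> borel_measurable borel" "\<And>x. 0 \<le> w x \<and> w x \<le> B" "\<And>x. x \<notin> D \<Longrightarrow> \<phi> x \<le> w x"
      "\<And>x. x \<in> D \<Longrightarrow> (\<integral>y. w (x + y) \<partial>step_law) \<le> w x"
    and v: "v \<in> borel_measurable borel" "\<And>x. 0 \<le> v x \<and> v x \<le> 1" "\<And>x. x \<notin> D \<Longrightarrow> v x \<le> \<phi> x"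
      "\<And>x. x \<in> D \<Longrightarrow> v x \<le> (\<integral>y. v (x + y) \<partial>step_law)"
  shows "\<exists>h. h \<in> borel_measurable borel \<and> (\<forall>x. 0 \<le> h x \<and> h x \<le> 1) \<and>
    (\<forall>x\<in>D. h x = (\<integral>y. h (x + y) \<partial>step_law)) \<and> (\<forall>x. h x \<le> w x) \<and> (\<forall>x. v x \<le> h x)"
proof -
  let ?u = "dirichlet_iter D \<phi>"
  have um: "?u n \<in> borel_measurable borel" for n
  proof (induction n)
    case 0 show ?case using D by simp
  next
    case (Suc n)
    then show ?case using D step_mean_measurable[OF Suc] by simp
  qed
  have u01: "0 \<le> ?u n x \<and> ?u n x \<le> 1" for n x
  proof (induction n arbitrary: x)
    case (Suc n)
    have "integrable step_law (\<lambda>v. ?u n (x + v))" by (rule step_integrable[OF um Suc])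
    then show ?case using Suc \<phi>01 by (auto intro!: integral_nonneg_AE step.integral_le_const)
  qed (use \<phi>01 in auto)
  note ui = step_integrable[OF um u01]
  have uinc: "?u n x \<le> ?u (Suc n) x" for n x
  proof (induction n arbitrary: x)
    case 0
    have "0 \<le> ?u (Suc 0) x" using u01 by blast
    then show ?case by (cases "x \<in> D") auto
  next
    case (Suc n)
    show ?case
    proof (cases "x \<in> D")
      case True
      have "(\<integral>y. ?u n (x + y) \<partial>step_law) \<le> (\<integral>y. ?u (Suc n) (x + y) \<partial>step_law)"
        by (rule integral_mono[OF ui ui]) (rule Suc)
      then show ?thesis using True by (metis dirichlet_iter.simps(2))
    qed simp
  qed
  have uw: "?u n x \<le> w x" for n x
  proof (induction n arbitrary: x)
    case 0 show ?case using w(2,3) by simp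
  next
    case (Suc n)
    show ?case
    proof (cases "x \<in> D")
      case True
      have "(\<integral>y. ?u n (x + y) \<partial>step_law) \<le> (\<integral>y. w (x + y) \<partial>step_law)"
        by (rule integral_mono[OF ui step_integrable[OF w(1,2)]]) (rule Suc)
      also have "\<dots> \<le> w x" by (rule w(4)[OF True])
      finally show ?thesis using True by simp
    qed (use w(3) in simp)
  qed
  have vu: "v x \<le> ?u n x + \<theta> ^ n * indicator D x" for n x
  proof (induction n arbitrary: x)
    case 0 show ?case using v(2,3) by (auto simp: indicator_def)
  next
    case (Suc n)
    show ?case
    proof (cases "x \<in> D")
      case True
      have Dv: "{v. x + v \<in> D} \<in> sets borel" using D by measurable
      have iD: "integrable step_law (indicator {v. x + v \<in> D} :: real \<Rightarrow> real)"
        using Dv by (simp add: step.emeasure_eq_measure)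
      have "v x \<le> (\<integral>y. v (x + y) \<partial>step_law)" by (rule v(4)[OF True])
      also have "\<dots> \<le> (\<integral>y. ?u n (x + y) + \<theta> ^ n * indicator {v. x + v \<in> D} y \<partial>step_law)"
      proof (rule integral_mono[OF step_integrable[OF v(1,2)]])
        show "integrable step_law (\<lambda>y. ?u n (x + y) + \<theta> ^ n * indicator {v. x + v \<in> D} y)"
          by (intro Bochner_Integration.integrable_add ui integrable_mult_right iD)
        show "v (x + y) \<le> ?u n (x + y) + \<theta> ^ n * indicator {v. x + v \<in> D} y" for y
          using Suc[of "x + y"] by (simp add: indicator_def)
      qed
      also have "\<dots> = (\<integral>y. ?u n (x + y) \<partial>step_law) + \<theta> ^ n * measure step_law {v. x + v \<in> D}"
        using Dv by (subst Bochner_Integration.integral_add[OF ui integrable_mult_right[OF iD]]) simp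
      also have "\<dots> \<le> (\<integral>y. ?u n (x + y) \<partial>step_law) + \<theta> ^ n * \<theta>"
        using \<theta> True by (intro add_left_mono mult_left_mono) auto
      finally show ?thesis using True by (simp add: mult.commute)
    qed (use v(3) in simp)
  qed
  have inc: "incseq (\<lambda>n. ?u n x)" for x by (rule incseq_SucI) (rule uinc)
  have "Bseq (\<lambda>n. ?u n x)" for x using u01 by (intro BseqI'[of _ 1]) auto
  then have conv: "convergent (\<lambda>n. ?u n x)" for x using inc by (intro Bseq_monoseq_convergent) (auto simp: incseq_imp_monoseq)
  define h where "h = (\<lambda>x. lim (\<lambda>n. ?u n x))"
  have lim: "(\<lambda>n. ?u n x) \<longlonglongrightarrow> h x" for x using conv[of x] unfolding h_def by (simp add: convergent_LIMSEQ_iff)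
  have hm: "h \<in> borel_measurable borel" unfolding h_def by (rule borel_measurable_lim_metric) (rule um)
  have h01: "0 \<le> h x \<and> h x \<le> 1" for x
    using LIMSEQ_le_const[OF lim[of x], of 0] LIMSEQ_le_const2[OF lim[of x], of 1] u01 by auto
  have eq: "h x = (\<integral>y. h (x + y) \<partial>step_law)" if x: "x \<in> D" for x
  proof (rule LIMSEQ_unique)
    show "(\<lambda>n. ?u (Suc n) x) \<longlonglongrightarrow> h x" by (rule LIMSEQ_Suc[OF lim])
    have "(\<lambda>n. \<integral>y. ?u n (x + y) \<partial>step_law) \<longlonglongrightarrow> (\<integral>y. h (x + y) \<partial>step_law)"
    proof (rule Bochner_Integration.integral_dominated_convergence[where w="\<lambda>_. 1::real"])
      show "(\<lambda>y. h (x + y)) \<in> borel_measurable step_law" "\<And>n. (\<lambda>y. ?u n (x + y)) \<in> borel_measurable step_law"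
        using hm um by measurable
    qed (use lim u01 in auto)
    then show "(\<lambda>n. ?u (Suc n) x) \<longlonglongrightarrow> (\<integral>y. h (x + y) \<partial>step_law)" using x by simp
  qed
  have "h x \<le> w x" for x using LIMSEQ_le_const2[OF lim[of x], of "w x"] uw by auto
  moreover have "v x \<le> h x" for x
  proof (rule LIMSEQ_le_const)
    have "(\<lambda>n. ?u n x + \<theta> ^ n * indicator D x) \<longlonglongrightarrow> h x + 0 * indicator D x"
      using \<theta> by (intro tendsto_intros lim LIMSEQ_power_zero) auto
    then show "(\<lambda>n. ?u n x + \<theta> ^ n * indicator D x) \<longlonglongrightarrow> h x" by simp
  qed (use vu in blast)
  ultimately show ?thesis using hm h01 eq by blast
qed

text \<open>The worst case is \<open>j = m - 1\<close>, where the exponents compare as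
  \<open>(m-1)\<^sup>2 + 2m = m\<^sup>2 + 1\<close>. In terms of the weight
  \<open>t = 1 / 2 ^ Suc m\<close> of type \<open>m\<close>, the ratio of scales is at most
  \<open>8 * t\<^sup>2\<close>, of second order compared with that weight.\<close>

lemma jump_scale_ratio_below:
  assumes "j < m" shows "jump_scale j * 4 ^ m \<le> 2 * jump_scale m"
proof -
  have "j^2 + 2 * m \<le> m^2 + 1"
  proof -
    obtain d where d: "m = j + 1 + d" using assms by (metis Suc_eq_plus1 add_Suc_right less_imp_Suc_add add.assoc add.commute)
    then show ?thesis by (simp add: power2_eq_square algebra_simps)
  qed
  then have "(2::real) ^ (j^2 + 2 * m) \<le> 2 ^ (m^2 + 1)" by (intro power_increasing) auto
  then show ?thesis by (simp add: jump_scale_def power_add power_mult)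
qed

lemma jump_scale_mono: "i \<le> j \<Longrightarrow> jump_scale i \<le> jump_scale j"
  unfolding jump_scale_def by (intro power_increasing power_mono) auto

text \<open>The separation from the next larger scale. Its convergence to 0 makes the landing error
  of the larger types vanish for a fixed ball size \<open>K\<close>.\<close>

lemma jump_scale_ratio_Suc: "jump_scale m / jump_scale (Suc m) = 1/2 * (1/4) ^ m"
proof -
  have "(Suc m)^2 = m^2 + (2 * m + 1)" by (simp add: power2_eq_square)
  then have "jump_scale (Suc m) = jump_scale m * (2 * 4 ^ m)" by (simp add: jump_scale_def power_add power_mult)
  then show ?thesis using jump_scale_pos[of m] by (simp add: power_one_over)
qed

text \<open>Here \<open>X\<close> stands for the exponential, \<open>t\<close> for the weight of
  type \<open>m\<close> and likewise of all larger types, and \<open>32/23\<close> is the moment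
  generating function at exponent \<open>3/4\<close>. As larger jumps return none of the
  exponential, the weights leave \<open>1 - 2 * t + 32/23 * t = 1 - 14/23 * t\<close>, and this
  deficit exceeds the gain \<open>9/2 * t\<^sup>2 \<le> 9/16 * t\<close> of the small jumps. The
  choice of \<open>\<delta>\<close> with \<open>q \<le> 1/2\<close> gives
  \<open>(E + \<delta>) * q \<le> \<delta>\<close>.\<close>

lemma supersolution_arith:
  fixes t X \<alpha> \<delta> q E :: real
  assumes t: "0 < t" "t \<le> 1/8" and X: "0 \<le> X" and \<alpha>: "\<alpha> \<le> 1 + 9/2 * t^2" and q: "0 \<le> q" "q \<le> 1/2" and E: "0 \<le> E" and \<delta>: "\<delta> = 2 * E * q"
  shows "(1 - 2 * t) * (X * \<alpha> + \<delta>) + t * (X * (32/23) + \<delta>) + t * ((E + \<delta>) * q) \<le> X + \<delta>"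
proof -
  have \<delta>0: "0 \<le> \<delta>" using E q \<delta> by simp
  have "(1 - 2 * t) * \<alpha> \<le> (1 - 2 * t) * (1 + 9/2 * t^2)" using t \<alpha> by (intro mult_left_mono) auto
  also have "\<dots> \<le> 1 - t * (32/23)"
  proof -
    have "9/2 * t^2 \<le> 9/2 * (t * (1/8))" using t unfolding power2_eq_square by (intro mult_left_mono) auto
    moreover have "0 \<le> t * (9/2 * t^2)" using t by simp
    moreover have "(1 - 2 * t) * (1 + s) = 1 - 2 * t + s - 2 * (t * s)" for s :: real by (simp add: algebra_simps)
    note this[of "9/2 * t^2"]
    ultimately show ?thesis using t by linarith
  qed
  finally have "X * ((1 - 2 * t) * \<alpha> + t * (32/23)) \<le> X * 1" using X by (intro mult_left_mono) auto
  moreover have "t * ((E + \<delta>) * q) \<le> t * \<delta>"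
  proof -
    have "\<delta> * q \<le> \<delta> * (1/2)" using q \<delta>0 by (intro mult_left_mono) auto
    then have "(E + \<delta>) * q \<le> \<delta>" using \<delta> by (simp add: algebra_simps)
    then show ?thesis using t by (intro mult_left_mono) auto
  qed
  ultimately show ?thesis by (simp add: algebra_simps)
qed

lemma mgf_ratio:
  assumes "0 < jump_scale m" "l = b / sqrt (jump_scale m)"
  shows "jump_scale j * l^2 / 2 = b^2 / 2 * (jump_scale j / jump_scale m)"
  using assms by (simp add: power_divide mult_ac)

text \<open>For \<open>m \<ge> 2\<close> one has \<open>9 * 2 ^ m \<le> 18 ^ m \<le> exp (17 * m)
  \<le> exp (256 * m - 240)\<close>. The last exponent arises below as
  \<open>(4/3 * m - 5/4) * 192\<close>.\<close>

lemma loss_small: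
  assumes "2 \<le> m" shows "exp (- (256 * real m - 240)) * 9 \<le> 1 / 2 ^ m"
proof -
  have "9 * 2 ^ m \<le> (9::real) ^ m * 2 ^ m" using assms power_increasing[of 1 m "9::real"] by (intro mult_right_mono) auto
  also have "\<dots> = 18 ^ m" by (simp add: power_mult_distrib[symmetric])
  also have "(18::real) ^ m \<le> exp 17 ^ m" using exp_ge_add_one_self[of 17] by (intro power_mono) auto
  also have "\<dots> = exp (real m * 17)" by (simp add: exp_of_nat_mult)
  also have "\<dots> \<le> exp (256 * real m - 240)" using assms by simp
  finally have le: "9 * 2 ^ m \<le> exp (256 * real m - 240)" .
  define E where "E = exp (256 * real m - 240)"
  have "9 / E \<le> 1 / 2 ^ m" using le unfolding E_def[symmetric] by (simp add: E_def field_simps)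
  then show ?thesis unfolding exp_minus E_def[symmetric] by (simp add: divide_inverse mult.commute)
qed

text \<open>Keeps \<open>(4/3 * m)\<^sup>2 / 2\<close> times the ratio of scales at most
  \<open>8/9\<close>, so that a smaller type has moment generating function at most 9 at the
  exponent \<open>4/3 * m\<close>.\<close>

lemma two_squares_le: "2 * real m ^ 2 \<le> 4 ^ m"
proof -
  have "2 * m ^ 2 \<le> 4 ^ m"
  proof (induction m)
    case (Suc m)
    show ?case
    proof (cases "m \<le> 2")
      case True then have "m = 0 \<or> m = 1 \<or> m = 2" by auto
      then show ?thesis by (auto simp: power2_eq_square)
    next
      case False
      then have "m * 1 \<le> m * m" by (intro mult_le_mono2) simp
      then have "2 * m + 1 \<le> 3 * (m * m)" using False by linarith
      then have "2 * (Suc m)^2 \<le> 4 * (2 * m^2)" by (simp add: power2_eq_square algebra_simps)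
      then show ?thesis using Suc by simp
    qed
  qed simp
  then have "real (2 * m ^ 2) \<le> real (4 ^ m)" by (simp only: of_nat_le_iff)
  then show ?thesis by simp
qed

text \<open>At the scale \<open>a\<close> of the jumps of type \<open>m\<close>, jumps of larger types occur at the same rate as those
  of type \<open>m\<close> and act as a killing. The walk therefore reaches \<open>[r, r + l]\<close> from \<open>x\<close> with a probability
  that decays exponentially in \<open>(r - x) / a\<close>, up to an error \<open>\<delta>\<close> for a single large jump that lands
  there.\<close>

lemma exponential_profile:
  fixes K :: real
  assumes m: "2 \<le> m" and K: "1 \<le> K"
    and q_def: "q = e + sqrt e" and e_def: "e = (2 * K + 192) * sqrt (jump_scale m / jump_scale (Suc m))" and q: "q \<le> 1/2"
  shows "\<exists>r>0. \<exists>h. h \<in> borel_measurable borel \<and> (\<forall>x. 0 \<le> h x \<and> h x \<le> 1) \<and>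
    (\<forall>x\<in>ball 0 r. h x = (\<integral>y. h (x + y) \<partial>step_law)) \<and>
    h 0 \<le> exp (- 3 * K / 4) + 2 * exp 144 * q \<and>
    exp (- 240) * (exp (- 5 * K / 8) - exp (- 5 * K / 4)) \<le> h (r / 2)"
proof -
  define a where "a = sqrt (jump_scale m)"
  define r where "r = K * a"
  \<comment> \<open>Wide enough that jumping over the target with a step of type \<open>m\<close>
    costs little: \<open>192 * (4/3 - 5/4) = 16\<close>, and \<open>9 * exp (- 16)\<close> is
    small.\<close>
  define l where "l = 192 * a"
  \<comment> \<open>The length of \<open>(- r, r + l]\<close>, outside which both barrier functions
    vanish; \<open>e\<close> is \<open>W / sqrt (jump_scale (Suc m))\<close>.\<close>
  define W where "W = (2 * K + 192) * a"
  define t :: real where "t = 1 / 2 ^ Suc m"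
  define D where "D = ball (0::real) r"
  define \<phi> :: "real \<Rightarrow> real" where "\<phi> = indicator {r..r + l}"
  have a: "0 < a" by (simp add: a_def jump_scale_pos)
  have r: "0 < r" using a K by (simp add: r_def)
  have l: "0 < l" using a by (simp add: l_def)
  have W: "0 < W" "W = 2 * r + l"
    using mult_pos_pos[of "2 * K + 192" a] a K by (simp_all add: W_def r_def l_def algebra_simps)
  have t2: "1 / 2 ^ m = 2 * t" by (simp add: t_def)
  have t: "0 < t" "t \<le> 1/8"
  proof -
    have "(2::real) ^ 3 \<le> 2 ^ Suc m" using m by (intro power_increasing) auto
    then show "t \<le> 1/8" by (simp add: t_def field_simps)
  qed (simp add: t_def)
  have t4: "1 / 4 ^ m = 4 * t^2"
    by (simp add: t_def power_divide power_mult[symmetric]) (simp add: power_mult mult.commute[of m 2])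
  have D: "D \<in> sets borel" "x \<in> D \<longleftrightarrow> - r < x \<and> x < r" for x by (auto simp: D_def dist_real_def)
  have e0: "0 \<le> e" using K by (simp add: e_def jump_scale_pos less_imp_le)
  have q0: "0 \<le> q" using e0 by (simp add: q_def)
  have ratio: "jump_scale j / jump_scale m \<le> 8 * t^2" if "j < m" for j
  proof -
    have "jump_scale j \<le> 2 * jump_scale m * (1 / 4 ^ m)" using jump_scale_ratio_below[OF that] by (simp add: field_simps)
    also have "\<dots> = 8 * t^2 * jump_scale m" unfolding t4 by simp
    finally show ?thesis using jump_scale_pos[of m] by (simp add: divide_le_eq)
  qed
  have ratio0: "0 \<le> jump_scale j / jump_scale m" for j using jump_scale_pos[of j] jump_scale_pos[of m] by simp
  have conc: "measure (jump_law (jump_scale j)) {p..p + W} \<le> q" if j: "m < j" for j p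
  proof -
    have sj: "jump_scale (Suc m) \<le> jump_scale j" using j by (intro jump_scale_mono) auto
    have "W / sqrt (jump_scale j) \<le> W / sqrt (jump_scale (Suc m))"
      using sj jump_scale_pos[of "Suc m"] jump_scale_pos[of j] W by (intro divide_left_mono) auto
    also have "\<dots> = e" by (simp add: W_def e_def a_def real_sqrt_divide)
    finally have le: "W / sqrt (jump_scale j) \<le> e" .
    have "measure (jump_law (jump_scale j)) {p..p + W} \<le> W / sqrt (jump_scale j) + sqrt (W / sqrt (jump_scale j))"
      by (rule jump_law_concentration[OF jump_scale_pos W(1)])
    also have "\<dots> \<le> q" unfolding q_def using le by (intro add_mono) auto
    finally show ?thesis .
  qed
  \<comment> \<open>Seen from \<open>x\<close>, a function supported in \<open>(- r, r + l]\<close>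
    is reached only by steps in an interval of length \<open>W\<close>, which a larger type hits
    with probability at most \<open>q\<close>.\<close>
  have big: "(\<integral>y. f (x + y) \<partial>jump_law (jump_scale j)) \<le> B * q"
    if j: "m < j" and x: "x \<in> D" and f: "f \<in> borel_measurable borel" "\<And>z. 0 \<le> f z \<and> f z \<le> B" and supp: "\<And>z. f z \<noteq> 0 \<Longrightarrow> - r < z \<and> z \<le> r + l"
    for j x f and B :: real
  proof -
    interpret J: prob_space "jump_law (jump_scale j)" by (rule prob_space_jump_law)
    have B: "0 \<le> B" using f(2)[of 0] by linarith
    have "(\<integral>y. f (x + y) \<partial>jump_law (jump_scale j)) \<le> (\<integral>y. B * indicator {- r - x..- r - x + W} y \<partial>jump_law (jump_scale j))"
    proof (rule integral_mono[OF jump_integrable[OF f]])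
      show "integrable (jump_law (jump_scale j)) (\<lambda>y. B * indicator {- r - x..- r - x + W} y)"
        by (intro integrable_mult_right) (simp add: J.emeasure_eq_measure)
      show "f (x + y) \<le> B * indicator {- r - x..- r - x + W} y" for y
        using f(2)[of "x + y"] supp[of "x + y"] W B by (cases "f (x + y) = 0") (auto simp: indicator_def)
    qed
    also have "\<dots> = B * measure (jump_law (jump_scale j)) {- r - x..- r - x + W}" by simp
    also have "\<dots> \<le> B * q" using B conc[OF j] by (intro mult_left_mono) auto
    finally show ?thesis .
  qed
  have total: "(\<integral>y. f (x + y) \<partial>jump_law c) \<le> 1" if "f \<in> borel_measurable borel" "\<And>z. 0 \<le> f z \<and> f z \<le> 1"
    for f :: "real \<Rightarrow> real" and x c
  proof -
    interpret J: prob_space "jump_law c" by (rule prob_space_jump_law)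
    show ?thesis using that(2) by (intro J.integral_le_const[OF jump_integrable[OF that]]) auto
  qed

  \<comment> \<open>With weight \<open>t\<close> the step is of a larger type, and then it leaves
    \<open>D\<close> with probability at least \<open>1 - q \<ge> 1/2\<close>.\<close>
  have \<theta>: "measure step_law {v. x + v \<in> D} \<le> 1 - t / 2" if x: "x \<in> D" for x
  proof -
    let ?f = "indicator D :: real \<Rightarrow> real"
    have f: "?f \<in> borel_measurable borel" "\<And>z. 0 \<le> ?f z \<and> ?f z \<le> 1" using D(1) by (auto simp: indicator_def)
    have fx: "(\<lambda>v. ?f (x + v)) \<in> borel_measurable borel" using f(1) by measurable
    have "{v. x + v \<in> D} \<in> sets borel" using D(1) by measurable
    then have "measure step_law {v. x + v \<in> D} = (\<integral>v. indicator {v. x + v \<in> D} v \<partial>step_law)" by simp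
    also have "\<dots> = (\<integral>v. ?f (x + v) \<partial>step_law)" by (intro Bochner_Integration.integral_cong) (auto simp: indicator_def)
    also have "\<dots> \<le> (1 - 1 / 2 ^ m) * 1 + 1 / 2 ^ Suc m * 1 + 1 / 2 ^ Suc m * (1 * q)"
    proof (rule step_law_upper[OF fx])
      show "m < j \<Longrightarrow> (\<integral>v. ?f (x + v) \<partial>jump_law (jump_scale j)) \<le> 1 * q" for j
        using l by (intro big[OF _ x f]) (auto simp: indicator_def D split: if_splits)
    qed (use f total[OF f] in auto)
    also have "\<dots> = 1 - t + t * q" by (simp add: t_def algebra_simps)
    also have "\<dots> \<le> 1 - t / 2"
    proof -
      have "t * q \<le> t * (1/2)" using t q by (intro mult_left_mono) auto
      then show ?thesis by simp
    qed
    finally show ?thesis .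
  qed

  \<comment> \<open>The supersolution: an exponential at the subcritical exponent
    \<open>3/4\<close>, whose maximum, at \<open>r + l\<close>, is \<open>exp 144\<close> since
    \<open>3/4 * 192 = 144\<close>, plus a constant on \<open>D\<close> that absorbs a single large
    jump into the support.\<close>
  define \<delta> where "\<delta> = 2 * exp 144 * q"
  define lam where "lam = (3/4) / sqrt (jump_scale m)"
  define w where "w = (\<lambda>x. (if - r < x \<and> x \<le> r + l then exp (lam * (x - r)) else 0) + \<delta> * indicator D x)"
  have lam: "0 < lam" "lam * l = 144" "lam * r = 3/4 * K"
    using a by (auto simp: lam_def l_def r_def a_def[symmetric])
  have \<delta>0: "0 \<le> \<delta>" using q0 by (simp add: \<delta>_def)
  have wm: "w \<in> borel_measurable borel" unfolding w_def using D(1) by measurable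
  have wb: "0 \<le> w x \<and> w x \<le> exp 144 + \<delta>" for x
  proof -
    have "exp (lam * (x - r)) \<le> exp 144" if "x \<le> r + l"
    proof -
      have "lam * (x - r) \<le> lam * l" using lam that by (intro mult_left_mono) auto
      then show ?thesis using lam by simp
    qed
    then have "(if - r < x \<and> x \<le> r + l then exp (lam * (x - r)) else 0) \<le> exp 144" by simp
    moreover have "0 \<le> (if - r < x \<and> x \<le> r + l then exp (lam * (x - r)) else 0)" by simp
    moreover have "0 \<le> \<delta> * indicator D x" "\<delta> * indicator D x \<le> \<delta>" using \<delta>0 by (auto simp: indicator_def)
    ultimately show ?thesis unfolding w_def by linarith
  qed
  have w_out: "\<phi> x \<le> w x" if "x \<notin> D" for x
  proof (cases "x \<in> {r..r + l}")
    case True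
    then have "1 \<le> exp (lam * (x - r))" using lam by simp
    then show ?thesis using True r that by (auto simp: w_def \<phi>_def indicator_def)
  qed (use wb in \<open>auto simp: \<phi>_def\<close>)
  have w_in: "(\<integral>y. w (x + y) \<partial>step_law) \<le> w x" if x: "x \<in> D" for x
  proof -
    define X where "X = exp (lam * (x - r))"
    have X0: "0 \<le> X" by (simp add: X_def)
    have wxm: "(\<lambda>y. w (x + y)) \<in> borel_measurable borel" using wm by measurable
    have w_le: "w (x + y) \<le> X * exp (lam * y) + \<delta>" for y
    proof -
      have "exp (lam * (x + y - r)) = X * exp (lam * y)" by (simp add: X_def exp_add[symmetric] algebra_simps)
      then show ?thesis using \<delta>0 X0 by (auto simp: w_def indicator_def)
    qed
    \<comment> \<open>For smaller types and for type \<open>m\<close> the cut-off is dropped, which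
      only increases the integrand and leaves a moment generating function.\<close>
    have I: "(\<integral>y. w (x + y) \<partial>jump_law (jump_scale j)) \<le> X * \<alpha> + \<delta>"
      if b: "(3/4)^2 / 2 * (jump_scale j / jump_scale m) < 1" "1 / (1 - (3/4)^2 / 2 * (jump_scale j / jump_scale m)) \<le> \<alpha>" for j \<alpha>
    proof -
      interpret J: prob_space "jump_law (jump_scale j)" by (rule prob_space_jump_law)
      note mg = mgf_ratio[OF jump_scale_pos[of m] lam_def, of j]
      note ex = jump_law_exp_integral[OF jump_scale_pos[of j], of lam, unfolded mg, OF b(1)]
      have "(\<integral>y. w (x + y) \<partial>jump_law (jump_scale j)) \<le> (\<integral>y. X * exp (lam * y) + \<delta> \<partial>jump_law (jump_scale j))"
        by (intro integral_mono jump_integrable[OF wm wb] Bochner_Integration.integrable_add integrable_mult_right ex w_le) simp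
      also have "\<dots> = X * (1 / (1 - (3/4)^2 / 2 * (jump_scale j / jump_scale m))) + \<delta>"
        using ex by (simp add: measure_jump_law_UNIV)
      also have "\<dots> \<le> X * \<alpha> + \<delta>" using b(2) X0 by (intro add_right_mono mult_left_mono) auto
      finally show ?thesis .
    qed
    have "(\<integral>y. w (x + y) \<partial>step_law) \<le> (1 - 1 / 2 ^ m) * (X * (1 + 9/2 * t^2) + \<delta>) + 1 / 2 ^ Suc m * (X * (32/23) + \<delta>) + 1 / 2 ^ Suc m * ((exp 144 + \<delta>) * q)"
    proof (rule step_law_upper[OF wxm])
      fix j assume j: "j < m"
      define \<eta> where "\<eta> = (3/4)^2 / 2 * (jump_scale j / jump_scale m)"
      have "\<eta> \<le> (3/4)^2 / 2 * (8 * t^2)" unfolding \<eta>_def using ratio[OF j] by (intro mult_left_mono) auto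
      then have \<eta>: "0 \<le> \<eta>" "\<eta> \<le> 9/4 * t^2" unfolding \<eta>_def using ratio0[of j] by (auto simp: power2_eq_square)
      have "t^2 \<le> (1/8)^2" using t by (intro power_mono) auto
      then have \<eta>2: "\<eta> \<le> 1/2" using \<eta> by (simp add: power2_eq_square)
      have "1 \<le> (1 + 2 * \<eta>) * (1 - \<eta>)"
      proof -
        have "\<eta> * \<eta> \<le> \<eta> * (1/2)" using \<eta> \<eta>2 by (intro mult_left_mono) auto
        then show ?thesis by (simp add: algebra_simps)
      qed
      then have "1 / (1 - \<eta>) \<le> 1 + 2 * \<eta>" using \<eta>2 by (simp add: divide_le_eq)
      then have "1 / (1 - \<eta>) \<le> 1 + 9/2 * t^2" using \<eta> by simp
      then show "(\<integral>y. w (x + y) \<partial>jump_law (jump_scale j)) \<le> X * (1 + 9/2 * t^2) + \<delta>"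
        using \<eta>2 unfolding \<eta>_def by (intro I) auto
    next
      show "(\<integral>y. w (x + y) \<partial>jump_law (jump_scale m)) \<le> X * (32/23) + \<delta>"
        using jump_scale_pos[of m] by (intro I) (auto simp: power2_eq_square)
    next
      fix j assume "m < j"
      then show "(\<integral>y. w (x + y) \<partial>jump_law (jump_scale j)) \<le> (exp 144 + \<delta>) * q"
        using l by (intro big[OF _ x wm wb]) (auto simp: w_def D indicator_def split: if_splits)
    qed (rule wb)
    also have "\<dots> = (1 - 2 * t) * (X * (1 + 9/2 * t^2) + \<delta>) + t * (X * (32/23) + \<delta>) + t * ((exp 144 + \<delta>) * q)"
      unfolding t2 unfolding t_def ..
    also have "\<dots> \<le> X + \<delta>" by (rule supersolution_arith[OF t X0 order_refl q0 q _ \<delta>_def]) simp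
    also have "\<dots> = w x" using x l by (simp add: w_def X_def D)
    finally show ?thesis .
  qed

  \<comment> \<open>The subsolution: the exponent \<open>5/4\<close> is supercritical, with moment
    generating function \<open>32/7\<close>. Subtracting 1 makes the function vanish at 0 and be
    negative to the left, so replacing it by 0 there only raises it; \<open>c\<close> keeps it below
    1.\<close>
  define lam' where "lam' = (5/4) / sqrt (jump_scale m)"
  define c where "c = exp (- (lam' * (r + l)))"
  define v where "v = (\<lambda>x. if 0 < x \<and> x \<le> r + l then c * (exp (lam' * x) - 1) else 0)"
  have lam': "0 < lam'" "lam' * l = 240" "lam' * r = 5/4 * K"
    using a by (auto simp: lam'_def l_def r_def a_def[symmetric])
  have c: "0 < c" by (simp add: c_def)
  have vm: "v \<in> borel_measurable borel" unfolding v_def by measurable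
  have vb: "0 \<le> v x \<and> v x \<le> 1" for x
  proof (cases "0 < x \<and> x \<le> r + l")
    case True
    have "1 \<le> exp (lam' * x)" using lam' True by simp
    moreover have "c * exp (lam' * x) \<le> 1"
    proof -
      have "lam' * x \<le> lam' * (r + l)" using lam' True by (intro mult_left_mono) auto
      then show ?thesis by (simp add: c_def exp_add[symmetric])
    qed
    ultimately show ?thesis using True c by (auto simp: v_def right_diff_distrib)
  qed (auto simp: v_def)
  have v_out: "v x \<le> \<phi> x" if "x \<notin> D" for x
  proof (cases "x \<in> {r..r + l}")
    case True then show ?thesis using vb by (simp add: \<phi>_def)
  next
    case False
    then have "v x = 0" using that r by (auto simp: v_def D)
    then show ?thesis by (simp add: \<phi>_def indicator_def)
  qed
  have v_in: "v x \<le> (\<integral>y. v (x + y) \<partial>step_law)" if x: "x \<in> D" for x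
  proof (cases "0 < x")
    case False
    then have "v x = 0" by (simp add: v_def)
    then show ?thesis using vb by (auto intro!: integral_nonneg_AE)
  next
    case True
    define X where "X = exp (lam' * x)"
    have X1: "1 \<le> X" using True lam' by (simp add: X_def)
    have vxm: "(\<lambda>y. v (x + y)) \<in> borel_measurable borel" using vm by measurable
    \<comment> \<open>The cut at \<open>r + l\<close> is paid for by a bound of Chernoff type:
      beyond it the step is at least \<open>l\<close>, and there \<open>exp (lam' * y)\<close> is at
      most \<open>exp (- g) * exp (L * y)\<close> with the larger exponent \<open>L = b / a\<close>.
      The condition with \<open>8/9\<close> keeps the second moment generating function at most
      9.\<close>
    have I: "c * (X * (1 / (1 - (5/4)^2 / 2 * (jump_scale j / jump_scale m))) - 1 - X * (exp (- ((b - 5/4) * 192)) * 9)) \<le> (\<integral>y. v (x + y) \<partial>jump_law (jump_scale j))"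
      if b: "5/4 \<le> b" "b^2 / 2 * (jump_scale j / jump_scale m) \<le> 8/9" for j b
    proof -
      interpret J: prob_space "jump_law (jump_scale j)" by (rule prob_space_jump_law)
      define L where "L = b / sqrt (jump_scale m)"
      define g where "g = (b - 5/4) * 192"
      have g: "g = (L - lam') * l" using a by (simp add: g_def L_def lam'_def l_def a_def[symmetric] field_simps)
      have Ll: "lam' \<le> L" unfolding L_def lam'_def using b jump_scale_pos[of m] by (intro divide_right_mono) auto
      have "(5/4)^2 / 2 * (jump_scale j / jump_scale m) \<le> b^2 / 2 * (jump_scale j / jump_scale m)"
        using b ratio0[of j] by (intro mult_right_mono divide_right_mono power_mono) auto
      then have lt: "(5/4)^2 / 2 * (jump_scale j / jump_scale m) < 1" "b^2 / 2 * (jump_scale j / jump_scale m) < 1" using b by auto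
      note mg = mgf_ratio[OF jump_scale_pos[of m] lam'_def, of j] and mg2 = mgf_ratio[OF jump_scale_pos[of m] L_def, of j]
      note ex = jump_law_exp_integral[OF jump_scale_pos[of j], of lam', unfolded mg, OF lt(1)]
      note ex2 = jump_law_exp_integral[OF jump_scale_pos[of j], of L, unfolded mg2, OF lt(2)]
      have nine: "1 / (1 - b^2 / 2 * (jump_scale j / jump_scale m)) \<le> 9"
      proof -
        have "1 / (1 - z) \<le> 9" if "z \<le> 8/9" for z :: real using that by (simp add: divide_le_eq)
        then show ?thesis using b(2) .
      qed
      have pt: "c * (X * exp (lam' * y) - 1 - X * (exp (- g) * exp (L * y))) \<le> v (x + y)" for y
      proof -
        have Xe: "X * exp (lam' * y) = exp (lam' * (x + y))" by (simp add: X_def exp_add[symmetric] algebra_simps)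
        have pos: "0 \<le> X * (exp (- g) * exp (L * y))" using X1 by simp
        consider "x + y \<le> 0" | "0 < x + y" "x + y \<le> r + l" | "r + l < x + y" by linarith
        then show ?thesis
        proof cases
          case 1
          then have "exp (lam' * (x + y)) \<le> 1" using lam' by (simp add: mult_nonneg_nonpos)
          then have "X * exp (lam' * y) - 1 - X * (exp (- g) * exp (L * y)) \<le> 0" using pos Xe by linarith
          then have "c * (X * exp (lam' * y) - 1 - X * (exp (- g) * exp (L * y))) \<le> 0"
            using c by (intro mult_nonneg_nonpos) auto
          then show ?thesis using vb[of "x + y"] by linarith
        next
          case 2
          then have "v (x + y) = c * (X * exp (lam' * y) - 1)" by (simp add: v_def Xe)
          then show ?thesis using pos c by simp
        next
          case 3
          then have "l \<le> y" using x by (simp add: D)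
          then have "0 \<le> (L - lam') * (y - l)" using Ll by (intro mult_nonneg_nonneg) auto
          then have "lam' * y \<le> - g + L * y" by (simp add: g algebra_simps)
          then have "exp (lam' * y) \<le> exp (- g) * exp (L * y)" by (simp add: exp_add[symmetric])
          then have "X * exp (lam' * y) \<le> X * (exp (- g) * exp (L * y))" using X1 by (intro mult_left_mono) auto
          then have "X * exp (lam' * y) - 1 - X * (exp (- g) * exp (L * y)) \<le> 0" by linarith
          then have "c * (X * exp (lam' * y) - 1 - X * (exp (- g) * exp (L * y))) \<le> 0"
            using c by (intro mult_nonneg_nonpos) auto
          then show ?thesis using vb[of "x + y"] by linarith
        qed
      qed
      have X0: "0 \<le> X" using X1 by simp
      have "X * (exp (- g) * (1 / (1 - b^2 / 2 * (jump_scale j / jump_scale m)))) \<le> X * (exp (- g) * 9)"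
        by (rule mult_left_mono[OF mult_left_mono[OF nine exp_ge_zero] X0])
      then have "c * (X * (1 / (1 - (5/4)^2 / 2 * (jump_scale j / jump_scale m))) - 1 - X * (exp (- g) * 9))
        \<le> c * (X * (1 / (1 - (5/4)^2 / 2 * (jump_scale j / jump_scale m))) - 1 - X * (exp (- g) * (1 / (1 - b^2 / 2 * (jump_scale j / jump_scale m)))))"
        using c by (intro mult_left_mono) auto
      also have "\<dots> = (\<integral>y. c * (X * exp (lam' * y) - 1 - X * (exp (- g) * exp (L * y))) \<partial>jump_law (jump_scale j))"
      proof -
        have "(\<integral>y. X * exp (lam' * y) - 1 - X * (exp (- g) * exp (L * y)) \<partial>jump_law (jump_scale j))
          = X * (1 / (1 - (5/4)^2 / 2 * (jump_scale j / jump_scale m))) - 1 - X * (exp (- g) * (1 / (1 - b^2 / 2 * (jump_scale j / jump_scale m))))"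
          using ex ex2 by (simp add: measure_jump_law_UNIV)
        then show ?thesis by simp
      qed
      also have "\<dots> \<le> (\<integral>y. v (x + y) \<partial>jump_law (jump_scale j))"
        by (intro integral_mono jump_integrable[OF vm vb] pt integrable_mult_right Bochner_Integration.integrable_diff ex ex2) simp
      finally show ?thesis unfolding g_def .
    qed
    \<comment> \<open>Smaller types still admit \<open>b = 4/3 * m\<close>. Letting \<open>b\<close>
      grow with \<open>m\<close> brings their loss below \<open>2 * t\<close>; a fixed
      \<open>b\<close> would leave a constant.\<close>
    define loss where "loss = exp (- (256 * real m - 240)) * 9"
    have loss: "loss \<le> 2 * t" using loss_small[OF m] t2 by (simp add: loss_def)
    \<comment> \<open>Larger types are credited with nothing. The surplus of type \<open>m\<close>
      is \<open>2 * t * X + t\<close>, of which the loss of the smaller types takes at most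
      \<open>2 * t * X\<close>.\<close>
    have "c * (X - 1) \<le> (1 - 2 * t) * (c * (X - 1 - X * loss)) + t * (c * (4 * X - 1)) + t * 0"
    proof -
      have l0: "0 \<le> loss" by (simp add: loss_def)
      have "(1 - 2 * t) * (X * loss) \<le> 1 * (X * loss)" using t X1 l0 by (intro mult_right_mono) auto
      moreover have "X * loss \<le> X * (2 * t)" using loss X1 by (intro mult_left_mono) auto
      moreover have "0 \<le> t" using t by simp
      ultimately have "X - 1 \<le> (1 - 2 * t) * (X - 1 - X * loss) + t * (4 * X - 1)" by (simp add: algebra_simps)
      then have "c * (X - 1) \<le> c * ((1 - 2 * t) * (X - 1 - X * loss) + t * (4 * X - 1))" using c by (intro mult_left_mono) auto
      then show ?thesis by (simp add: algebra_simps)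
    qed
    also have "\<dots> = (1 - 1 / 2 ^ m) * (c * (X - 1 - X * loss)) + 1 / 2 ^ Suc m * (c * (4 * X - 1)) + 1 / 2 ^ Suc m * 0"
      unfolding t2 unfolding t_def ..
    also have "\<dots> \<le> (\<integral>y. v (x + y) \<partial>step_law)"
    proof (rule step_law_lower[OF vxm])
      fix j assume j: "j < m"
      have "(4/3 * real m)^2 / 2 * (jump_scale j / jump_scale m) \<le> (4/3 * real m)^2 / 2 * (8 * t^2)"
        using ratio[OF j] by (intro mult_left_mono) auto
      also have "\<dots> = 16/9 * (real m ^ 2) * (1 / 4 ^ m)" unfolding t4 by (simp add: power2_eq_square)
      also have "\<dots> \<le> 8/9" using two_squares_le[of m] by (simp add: field_simps)
      finally have b: "(4/3 * real m)^2 / 2 * (jump_scale j / jump_scale m) \<le> 8/9" .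
      have b1: "5/4 \<le> 4/3 * real m" using m by simp
      have "(5/4)^2 / 2 * (jump_scale j / jump_scale m) \<le> (4/3 * real m)^2 / 2 * (jump_scale j / jump_scale m)"
        using b1 ratio0[of j] by (intro mult_right_mono divide_right_mono power_mono) auto
      moreover have "0 \<le> (5/4)^2 / 2 * (jump_scale j / jump_scale m)" by (rule mult_nonneg_nonneg[OF _ ratio0]) simp
      moreover have "1 \<le> 1 / (1 - z)" if "0 \<le> z" "z \<le> 8/9" for z :: real using that by (simp add: le_divide_eq)
      ultimately have "1 \<le> 1 / (1 - (5/4)^2 / 2 * (jump_scale j / jump_scale m))" using b by (meson order_trans)
      then have "X * 1 \<le> X * (1 / (1 - (5/4)^2 / 2 * (jump_scale j / jump_scale m)))" using X1 by (intro mult_left_mono) auto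
      moreover have "(4/3 * real m - 5/4) * 192 = 256 * real m - 240" by simp
      ultimately have "c * (X - 1 - X * loss) \<le> c * (X * (1 / (1 - (5/4)^2 / 2 * (jump_scale j / jump_scale m))) - 1 - X * (exp (- ((4/3 * real m - 5/4) * 192)) * 9))"
        unfolding loss_def using c by (intro mult_left_mono) auto
      also have "\<dots> \<le> (\<integral>y. v (x + y) \<partial>jump_law (jump_scale j))" by (rule I[OF b1 b])
      finally show "c * (X - 1 - X * loss) \<le> (\<integral>y. v (x + y) \<partial>jump_law (jump_scale j))" .
    next
      have mm: "jump_scale m / jump_scale m = 1" using jump_scale_pos[of m] by simp
      have "17 \<le> exp (16::real)" using exp_ge_add_one_self[of 16] by simp
      then have "exp (- 16) * 9 \<le> 9 / (17::real)" by (simp add: exp_minus field_simps)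
      then have "X * (exp (- 16) * 9) \<le> X * (9 / 17)" using X1 by (intro mult_left_mono) auto
      moreover have e1: "1 / (1 - (5/4)^2 / 2 * (jump_scale m / jump_scale m)) = 32/7" unfolding mm by (simp add: power2_eq_square)
      moreover have e2: "- ((4/3 - 5/4) * 192) = (- 16 :: real)" by simp
      \<comment> \<open>The value \<open>32/7 - 9/17\<close> exceeds 4.\<close>
      ultimately have "4 * X - 1 \<le> X * (1 / (1 - (5/4)^2 / 2 * (jump_scale m / jump_scale m))) - 1 - X * (exp (- ((4/3 - 5/4) * 192)) * 9)"
        unfolding e1 e2 using X1 by linarith
      then have "c * (4 * X - 1) \<le> c * (X * (1 / (1 - (5/4)^2 / 2 * (jump_scale m / jump_scale m))) - 1 - X * (exp (- ((4/3 - 5/4) * 192)) * 9))"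
        by (rule mult_left_mono[OF _ less_imp_le[OF c]])
      also have "\<dots> \<le> (\<integral>y. v (x + y) \<partial>jump_law (jump_scale m))"
        by (rule I) (auto simp: mm power2_eq_square)
      finally show "c * (4 * X - 1) \<le> (\<integral>y. v (x + y) \<partial>jump_law (jump_scale m))" .
    next
      fix j show "0 \<le> (\<integral>y. v (x + y) \<partial>jump_law (jump_scale j))" using vb by (intro integral_nonneg_AE) auto
    qed (rule vb)
    finally have "c * (X - 1) \<le> (\<integral>y. v (x + y) \<partial>step_law)" .
    then show ?thesis using True x l by (simp add: v_def X_def D)
  qed

  have \<phi>: "\<phi> \<in> borel_measurable borel" "\<And>x. 0 \<le> \<phi> x \<and> \<phi> x \<le> 1" by (auto simp: \<phi>_def indicator_def)
  have \<theta>0: "0 \<le> 1 - t / 2" "1 - t / 2 < 1" using t by auto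
  from exterior_value_problem[OF D(1) \<phi> \<theta>0 \<theta> wm wb w_out w_in vm vb v_out v_in]
  obtain h where h: "h \<in> borel_measurable borel" "\<forall>x. 0 \<le> h x \<and> h x \<le> 1"
    "\<forall>x\<in>D. h x = (\<integral>y. h (x + y) \<partial>step_law)" "\<forall>x. h x \<le> w x" "\<forall>x. v x \<le> h x" by blast
  have "h 0 \<le> w 0" using h(4) by blast
  also have "w 0 = exp (- 3 * K / 4) + 2 * exp 144 * q"
    using r l lam by (simp add: w_def D \<delta>_def)
  finally have h0: "h 0 \<le> exp (- 3 * K / 4) + 2 * exp 144 * q" .
  have "exp (- 240) * (exp (- 5 * K / 8) - exp (- 5 * K / 4)) = v (r / 2)"
  proof -
    have "lam' * (r + l) = 5/4 * K + 240" "lam' * (r / 2) = 5/8 * K" using lam' by (simp_all add: distrib_left)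
    then have "v (r / 2) = exp (- (5/4 * K + 240)) * (exp (5/8 * K) - 1)" using r l by (simp add: v_def c_def)
    also have "\<dots> = exp (- 240) * (exp (- (5/4 * K)) * exp (5/8 * K) - exp (- (5/4 * K)))"
    proof -
      have "exp (- (5/4 * K + 240)) = exp (- 240) * exp (- (5/4 * K))" by (simp add: exp_add[symmetric])
      then show ?thesis by (simp only: right_diff_distrib mult.assoc mult_1_right)
    qed
    also have "exp (- (5/4 * K)) * exp (5/8 * K) = exp (- 5 * K / 8)" by (simp add: exp_add[symmetric])
    finally show ?thesis by simp
  qed
  also have "\<dots> \<le> h (r / 2)" using h(5) by blast
  finally have hr: "exp (- 240) * (exp (- 5 * K / 8) - exp (- 5 * K / 4)) \<le> h (r / 2)" .
  show ?thesis
    using r h(1,2,3) h0 hr unfolding D_def by blast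
qed

text \<open>With \<open>K = 8 * k\<close> the upper bound at 0 decays like
  \<open>exp (- 6 * k)\<close> and the lower bound at \<open>r / 2\<close> like
  \<open>exp (- 5 * k)\<close>; the quotient \<open>exp k\<close> beats any constant. The landing
  error depends on \<open>K\<close>, so \<open>k\<close> is fixed before \<open>m\<close> is taken
  large enough to push that error below \<open>exp (- 6 * k)\<close>.\<close>

lemma unbounded_oscillation:
  fixes C :: real
  shows "\<exists>r>0. \<exists>h. h \<in> borel_measurable borel \<and> (\<forall>x. 0 \<le> h x \<and> h x \<le> 1) \<and>
    (\<forall>x\<in>ball 0 r. h x = (\<integral>y. h (x + y) \<partial>step_law)) \<and> C * h 0 < h (r / 2)"
proof -
  define C' where "C' = max C 1"
  have C': "0 < C'" "C \<le> C'" by (auto simp: C'_def)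
  \<comment> \<open>The factor 4 covers the two terms that bound \<open>h 0\<close> and the halving
    of \<open>exp (- 5 * k)\<close> in the lower bound; \<open>exp 240\<close> undoes the
    normalisation of the subsolution.\<close>
  obtain k0 :: nat where k0: "4 * C' * exp 240 < real k0" using reals_Archimedean2 by blast
  define k where "k = Suc k0"
  have "real k \<le> exp (real k)" using exp_ge_add_one_self[of "real k"] by linarith
  then have k: "4 * C' * exp 240 < exp (real k)" "1 \<le> k" using k0 by (auto simp: k_def)
  define K where "K = 8 * real k"
  define e where "e = (\<lambda>m. (2 * K + 192) * sqrt (jump_scale m / jump_scale (Suc m)))"
  define q where "q = (\<lambda>m. e m + sqrt (e m))"
  have "(\<lambda>m. (2 * K + 192) * sqrt (1/2 * (1/4) ^ m)) \<longlonglongrightarrow> (2 * K + 192) * sqrt (1/2 * 0)"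
    by (intro tendsto_intros LIMSEQ_power_zero) simp
  then have el: "e \<longlonglongrightarrow> 0" unfolding e_def jump_scale_ratio_Suc by simp
  have "q \<longlonglongrightarrow> 0 + sqrt 0" unfolding q_def by (intro tendsto_intros el)
  then have ql: "q \<longlonglongrightarrow> 0" by simp
  define \<epsilon> where "\<epsilon> = min (1/2) (exp (- 6 * real k) / (2 * exp 144))"
  have \<epsilon>: "0 < \<epsilon>" by (simp add: \<epsilon>_def)
  have "\<forall>\<^sub>F m in sequentially. q m < \<epsilon> \<and> 2 \<le> m"
    using order_tendstoD(2)[OF ql \<epsilon>] eventually_ge_at_top[of 2] by (rule eventually_conj)
  then obtain m where m: "q m < \<epsilon>" "2 \<le> m" unfolding eventually_sequentially by blast
  have "\<epsilon> \<le> 1/2" "\<epsilon> \<le> exp (- 6 * real k) / (2 * exp 144)" unfolding \<epsilon>_def by (rule min.cobounded1 min.cobounded2)+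
  then have q1: "q m \<le> 1/2" and "q m \<le> exp (- 6 * real k) / (2 * exp 144)" using m by linarith+
  then have q2: "2 * exp 144 * q m \<le> exp (- 6 * real k)" by (simp add: field_simps)
  have K1: "1 \<le> K" using k by (simp add: K_def)
  from exponential_profile[OF m(2) K1 q_def[THEN fun_cong] e_def[THEN fun_cong] q1]
  obtain r h where r: "0 < r" and h: "h \<in> borel_measurable borel" "\<forall>x. 0 \<le> h x \<and> h x \<le> 1"
    "\<forall>x\<in>ball 0 r. h x = (\<integral>y. h (x + y) \<partial>step_law)"
    and h0: "h 0 \<le> exp (- 3 * K / 4) + 2 * exp 144 * q m"
    and hr: "exp (- 240) * (exp (- 5 * K / 8) - exp (- 5 * K / 4)) \<le> h (r / 2)" by blast
  define E where "E = exp (- 5 * real k)"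
  have "h 0 \<le> 2 * exp (- 6 * real k)" using h0 q2 by (simp add: K_def)
  then have "C * h 0 \<le> C' * (2 * exp (- 6 * real k))" using C' h(2) by (intro mult_mono) auto
  also have "exp (- 6 * real k) = E * exp (- real k)" by (simp add: E_def exp_add[symmetric])
  also have "C' * (2 * (E * exp (- real k))) < exp (- 240) * (E / 2)"
  proof -
    have "4 * C' * exp 240 * (E * exp (- real k) * exp (- 240)) < exp (real k) * (E * exp (- real k) * exp (- 240))"
      using k(1) by (intro mult_strict_right_mono) (auto simp: E_def)
    then show ?thesis by (simp add: exp_minus field_simps)
  qed
  also have "\<dots> \<le> exp (- 240) * (exp (- 5 * K / 8) - exp (- 5 * K / 4))"
  proof -
    have "1 \<le> real k" using k(2) by simp
    then have "6 \<le> exp (5 * real k)" using exp_ge_add_one_self[of "5 * real k"] k(2) by linarith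
    then have "E \<le> 1/2" by (simp add: E_def exp_minus field_simps)
    then have "E * E \<le> E * (1/2)" by (intro mult_left_mono) (auto simp: E_def)
    moreover have "exp (- 5 * K / 8) = E" "exp (- 5 * K / 4) = E * E" by (simp_all add: E_def K_def exp_add[symmetric])
    ultimately show ?thesis by (intro mult_left_mono) auto
  qed
  also note hr
  finally show ?thesis using r h by blast
qed

section \<open>From the step law to the process\<close>

text \<open>Sampling a right-constant path on finer and finer grids recovers its exit position, because the
  path rests at that position for a positive time.\<close>

lemma grid_exit_limit:
  fixes p :: "real \<Rightarrow> real"
  assumes rc: "\<And>t. 0 \<le> t \<Longrightarrow> \<exists>e>0. \<forall>s\<in>{t..<t+e}. p s = p t"
    and exits: "\<exists>t. 0 \<le> t \<and> p t \<notin> U"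
  shows "\<exists>t. exit_time (\<lambda>t _. p t) U \<omega> = ereal t \<and>
    (\<forall>\<^sub>F j in sequentially. \<exists>k\<le>Suc j * 2 ^ j. (\<forall>i<k. p (real i * (1 / 2^j)) \<in> U) \<and> p (real k * (1 / 2^j)) \<notin> U \<and> p (real k * (1 / 2^j)) = p t)"
proof -
  define A where "A = {t. 0 \<le> t \<and> p t \<notin> U}"
  define t where "t = Inf A"
  have ne: "A \<noteq> {}" and bb: "bdd_below A" using exits by (auto simp: A_def intro: bdd_belowI[of _ 0])
  have t0: "0 \<le> t" unfolding t_def using ne by (intro cInf_greatest) (auto simp: A_def)
  from rc[OF t0] obtain e where e: "e > 0" "\<forall>s\<in>{t..<t+e}. p s = p t" by blast
  obtain s where s: "s \<in> A" "s < t + e" using cInf_lessD[OF ne, of "t + e"] e(1) unfolding t_def by auto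
  have "t \<le> s" unfolding t_def by (rule cInf_lower[OF s(1) bb])
  then have "s \<in> {t..<t+e}" using s(2) by simp
  then have "p s = p t" using e(2) by blast
  then have tA: "p t \<notin> U" using s(1) by (simp add: A_def)
  have before: "p s \<in> U" if "0 \<le> s" "s < t" for s
  proof (rule ccontr)
    assume "p s \<notin> U"
    then have "t \<le> s" unfolding t_def using that bb by (intro cInf_lower) (auto simp: A_def)
    then show False using that by simp
  qed
  have ex: "exit_time (\<lambda>t _. p t) U \<omega> = ereal t"
    unfolding exit_time_def
  proof (rule antisym)
    show "Inf (ereal ` {t. 0 \<le> t \<and> p t \<notin> U}) \<le> ereal t" using t0 tA by (intro Inf_lower) auto
    show "ereal t \<le> Inf (ereal ` {t. 0 \<le> t \<and> p t \<notin> U})"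
    proof (rule Inf_greatest)
      fix x assume "x \<in> ereal ` {t. 0 \<le> t \<and> p t \<notin> U}"
      then obtain s where "x = ereal s" "0 \<le> s" "p s \<notin> U" by auto
      then show "ereal t \<le> x" using before[of s] by (cases "s < t") auto
    qed
  qed
  obtain j0 :: nat where j0: "t \<le> real j0" using real_arch_simple by blast
  have "(\<lambda>j. (1/2::real)^j) \<longlonglongrightarrow> 0" by (intro LIMSEQ_power_zero) simp
  then have "\<forall>\<^sub>F j in sequentially. (1/2)^j < e" using e by (intro order_tendstoD(2)) auto
  then have "\<forall>\<^sub>F j in sequentially. \<exists>k\<le>Suc j * 2 ^ j. (\<forall>i<k. p (real i * (1 / 2^j)) \<in> U) \<and> p (real k * (1 / 2^j)) \<notin> U \<and> p (real k * (1 / 2^j)) = p t"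
    using eventually_ge_at_top[of j0]
  proof eventually_elim
    case (elim j)
    define d :: real where "d = 1 / 2^j"
    have d: "0 < d" "d < e" using elim(1) by (simp_all add: d_def power_one_over)
    \<comment> \<open>The first grid point not before the exit time. It comes less than
      \<open>d < e\<close> later and so still finds the path at the exit position. The horizon
      \<open>Suc j * 2 ^ j\<close> reaches time \<open>j + 1\<close>, which is at least
      \<open>t + d\<close>.\<close>
    define k where "k = nat \<lceil>t / d\<rceil>"
    have rk: "real k = of_int \<lceil>t / d\<rceil>" unfolding k_def using t0 d by simp
    have "t / d \<le> real k" "real k < t / d + 1" unfolding rk by linarith+
    then have k: "t \<le> real k * d" "real k * d < t + d" using d by (simp_all add: field_simps)
    have "real k * d \<in> {t..<t+e}" using k d by auto
    then have pk: "p (real k * d) = p t" using e(2) by blast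
    have "t / d + 1 \<le> real j * 2 ^ j + 2 ^ j"
    proof -
      have "t * 2 ^ j \<le> real j * 2 ^ j" using j0 elim(2) by (intro mult_right_mono) auto
      moreover have "(1::real) \<le> 2 ^ j" by simp
      moreover have "t / d = t * 2 ^ j" by (simp add: d_def)
      ultimately show ?thesis by linarith
    qed
    also have "\<dots> = real (Suc j * 2 ^ j)" by (simp add: algebra_simps)
    finally have "real k \<le> real (Suc j * 2 ^ j)" using \<open>real k < t / d + 1\<close> by linarith
    then have kj: "k \<le> Suc j * 2 ^ j" by (simp only: of_nat_le_iff)
    have bef: "p (real i * d) \<in> U" if "i < k" for i
    proof (rule before)
      have "real i \<le> real k - 1" using that by linarith
      then have "real i < t / d" using \<open>real k < t / d + 1\<close> by linarith
      then show "real i * d < t" using d by (simp add: field_simps)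
    qed (use d in simp)
    show ?case using kj bef pk tA unfolding d_def by (intro exI[of _ k]) auto
  qed
  then show ?thesis using ex by blast
qed

text \<open>The product of indicators switches off at the first index outside \<open>U\<close>, so
  the sum telescopes up to there. It writes the value at the stopped position through increments
  whose means can be estimated one by one.\<close>

lemma stopped_sum:
  fixes y :: "nat \<Rightarrow> real" and h :: "real \<Rightarrow> real"
  shows "h (y 0) + (\<Sum>i<k. (\<Prod>l\<le>i. indicator U (y l)) * (h (y (Suc i)) - h (y i))) = h (y (if \<exists>i<k. y i \<notin> U then LEAST i. y i \<notin> U else k))"
proof (induction k)
  case (Suc k)
  show ?case
  proof (cases "\<exists>i<Suc k. y i \<notin> U")
    case True
    then obtain i where i: "i \<le> k" "y i \<notin> U" by (auto simp: less_Suc_eq_le)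
    then have P0: "(\<Prod>l\<le>k. indicator U (y l)) = (0::real)" by (intro prod_zero bexI[of _ i]) auto
    have L: "(if \<exists>i<k. y i \<notin> U then LEAST i. y i \<notin> U else k) = (LEAST i. y i \<notin> U)"
    proof (cases "\<exists>i<k. y i \<notin> U")
      case False
      then have "i = k" using i by (metis le_neq_implies_less)
      then have "(LEAST i. y i \<notin> U) = k" using i False by (intro Least_equality) (auto simp: not_less[symmetric])
      then show ?thesis using False by simp
    qed simp
    have "h (y 0) + (\<Sum>i<Suc k. (\<Prod>l\<le>i. indicator U (y l)) * (h (y (Suc i)) - h (y i)))
      = h (y 0) + (\<Sum>i<k. (\<Prod>l\<le>i. indicator U (y l)) * (h (y (Suc i)) - h (y i)))"
      by (simp only: sum.lessThan_Suc P0 mult_zero_left add_0_right)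
    then show ?thesis unfolding Suc L using True by simp
  next
    case False
    then have P1: "(\<Prod>l\<le>k. indicator U (y l)) = (1::real)" by (intro prod.neutral) auto
    have N: "\<not> (\<exists>i<k. y i \<notin> U)" using False by auto
    show ?thesis unfolding sum.lessThan_Suc P1 mult_1 if_not_P[OF False] using Suc unfolding if_not_P[OF N] by linarith
  qed
qed simp

text \<open>Some type has a scale so large that, by concentration, at least half of its jumps leave
  \<open>[- R, R]\<close>.\<close>

lemma step_law_tail_pos: "0 < measure step_law {v. R < \<bar>v\<bar>}"
proof -
  define w where "w = 2 * max R 1"
  have w: "0 < w" by (simp add: w_def)
  \<comment> \<open>This gives \<open>w / sqrt (jump_scale n) \<le> 1/16\<close>, whence the
    concentration bound is at most \<open>1/16 + 1/4 \<le> 1/2\<close>.\<close>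
  obtain n :: nat where n: "(16 * w)^2 < real n" using reals_Archimedean2 by blast
  have "real n \<le> jump_scale n"
  proof -
    have "n \<le> 2 ^ n" by (rule less_imp_le) (rule less_exp)
    also have "(2::nat) ^ n \<le> 2 ^ (n^2)" by (intro power_increasing) (auto simp: power2_eq_square)
    finally have "real n \<le> real (2 ^ (n^2))" by (simp only: of_nat_le_iff)
    then show ?thesis by (simp add: jump_scale_def)
  qed
  then have "(16 * w)^2 \<le> jump_scale n" using n by linarith
  then have "16 * w \<le> sqrt (jump_scale n)" by (rule real_le_rsqrt)
  then have e: "w / sqrt (jump_scale n) \<le> 1/16" using jump_scale_pos[of n] by (simp add: divide_le_eq)
  interpret J: prob_space "jump_law (jump_scale n)" by (rule prob_space_jump_law)
  have "sqrt (w / sqrt (jump_scale n)) \<le> sqrt ((1/4)^2)" using e by (intro real_sqrt_le_mono) (simp add: power2_eq_square)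
  also have "sqrt ((1/4)^2) = (1/4::real)" by (simp only: real_sqrt_abs)
  finally have "w / sqrt (jump_scale n) + sqrt (w / sqrt (jump_scale n)) \<le> 1/2" using e by linarith
  then have c: "measure (jump_law (jump_scale n)) {- (w/2)..- (w/2) + w} \<le> 1/2"
    using jump_law_concentration[OF jump_scale_pos w, of n "- (w/2)"] by linarith
  let ?B = "{v. R < \<bar>v\<bar>} :: real set"
  have B: "?B \<in> sets borel" by measurable
  have "1 - 1/2 \<le> measure (jump_law (jump_scale n)) (space (jump_law (jump_scale n)) - {- (w/2)..- (w/2) + w})"
    using c by (subst J.prob_compl) auto
  also have "\<dots> \<le> measure (jump_law (jump_scale n)) ?B"
    using B by (intro J.finite_measure_mono) (auto simp: w_def)
  finally have n2: "1/2 \<le> measure (jump_law (jump_scale n)) ?B" by simp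
  have "(\<lambda>m. 1 / 2 ^ Suc m * (\<integral>v. indicat_real ?B v \<partial>jump_law (jump_scale m))) sums (\<integral>v. indicat_real ?B v \<partial>step_law)"
    by (rule integral_step_law[where B=1]) (use B in \<open>auto simp: indicator_def\<close>)
  then have s: "(\<lambda>m. 1 / 2 ^ Suc m * measure (jump_law (jump_scale m)) ?B) sums measure step_law ?B"
    using B by simp
  have "(\<Sum>m<Suc n. 1 / 2 ^ Suc m * measure (jump_law (jump_scale m)) ?B) \<le> measure step_law ?B"
    unfolding sums_unique[OF s] by (rule sum_le_suminf[OF sums_summable[OF s]]) auto
  moreover have "0 \<le> (\<Sum>m<n. 1 / 2 ^ Suc m * measure (jump_law (jump_scale m)) ?B)" by (intro sum_nonneg) auto
  moreover have "0 < 1 / 2 ^ Suc n * measure (jump_law (jump_scale n)) ?B" using n2 by (intro mult_pos_pos) auto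
  ultimately show ?thesis by simp
qed

context subordinated
begin

text \<open>The next increment is independent of the past ones, so by Fubini its mean effect can be
  computed with the past frozen. In the application \<open>\<phi>\<close> is the indicator that the
  walk has not yet left the set and \<open>z\<close> is its current position, both functions of the
  past increments.\<close>

lemma time_changed_step_expectation:
  assumes d: "0 < d" and \<phi>: "\<phi> \<in> borel_measurable (PiM {..<k} (\<lambda>_. borel))" "\<And>v. 0 \<le> \<phi> v \<and> \<phi> v \<le> 1"
    and z: "z \<in> borel_measurable (PiM {..<k} (\<lambda>_. borel))"
    and h: "h \<in> borel_measurable borel" "\<And>x. 0 \<le> h x \<and> h x \<le> (1::real)"
    and small: "\<And>v. \<phi> v \<noteq> 0 \<Longrightarrow> \<bar>expectation (\<lambda>\<omega>. h (z v + (time_changed (real (Suc k) * d) \<omega> - time_changed (real k * d) \<omega>))) - h (z v)\<bar> \<le> \<epsilon>"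
    and \<epsilon>: "0 \<le> \<epsilon>"
  defines "\<xi> \<equiv> \<lambda>i \<omega>. time_changed (real (Suc i) * d) \<omega> - time_changed (real i * d) \<omega>"
  defines "V \<equiv> \<lambda>\<omega>. \<lambda>i\<in>{..<k}. \<xi> i \<omega>"
  shows "\<bar>expectation (\<lambda>\<omega>. \<phi> (V \<omega>) * (h (z (V \<omega>) + \<xi> k \<omega>) - h (z (V \<omega>))))\<bar> \<le> \<epsilon>"
proof -
  have \<xi>: "\<xi> i \<in> borel_measurable M" for i
    unfolding \<xi>_def using d by (intro borel_measurable_diff time_changed_measurable) auto
  have ind: "indep_vars (\<lambda>_. borel) \<xi> {..<Suc k}"
    using time_changed_independent_increments d unfolding independent_increments_def \<xi>_def
    by (elim allE[of _ "Suc k"] allE[of _ "\<lambda>i. real i * d"]) (simp add: algebra_simps)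
  have V: "V \<in> M \<rightarrow>\<^sub>M PiM {..<k} (\<lambda>_. borel)" unfolding V_def by (intro measurable_restrict \<xi>)
  define U where "U = (\<lambda>\<omega>. \<lambda>i\<in>{k}. \<xi> i \<omega>)"
  have iv: "indep_var (PiM {..<k} (\<lambda>_. borel)) V (PiM {k} (\<lambda>_. borel)) U"
    unfolding V_def U_def by (rule indep_var_restrict[OF ind]) auto
  have U: "U \<in> M \<rightarrow>\<^sub>M PiM {k} (\<lambda>_. borel)" unfolding U_def by (intro measurable_restrict \<xi>)
  have Uk: "U \<omega> k = \<xi> k \<omega>" for \<omega> by (simp add: U_def)
  define P where "P = distr M (PiM {..<k} (\<lambda>_. borel)) V"
  define Q where "Q = distr M (PiM {k} (\<lambda>_. borel)) U"
  interpret P: prob_space P unfolding P_def by (rule prob_space_distr[OF V])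
  interpret Q: prob_space Q unfolding Q_def by (rule prob_space_distr[OF U])
  interpret PQ: pair_prob_space P Q ..
  have eqd: "distr M (PiM {..<k} (\<lambda>_. borel) \<Otimes>\<^sub>M PiM {k} (\<lambda>_. borel)) (\<lambda>\<omega>. (V \<omega>, U \<omega>)) = P \<Otimes>\<^sub>M Q"
    using iv unfolding P_def Q_def by (simp add: indep_var_distribution_eq)
  define G where "G = (\<lambda>(v, y :: nat \<Rightarrow> real). \<phi> v * (h (z v + y k) - h (z v)))"
  have sP: "sets P = sets (PiM {..<k} (\<lambda>_. borel))" and sQ: "sets Q = sets (PiM {k} (\<lambda>_. borel))" by (simp_all add: P_def Q_def)
  have ck: "(\<lambda>y. y k) \<in> PiM {k} (\<lambda>_. borel) \<rightarrow>\<^sub>M (borel :: real measure)"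
    by (rule measurable_component_singleton) simp
  have G: "G \<in> borel_measurable (PiM {..<k} (\<lambda>_. borel) \<Otimes>\<^sub>M PiM {k} (\<lambda>_. borel))"
    unfolding G_def case_prod_beta'
    by (intro borel_measurable_times borel_measurable_diff measurable_compose[OF measurable_fst \<phi>(1)] measurable_compose[OF _ h(1)]
       borel_measurable_add measurable_compose[OF measurable_fst z] measurable_compose[OF measurable_snd ck])
  have GP: "G \<in> borel_measurable (P \<Otimes>\<^sub>M Q)"
    using G by (subst measurable_cong_sets[OF sets_pair_measure_cong[OF sP sQ] refl])
  have Gb: "\<bar>G p\<bar> \<le> 1" for p
  proof -
    obtain v y where p: "p = (v, y)" by (cases p)
    have "\<bar>h (z v + y k) - h (z v)\<bar> \<le> 1" using h(2)[of "z v + y k"] h(2)[of "z v"] by linarith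
    then have "\<bar>\<phi> v\<bar> * \<bar>h (z v + y k) - h (z v)\<bar> \<le> 1 * 1" using \<phi>(2)[of v] by (intro mult_mono) auto
    then show ?thesis by (simp add: p G_def abs_mult)
  qed
  have "expectation (\<lambda>\<omega>. \<phi> (V \<omega>) * (h (z (V \<omega>) + \<xi> k \<omega>) - h (z (V \<omega>)))) = expectation (\<lambda>\<omega>. G (V \<omega>, U \<omega>))"
    by (simp add: G_def Uk)
  also have "\<dots> = (\<integral>p. G p \<partial>(P \<Otimes>\<^sub>M Q))"
    unfolding eqd[symmetric] by (rule integral_distr[OF measurable_Pair[OF V U] G, symmetric])
  also have "\<dots> = (\<integral>v. (\<integral>y. G (v, y) \<partial>Q) \<partial>P)"
  proof (rule PQ.integral_fst'[symmetric])
    show "integrable (P \<Otimes>\<^sub>M Q) G" using Gb GP by (intro PQ.integrable_const_bound[of _ 1]) auto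
  qed
  also have "\<bar>\<dots>\<bar> \<le> (\<integral>v. \<bar>\<integral>y. G (v, y) \<partial>Q\<bar> \<partial>P)" by (rule integral_abs_bound)
  also have "\<dots> \<le> \<epsilon>"
  proof -
    have bd: "\<bar>\<integral>y. G (v, y) \<partial>Q\<bar> \<le> \<epsilon>" for v
    proof (cases "\<phi> v = 0")
      case True then show ?thesis using \<epsilon> by (simp add: G_def)
    next
      case False
      have "(\<lambda>y. h (z v + y)) \<in> borel_measurable borel" using h(1) by measurable
      then have hm: "(\<lambda>y. h (z v + y k)) \<in> borel_measurable (PiM {k} (\<lambda>_. borel))"
        by (rule measurable_compose[OF ck])
      have hQ: "(\<lambda>y. h (z v + y k)) \<in> borel_measurable Q"
        using hm by (subst measurable_cong_sets[OF sQ refl])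
      have hi: "integrable Q (\<lambda>y. h (z v + y k))"
        using h(2) hQ by (intro Q.integrable_const_bound[of _ 1]) auto
      have "(\<integral>y. G (v, y) \<partial>Q) = \<phi> v * ((\<integral>y. h (z v + y k) \<partial>Q) - h (z v))"
        using hi by (simp add: G_def Q.prob_space)
      also have "(\<integral>y. h (z v + y k) \<partial>Q) = expectation (\<lambda>\<omega>. h (z v + \<xi> k \<omega>))"
        unfolding Q_def by (subst integral_distr[OF U hm]) (simp add: Uk)
      finally have "\<bar>\<integral>y. G (v, y) \<partial>Q\<bar> = \<phi> v * \<bar>expectation (\<lambda>\<omega>. h (z v + \<xi> k \<omega>)) - h (z v)\<bar>"
        using \<phi>(2)[of v] by (simp add: abs_mult)
      also have "\<dots> \<le> 1 * \<epsilon>" using \<phi>(2)[of v] small[OF False] \<epsilon> unfolding \<xi>_def by (intro mult_mono) auto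
      finally show ?thesis by simp
    qed
    show ?thesis
    proof (rule P.integral_le_const)
      have "(\<lambda>v. \<integral>y. G (v, y) \<partial>Q) \<in> borel_measurable P"
        using GP Q.borel_measurable_lebesgue_integral[of "\<lambda>v y. G (v, y)" P] by simp
      then show "integrable P (\<lambda>v. \<bar>\<integral>y. G (v, y) \<partial>Q\<bar>)" using bd by (intro P.integrable_const_bound[of _ \<epsilon>]) auto
    qed (use bd in auto)
  qed
  finally show ?thesis .
qed

text \<open>On the grid of mesh \<open>1 / 2 ^ n\<close> at most \<open>(n + 1) * 2 ^ n\<close>
  steps are made, so the mean changes by at most \<open>c * (n + 1) / 2 ^ n\<close> in all, while
  the time horizon \<open>n + 1\<close> tends to infinity. In the limit \<open>h\<close> at the
  stopped grid position becomes \<open>h\<close> at the exit position, and dominated convergence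
  applies as \<open>h\<close> is bounded. The factor 2 in the first hypothesis is the total jump
  rate.\<close>

lemma harmonic_of_step_law:
  fixes h :: "real \<Rightarrow> real" and X :: "real \<Rightarrow> 'a \<Rightarrow> real" and c r :: real
  assumes gen: "\<And>(f :: real \<Rightarrow> real) s t. f \<in> borel_measurable borel \<Longrightarrow> (\<And>x. 0 \<le> f x \<and> f x \<le> 1) \<Longrightarrow> 0 \<le> s \<Longrightarrow> s < t \<Longrightarrow>
      \<bar>expectation (\<lambda>\<omega>. f (time_changed t \<omega> - time_changed s \<omega>)) - f 0 - 2 * (t - s) * ((\<integral>v. f v \<partial>step_law) - f 0)\<bar> \<le> c * (t - s)^2"
    and c: "0 < c"
    and T_const: "AE \<omega> in M. \<forall>t\<ge>0. \<exists>e>0. \<forall>s\<in>{t..<t+e}. T s \<omega> = T t \<omega>"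
    and T0: "AE \<omega> in M. T 0 \<omega> = 0"
    and X: "\<And>t \<omega>. 0 \<le> t \<Longrightarrow> \<omega> \<in> space M \<Longrightarrow> X t \<omega> = W (T t \<omega>) \<omega>"
    and h: "h \<in> borel_measurable borel" "\<And>x. 0 \<le> h x \<and> h x \<le> 1"
    and hD: "\<And>x. x \<in> ball 0 r \<Longrightarrow> h x = (\<integral>y. h (x + y) \<partial>step_law)"
  shows "harmonic_wrt M (\<lambda>x t \<omega>. x + X t \<omega>) (ball 0 r) h"
  unfolding harmonic_wrt_def
proof (intro conjI allI impI ballI)
  show "h \<in> borel_measurable borel" by (rule h)
next
  fix E :: "real set" and x :: real assume E: "open E \<and> compact (closure E) \<and> closure E \<subseteq> ball 0 r" and x: "x \<in> E"
  have Er: "E \<subseteq> ball 0 r" using E closure_subset by blast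
  have Eb: "E \<in> sets borel" using E by auto
  have incm: "(\<lambda>\<omega>. time_changed t \<omega> - time_changed s \<omega>) \<in> borel_measurable M" if "0 \<le> s" "0 \<le> t" for s t
    using that by (intro borel_measurable_diff time_changed_measurable)
  \<comment> \<open>independent increments over unit multiples of a short time exceed the diameter of the ball\<close>
  have exits: "AE \<omega> in M. \<exists>t\<ge>0. x + time_changed t \<omega> \<notin> E"
  proof -
    let ?B = "{v. 2 * r < \<bar>v\<bar>} :: real set"
    define \<kappa> where "\<kappa> = measure step_law ?B"
    have \<kappa>: "0 < \<kappa>" unfolding \<kappa>_def by (rule step_law_tail_pos)
    \<comment> \<open>With this time step the error \<open>c * d\<^sup>2\<close> is half of the main
      term \<open>2 * d * \<kappa>\<close>.\<close>
    define d where "d = \<kappa> / c"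
    have d: "0 < d" using \<kappa> c by (simp add: d_def)
    define \<beta> where "\<beta> = d * \<kappa>"
    have \<beta>: "0 < \<beta>" using d \<kappa> by (simp add: \<beta>_def)
    have B: "?B \<in> sets borel" by measurable
    let ?X = "\<lambda>k \<omega>. time_changed (real (Suc k) * d) \<omega> - time_changed (real k * d) \<omega>"
    have Xm: "?X k \<in> borel_measurable M" for k using d by (intro incm) auto
    have r0: "0 < r" using x Er by auto
    have big: "\<beta> \<le> prob (?X k -` ?B \<inter> space M)" for k
    proof -
      have f: "(indicator ?B :: real \<Rightarrow> real) \<in> borel_measurable borel" "\<And>x. 0 \<le> (indicator ?B x :: real) \<and> (indicator ?B x :: real) \<le> 1"
        using B by (auto simp: indicator_def)
      have "real (Suc k) * d - real k * d = d" by (simp add: algebra_simps)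
      then have "\<bar>expectation (\<lambda>\<omega>. indicat_real ?B (?X k \<omega>)) - indicator ?B 0 - 2 * d * ((\<integral>v. indicator ?B v \<partial>step_law) - indicator ?B 0)\<bar> \<le> c * d^2"
        using gen[OF f, of "real k * d" "real (Suc k) * d"] d by simp
      moreover have "indicator ?B 0 = (0::real)" using r0 by simp
      moreover have "(\<integral>v. indicator ?B v \<partial>step_law) = \<kappa>" using B by (simp add: \<kappa>_def)
      moreover have "c * d^2 = \<beta>" using c by (simp add: \<beta>_def d_def power2_eq_square)
      moreover have "expectation (\<lambda>\<omega>. indicat_real ?B (?X k \<omega>)) = prob (?X k -` ?B \<inter> space M)"
      proof -
        have "expectation (\<lambda>\<omega>. indicat_real ?B (?X k \<omega>)) = expectation (indicat_real (?X k -` ?B \<inter> space M))"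
          by (intro Bochner_Integration.integral_cong) (auto simp: indicator_def)
        then show ?thesis using measurable_sets[OF Xm B] by simp
      qed
      ultimately have "\<bar>prob (?X k -` ?B \<inter> space M) - 0 - 2 * d * (\<kappa> - 0)\<bar> \<le> \<beta>" by (simp only:)
      moreover have "2 * d * (\<kappa> - 0) = 2 * \<beta>" by (simp add: \<beta>_def)
      ultimately show ?thesis by linarith
    qed
    have small: "prob (\<Inter>k<Suc n. ?X k -` (- ?B) \<inter> space M) \<le> (1 - \<beta>) ^ Suc n" for n
    proof -
      have "indep_vars (\<lambda>_. borel) ?X {..<Suc n}"
        using time_changed_independent_increments d unfolding independent_increments_def
        by (elim allE[of _ "Suc n"] allE[of _ "\<lambda>i. real i * d"]) (simp add: algebra_simps)
      then have "prob (\<Inter>k<Suc n. ?X k -` (- ?B) \<inter> space M) = (\<Prod>k<Suc n. prob (?X k -` (- ?B) \<inter> space M))"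
        by (rule indep_varsD_finite) (use B in auto)
      also have "\<dots> \<le> (\<Prod>k<Suc n. 1 - \<beta>)"
      proof (rule prod_mono)
        fix k
        have "?X k -` (- ?B) \<inter> space M = space M - (?X k -` ?B \<inter> space M)" by auto
        then have "prob (?X k -` (- ?B) \<inter> space M) = 1 - prob (?X k -` ?B \<inter> space M)"
          using measurable_sets[OF Xm B] by (simp only: prob_compl)
        then show "0 \<le> prob (?X k -` (- ?B) \<inter> space M) \<and> prob (?X k -` (- ?B) \<inter> space M) \<le> 1 - \<beta>" using big[of k] by simp
      qed
      finally show ?thesis by simp
    qed
    let ?S = "{\<omega>\<in>space M. \<forall>k. ?X k \<omega> \<notin> ?B}"
    have "?X k -` (- ?B) \<inter> space M \<in> events" for k using B by (intro measurable_sets[OF Xm]) auto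
    then have "(\<Inter>k. ?X k -` (- ?B) \<inter> space M) \<in> events" by (intro sets.countable_INT) auto
    also have "(\<Inter>k. ?X k -` (- ?B) \<inter> space M) = ?S" by auto
    finally have S: "?S \<in> events" .
    have "\<beta> \<le> 1" using big[of 0] prob_le_1 order_trans by blast
    have "prob ?S \<le> (1 - \<beta>) ^ Suc n" for n
    proof (rule order_trans[OF finite_measure_mono small])
      show "(\<Inter>k<Suc n. ?X k -` (- ?B) \<inter> space M) \<in> events"
        using B by (intro sets.finite_INT measurable_sets[OF Xm]) auto
    qed auto
    moreover have "(\<lambda>n. (1 - \<beta>) ^ Suc n) \<longlonglongrightarrow> 0"
      using \<beta> \<open>\<beta> \<le> 1\<close> by (intro LIMSEQ_Suc LIMSEQ_power_zero) auto
    ultimately have "prob ?S \<le> 0" by (intro LIMSEQ_le_const[of "\<lambda>n. (1 - \<beta>) ^ Suc n"]) auto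
    then have "prob ?S = 0" using measure_nonneg[of M ?S] by linarith
    then have "AE \<omega> in M. \<not> (\<forall>k. ?X k \<omega> \<notin> ?B)" by (rule iffD1[OF prob_Collect_eq_0[OF S]])
    then show ?thesis
    proof eventually_elim
      case (elim \<omega>)
      then obtain k where k: "2 * r < \<bar>?X k \<omega>\<bar>" by blast
      show ?case
      proof (rule ccontr)
        assume "\<not> ?thesis"
        then have "x + time_changed (real k * d) \<omega> \<in> ball 0 r" "x + time_changed (real (Suc k) * d) \<omega> \<in> ball 0 r"
          using Er d by (meson mult_nonneg_nonneg of_nat_0_le_iff less_imp_le subsetD)+
        then show False using k by (simp add: dist_real_def)
      qed
    qed
  qed
  define d :: "nat \<Rightarrow> real" where "d = (\<lambda>n. 1 / 2 ^ n)"
  have d: "0 < d n" for n by (simp add: d_def)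
  define \<xi> where "\<xi> = (\<lambda>n i \<omega>. time_changed (real (Suc i) * d n) \<omega> - time_changed (real i * d n) \<omega>)"
  \<comment> \<open>\<open>Z\<close> is the path on the grid and \<open>Y\<close> the increment of
    \<open>h\<close> along it, switched off after the first exit; \<open>R\<close> is therefore
    \<open>h\<close> at the stopped grid path.\<close>
  define Z where "Z = (\<lambda>n k \<omega>. x + (\<Sum>l<k. \<xi> n l \<omega>))"
  define Y where "Y = (\<lambda>n i \<omega>. (\<Prod>l\<le>i. indicator E (Z n l \<omega>)) * (h (Z n (Suc i) \<omega>) - h (Z n i \<omega>)))"
  define R where "R = (\<lambda>n \<omega>. h x + (\<Sum>i<Suc n * 2 ^ n. Y n i \<omega>))"
  have \<xi>m: "\<xi> n i \<in> borel_measurable M" for n i unfolding \<xi>_def using d[of n] by (intro incm) auto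
  have Zm: "Z n k \<in> borel_measurable M" for n k unfolding Z_def by (intro borel_measurable_add borel_measurable_sum \<xi>m) auto
  have Im: "(indicator E :: real \<Rightarrow> real) \<in> borel_measurable borel" using Eb by simp
  have Ym: "Y n i \<in> borel_measurable M" for n i
    unfolding Y_def by (intro borel_measurable_times borel_measurable_prod borel_measurable_diff measurable_compose[OF Zm Im] measurable_compose[OF Zm h(1)])
  have Yi: "integrable M (Y n i)" for n i
  proof (rule integrable_const_bound[of _ 1])
    have "\<bar>Y n i \<omega>\<bar> \<le> 1" for \<omega>
    proof -
      have "0 \<le> (\<Prod>l\<le>i. indicator E (Z n l \<omega>) :: real)" "(\<Prod>l\<le>i. indicator E (Z n l \<omega>)) \<le> (1::real)"
        by (auto intro!: prod_nonneg prod_le_1 simp: indicator_def)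
      moreover have "\<bar>h (Z n (Suc i) \<omega>) - h (Z n i \<omega>)\<bar> \<le> 1" using h(2)[of "Z n (Suc i) \<omega>"] h(2)[of "Z n i \<omega>"] by linarith
      ultimately have "\<bar>\<Prod>l\<le>i. indicator E (Z n l \<omega>)\<bar> * \<bar>h (Z n (Suc i) \<omega>) - h (Z n i \<omega>)\<bar> \<le> 1 * (1::real)"
        by (intro mult_mono) auto
      then show ?thesis by (simp add: Y_def abs_mult)
    qed
    then show "AE \<omega> in M. norm (Y n i \<omega>) \<le> 1" by simp
  qed (rule Ym)
  \<comment> \<open>Before the exit the position lies in \<open>E\<close>, where \<open>h\<close>
    has the mean value property for a step; the first-order term of the expansion vanishes and
    \<open>c * d\<^sup>2\<close> remains.\<close>
  have EY: "\<bar>expectation (Y n i)\<bar> \<le> c * (d n)^2" for n i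
  proof -
    define z where "z = (\<lambda>v :: nat \<Rightarrow> real. x + (\<Sum>l<i. v l))"
    define \<phi> where "\<phi> = (\<lambda>v :: nat \<Rightarrow> real. \<Prod>l\<le>i. indicator E (x + (\<Sum>l'<l. v l')) :: real)"
    have comp: "(\<lambda>v. v l) \<in> PiM {..<i} (\<lambda>_. borel) \<rightarrow>\<^sub>M (borel :: real measure)" if "l < i" for l
      using that by (intro measurable_component_singleton) auto
    have part: "(\<lambda>v. x + (\<Sum>l'<l. v l')) \<in> borel_measurable (PiM {..<i} (\<lambda>_. borel))" if "l \<le> i" for l
      using that by (intro borel_measurable_add borel_measurable_sum comp) auto
    have "\<bar>expectation (\<lambda>\<omega>. \<phi> (\<lambda>l\<in>{..<i}. time_changed (real (Suc l) * d n) \<omega> - time_changed (real l * d n) \<omega>)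
       * (h (z (\<lambda>l\<in>{..<i}. time_changed (real (Suc l) * d n) \<omega> - time_changed (real l * d n) \<omega>) + (time_changed (real (Suc i) * d n) \<omega> - time_changed (real i * d n) \<omega>))
          - h (z (\<lambda>l\<in>{..<i}. time_changed (real (Suc l) * d n) \<omega> - time_changed (real l * d n) \<omega>))))\<bar> \<le> c * (d n)^2"
    proof (rule time_changed_step_expectation[OF d])
      show "\<phi> \<in> borel_measurable (PiM {..<i} (\<lambda>_. borel))"
        unfolding \<phi>_def by (intro borel_measurable_prod measurable_compose[OF part Im]) auto
      show "z \<in> borel_measurable (PiM {..<i} (\<lambda>_. borel))" unfolding z_def by (rule part) simp
      show "0 \<le> \<phi> v \<and> \<phi> v \<le> 1" for v unfolding \<phi>_def by (auto intro!: prod_nonneg prod_le_1 simp: indicator_def)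
      show "0 \<le> c * (d n)^2" using c by simp
      fix v assume "\<phi> v \<noteq> 0"
      then have "indicator E (z v) \<noteq> (0::real)" unfolding \<phi>_def z_def by (auto simp: prod_zero_iff)
      then have "z v \<in> E" by (auto simp: indicator_def split: if_splits)
      then have "h (z v) = (\<integral>y. h (z v + y) \<partial>step_law)" using Er hD by blast
      moreover have "(\<lambda>y. h (z v + y)) \<in> borel_measurable borel" using h(1) by measurable
      from gen[OF this, of "real i * d n" "real (Suc i) * d n"]
      have "\<bar>expectation (\<lambda>\<omega>. h (z v + (time_changed (real (Suc i) * d n) \<omega> - time_changed (real i * d n) \<omega>))) - h (z v + 0)
         - 2 * (real (Suc i) * d n - real i * d n) * ((\<integral>y. h (z v + y) \<partial>step_law) - h (z v + 0))\<bar> \<le> c * (real (Suc i) * d n - real i * d n)^2"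
        using h(2) d[of n] by simp
      moreover have "real (Suc i) * d n - real i * d n = d n" by (simp add: algebra_simps)
      ultimately show "\<bar>expectation (\<lambda>\<omega>. h (z v + (time_changed (real (Suc i) * d n) \<omega> - time_changed (real i * d n) \<omega>))) - h (z v)\<bar> \<le> c * (d n)^2"
        by simp
    qed (use h in auto)
    moreover have "\<phi> (\<lambda>l\<in>{..<i}. \<xi> n l \<omega>) = (\<Prod>l\<le>i. indicator E (Z n l \<omega>))" for \<omega>
      unfolding \<phi>_def Z_def by (intro prod.cong refl arg_cong[where f="indicator E"] arg_cong[where f="\<lambda>s. x + s"] sum.cong) auto
    moreover have "z (\<lambda>l\<in>{..<i}. \<xi> n l \<omega>) = Z n i \<omega>" for \<omega>
      unfolding z_def Z_def by simp
    moreover have "Z n i \<omega> + \<xi> n i \<omega> = Z n (Suc i) \<omega>" for \<omega> by (simp add: Z_def)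
    ultimately show ?thesis unfolding Y_def by (simp add: \<xi>_def)
  qed
  have ER: "\<bar>expectation (R n) - h x\<bar> \<le> c * (real (Suc n) * (1/2) ^ n)" for n
  proof -
    have "expectation (R n) = h x + (\<Sum>i<Suc n * 2 ^ n. expectation (Y n i))"
      unfolding R_def using Yi by (simp add: prob_space)
    then have "\<bar>expectation (R n) - h x\<bar> \<le> (\<Sum>i<Suc n * 2 ^ n. \<bar>expectation (Y n i)\<bar>)"
      by (simp add: sum_abs)
    also have "\<dots> \<le> (\<Sum>i<Suc n * 2 ^ n. c * (d n)^2)" by (intro sum_mono EY)
    also have "\<dots> = c * (real (Suc n) * (1/2) ^ n)" by (simp add: d_def power2_eq_square power_one_over field_simps)
    finally show ?thesis .
  qed
  have "(\<lambda>n. c * (real (Suc n) * (1/2) ^ n)) \<longlonglongrightarrow> c * 0"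
  proof (intro tendsto_mult tendsto_const)
    have "(\<lambda>n. real n * (1/2::real) ^ n) \<longlonglongrightarrow> 0" by (rule powser_times_n_limit_0) simp
    moreover have "(\<lambda>n. (1/2::real) ^ n) \<longlonglongrightarrow> 0" by (rule LIMSEQ_power_zero) simp
    ultimately have "(\<lambda>n. (1/2::real) ^ n + real n * (1/2) ^ n) \<longlonglongrightarrow> 0 + 0" by (intro tendsto_add)
    then show "(\<lambda>n. real (Suc n) * (1/2::real) ^ n) \<longlonglongrightarrow> 0" unfolding of_nat_Suc distrib_right mult_1 add_0_left .
  qed
  then have z: "(\<lambda>n. c * (real (Suc n) * (1/2) ^ n)) \<longlonglongrightarrow> 0" unfolding mult_zero_right .
  have "(\<lambda>n. expectation (R n) - h x) \<longlonglongrightarrow> 0"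
  proof (rule Lim_null_comparison[OF _ z])
    show "\<forall>\<^sub>F n in sequentially. norm (expectation (R n) - h x) \<le> c * (real (Suc n) * (1/2) ^ n)"
      unfolding real_norm_def by (rule always_eventually) (intro allI ER)
  qed
  then have lim1: "(\<lambda>n. expectation (R n)) \<longlonglongrightarrow> h x" by (rule LIM_zero_cancel)
  have Rm: "R n \<in> borel_measurable M" for n unfolding R_def by (intro borel_measurable_add borel_measurable_sum Ym) auto
  have Rb: "\<bar>R n \<omega>\<bar> \<le> 1" for n \<omega>
  proof -
    have "Z n 0 \<omega> = x" by (simp add: Z_def)
    then have "R n \<omega> = h (Z n (if \<exists>i<Suc n * 2 ^ n. Z n i \<omega> \<notin> E then LEAST i. Z n i \<omega> \<notin> E else Suc n * 2 ^ n) \<omega>)"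
      using stopped_sum[of h "\<lambda>i. Z n i \<omega>" E "Suc n * 2 ^ n"] by (simp only: R_def Y_def)
    then show ?thesis using h(2) by simp
  qed
  let ?a = "at_exit (\<lambda>t \<omega>. x + X t \<omega>) E h"
  have lim2: "AE \<omega> in M. (\<lambda>n. R n \<omega>) \<longlonglongrightarrow> ?a \<omega>"
    using exits time_changed_eq T_const T0 W_continuous AE_space
  proof eventually_elim
    case (elim \<omega>)
    define p where "p = (\<lambda>t. x + X t \<omega>)"
    have tc: "time_changed t \<omega> = X t \<omega>" if "0 \<le> t" for t using elim(2) X[OF that elim(6)] that by simp
    have rc: "\<exists>e>0. \<forall>s\<in>{t..<t+e}. p s = p t" if "0 \<le> t" for t
    proof -
      from elim(3) that obtain e where e: "e > 0" "\<forall>s\<in>{t..<t+e}. T s \<omega> = T t \<omega>" by blast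
      have "p s = p t" if s: "s \<in> {t..<t+e}" for s
      proof -
        have "0 \<le> s" using s \<open>0 \<le> t\<close> by simp
        show ?thesis unfolding p_def X[OF \<open>0 \<le> s\<close> elim(6)] X[OF \<open>0 \<le> t\<close> elim(6)] bspec[OF e(2) s] ..
      qed
      then show ?thesis using e(1) by blast
    qed
    have "\<exists>t. 0 \<le> t \<and> p t \<notin> E" using elim(1) tc unfolding p_def by metis
    from grid_exit_limit[OF rc this, of \<omega>] obtain t where t: "exit_time (\<lambda>t _. p t) E \<omega> = ereal t"
      "\<forall>\<^sub>F j in sequentially. \<exists>k\<le>Suc j * 2 ^ j. (\<forall>i<k. p (real i * (1 / 2^j)) \<in> E) \<and> p (real k * (1 / 2^j)) \<notin> E \<and> p (real k * (1 / 2^j)) = p t"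
      by blast
    have "exit_time (\<lambda>t \<omega>. x + X t \<omega>) E \<omega> = ereal t" using t(1) by (simp add: exit_time_def p_def)
    then have a: "?a \<omega> = h (p t)" by (simp add: at_exit_def p_def)
    have X0: "X 0 \<omega> = 0" using X[OF order_refl elim(6)] elim(4,5) by simp
    have Zp: "Z n k \<omega> = p (real k * (1 / 2 ^ n))" for n k
    proof -
      have "(\<Sum>l<k. \<xi> n l \<omega>) = time_changed (real k * d n) \<omega> - time_changed 0 \<omega>"
        unfolding \<xi>_def by (subst sum_lessThan_telescope) simp
      then show ?thesis using tc[of "real k * d n"] tc[of 0] X0 d[of n] by (simp add: Z_def p_def d_def)
    qed
    have "\<forall>\<^sub>F n in sequentially. R n \<omega> = ?a \<omega>"
      using t(2)
    proof eventually_elim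
      case (elim n)
      then obtain k where k: "k \<le> Suc n * 2 ^ n" "\<And>i. i < k \<Longrightarrow> Z n i \<omega> \<in> E" "Z n k \<omega> \<notin> E" "Z n k \<omega> = p t"
        unfolding Zp by blast
      have least: "(LEAST i. Z n i \<omega> \<notin> E) = k"
      proof (rule Least_equality)
        show "Z n k \<omega> \<notin> E" by (rule k)
        show "k \<le> i" if "Z n i \<omega> \<notin> E" for i using k(2)[of i] that by (meson not_le)
      qed
      have "(if \<exists>i<Suc n * 2 ^ n. Z n i \<omega> \<notin> E then LEAST i. Z n i \<omega> \<notin> E else Suc n * 2 ^ n) = k"
      proof (cases "\<exists>i<Suc n * 2 ^ n. Z n i \<omega> \<notin> E")
        case True then show ?thesis using least by simp
      next
        case False
        then have "\<not> k < Suc n * 2 ^ n" using k(3) by blast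
        then show ?thesis unfolding if_not_P[OF False] using k(1) by (intro le_antisym) (simp_all only: not_less)
      qed
      moreover have "Z n 0 \<omega> = x" by (simp add: Z_def)
      ultimately have "R n \<omega> = h (Z n k \<omega>)"
        using stopped_sum[of h "\<lambda>i. Z n i \<omega>" E "Suc n * 2 ^ n"] by (simp only: R_def Y_def)
      then show ?case using k(4) a by simp
    qed
    then show ?case by (rule tendsto_eventually)
  qed
  \<comment> \<open>The exit value is only almost surely the limit of the \<open>R n\<close>.
    \<open>L\<close> is a measurable version of it, through which the integral passes to the
    completion.\<close>
  define L where "L = (\<lambda>\<omega>. lim (\<lambda>n. R n \<omega>))"
  have Lm: "L \<in> borel_measurable M" unfolding L_def by (rule borel_measurable_lim_metric[OF Rm])
  have La: "AE \<omega> in M. L \<omega> = ?a \<omega>" using lim2 by eventually_elim (simp add: L_def limI)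
  have am: "?a \<in> borel_measurable (completion M)" by (rule measurable_completion_AE[OF Lm La]) simp
  have "(\<lambda>n. expectation (R n)) \<longlonglongrightarrow> expectation L"
  proof (rule Bochner_Integration.integral_dominated_convergence[where w="\<lambda>_. 1::real"])
    show "AE \<omega> in M. (\<lambda>n. R n \<omega>) \<longlonglongrightarrow> L \<omega>" using lim2 La by eventually_elim simp
  qed (use Rm Lm Rb in auto)
  then have hL: "h x = expectation L" using lim1 LIMSEQ_unique by blast
  interpret C: prob_space "completion M" by (rule prob_space_completion)
  have ab: "norm (?a \<omega>) \<le> 1" for \<omega> using h(2) by (simp add: at_exit_def)
  show "integrable (completion M) ?a" using am ab by (intro C.integrable_const_bound[of _ 1]) auto
  have "(\<integral>\<omega>. ?a \<omega> \<partial>completion M) = (\<integral>\<omega>. L \<omega> \<partial>completion M)"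
    using AE_completion[OF La] am measurable_completion[OF Lm] by (intro integral_cong_AE) auto
  also have "\<dots> = expectation L" by (rule integral_completion[OF Lm])
  finally show "h x = (\<integral>\<omega>. ?a \<omega> \<partial>completion M)" using hL by simp
qed

end

lemma generated_events_cong:
  assumes "\<And>i \<omega>. i \<in> I \<Longrightarrow> \<omega> \<in> space M \<Longrightarrow> Z i \<omega> = Z' i \<omega>"
  shows "generated_events M I V Z = generated_events M I V Z'"
proof -
  have "Z i -` B \<inter> space M = Z' i -` B \<inter> space M" if "i \<in> I" for i B using assms[OF that] by auto
  then show ?thesis unfolding generated_events_def by (intro arg_cong[where f="sigma_sets (space M)"] SUP_cong refl) simp
qed

section \<open>Chaining the Harnack inequality\<close>

lemma harmonic_wrt_subset: "harmonic_wrt M Xs D h \<Longrightarrow> D' \<subseteq> D \<Longrightarrow> harmonic_wrt M Xs D' h"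
  unfolding harmonic_wrt_def by (meson order_trans)

text \<open>Harnack inequalities on a chain of small balls joining \<open>0\<close> to \<open>r/2\<close> bound \<open>h (r/2) / h 0\<close> by a power of
  the constant that does not depend on \<open>r\<close>.\<close>

lemma not_elliptic_harnack:
  assumes osc: "\<And>C::real. \<exists>r>0. \<exists>h. (\<forall>x. 0 \<le> h x) \<and> harmonic_wrt M Xs (ball 0 r) h \<and> C * h 0 < h (r / 2)"
  shows "\<not> elliptic_harnack M Xs"
proof
  assume "elliptic_harnack M Xs"
  then obtain C \<kappa> where C: "0 < C" and \<kappa>: "0 < \<kappa>" "\<kappa> < 1" and
    EHI: "\<And>x0 r h x y. 0 < r \<Longrightarrow> (\<forall>x. 0 \<le> h x) \<Longrightarrow> harmonic_wrt M Xs (ball x0 r) h \<Longrightarrow>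
      x \<in> ball x0 (\<kappa> * r) \<Longrightarrow> y \<in> ball x0 (\<kappa> * r) \<Longrightarrow> h x \<le> C * h y"
    unfolding elliptic_harnack_def by metis
  \<comment> \<open>The number of links depends on \<open>\<kappa>\<close> alone: the spacing
    \<open>s / n\<close> is below \<open>\<kappa> * s\<close>, and balls of radius
    \<open>s = r / 2\<close> centred in \<open>[0, r / 2]\<close> stay inside
    \<open>ball 0 r\<close>.\<close>
  obtain n :: nat where n: "1 / \<kappa> < real n" using reals_Archimedean2 by blast
  have n0: "0 < real n" using n \<kappa>(1) by (meson less_trans zero_less_divide_1_iff)
  have n\<kappa>: "1 / real n < \<kappa>" using n n0 \<kappa>(1) by (simp add: field_simps)
  from osc[of "C ^ n"] obtain r h where r: "0 < r" and h: "\<forall>x. 0 \<le> h x"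
    and harm: "harmonic_wrt M Xs (ball 0 r) h" and lt: "C ^ n * h 0 < h (r / 2)" by blast
  define s where "s = r / 2"
  have s: "0 < s" and rs: "r = 2 * s" using r by (simp_all add: s_def)
  define x where "x = (\<lambda>i. real i * (s / real n))"
  have "h (x i) \<le> C ^ i * h 0" if "i \<le> n" for i
    using that
  proof (induction i)
    case (Suc i)
    have "x i \<le> real n * (s / real n)" unfolding x_def using Suc s n0 by (intro mult_right_mono) auto
    then have xi: "0 \<le> x i" "x i \<le> s" using n0 s by (simp_all add: x_def)
    have "ball (x i) s \<subseteq> ball 0 r" using xi unfolding rs by (auto simp: dist_real_def)
    then have harm': "harmonic_wrt M Xs (ball (x i) s) h" by (rule harmonic_wrt_subset[OF harm])
    have "x (Suc i) - x i = s * (1 / real n)" unfolding x_def of_nat_Suc distrib_right by simp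
    moreover have "s * (1 / real n) < s * \<kappa>" using s n\<kappa> by (intro mult_strict_left_mono)
    moreover have "0 \<le> s * (1 / real n)" using s n0 by simp
    ultimately have "x (Suc i) \<in> ball (x i) (\<kappa> * s)" by (simp add: dist_real_def mult.commute[of \<kappa>])
    moreover have "x i \<in> ball (x i) (\<kappa> * s)" using s \<kappa>(1) by simp
    ultimately have "h (x (Suc i)) \<le> C * h (x i)" by (rule EHI[OF s h harm'])
    also have "\<dots> \<le> C * (C ^ i * h 0)" using Suc C by (intro mult_left_mono) auto
    finally show ?case by simp
  qed (simp add: x_def)
  from this[of n] have "h (x n) \<le> C ^ n * h 0" by simp
  moreover have "x n = r / 2" using n0 by (simp add: x_def rs)
  ultimately show False using lt by simp
qed

section \<open>The subordinator as a random clock, and the conclusion\<close>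

context exponential_jumps
begin

text \<open>\<open>S\<close> at nonnegative times and on \<open>space M\<close>; written as a
  \<open>marked\<close> sum it falls under the results on increments.\<close>

abbreviation scaled_marks :: "real \<Rightarrow> 'a \<Rightarrow> real" where
  "scaled_marks \<equiv> marked (\<lambda>m y. A m * y)"

lemma scaled_marks_eq: "0 \<le> t \<Longrightarrow> \<omega> \<in> space M \<Longrightarrow> scaled_marks t \<omega> = S t \<omega>"
  by (simp add: marked_def S_eq)

lemma scale_measurable: "(\<lambda>y. A m * y) \<in> borel_measurable borel"
  by measurable

lemma marks_nonneg: "AE \<omega> in M. \<forall>m i. 1 \<le> i \<longrightarrow> 0 \<le> Y m i \<omega>"
proof (intro AE_all_countable[THEN iffD2] allI)
  fix m i
  show "AE \<omega> in M. 1 \<le> i \<longrightarrow> 0 \<le> Y m i \<omega>"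
  proof (cases "1 \<le> i")
    case True
    have "AE x in lborel. 0 < ennreal (exponential_density 1 x) \<longrightarrow> 0 \<le> x" by (simp add: exponential_density_def)
    then have "AE \<omega> in M. 0 \<le> Y m i \<omega>"
      by (subst distributed_AE2[OF Y_distr[OF True]]) auto
    then show ?thesis by simp
  qed simp
qed

lemma scaled_marks_mono: "AE \<omega> in M. \<forall>s t. 0 \<le> s \<longrightarrow> s \<le> t \<longrightarrow> 0 \<le> scaled_marks s \<omega> \<and> scaled_marks s \<omega> \<le> scaled_marks t \<omega>"
  using marks_nonneg N_mono finite_support
proof (eventually_elim, intro allI impI)
  fix \<omega> and s t :: real
  assume Y: "\<forall>m i. 1 \<le> i \<longrightarrow> 0 \<le> Y m i \<omega>" and N: "\<forall>m s t. 0 \<le> s \<longrightarrow> s \<le> t \<longrightarrow> N m s \<omega> \<le> N m t \<omega>"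
    and fin: "\<forall>t\<ge>0. finite {m. N m t \<omega> \<noteq> 0}" and st: "0 \<le> s" "s \<le> t"
  let ?a = "\<lambda>t m. \<Sum>i=1..N m t \<omega>. A m * Y m i \<omega>"
  have nn: "0 \<le> A m * Y m i \<omega>" if "1 \<le> i" for m i using Y that A_pos[of m] by (intro mult_nonneg_nonneg) auto
  have sm: "summable (?a t)" if "0 \<le> t" for t
  proof (rule summable_finite)
    show "finite {m. N m t \<omega> \<noteq> 0}" using fin that by blast
  qed simp
  have le: "?a s m \<le> ?a t m" for m
  proof -
    have "N m s \<omega> \<le> N m t \<omega>" using N st by blast
    then show ?thesis by (intro sum_mono2) (auto intro: nn)
  qed
  have "0 \<le> (\<Sum>m. ?a s m)" by (intro suminf_nonneg sm st sum_nonneg nn) simp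
  moreover have "(\<Sum>m. ?a s m) \<le> (\<Sum>m. ?a t m)" using st by (intro suminf_le sm le) auto
  ultimately show "0 \<le> scaled_marks s \<omega> \<and> scaled_marks s \<omega> \<le> scaled_marks t \<omega>" unfolding marked_def by blast
qed

lemma scaled_marks_right_const: "AE \<omega> in M. scaled_marks 0 \<omega> = 0 \<and> (\<forall>t\<ge>0. \<exists>e>0. \<forall>s\<in>{t..<t+e}. scaled_marks s \<omega> = scaled_marks t \<omega>)"
  using AE_counting_paths
proof eventually_elim
  case (elim \<omega>)
  interpret counting_paths "\<lambda>m t. N m t \<omega>" by (rule elim)
  have "scaled_marks 0 \<omega> = 0" by (simp add: marked_def zero)
  moreover have "\<exists>e>0. \<forall>s\<in>{t..<t+e}. scaled_marks s \<omega> = scaled_marks t \<omega>" if "0 \<le> t" for t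
  proof -
    from right_const[OF that] obtain e where e: "e > 0" "\<And>s m. s \<in> {t..<t+e} \<Longrightarrow> N m s \<omega> = N m t \<omega>" by blast
    have "scaled_marks s \<omega> = scaled_marks t \<omega>" if "s \<in> {t..<t+e}" for s unfolding marked_def e(2)[OF that] ..
    then show ?thesis using e(1) by blast
  qed
  ultimately show ?case by blast
qed

lemma scaled_marks_subordinated:
  assumes W: "standard_brownian_motion M W"
    and WS: "indep_set (generated_events M {0..} borel W) (generated_events M {0..} borel S)"
  shows "subordinated M scaled_marks W"
proof
  show "scaled_marks t \<in> borel_measurable M" if "0 \<le> t" for t
    by (rule marked_measurable[OF scale_measurable that])
  show "independent_increments M borel scaled_marks"
    by (rule marked_independent_increments[OF scale_measurable])
  show "AE \<omega> in M. \<forall>s t. 0 \<le> s \<longrightarrow> s \<le> t \<longrightarrow> 0 \<le> scaled_marks s \<omega> \<and> scaled_marks s \<omega> \<le> scaled_marks t \<omega>"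
    by (rule scaled_marks_mono)
  have "generated_events M {0..} borel scaled_marks = generated_events M {0..} borel S"
    by (rule generated_events_cong) (simp add: scaled_marks_eq)
  then show "indep_set (generated_events M {0..} borel W) (generated_events M {0..} borel scaled_marks)"
    using WS by simp
qed (rule W)

lemma expectation_mark:
  fixes g :: "real \<Rightarrow> real"
  assumes "g \<in> borel_measurable borel" "1 \<le> i"
  shows "expectation (\<lambda>\<omega>. g (Y m i \<omega>)) = (\<integral>y. g y \<partial>expd)"
proof -
  have "distr M lborel (Y m i) = expd" using Y_distr[OF assms(2), of m] by (simp add: distributed_def)
  moreover have "(\<integral>y. g y \<partial>distr M lborel (Y m i)) = expectation (\<lambda>\<omega>. g (Y m i \<omega>))"
    using assms Y_measurable[OF assms(2), of m] by (intro integral_distr) simp_all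
  ultimately show ?thesis by simp
qed

end

theorem mainTheorem4:
  fixes M :: "'a measure"
    and H A :: "nat \<Rightarrow> real"
    and N :: "nat \<Rightarrow> real \<Rightarrow> 'a \<Rightarrow> nat"
    and Y :: "nat \<Rightarrow> nat \<Rightarrow> 'a \<Rightarrow> real"
    and S W X :: "real \<Rightarrow> 'a \<Rightarrow> real"
  assumes "prob_space M"
    and "\<And>m. H m = 1 / 2 ^ m"
    and "\<And>m. A m = 2 ^ (m ^ 2)"
    and "\<And>m. poisson_process M (H m) (N m)"
    and "prob_space.indep_sets M (\<lambda>m. generated_events M {0..} (count_space UNIV) (N m)) UNIV"
    and "\<And>m i. 1 \<le> i \<Longrightarrow> distributed M lborel (Y m i) (exponential_density 1)"
    and "prob_space.indep_vars M (\<lambda>_. borel) (\<lambda>(m, i). Y m i) (UNIV \<times> {1..})"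
    and "prob_space.indep_set M
           (generated_events M (UNIV \<times> {0..}) (count_space UNIV) (\<lambda>(m, t). N m t))
           (generated_events M (UNIV \<times> {1..}) borel (\<lambda>(m, i). Y m i))"
    and "\<And>t \<omega>. 0 \<le> t \<Longrightarrow> \<omega> \<in> space M \<Longrightarrow> S t \<omega> = (\<Sum>m. \<Sum>i=1..N m t \<omega>. A m * Y m i \<omega>)"
    and "standard_brownian_motion M W"
    and "prob_space.indep_set M (generated_events M {0..} borel W) (generated_events M {0..} borel S)"
    and "\<And>t \<omega>. 0 \<le> t \<Longrightarrow> \<omega> \<in> space M \<Longrightarrow> X t \<omega> = W (S t \<omega>) \<omega>"
  shows "(\<exists>\<mu>. levy_measure M S \<mu>) \<and>
    (\<forall>\<mu>. levy_measure M S \<mu> \<longrightarrow>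
       absolutely_continuous (restrict_space lborel {0<..}) \<mu> \<and>
       (\<exists>f. f \<in> borel_measurable (restrict_space lborel {0<..}) \<and>
            (\<forall>x>0. 0 \<le> f x) \<and> strict_antimono_on {0<..} f \<and>
            \<mu> = density (restrict_space lborel {0<..}) (\<lambda>x. ennreal (f x)))) \<and>
    \<not> elliptic_harnack M (\<lambda>x t \<omega>. x + X t \<omega>)"
proof -
  interpret prob_space M by (rule assms)
  \<comment> \<open>Half of \<open>H\<close> is the geometric law of the type, so the total rate is
    2.\<close>
  have H: "H = (\<lambda>m. 2 * (1/2) ^ Suc m)" using assms(2) by (simp add: fun_eq_iff power_one_over)
  have H_sums: "H sums 2"
    using sums_mult[OF power_half_series, of 2] unfolding H by simp
  interpret exponential_jumps M H N Y A S
  proof unfold_locales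
    show "0 < H m" for m by (simp add: assms(2))
    show "summable H" by (rule sums_summable[OF H_sums])
    show "1 \<le> A m" for m by (simp add: assms(3))
  qed (fact assms)+
  have jump_scale: "A m = jump_scale m" for m by (simp add: assms(3) jump_scale_def)
  interpret subordinated M scaled_marks W by (rule scaled_marks_subordinated) (fact assms)+
  have gen: "\<bar>expectation (\<lambda>\<omega>. f (time_changed t \<omega> - time_changed s \<omega>)) - f 0 - 2 * (t - s) * ((\<integral>v. f v \<partial>step_law) - f 0)\<bar> \<le> 8 * (t - s)^2"
    if f: "f \<in> borel_measurable borel" "\<And>x. 0 \<le> f x \<and> f x \<le> 1" and st: "0 \<le> s" "s < t"
    for f :: "real \<Rightarrow> real" and s t
  proof -
    \<comment> \<open>Given the clock an increment is Gaussian, so the expansion for the clock is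
      applied to \<open>gauss_mean f\<close>, whose mean over a mark of type \<open>m\<close> is an
      integral against \<open>jump_law\<close>. The constant is \<open>8 = 2 * 2\<^sup>2\<close>,
      with 2 the total rate.\<close>
    let ?g = "gauss_mean f"
    have g0: "?g 0 = f 0"
      using prob_space.prob_space[OF prob_space_stdn] by (simp add: gauss_mean_def)
    have gm: "?g \<in> borel_measurable borel" by (rule gauss_mean_measurable[OF f(1)])
    have gb: "0 \<le> ?g x \<and> ?g x \<le> 1" for x using gauss_mean_bounds[OF f] by blast
    have "expectation (\<lambda>\<omega>. ?g (A m * Y m 1 \<omega>)) = (\<integral>v. f v \<partial>jump_law (jump_scale m))" for m
    proof -
      have "(\<lambda>y. ?g (A m * y)) \<in> borel_measurable borel" by (rule measurable_compose[OF scale_measurable gm])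
      then have "expectation (\<lambda>\<omega>. ?g (A m * Y m 1 \<omega>)) = (\<integral>y. ?g (A m * y) \<partial>expd)" by (intro expectation_mark) auto
      then show ?thesis by (simp add: integral_jump_law[OF f] jump_scale)
    qed
    moreover have "(\<lambda>m. H m * ((\<integral>v. f v \<partial>jump_law (jump_scale m)) - f 0)) sums (2 * ((\<integral>v. f v \<partial>step_law) - f 0))"
    proof -
      have "(\<lambda>m. 2 * (1 / 2 ^ Suc m * (\<integral>v. f v \<partial>jump_law (jump_scale m))) - H m * f 0) sums (2 * (\<integral>v. f v \<partial>step_law) - 2 * f 0)"
        by (intro sums_diff sums_mult sums_mult2 H_sums integral_step_law[OF f])
      then show ?thesis by (simp add: assms(2) algebra_simps)
    qed
    ultimately have gsum: "(\<Sum>m. H m * (expectation (\<lambda>\<omega>. ?g (A m * Y m 1 \<omega>)) - ?g 0)) = 2 * ((\<integral>v. f v \<partial>step_law) - f 0)"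
      using g0 by (simp add: sums_iff)
    have S2: "(\<Sum>m. H m) = 2" using H_sums by (simp add: sums_iff)
    have "\<bar>expectation (\<lambda>\<omega>. ?g (scaled_marks t \<omega> - scaled_marks s \<omega>)) - ?g 0
      - (t - s) * (\<Sum>m. H m * (expectation (\<lambda>\<omega>. ?g (A m * Y m 1 \<omega>)) - ?g 0))\<bar> \<le> 2 * ((t - s) * (\<Sum>m. H m))^2"
      by (rule marked_expansion[OF gm gb scale_measurable st])
    then have "\<bar>expectation (\<lambda>\<omega>. f (time_changed t \<omega> - time_changed s \<omega>)) - f 0 - (t - s) * (2 * ((\<integral>v. f v \<partial>step_law) - f 0))\<bar> \<le> 2 * ((t - s) * 2)^2"
      unfolding gsum S2 time_changed_increment_law[OF st f] by (simp only: g0)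
    moreover have "(t - s) * (2 * ((\<integral>v. f v \<partial>step_law) - f 0)) = 2 * (t - s) * ((\<integral>v. f v \<partial>step_law) - f 0)" by (simp only: mult_ac)
    moreover have "2 * ((t - s) * 2)^2 = 8 * (t - s)^2"
      using power_mult_distrib[of "t - s" 2 2] by simp
    ultimately show ?thesis by (simp only:)
  qed
  have X: "X t \<omega> = W (scaled_marks t \<omega>) \<omega>" if "0 \<le> t" "\<omega> \<in> space M" for t \<omega>
    using assms(12)[OF that] scaled_marks_eq[OF that] by simp
  have harnack: "\<not> elliptic_harnack M (\<lambda>x t \<omega>. x + X t \<omega>)"
  proof (rule not_elliptic_harnack)
    fix C :: real
    from unbounded_oscillation[of C] obtain r h where r: "0 < r" and h: "h \<in> borel_measurable borel" "\<And>x. 0 \<le> h x \<and> h x \<le> 1"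
      and hD: "\<And>x. x \<in> ball 0 r \<Longrightarrow> h x = (\<integral>y. h (x + y) \<partial>step_law)" and C: "C * h 0 < h (r / 2)"
      by blast
    have "harmonic_wrt M (\<lambda>x t \<omega>. x + X t \<omega>) (ball 0 r) h"
    proof (rule harmonic_of_step_law[where c=8, OF gen])
      show "AE \<omega> in M. \<forall>t\<ge>0. \<exists>e>0. \<forall>s\<in>{t..<t + e}. scaled_marks s \<omega> = scaled_marks t \<omega>" "AE \<omega> in M. scaled_marks 0 \<omega> = 0"
        using scaled_marks_right_const by auto
    qed (use X h hD in auto)
    then show "\<exists>r>0. \<exists>h. (\<forall>x. 0 \<le> h x) \<and> harmonic_wrt M (\<lambda>x t \<omega>. x + X t \<omega>) (ball 0 r) h \<and> C * h 0 < h (r / 2)"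
      using r h(2) C by blast
  qed
  have dm: "levy_density \<in> borel_measurable (restrict_space lborel {0<..})"
    by (rule measurable_restrict_space1) (use levy_density_measurable in simp)
  have "absolutely_continuous (restrict_space lborel {0<..}) levy"
    unfolding levy_def by (rule absolutely_continuousI_density) (use dm in measurable)
  then have ex: "\<exists>f. f \<in> borel_measurable (restrict_space lborel {0<..}) \<and> (\<forall>x>0. 0 \<le> f x) \<and> strict_antimono_on {0<..} f \<and>
      levy = density (restrict_space lborel {0<..}) (\<lambda>x. ennreal (f x))"
    and ac: "absolutely_continuous (restrict_space lborel {0<..}) levy"
    using dm levy_density_strict_antimono by (auto intro!: exI[of _ levy_density] levy_density_nonneg simp: levy_def)
  show ?thesis
  proof (intro conjI allI impI)
    show "\<exists>\<mu>. levy_measure M S \<mu>" using levy_measure_levy by blast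
    fix \<mu> assume "levy_measure M S \<mu>"
    then have \<mu>: "\<mu> = levy" by (rule levy_measure_unique)
    show "absolutely_continuous (restrict_space lborel {0<..}) \<mu>" unfolding \<mu> by (rule ac)
    show "\<exists>f. f \<in> borel_measurable (restrict_space lborel {0<..}) \<and> (\<forall>x>0. 0 \<le> f x) \<and> strict_antimono_on {0<..} f \<and>
      \<mu> = density (restrict_space lborel {0<..}) (\<lambda>x. ennreal (f x))" unfolding \<mu> by (rule ex)
  qed (rule harnack)
qed

end
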